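(* Let $U=(a,b)$, $\beta\in\mathbb R$, let $V\in C^1(\overline U)$ be real-valued with $V\ge0$, and let $\psi$ be the solution of $$i\partial_t\psi=-\tfrac12\psi_{xx}+V(x)\psi+\beta|\psi|^2\psi,\quad x\in U,\ t>0,\qquad \psi(a,t)=\psi(b,t)=0,\qquad \psi(x,0)=\psi_0(x).$$ Let $0<T<T_{\max}$, with $T_{\max}$ the maximal existence time of $\psi$, and assume $$\psi\in C^3([0,T];W^{1,\infty}(U))\cap C^2([0,T];W^{3,\infty}(U))\cap C^0([0,T];W^{5,\infty}(U)\cap H^1_0(U)).$$ Then there exist $h_0>0$, $\tau_0>0$ sufficiently small and a constant $C>0$ independent of $h,\tau$ such that whenever $0<h\le h_0$ and $0<\tau\le\tau_0$, the CNFD scheme (defined in the context) with mesh size $h=(b-a)/M$ and time step $\tau$ admits a unique solution $\psi^n$ ($0\le n\le T/\tau$), and, with $e^n_j=\psi(x_j,t_n)-\psi^n_j$, for all $0\le n\le T/\tau$, $$\|e^n\|_2\le C(h^2+\tau^2),\qquad \|\delta_x^+e^n\|_2\le C(h^{3/2}+\tau^{3/2}),\qquad \|\psi^n\|_\infty\le1+M_1,$$ where $M_1=\max_{0\le t\le T}\|\psi(\cdot,t)\|_{L^\infty(U)}$. In addition, if either $\partial_nV|_{\partial U}=0$ (outer normal derivative, i.e. $V'(a)=V'(b)=0$) or $\psi\in C^0([0,T];H^2_0(U))$, then $$\|e^n\|_2+\|\delta_x^+e^n\|_2\le C(h^2+\tau^2),\qquad \|\psi^n\|_\infty\le1+M_1,\qquad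 0\le n\le T/\tau .$$
   Context: Grid: $M$ an even positive integer, $h=(b-a)/M$, $x_j=a+jh$ ($0\le j\le M$), $t_n=n\tau$, $V_j=V(x_j)$. For grid functions: $\delta_x^+v_j=(v_{j+1}-v_j)/h$, $\delta_x^2v_j=(v_{j+1}-2v_j+v_{j-1})/h^2$, $\delta_t^+\psi^n_j=(\psi^{n+1}_j-\psi^n_j)/\tau$; $\|v\|_2^2=h\sum_{j=0}^{M-1}|v_j|^2$, $\|\delta_x^+v\|_2^2=h\sum_{j=0}^{M-1}|\delta_x^+v_j|^2$, $\|v\|_\infty=\max_{0\le j\le M}|v_j|$. CNFD (conservative Crank--Nicolson finite difference) scheme: $\psi^0_j=\psi_0(x_j)$ for $0\le j\le M$; $\psi^{n+1}_0=\psi^{n+1}_M=0$ for $n\ge0$; and for $n\ge0$, $1\le j\le M-1$, $$i\delta_t^+\psi^n_j=\Big[-\tfrac12\delta_x^2+V_j+\tfrac\beta2\big(|\psi^{n+1}_j|^2+|\psi^n_j|^2\big)\Big]\psi^{n+1/2}_j,\qquad \psi^{n+1/2}_j=\tfrac12(\psi^{n+1}_j+\psi^n_j).$$ *)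

theory Defs
  imports "HOL-Analysis.Analysis" "HOL-Probability.Essential_Supremum"
begin

section \<open>Sobolev spaces on an open set of the real line\<close>

text \<open>Elements are complex functions on the real line, of which only the values on \<open>U\<close> up to null
  sets matter; the spaces are sets of representatives and the norms are seminorms on them.
  The Lebesgue-completed measure is used, so membership is invariant under a.e. equality.\<close>

definition nth_vderiv :: "nat \<Rightarrow> (real \<Rightarrow> complex) \<Rightarrow> real \<Rightarrow> complex" where
  "nth_vderiv k = ((\<lambda>f x. vector_derivative f (at x)) ^^ k)"

definition test_function :: "real set \<Rightarrow> (real \<Rightarrow> complex) \<Rightarrow> bool" where
  "test_function U \<phi> \<longleftrightarrow>
     (\<forall>k x. nth_vderiv k \<phi> differentiable (at x)) \<and>
     compact (closure {x. \<phi> x \<noteq> 0}) \<and> closure {x. \<phi> x \<noteq> 0} \<subseteq> U"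

definition locally_integrable :: "real set \<Rightarrow> (real \<Rightarrow> complex) \<Rightarrow> bool" where
  "locally_integrable U u \<longleftrightarrow> (\<forall>K. compact K \<and> K \<subseteq> U \<longrightarrow> u absolutely_integrable_on K)"

definition is_weak_deriv ::
    "real set \<Rightarrow> nat \<Rightarrow> (real \<Rightarrow> complex) \<Rightarrow> (real \<Rightarrow> complex) \<Rightarrow> bool" where
  "is_weak_deriv U k u v \<longleftrightarrow>
     locally_integrable U u \<and> locally_integrable U v \<and>
     (\<forall>\<phi>. test_function U \<phi> \<longrightarrow>
        (LINT x|lebesgue_on U. u x * nth_vderiv k \<phi> x)
          = (-1) ^ k * (LINT x|lebesgue_on U. v x * \<phi> x))"

text \<open>Weak derivatives are unique up to null sets; any representative may be chosen.\<close>

definition weak_deriv :: "real set \<Rightarrow> nat \<Rightarrow> (real \<Rightarrow> complex) \<Rightarrow> real \<Rightarrow> complex" where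
  "weak_deriv U k u = (SOME v. is_weak_deriv U k u v)"

definition Linf :: "real set \<Rightarrow> (real \<Rightarrow> complex) set" where
  "Linf U = {u \<in> borel_measurable (lebesgue_on U).
               esssup (lebesgue_on U) (\<lambda>x. ereal (cmod (u x))) < \<infinity>}"

definition Linf_norm :: "real set \<Rightarrow> (real \<Rightarrow> complex) \<Rightarrow> real" where
  "Linf_norm U u = real_of_ereal (esssup (lebesgue_on U) (\<lambda>x. ereal (cmod (u x))))"

definition L2 :: "real set \<Rightarrow> (real \<Rightarrow> complex) set" where
  "L2 U = {u \<in> borel_measurable (lebesgue_on U).
             integrable (lebesgue_on U) (\<lambda>x. (cmod (u x))\<^sup>2)}"

definition L2_norm :: "real set \<Rightarrow> (real \<Rightarrow> complex) \<Rightarrow> real" where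
  "L2_norm U u = sqrt (LINT x|lebesgue_on U. (cmod (u x))\<^sup>2)"

definition W_inf :: "real set \<Rightarrow> nat \<Rightarrow> (real \<Rightarrow> complex) set" where
  "W_inf U k = {u. \<forall>j\<le>k. \<exists>v \<in> Linf U. is_weak_deriv U j u v}"

definition W_inf_norm :: "real set \<Rightarrow> nat \<Rightarrow> (real \<Rightarrow> complex) \<Rightarrow> real" where
  "W_inf_norm U k u = (\<Sum>j\<le>k. Linf_norm U (weak_deriv U j u))"

definition H_space :: "real set \<Rightarrow> nat \<Rightarrow> (real \<Rightarrow> complex) set" where
  "H_space U k = {u. \<forall>j\<le>k. \<exists>v \<in> L2 U. is_weak_deriv U j u v}"

definition H_norm :: "real set \<Rightarrow> nat \<Rightarrow> (real \<Rightarrow> complex) \<Rightarrow> real" where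
  "H_norm U k u = sqrt (\<Sum>j\<le>k. (L2_norm U (weak_deriv U j u))\<^sup>2)"

text \<open>Closure of the test functions in \<open>H_space U k\<close>.\<close>

definition H0_space :: "real set \<Rightarrow> nat \<Rightarrow> (real \<Rightarrow> complex) set" where
  "H0_space U k = {u \<in> H_space U k.
     \<exists>\<phi> :: nat \<Rightarrow> real \<Rightarrow> complex. (\<forall>n. test_function U (\<phi> n)) \<and>
        (\<lambda>n. H_norm U k (\<lambda>x. \<phi> n x - u x)) \<longlonglongrightarrow> 0}"


section \<open>Strongly differentiable functions of time with values in a function space\<close>

text \<open>\<open>Ck_into m I X N u\<close> is \<open>u \<in> C\<^sup>m(I; X)\<close> for the space \<open>X\<close> normed by \<open>N\<close>; \<open>D k\<close> is the \<open>k\<close>-th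
  time derivative, one-sided at endpoints belonging to \<open>I\<close>.  The time argument comes first:
  \<open>u t x\<close> is written \<open>u(x,t)\<close> in the PDE literature.\<close>

definition Ck_into ::
    "nat \<Rightarrow> real set \<Rightarrow> (real \<Rightarrow> complex) set \<Rightarrow> ((real \<Rightarrow> complex) \<Rightarrow> real)
       \<Rightarrow> (real \<Rightarrow> real \<Rightarrow> complex) \<Rightarrow> bool" where
  "Ck_into m I X N u \<longleftrightarrow>
     (\<exists>D :: nat \<Rightarrow> real \<Rightarrow> real \<Rightarrow> complex.
        (\<forall>t\<in>I. D 0 t = u t) \<and>
        (\<forall>k\<le>m. \<forall>t\<in>I. D k t \<in> X \<and>
           ((\<lambda>s. N (\<lambda>x. D k s x - D k t x)) \<longlongrightarrow> 0) (at t within I)) \<and>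
        (\<forall>k<m. \<forall>t\<in>I.
           ((\<lambda>s. N (\<lambda>x. (D k s x - D k t x) /\<^sub>R (s - t) - D (Suc k) t x)) \<longlongrightarrow> 0)
             (at t within I)))"


section \<open>The nonlinear Schroedinger equation\<close>

text \<open>Energy-space solutions on \<open>[0,S)\<close>: \<open>\<psi> \<in> C([0,S); H\<^sup>1\<^sub>0(a,b))\<close> solving
  \<open>i \<psi>\<^sub>t = - \<psi>\<^sub>x\<^sub>x / 2 + V \<psi> + \<beta> |\<psi>|\<^sup>2 \<psi>\<close> in the sense of distributions on \<open>(a,b)\<close> for \<open>0 < t < S\<close>.
  Each \<open>\<psi> t\<close> is the continuous representative on \<open>[a,b]\<close>, so that the boundary and initial
  conditions and the values at grid points are meaningful pointwise.\<close>

definition nls_solution ::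
    "real \<Rightarrow> real \<Rightarrow> real \<Rightarrow> (real \<Rightarrow> real) \<Rightarrow> (real \<Rightarrow> complex) \<Rightarrow> ereal
       \<Rightarrow> (real \<Rightarrow> real \<Rightarrow> complex) \<Rightarrow> bool" where
  "nls_solution a b \<beta> V \<psi>0 S \<psi> \<longleftrightarrow>
     (let U = {a<..<b}; I = {t. 0 \<le> t \<and> ereal t < S} in
      Ck_into 0 I (H0_space U 1) (H_norm U 1) \<psi> \<and>
      (\<forall>t\<in>I. continuous_on {a..b} (\<psi> t) \<and> \<psi> t a = 0 \<and> \<psi> t b = 0) \<and>
      (\<forall>x\<in>{a..b}. \<psi> 0 x = \<psi>0 x) \<and>
      (\<forall>\<phi> t. test_function U \<phi> \<and> 0 < t \<and> ereal t < S \<longrightarrow>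
         (\<exists>d. ((\<lambda>s. LINT x|lebesgue_on U. \<psi> s x * \<phi> x) has_vector_derivative d) (at t) \<and>
            \<i> * d = - (1/2) * (LINT x|lebesgue_on U. \<psi> t x * nth_vderiv 2 \<phi> x)
              + (LINT x|lebesgue_on U.
                   (of_real (V x) * \<psi> t x
                    + of_real (\<beta> * (cmod (\<psi> t x))\<^sup>2) * \<psi> t x) * \<phi> x))))"

text \<open>\<open>Tmax\<close> (possibly infinite) is the maximal existence time of \<open>\<psi>\<close>.\<close>

definition nls_maximal_solution ::
    "real \<Rightarrow> real \<Rightarrow> real \<Rightarrow> (real \<Rightarrow> real) \<Rightarrow> (real \<Rightarrow> complex) \<Rightarrow> ereal
       \<Rightarrow> (real \<Rightarrow> real \<Rightarrow> complex) \<Rightarrow> bool" where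
  "nls_maximal_solution a b \<beta> V \<psi>0 Tmax \<psi> \<longleftrightarrow>
     0 < Tmax \<and> nls_solution a b \<beta> V \<psi>0 Tmax \<psi> \<and>
     \<not> (\<exists>S \<xi>. Tmax < S \<and> nls_solution a b \<beta> V \<psi>0 S \<xi> \<and>
          (\<forall>t x. 0 \<le> t \<and> ereal t < Tmax \<and> x \<in> {a..b} \<longrightarrow> \<xi> t x = \<psi> t x))"


section \<open>Grid functions and the conservative Crank-Nicolson scheme\<close>

definition mesh :: "real \<Rightarrow> real \<Rightarrow> nat \<Rightarrow> real" where
  "mesh a b M = (b - a) / real M"

definition node :: "real \<Rightarrow> real \<Rightarrow> nat \<Rightarrow> nat \<Rightarrow> real" where
  "node a b M j = a + real j * mesh a b M"

definition dx_plus :: "real \<Rightarrow> (nat \<Rightarrow> complex) \<Rightarrow> nat \<Rightarrow> complex" where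
  "dx_plus h v j = (v (Suc j) - v j) / of_real h"

text \<open>Only used for \<open>j \<ge> 1\<close>, where \<open>j - 1\<close> is not truncated.\<close>

definition dx2 :: "real \<Rightarrow> (nat \<Rightarrow> complex) \<Rightarrow> nat \<Rightarrow> complex" where
  "dx2 h v j = (v (j + 1) - 2 * v j + v (j - 1)) / of_real (h\<^sup>2)"

definition grid_l2_norm :: "real \<Rightarrow> nat \<Rightarrow> (nat \<Rightarrow> complex) \<Rightarrow> real" where
  "grid_l2_norm h M v = sqrt (h * (\<Sum>j<M. (cmod (v j))\<^sup>2))"

definition grid_max_norm :: "nat \<Rightarrow> (nat \<Rightarrow> complex) \<Rightarrow> real" where
  "grid_max_norm M v = Max ((\<lambda>j. cmod (v j)) ` {0..M})"

text \<open>\<open>u n j\<close> is the scheme's \<open>\<psi>\<^sup>n\<^sub>j\<close>; only \<open>n \<le> T/\<tau>\<close> and \<open>j \<le> M\<close> are constrained.\<close>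

definition cnfd_solution ::
    "real \<Rightarrow> real \<Rightarrow> real \<Rightarrow> (real \<Rightarrow> real) \<Rightarrow> (real \<Rightarrow> complex) \<Rightarrow> real \<Rightarrow> nat \<Rightarrow> real
       \<Rightarrow> (nat \<Rightarrow> nat \<Rightarrow> complex) \<Rightarrow> bool" where
  "cnfd_solution a b \<beta> V \<psi>0 T M \<tau> u \<longleftrightarrow>
     (\<forall>j\<le>M. u 0 j = \<psi>0 (node a b M j)) \<and>
     (\<forall>n. real (Suc n) \<le> T / \<tau> \<longrightarrow>
        u (Suc n) 0 = 0 \<and> u (Suc n) M = 0 \<and>
        (\<forall>j. 1 \<le> j \<and> j \<le> M - 1 \<longrightarrow>
          (let w = (\<lambda>k. (u (Suc n) k + u n k) / 2) in
           \<i> * ((u (Suc n) j - u n j) / of_real \<tau>)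
             = - (1/2) * dx2 (mesh a b M) w j
               + of_real (V (node a b M j)
                   + \<beta> / 2 * ((cmod (u (Suc n) j))\<^sup>2 + (cmod (u n j))\<^sup>2)) * w j)))"

definition grid_error ::
    "real \<Rightarrow> real \<Rightarrow> nat \<Rightarrow> real \<Rightarrow> (real \<Rightarrow> real \<Rightarrow> complex) \<Rightarrow> (nat \<Rightarrow> nat \<Rightarrow> complex)
       \<Rightarrow> nat \<Rightarrow> nat \<Rightarrow> complex" where
  "grid_error a b M \<tau> \<psi> u n j = \<psi> (real n * \<tau>) (node a b M j) - u n j"

end

theory Submission
  imports Defs
begin

text \<open>In one space dimension the membership \<open>\<psi> t \<in> W\<^sup>5\<^sup>,\<^sup>\<infinity>\<close> makes \<open>\<psi>\<close> a classical solution. Averaging the equation over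
  two consecutive time levels gives a residual of the scheme from which \<open>V\<close> disappears: it consists of the trapezoidal
  error of \<open>\<psi>\<^sub>t\<close>, the error of the second difference quotient, and a product of two time increments. The residual
  and its differences are \<open>O(h\<^sup>2 + \<tau>\<^sup>2)\<close>, except that next to an endpoint \<open>e\<close> the second difference leaves
  \<open>h\<^sup>2 \<psi>\<^sub>x\<^sub>x\<^sub>x\<^sub>x(e)\<close>; the \<open>(x - e)\<^sup>2\<close> coefficient of the equation yields \<open>\<psi>\<^sub>x\<^sub>x\<^sub>x\<^sub>x(e) = 4 V'(e) \<psi>\<^sub>x(e)\<close>, which
  vanishes under either additional hypothesis and otherwise costs half an order in the discrete \<open>H\<^sup>1\<close> norm.
  A Crank-Nicolson step is nonexpansive in the discrete \<open>L\<^sup>2\<close> and \<open>H\<^sup>1\<close> norms, the discrete \<open>H\<^sup>1\<close> space is an algebra, and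
  conservation of mass and energy bounds every discrete solution in \<open>H\<^sup>1\<close>. Hence the nonlinearity is Lipschitz along
  all solutions, which gives solvability by iteration, uniqueness, and by a discrete Gronwall argument the error bounds.\<close>

section \<open>Smooth bump functions and the fundamental lemma of the calculus of variations\<close>

text \<open>Two obstacles shape the argument. First, \<open>V\<close> is only C^1 and the equation
  is only distributional, so the equation cannot be differentiated twice in space. The fourth
  derivative at an endpoint is therefore obtained from limits of quotients of a Taylor remainder,
  and differences of the residual are estimated from Lipschitz bounds of derivatives taken in time
  alone or in space alone. Second, the discrete H^1 estimate tests with a second difference and
  requires a source that vanishes at both ends. The residual is therefore extended by zero, and its
  jump to the first interior node is divided by h. Its time part is small enough there because
  \<psi> and its time derivative vanish at the endpoint, but its h^2 part need not be: a quotient of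
  size h on two cells of length h has discrete norm of order h^(3/2). No relation between \<tau> and
  h arises, since every constant comes from conserved quantities and from the length b - a = h M,
  never from an inverse inequality. The maximum norm bound comes at the end from the discrete
  Sobolev inequality applied to the error.\<close>

lemma nth_vderiv_0 [simp]: "nth_vderiv 0 f = f"
  by (simp add: nth_vderiv_def)

lemma nth_vderiv_Suc: "nth_vderiv (Suc k) f = nth_vderiv k (\<lambda>x. vector_derivative f (at x))"
  unfolding nth_vderiv_def by (simp only: funpow_Suc_right o_apply)

lemma nth_vderiv_Suc': "nth_vderiv (Suc k) f = (\<lambda>x. vector_derivative (nth_vderiv k f) (at x))"
  unfolding nth_vderiv_def by simp

text \<open>The smoothness clause of \<open>test_function\<close> speaks of all orders at once. Cut
  off at a finite order, it can be proved for products and affine substitutions by induction,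
  peeling off one derivative at a time.\<close>

definition smooth_upto :: "nat \<Rightarrow> (real \<Rightarrow> complex) \<Rightarrow> bool" where
  "smooth_upto m f \<longleftrightarrow> (\<forall>k<m. \<forall>x. nth_vderiv k f differentiable (at x))"

lemma smooth_upto_0 [simp]: "smooth_upto 0 f"
  by (simp add: smooth_upto_def)

lemma smooth_upto_Suc:
  "smooth_upto (Suc m) f \<longleftrightarrow>
     (\<forall>x. f differentiable (at x)) \<and> smooth_upto m (\<lambda>x. vector_derivative f (at x))"
  unfolding smooth_upto_def nth_vderiv_Suc[symmetric] by (auto simp: less_Suc_eq_0_disj)

lemma smooth_uptoI:
  assumes "\<And>x. (f has_vector_derivative f' x) (at x)" "smooth_upto m f'"
  shows "smooth_upto (Suc m) f"
proof -
  have "(\<lambda>x. vector_derivative f (at x)) = f'"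
    using assms(1) by (auto intro: vector_derivative_at)
  then show ?thesis
    using assms by (auto simp: smooth_upto_Suc intro: differentiableI_vector)
qed

lemma smooth_uptoE:
  assumes "smooth_upto (Suc m) f"
  obtains f' where "\<And>x. (f has_vector_derivative f' x) (at x)" "smooth_upto m f'"
  using assms by (metis smooth_upto_Suc vector_derivative_works)

lemma smooth_upto_mono: "smooth_upto m f \<Longrightarrow> k \<le> m \<Longrightarrow> smooth_upto k f"
  by (auto simp: smooth_upto_def)

lemma smooth_upto_const: "smooth_upto m (\<lambda>x. c)"
proof (induction m arbitrary: c)
  case (Suc m)
  show ?case by (rule smooth_uptoI[where f' = "\<lambda>_. 0"]) (auto intro!: derivative_eq_intros Suc)
qed simp

lemma smooth_upto_add: "smooth_upto m f \<Longrightarrow> smooth_upto m g \<Longrightarrow> smooth_upto m (\<lambda>x. f x + g x)"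
proof (induction m arbitrary: f g)
  case (Suc m)
  obtain f' g' where *: "\<And>x. (f has_vector_derivative f' x) (at x)" "smooth_upto m f'"
     "\<And>x. (g has_vector_derivative g' x) (at x)" "smooth_upto m g'"
    using Suc.prems by (metis smooth_uptoE)
  show ?case
    by (rule smooth_uptoI[where f' = "\<lambda>x. f' x + g' x"])
      (auto intro!: derivative_eq_intros * Suc.IH)
qed simp

lemma smooth_upto_mult: "smooth_upto m f \<Longrightarrow> smooth_upto m g \<Longrightarrow> smooth_upto m (\<lambda>x. f x * g x)"
proof (induction m arbitrary: f g)
  case (Suc m)
  obtain f' g' where *: "\<And>x. (f has_vector_derivative f' x) (at x)" "smooth_upto m f'"
     "\<And>x. (g has_vector_derivative g' x) (at x)" "smooth_upto m g'"
    using Suc.prems by (metis smooth_uptoE)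
  have "smooth_upto m f" "smooth_upto m g"
    using Suc.prems by (auto intro: smooth_upto_mono)
  then show ?case
    by (intro smooth_uptoI[where f' = "\<lambda>x. f x * g' x + f' x * g x"] smooth_upto_add Suc.IH *)
      (intro has_vector_derivative_mult *)
qed simp

lemma smooth_upto_affine: "smooth_upto m f \<Longrightarrow> smooth_upto m (\<lambda>x. f (\<alpha> * x + \<beta>))"
proof (induction m arbitrary: f)
  case (Suc m)
  obtain f' where *: "\<And>x. (f has_vector_derivative f' x) (at x)" "smooth_upto m f'"
    using Suc.prems by (metis smooth_uptoE)
  show ?case
  proof (rule smooth_uptoI[where f' = "\<lambda>x. of_real \<alpha> * f' (\<alpha> * x + \<beta>)"])
    fix x
    have "((\<lambda>x. \<alpha> * x + \<beta>) has_real_derivative \<alpha>) (at x)"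
      by (auto intro!: derivative_eq_intros)
    then have "((\<lambda>x. \<alpha> * x + \<beta>) has_vector_derivative \<alpha>) (at x)"
      by (simp add: has_real_derivative_iff_has_vector_derivative)
    from vector_diff_chain_at[OF this *(1)]
    show "((\<lambda>x. f (\<alpha> * x + \<beta>)) has_vector_derivative of_real \<alpha> * f' (\<alpha> * x + \<beta>)) (at x)"
      by (simp add: o_def scaleR_conv_of_real)
  qed (intro smooth_upto_mult smooth_upto_const Suc.IH *)
qed simp

text \<open>For x > 0 the derivative of p(1/x) exp(-1/x) is x^(-2) (p - p')(1/x) exp(-1/x), so this
  family is closed under differentiation. Carrying the polynomial along turns smoothness into an
  induction over the order for all p simultaneously.\<close>

definition bump_poly :: "real poly \<Rightarrow> real \<Rightarrow> real" where
  "bump_poly p x = (if x > 0 then poly p (1 / x) * exp (- (1 / x)) else 0)"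

lemma tendsto_poly_exp_neg: "((\<lambda>y::real. poly p y * exp (- y)) \<longlongrightarrow> 0) at_top"
proof -
  have "((\<lambda>y. \<Sum>i\<le>degree p. coeff p i * (y ^ i * exp (- y))) \<longlongrightarrow> (\<Sum>i\<le>degree p. coeff p i * 0)) at_top"
    by (intro tendsto_sum tendsto_mult tendsto_const)
       (use tendsto_power_div_exp_0 in \<open>simp add: exp_minus field_simps\<close>)
  then show ?thesis
    by (simp add: poly_altdef sum_distrib_right mult.assoc)
qed

lemma bump_poly_tendsto_0: "(bump_poly p \<longlongrightarrow> 0) (at 0)"
proof -
  have "((\<lambda>x. poly p (1 / x) * exp (- (1 / x))) \<longlongrightarrow> 0) (at_right (0::real))"
    using filterlim_compose[OF tendsto_poly_exp_neg filterlim_inverse_at_top_right, of p]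
    by (simp add: field_simps)
  then have "(bump_poly p \<longlongrightarrow> 0) (at_right 0)"
    by (rule Lim_transform_eventually)
      (auto simp: bump_poly_def eventually_at_filter)
  moreover have "(bump_poly p \<longlongrightarrow> 0) (at_left 0)"
    by (rule Lim_transform_eventually[OF tendsto_const])
      (auto simp: bump_poly_def eventually_at_filter)
  ultimately show ?thesis
    by (simp add: filterlim_split_at_real)
qed

lemma bump_poly_deriv:
  "(bump_poly p has_real_derivative bump_poly ([:0, 0, 1:] * (p - pderiv p)) x) (at x)"
proof (cases x "0::real" rule: linorder_cases)
  case less
  have "(bump_poly p has_real_derivative 0) (at x)"
    by (rule has_field_derivative_transform_within_open[where S = "{..<0}" and f = "\<lambda>_. 0"])
      (use less in \<open>auto simp: bump_poly_def\<close>)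
  then show ?thesis using less by (simp add: bump_poly_def)
next
  case equal
  \<comment> \<open>The difference quotient at 0 is again a \<open>bump_poly\<close>, now of X p, so
    its limit is already known.\<close>
  have "((\<lambda>h. bump_poly p h / h) \<longlongrightarrow> 0) (at 0)"
    by (rule Lim_transform_eventually[OF bump_poly_tendsto_0[of "[:0,1:] * p"]])
      (auto simp: bump_poly_def eventually_at_filter field_simps)
  then have "(bump_poly p has_real_derivative 0) (at 0)"
    by (simp add: DERIV_def bump_poly_def)
  then show ?thesis using equal by (simp add: bump_poly_def)
next
  case greater
  have "((\<lambda>x. poly p (1 / x) * exp (- (1 / x))) has_real_derivative
      bump_poly ([:0, 0, 1:] * (p - pderiv p)) x) (at x)"
    using greater
    by (auto intro!: derivative_eq_intros DERIV_chain'[OF _ poly_DERIV]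
        simp: bump_poly_def field_simps power2_eq_square)
  then show ?thesis
    by (rule has_field_derivative_transform_within_open[where S = "{0<..}"])
      (use greater in \<open>auto simp: bump_poly_def\<close>)
qed

lemma smooth_upto_bump_poly: "smooth_upto m (\<lambda>x. of_real (bump_poly p x))"
proof (induction m arbitrary: p)
  case (Suc m)
  show ?case
  proof (rule smooth_uptoI)
    fix x
    show "((\<lambda>x. of_real (bump_poly p x)) has_vector_derivative
         complex_of_real (bump_poly ([:0, 0, 1:] * (p - pderiv p)) x)) (at x)"
      using bump_poly_deriv[of p x]
      by (simp add: has_real_derivative_iff_has_vector_derivative has_vector_derivative_of_real)
  qed (rule Suc)
qed simp

section \<open>Plateau functions approximating indicators of intervals\<close>

definition smooth_step :: "real \<Rightarrow> real" where "smooth_step = bump_poly 1"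

lemma smooth_step_eq: "smooth_step x = (if x > 0 then exp (- (1 / x)) else 0)"
  by (simp add: smooth_step_def bump_poly_def)

lemma smooth_step_bounds: "0 \<le> smooth_step x" "smooth_step x \<le> 1"
  by (auto simp: smooth_step_eq)

lemma smooth_upto_iff_differentiable:
  "(\<forall>k x. nth_vderiv k \<phi> differentiable (at x)) \<longleftrightarrow> (\<forall>m. smooth_upto m \<phi>)"
  unfolding smooth_upto_def by blast

text \<open>The shift by -1 makes the first factor vanish up to c + 1/n and the second from d - 1/n
  on, so the support stays strictly inside (c, d). As n grows both arguments tend to infinity at
  each interior point, where \<open>smooth_step\<close> tends to 1; no normalisation or
  mollification is needed.\<close>

definition plateau :: "real \<Rightarrow> real \<Rightarrow> nat \<Rightarrow> real \<Rightarrow> real" where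
  "plateau c d n x = smooth_step (real n * (x - c) - 1) * smooth_step (real n * (d - x) - 1)"

lemma test_functionI:
  assumes "\<And>m. smooth_upto m \<phi>" "\<And>x. x \<notin> {c..d} \<Longrightarrow> \<phi> x = 0" "{c..d} \<subseteq> U"
  shows "test_function U \<phi>"
proof -
  have "closure {x. \<phi> x \<noteq> 0} \<subseteq> {c..d}"
    by (rule closure_minimal) (use assms(2) in blast, simp)
  moreover from this have "compact (closure {x. \<phi> x \<noteq> 0})"
    by (metis bounded_closed_interval bounded_subset closed_closure compact_eq_bounded_closed)
  ultimately show ?thesis
    using assms(1,3) by (auto simp: test_function_def smooth_upto_iff_differentiable)
qed

lemma smooth_upto_plateau: "smooth_upto m (\<lambda>x. of_real (plateau c d n x))"
proof -
  have "smooth_upto m (\<lambda>x. of_real (bump_poly 1 (real n * x + (- (real n * c) - 1))) *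
      of_real (bump_poly 1 ((- real n) * x + (real n * d - 1))))"
    by (intro smooth_upto_mult smooth_upto_affine[where f = "\<lambda>x. of_real (bump_poly 1 x)"] smooth_upto_bump_poly)
  then show ?thesis
    by (simp add: plateau_def smooth_step_def algebra_simps)
qed

lemma plateau_test_function:
  assumes "a \<le> c" "d \<le> b"
  shows "test_function {a<..<b} (\<lambda>x. of_real (plateau c d (Suc n) x))"
proof (rule test_functionI[where c = "c + 1 / Suc n" and d = "d - 1 / Suc n"])
  show "complex_of_real (plateau c d (Suc n) x) = 0" if "x \<notin> {c + 1 / Suc n..d - 1 / Suc n}" for x
    using that by (auto simp: plateau_def smooth_step_eq field_simps)
  have "0 < 1 / real (Suc n)" by simp
  then have "a < c + 1 / Suc n" "d - 1 / Suc n < b"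
    using assms by linarith+
  then show "{c + 1 / Suc n..d - 1 / Suc n} \<subseteq> {a<..<b}"
    by auto
qed (rule smooth_upto_plateau)

lemma plateau_bounds: "0 \<le> plateau c d n x" "plateau c d n x \<le> 1"
  using smooth_step_bounds by (auto simp: plateau_def intro: mult_le_one)

lemma smooth_step_tendsto: "x > 0 \<Longrightarrow> (\<lambda>n. smooth_step (real n * x - 1)) \<longlonglongrightarrow> 1"
proof -
  assume x: "x > 0"
  have lim: "filterlim (\<lambda>n. real n * x - 1) at_top sequentially"
    using filterlim_tendsto_add_at_top[OF tendsto_const[of "-1"]
        filterlim_at_top_mult_tendsto_pos[OF tendsto_const[of x] x filterlim_real_sequentially]]
    by (simp add: mult.commute)
  have "((\<lambda>y::real. exp (- (1 / y))) \<longlongrightarrow> exp (- 0)) at_top"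
    by (intro tendsto_intros) (use tendsto_inverse_0_at_top[OF filterlim_ident] in \<open>simp add: divide_inverse\<close>)
  then have "(smooth_step \<longlongrightarrow> 1) at_top"
    using Lim_transform_eventually[of _ _ _ smooth_step]
      eventually_mono[OF eventually_gt_at_top[of 0], of "\<lambda>x. exp (- (1 / x)) = smooth_step x"]
    by (simp add: smooth_step_eq)
  from filterlim_compose[OF this lim] show ?thesis .
qed

lemma plateau_tendsto: "(\<lambda>n. plateau c d n x) \<longlonglongrightarrow> indicator {c<..<d} x"
proof (cases "x \<in> {c<..<d}")
  case True
  then show ?thesis
    using tendsto_mult[OF smooth_step_tendsto[of "x - c"] smooth_step_tendsto[of "d - x"]]
    by (simp add: plateau_def)
next
  case False
  have "plateau c d n x = 0" for n
  proof (cases "x \<le> c")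
    case True
    then have "real n * (x - c) \<le> 0" by (simp add: mult_nonneg_nonpos)
    then show ?thesis by (simp add: plateau_def smooth_step_eq)
  next
    case F: False
    then have "real n * (d - x) \<le> 0" using False by (simp add: mult_nonneg_nonpos)
    then show ?thesis by (simp add: plateau_def smooth_step_eq)
  qed
  then show ?thesis using False by simp
qed

text \<open>Half-open intervals are stable under intersection and generate the Borel sets, so
  Dynkin's argument spreads the vanishing integrals to all Borel sets, and a function with zero
  integral over every set is zero almost everywhere.\<close>

lemma AE_zero_of_intervals:
  fixes f :: "real \<Rightarrow> real"
  assumes f: "integrable lborel f"
    and z: "\<And>c d. c < d \<Longrightarrow> (LINT x|lborel. indicator {c<..d} x *\<^sub>R f x) = 0"
  shows "AE x in lborel. f x = 0"
proof (rule sigma_finite_measure.density_zero[OF sigma_finite_lborel f])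
  have z': "set_lebesgue_integral lborel {c<..d} f = 0" for c d
    using z[of c d] by (cases "c < d") (auto simp: set_lebesgue_integral_def)
  have si: "set_integrable lborel A f" if "A \<in> sets borel" for A
    unfolding set_integrable_def by (rule integrable_mult_indicator) (use that f in auto)
  \<comment> \<open>The complement case of the induction needs the integral over the whole line; it
    is the limit over exhausting intervals.\<close>
  have UN: "(\<lambda>n. set_lebesgue_integral lborel {- real n<..real n} f) \<longlonglongrightarrow> set_lebesgue_integral lborel (\<Union>n. {- real n<..real n}) f"
    by (rule set_integral_cont_up) (auto simp: incseq_def intro!: si)
  moreover have "(\<Union>n. {- real n<..real n}) = UNIV"
  proof -
    have "\<exists>n. - real n < x \<and> x \<le> real n" for x
      using reals_Archimedean2[of "\<bar>x\<bar>"] by (metis abs_less_iff less_eq_real_def minus_less_iff)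
    then show ?thesis by auto
  qed
  ultimately have U0: "set_lebesgue_integral lborel UNIV f = 0"
    by (simp add: z' LIMSEQ_const_iff)
  fix A :: "real set"
  assume "A \<in> sets lborel"
  let ?G = "range (\<lambda>(c, d). {c<..d::real})"
  have "Int_stable ?G" "?G \<subseteq> Pow UNIV"
    by (auto simp: Int_stable_def)
  moreover have "A \<in> sigma_sets UNIV ?G"
    using \<open>A \<in> sets lborel\<close> by (simp add: borel_sigma_sets_Ioc)
  ultimately show "set_lebesgue_integral lborel A f = 0"
  proof (induction rule: sigma_sets_induct_disjoint)
    case (basic A)
    then show ?case using z' by auto
  next
    case empty
    show ?case by (simp add: set_lebesgue_integral_def)
  next
    case (compl A)
    then have A: "A \<in> sets borel" by (simp add: borel_sigma_sets_Ioc)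
    have "set_lebesgue_integral lborel (A \<union> (UNIV - A)) f
       = set_lebesgue_integral lborel A f + set_lebesgue_integral lborel (UNIV - A) f"
      by (rule set_integral_Un) (use A in \<open>auto intro!: si\<close>)
    then show ?case using U0 compl by simp
  next
    case (union F)
    then have F: "F i \<in> sets borel" for i by (auto simp: borel_sigma_sets_Ioc)
    then have "set_lebesgue_integral lborel (\<Union>i. F i) f = (\<Sum>i. set_lebesgue_integral lborel (F i) f)"
      using union(1) by (intro lebesgue_integral_countable_add) (auto intro!: si simp: disjoint_family_on_def)
    then show ?case using union by simp
  qed
qed

text \<open>The function spaces use the completed measure, whereas Fubini and the Dynkin argument
  are applied over \<open>lborel\<close>. A Borel representative that vanishes outside S bridges the
  two.\<close>

lemma lebesgue_on_borel_rep:
  fixes v :: "real \<Rightarrow> complex"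
  assumes v: "integrable (lebesgue_on S) v" and S[measurable]: "S \<in> sets borel"
  obtains g where "integrable lborel g" "\<And>x. x \<notin> S \<Longrightarrow> g x = 0" "AE x in lebesgue_on S. v x = g x"
proof -
  define v0 where "v0 = (\<lambda>x. indicator S x *\<^sub>R v x)"
  have v0: "integrable lebesgue v0"
    using v unfolding v0_def by (subst (asm) integrable_restrict_space) auto
  have "(\<lambda>x. Re (v0 x)) \<in> borel_measurable lebesgue" "(\<lambda>x. Im (v0 x)) \<in> borel_measurable lebesgue"
    using v0 by (auto intro!: borel_measurable_integrable)
  from this[THEN completion_ex_borel_measurable_real]
  obtain g1 g2 where g[measurable]: "g1 \<in> borel_measurable lborel" "g2 \<in> borel_measurable lborel"
    and AE: "AE x in lborel. Re (v0 x) = g1 x" "AE x in lborel. Im (v0 x) = g2 x"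
    by metis
  define g where "g = (\<lambda>x. indicator S x *\<^sub>R Complex (g1 x) (g2 x))"
  have gm[measurable]: "g \<in> borel_measurable lborel"
    unfolding g_def Complex_eq by measurable
  from AE have "AE x in lborel. v0 x = g x"
  proof eventually_elim
    case (elim x)
    then show ?case by (auto simp: g_def v0_def complex_eq_iff indicator_def)
  qed
  then have AE': "AE x in lebesgue. v0 x = g x"
    by (rule AE_completion)
  have "integrable lebesgue g"
    using v0 AE' by (subst integrable_cong_AE[of g _ v0]) (auto intro: measurable_completion borel_measurable_integrable)
  then have "integrable lborel g"
    by (simp add: integrable_completion)
  moreover have "AE x in lebesgue_on S. v x = g x"
    using AE' by (subst AE_restrict_space_iff) (auto simp: v0_def elim: eventually_mono)
  ultimately show thesis
    using that by (auto simp: g_def)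
qed

lemma integral_lebesgue_on_borel:
  fixes g :: "real \<Rightarrow> complex"
  assumes "g \<in> borel_measurable borel" "\<And>x. x \<notin> S \<Longrightarrow> g x = 0" "S \<in> sets borel"
  shows "(LINT x|lebesgue_on S. g x) = (LINT x|lborel. g x)"
proof -
  have "(LINT x|lebesgue_on S. g x) = (LINT x|lebesgue. indicator S x *\<^sub>R g x)"
    using assms(3) by (subst integral_restrict_space) auto
  also have "(\<lambda>x. indicator S x *\<^sub>R g x) = g"
    using assms(2) by (auto simp: indicator_def fun_eq_iff)
  finally show ?thesis using assms(1) by (simp add: integral_completion)
qed

lemma integrable_mult_bounded:
  fixes v \<phi> :: "'a \<Rightarrow> complex"
  assumes v: "integrable M v" and [measurable]: "\<phi> \<in> borel_measurable M"
    and B: "\<And>x. x \<in> space M \<Longrightarrow> cmod (\<phi> x) \<le> B"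
  shows "integrable M (\<lambda>x. v x * \<phi> x)"
proof (rule Bochner_Integration.integrable_bound)
  show "integrable M (\<lambda>x. of_real B * v x)" using v by simp
  show "(\<lambda>x. v x * \<phi> x) \<in> borel_measurable M" using v by measurable
  show "AE x in M. norm (v x * \<phi> x) \<le> norm (of_real B * v x)"
  proof (rule AE_I2)
    fix x assume "x \<in> space M"
    then have "cmod (\<phi> x) \<le> \<bar>B\<bar>" using B by fastforce
    then show "norm (v x * \<phi> x) \<le> norm (of_real B * v x)"
      by (simp add: norm_mult mult.commute mult_right_mono)
  qed
qed

section \<open>Calculus of test functions on an interval\<close>

lemma test_function_smooth: "test_function U \<phi> \<Longrightarrow> smooth_upto m \<phi>"
  using smooth_upto_iff_differentiable test_function_def by blast

lemma test_function_vderiv: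
  "test_function U \<phi> \<Longrightarrow> (\<phi> has_vector_derivative nth_vderiv 1 \<phi> x) (at x)"
  unfolding test_function_def
  by (metis One_nat_def nth_vderiv_0 nth_vderiv_Suc' vector_derivative_works)

lemma test_function_continuous: "test_function U \<phi> \<Longrightarrow> continuous_on A \<phi>"
  by (meson continuous_at_imp_continuous_on has_vector_derivative_continuous test_function_vderiv)

lemma test_function_measurable: "test_function U \<phi> \<Longrightarrow> \<phi> \<in> borel_measurable borel"
  by (intro borel_measurable_continuous_onI test_function_continuous)

lemma test_function_support:
  assumes "test_function {a<..<b} \<phi>" "a < (b::real)"
  obtains c d where "a < c" "c \<le> d" "d < b" "\<forall>x. x \<notin> {c..d} \<longrightarrow> \<phi> x = 0"
proof (cases "{x. \<phi> x \<noteq> 0} = {}")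
  case True
  then show thesis using that[of "(a + b) / 2" "(a + b) / 2"] assms(2) by auto
next
  case False
  let ?S = "closure {x. \<phi> x \<noteq> 0}"
  have S: "compact ?S" "?S \<noteq> {}" "?S \<subseteq> {a<..<b}"
    using assms(1) False by (auto simp: test_function_def)
  obtain c where c: "c \<in> ?S" "\<And>x. x \<in> ?S \<Longrightarrow> c \<le> x" using compact_attains_inf[OF S(1,2)] by blast
  obtain d where d: "d \<in> ?S" "\<And>x. x \<in> ?S \<Longrightarrow> x \<le> d" using compact_attains_sup[OF S(1,2)] by blast
  have "\<phi> x = 0" if "x \<notin> {c..d}" for x
  proof (rule ccontr)
    assume "\<phi> x \<noteq> 0"
    then have "x \<in> ?S" by (intro subsetD[OF closure_subset]) simp
    then show False using that c(2) d(2) by auto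
  qed
  moreover have "a < c" "d < b" "c \<le> d" using c d S(3) by auto
  ultimately show thesis using that[of c d] by blast
qed

lemma test_function_bounded:
  assumes "test_function {a<..<b} \<phi>" "a < (b::real)"
  obtains B where "0 \<le> B" "\<And>x. cmod (\<phi> x) \<le> B"
proof -
  obtain c d where cd: "a < c" "d < b" "c \<le> d" "\<forall>x. x \<notin> {c..d} \<longrightarrow> \<phi> x = 0"
    by (rule test_function_support[OF assms])
  have "compact (\<phi> ` {c..d})"
    by (intro compact_continuous_image test_function_continuous[OF assms(1)]) auto
  then obtain B where B: "\<And>y. y \<in> \<phi> ` {c..d} \<Longrightarrow> norm y \<le> B"
    using compact_imp_bounded bounded_iff by metis
  have "norm (\<phi> c) \<le> B" using cd(3) by (intro B) auto
  then have "0 \<le> B" using norm_ge_zero order_trans by blast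
  moreover have "cmod (\<phi> x) \<le> B" for x
    using B[of "\<phi> x"] cd(4) \<open>0 \<le> B\<close> by (cases "x \<in> {c..d}") auto
  ultimately show thesis using that by blast
qed

lemma test_function_deriv:
  assumes "test_function {a<..<b} \<phi>" "a < (b::real)"
  shows "test_function {a<..<b} (nth_vderiv 1 \<phi>)"
proof -
  obtain c d where cd: "a < c" "c \<le> d" "d < b" "\<forall>x. x \<notin> {c..d} \<longrightarrow> \<phi> x = 0"
    by (rule test_function_support[OF assms])
  show ?thesis
  proof (rule test_functionI[where c = c and d = d])
    show "smooth_upto m (nth_vderiv 1 \<phi>)" for m
      using test_function_smooth[OF assms(1), of "Suc m"] by (simp add: smooth_upto_Suc nth_vderiv_Suc)
    show "nth_vderiv 1 \<phi> x = 0" if "x \<notin> {c..d}" for x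
    proof -
      have "(\<phi> has_vector_derivative 0) (at x)"
        by (rule has_vector_derivative_transform_within_open[where S = "- {c..d}" and f = "\<lambda>_. 0"])
          (use that cd in \<open>auto simp: open_Compl\<close>)
      then show ?thesis
        using test_function_vderiv[OF assms(1)] vector_derivative_unique_at by blast
    qed
    show "{c..d} \<subseteq> {a<..<b}" using cd by auto
  qed
qed

lemma test_function_lincomb:
  assumes "test_function {a<..<b} \<phi>" "test_function {a<..<b} \<theta>" "a < (b::real)"
  shows "test_function {a<..<b} (\<lambda>x. \<phi> x + \<kappa> * \<theta> x)"
proof -
  obtain c d where cd: "a < c" "c \<le> d" "d < b" "\<forall>x. x \<notin> {c..d} \<longrightarrow> \<phi> x = 0"
    by (rule test_function_support[OF assms(1,3)])
  obtain c' d' where cd': "a < c'" "c' \<le> d'" "d' < b" "\<forall>x. x \<notin> {c'..d'} \<longrightarrow> \<theta> x = 0"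
    by (rule test_function_support[OF assms(2,3)])
  show ?thesis
  proof (rule test_functionI[where c = "min c c'" and d = "max d d'"])
    show "smooth_upto m (\<lambda>x. \<phi> x + \<kappa> * \<theta> x)" for m
      using assms by (intro smooth_upto_add smooth_upto_mult smooth_upto_const test_function_smooth)
    show "\<phi> x + \<kappa> * \<theta> x = 0" if "x \<notin> {min c c'..max d d'}" for x
    proof -
      have "x \<notin> {c..d}" "x \<notin> {c'..d'}" using that by auto
      then show ?thesis using cd(4) cd'(4) by simp
    qed
    show "{min c c'..max d d'} \<subseteq> {a<..<b}" using cd cd' by auto
  qed
qed

text \<open>A primitive started left of the support is constant to the right of it, with the total
  integral as value; zero mean is what makes the support compact again.\<close>

lemma test_function_primitive:
  assumes \<theta>: "test_function {a<..<b} \<theta>" and "a < (b::real)" and z: "(LINT x|lborel. \<theta> x) = 0"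
  obtains \<phi> where "test_function {a<..<b} \<phi>" "nth_vderiv 1 \<phi> = \<theta>"
proof -
  obtain c d where cd: "a < c" "c \<le> d" "d < b" "\<forall>x. x \<notin> {c..d} \<longrightarrow> \<theta> x = 0"
    by (rule test_function_support[OF assms(1,2)])
  have int: "\<theta> integrable_on {x..y}" for x y
    by (intro integrable_continuous_real test_function_continuous[OF \<theta>])
  have zero: "integral {x..y} \<theta> = 0" if "y \<le> c \<or> d \<le> x" for x y
  proof -
    have "integral {x..y} \<theta> = integral {x..y} (\<lambda>_. 0)"
      by (rule integral_spike[of "{c, d}"]) (use that cd(4) in \<open>auto\<close>)
    then show ?thesis by simp
  qed
  have "integral {c..d} \<theta> = (LINT x|lborel. indicator {c..d} x *\<^sub>R \<theta> x)"
    using set_borel_integral_eq_integral(2)[OF borel_integrable_atLeastAtMost'[OF test_function_continuous[OF \<theta>], of c d]]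
    by (simp add: set_lebesgue_integral_def)
  also have "(\<lambda>x. indicator {c..d} x *\<^sub>R \<theta> x) = \<theta>"
    using cd(4) by (auto simp: indicator_def fun_eq_iff)
  finally have tot: "integral {c..d} \<theta> = 0" using z by simp
  define \<phi> where "\<phi> x = integral {c..x} \<theta>" for x
  \<comment> \<open>The base point may be moved anywhere to the left of c. For the derivative at x
    it is moved strictly below x, so that x is interior to the interval of integration.\<close>
  have ext: "\<phi> y = integral {L..y} \<theta>" if "L \<le> c" for L y
  proof (cases "c \<le> y")
    case True
    then have "integral {L..y} \<theta> = integral {L..c} \<theta> + integral {c..y} \<theta>"
      using that int by (simp add: Henstock_Kurzweil_Integration.integral_combine)
    then show ?thesis using zero[of c L] by (simp add: \<phi>_def)
  next
    case False
    then show ?thesis using zero[of y L] by (simp add: \<phi>_def)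
  qed
  have der: "(\<phi> has_vector_derivative \<theta> x) (at x)" for x
  proof -
    define L where "L = min c x - 1"
    have "((\<lambda>y. integral {L..y} \<theta>) has_vector_derivative \<theta> x) (at x within {L..x + 1})"
      by (rule integral_has_vector_derivative[OF test_function_continuous[OF \<theta>]]) (auto simp: L_def)
    moreover have "(\<lambda>y. integral {L..y} \<theta>) = \<phi>" using ext[of L] by (auto simp: L_def)
    moreover have "at x within {L..x + 1} = at x" by (rule at_within_interior) (auto simp: L_def)
    ultimately show ?thesis by simp
  qed
  have "test_function {a<..<b} \<phi>"
  proof (rule test_functionI[where c = c and d = d])
    show "smooth_upto m \<phi>" for m
      by (cases m) (auto intro!: smooth_uptoI[OF der] test_function_smooth[OF \<theta>])
    show "\<phi> x = 0" if "x \<notin> {c..d}" for x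
    proof (cases "x < c")
      case False
      then have "d < x" using that by auto
      then have "\<phi> x = integral {c..d} \<theta> + integral {d..x} \<theta>"
        unfolding \<phi>_def using cd(2) int by (simp add: Henstock_Kurzweil_Integration.integral_combine)
      then show ?thesis using tot zero[of x d] by simp
    qed (simp add: \<phi>_def)
    show "{c..d} \<subseteq> {a<..<b}" using cd by auto
  qed
  moreover have "nth_vderiv 1 \<phi> = \<theta>"
    using vector_derivative_at[OF der] by (simp add: nth_vderiv_Suc)
  ultimately show thesis using that by blast
qed

section \<open>The fundamental lemma and its ingredients\<close>

lemma pairing_borel_rep:
  fixes w g \<phi> :: "real \<Rightarrow> complex"
  assumes w: "integrable (lebesgue_on S) w" and g: "integrable lborel g" "\<And>x. x \<notin> S \<Longrightarrow> g x = 0"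
    "AE x in lebesgue_on S. w x = g x" and [measurable]: "\<phi> \<in> borel_measurable borel" and S: "S \<in> sets borel"
  shows "(LINT x|lebesgue_on S. w x * \<phi> x) = (LINT x|lborel. g x * \<phi> x)"
proof -
  have \<phi>[measurable]: "\<phi> \<in> borel_measurable (lebesgue_on S)"
    by (intro measurable_restrict_space1 measurable_completion) simp
  have [measurable]: "w \<in> borel_measurable (lebesgue_on S)" "g \<in> borel_measurable borel"
    using w g by (auto dest: borel_measurable_integrable)
  have [measurable]: "g \<in> borel_measurable (lebesgue_on S)"
    by (intro measurable_restrict_space1 measurable_completion) simp
  have "(LINT x|lebesgue_on S. w x * \<phi> x) = (LINT x|lebesgue_on S. g x * \<phi> x)"
    by (rule integral_cong_AE) (use g(3) in \<open>auto elim: eventually_mono\<close>)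
  also have "\<dots> = (LINT x|lborel. g x * \<phi> x)"
    by (rule integral_lebesgue_on_borel) (use g(2) S in auto)
  finally show ?thesis .
qed

lemma plateau_integral_tendsto:
  fixes g :: "real \<Rightarrow> complex"
  assumes g: "integrable lborel g"
  shows "(\<lambda>n. LINT x|lborel. g x * of_real (plateau c d (Suc n) x))
     \<longlonglongrightarrow> (LINT x|lborel. g x * of_real (indicator {c<..<d} x))"
proof (rule integral_dominated_convergence[where w = "\<lambda>x. norm (g x)"])
  have [measurable]: "g \<in> borel_measurable borel" using g by (auto dest: borel_measurable_integrable)
  have "test_function {c - 1<..<d + 1} (\<lambda>x. of_real (plateau c d (Suc n) x))" for n
    by (rule plateau_test_function) auto
  then have [measurable]: "(\<lambda>x. complex_of_real (plateau c d (Suc n) x)) \<in> borel_measurable borel" for n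
    by (rule test_function_measurable)
  show "(\<lambda>x. g x * of_real (plateau c d (Suc n) x)) \<in> borel_measurable lborel" for n
    by measurable
  show "(\<lambda>x. g x * of_real (indicator {c<..<d} x)) \<in> borel_measurable lborel"
    by measurable
  show "AE x in lborel. (\<lambda>n. g x * of_real (plateau c d (Suc n) x)) \<longlonglongrightarrow> g x * of_real (indicator {c<..<d} x)"
    by (intro AE_I2 tendsto_mult tendsto_const tendsto_of_real LIMSEQ_Suc plateau_tendsto)
  show "AE x in lborel. norm (g x * of_real (plateau c d (Suc n) x)) \<le> norm (g x)" for n
    using plateau_bounds by (auto simp: norm_mult intro!: mult_left_le)
qed (use g in auto)

text \<open>Testing with plateaus and passing to the limit by dominated convergence gives vanishing
  integrals over all intervals; real and imaginary part are then zero almost everywhere.\<close>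

lemma weak_zero_integrable:
  fixes w :: "real \<Rightarrow> complex"
  assumes w: "integrable (lebesgue_on {a<..<b}) w" and "a < b"
    and z: "\<And>\<phi>. test_function {a<..<b} \<phi> \<Longrightarrow> (LINT x|lebesgue_on {a<..<b}. w x * \<phi> x) = 0"
  shows "AE x in lebesgue_on {a<..<b}. w x = 0"
proof -
  obtain g where g: "integrable lborel g" "\<And>x. x \<notin> {a<..<b} \<Longrightarrow> g x = 0"
    "AE x in lebesgue_on {a<..<b}. w x = g x"
    using lebesgue_on_borel_rep[OF w] by auto
  have zI: "(LINT x|lborel. g x * of_real (indicator {c<..<d} x)) = 0" for c d
  proof -
    \<comment> \<open>Clipping to (a, b) makes the plateau an admissible test function and loses
      nothing, because g vanishes outside (a, b).\<close>
    have "(LINT x|lborel. g x * of_real (plateau (max c a) (min d b) (Suc n) x)) = 0" for n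
    proof -
      have t: "test_function {a<..<b} (\<lambda>x. of_real (plateau (max c a) (min d b) (Suc n) x))"
        by (rule plateau_test_function) auto
      show ?thesis
        using z[OF t] pairing_borel_rep[OF w g test_function_measurable[OF t]] by simp
    qed
    with plateau_integral_tendsto[OF g(1), of "max c a" "min d b"]
    have "(LINT x|lborel. g x * of_real (indicator {max c a<..<min d b} x)) = 0"
      by (simp add: LIMSEQ_const_iff)
    moreover have "g x * of_real (indicator {max c a<..<min d b} x) = g x * of_real (indicator {c<..<d} x)" for x
      using g(2)[of x] by (auto simp: indicator_def)
    ultimately show ?thesis by simp
  qed
  have zc: "(LINT x|lborel. indicator {c<..d} x *\<^sub>R g x) = 0" for c d
  proof -
    have [measurable]: "g \<in> borel_measurable borel" using g by (auto dest: borel_measurable_integrable)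
    have "(LINT x|lborel. indicator {c<..d} x *\<^sub>R g x) = (LINT x|lborel. g x * of_real (indicator {c<..<d} x))"
    proof (rule integral_cong_AE)
      have "AE x in lborel. x \<noteq> d" by (rule AE_lborel_singleton)
      then show "AE x in lborel. indicator {c<..d} x *\<^sub>R g x = g x * of_real (indicator {c<..<d} x)"
        by eventually_elim (auto simp: indicator_def)
    qed measurable
    then show ?thesis using zI by simp
  qed
  have int: "integrable lborel (\<lambda>x. indicator {c<..d} x *\<^sub>R g x)" for c d
    using g(1) by (intro integrable_mult_indicator) auto
  have "AE x in lborel. Re (g x) = 0"
  proof (rule AE_zero_of_intervals)
    show "(LINT x|lborel. indicator {c<..d} x *\<^sub>R Re (g x)) = 0" for c d
      using integral_Re[OF int, of c d] zc[of c d] by simp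
  qed (use g in auto)
  moreover have "AE x in lborel. Im (g x) = 0"
  proof (rule AE_zero_of_intervals)
    show "(LINT x|lborel. indicator {c<..d} x *\<^sub>R Im (g x)) = 0" for c d
      using integral_Im[OF int, of c d] zc[of c d] by simp
  qed (use g in auto)
  ultimately have "AE x in lborel. g x = 0"
    by eventually_elim (simp add: complex_eq_iff)
  then have "AE x in lebesgue. g x = 0" by (rule AE_completion)
  then have "AE x in lebesgue_on {a<..<b}. g x = 0"
    by (subst AE_restrict_space_iff) (auto elim: eventually_mono)
  with g(3) show ?thesis by eventually_elim simp
qed

lemma integral_primitive_mult:
  fixes v \<theta> :: "real \<Rightarrow> complex"
  assumes v: "integrable lborel v" and \<theta>: "integrable lborel \<theta>"
  shows "(LINT x|lborel. (LINT s|lborel. indicator {..x} s *\<^sub>R v s) * \<theta> x)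
       = (LINT s|lborel. v s * (LINT x|lborel. indicator {s..} x *\<^sub>R \<theta> x))"
proof -
  have [measurable]: "v \<in> borel_measurable borel" "\<theta> \<in> borel_measurable borel"
    using v \<theta> by (auto dest: borel_measurable_integrable)
  define f where "f = (\<lambda>(s, x). (if s \<le> x then v s * \<theta> x else 0))"
  have [measurable]: "f \<in> borel_measurable (lborel \<Otimes>\<^sub>M lborel)"
    unfolding f_def by measurable
  have intx: "integrable lborel (\<lambda>x. f (s, x))" for s
  proof (rule Bochner_Integration.integrable_bound)
    show "integrable lborel (\<lambda>x. v s * \<theta> x)" using \<theta> by simp
  qed (auto simp: f_def)
  have "integrable (lborel \<Otimes>\<^sub>M lborel) f"
  proof (rule lborel_pair.Fubini_integrable)
    show "integrable lborel (\<lambda>s. LINT x|lborel. norm (f (s, x)))"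
    proof (rule Bochner_Integration.integrable_bound)
      show "integrable lborel (\<lambda>s. norm (v s) * (LINT x|lborel. norm (\<theta> x)))" using v by simp
      show "(\<lambda>s. LINT x|lborel. norm (f (s, x))) \<in> borel_measurable lborel" by measurable
      show "AE s in lborel. norm (LINT x|lborel. norm (f (s, x))) \<le> norm (norm (v s) * (LINT x|lborel. norm (\<theta> x)))"
      proof (rule AE_I2)
        fix s
        have "(LINT x|lborel. norm (f (s, x))) \<le> (LINT x|lborel. norm (v s) * norm (\<theta> x))"
          by (rule integral_mono) (use intx[of s] \<theta> in \<open>auto simp: f_def norm_mult\<close>)
        then show "norm (LINT x|lborel. norm (f (s, x))) \<le> norm (norm (v s) * (LINT x|lborel. norm (\<theta> x)))"
          by (simp add: abs_mult)
      qed
    qed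
  qed (use intx in auto)
  then have "integrable (lborel \<Otimes>\<^sub>M lborel) (case_prod (\<lambda>s x. f (s, x)))" by simp
  from lborel_pair.Fubini_integral[OF this]
  have "(LINT x|lborel. LINT s|lborel. f (s, x)) = (LINT s|lborel. LINT x|lborel. f (s, x))" .
  moreover have "(LINT s|lborel. f (s, x)) = (LINT s|lborel. indicator {..x} s *\<^sub>R v s) * \<theta> x" for x
  proof -
    have "(LINT s|lborel. f (s, x)) = (LINT s|lborel. (indicator {..x} s *\<^sub>R v s) * \<theta> x)"
      by (rule Bochner_Integration.integral_cong) (auto simp: f_def)
    then show ?thesis by (simp only: integral_mult_left_zero)
  qed
  moreover have "(LINT x|lborel. f (s, x)) = v s * (LINT x|lborel. indicator {s..} x *\<^sub>R \<theta> x)" for s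
  proof -
    have "(LINT x|lborel. f (s, x)) = (LINT x|lborel. v s * (indicator {s..} x *\<^sub>R \<theta> x))"
      by (rule Bochner_Integration.integral_cong) (auto simp: f_def)
    then show ?thesis by (simp only: integral_mult_right_zero)
  qed
  ultimately show ?thesis by simp
qed

text \<open>Evaluates the inner integral that \<open>integral_primitive_mult\<close> leaves when a
  primitive is tested with a derivative.\<close>

lemma test_function_tail_integral:
  assumes \<phi>: "test_function {a<..<b} \<phi>" and "a < (b::real)"
  shows "(LINT x|lborel. indicator {s..} x *\<^sub>R nth_vderiv 1 \<phi> x) = - \<phi> s"
proof -
  obtain c d where cd: "a < c" "c \<le> d" "d < b" "\<forall>x. x \<notin> {c..d} \<longrightarrow> \<phi> x = 0"
    by (rule test_function_support[OF assms])
  obtain c' d' where cd': "a < c'" "c' \<le> d'" "d' < b" "\<forall>x. x \<notin> {c'..d'} \<longrightarrow> nth_vderiv 1 \<phi> x = 0"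
    by (rule test_function_support[OF test_function_deriv[OF assms] assms(2)])
  define D where "D = max s b"
  have "(LINT x|lborel. indicator {s..} x *\<^sub>R nth_vderiv 1 \<phi> x) = (LINT x|lborel. indicator {s..D} x *\<^sub>R nth_vderiv 1 \<phi> x)"
  proof (rule Bochner_Integration.integral_cong)
    fix x
    show "indicator {s..} x *\<^sub>R nth_vderiv 1 \<phi> x = indicator {s..D} x *\<^sub>R nth_vderiv 1 \<phi> x"
      using cd'(1,2,3) cd'(4)[rule_format, of x] by (cases "x \<le> d'") (auto simp: D_def indicator_def simp del: One_nat_def)
  qed simp
  also have "\<dots> = \<phi> D - \<phi> s"
  proof (rule integral_FTC_Icc)
    show "s \<le> D" by (simp add: D_def)
    show "(\<phi> has_vector_derivative nth_vderiv 1 \<phi> x) (at x within {s..D})" for x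
      by (rule has_vector_derivative_at_within[OF test_function_vderiv[OF \<phi>]])
    show "continuous_on {s..D} (nth_vderiv 1 \<phi>)"
      by (rule test_function_continuous[OF test_function_deriv[OF assms]])
  qed
  also have "\<phi> D = 0" using cd by (auto simp: D_def)
  finally show ?thesis by simp
qed

lemma test_function_integrable:
  assumes \<phi>: "test_function {a<..<b} \<phi>" and "a < (b::real)"
  shows "integrable lborel \<phi>"
proof -
  obtain c d where cd: "a < c" "c \<le> d" "d < b" "\<forall>x. x \<notin> {c..d} \<longrightarrow> \<phi> x = 0"
    by (rule test_function_support[OF assms])
  have "integrable lborel (\<lambda>x. indicator {c..d} x *\<^sub>R \<phi> x)"
    by (rule borel_integrable_compact) (auto intro: test_function_continuous[OF \<phi>])
  also have "(\<lambda>x. indicator {c..d} x *\<^sub>R \<phi> x) = \<phi>"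
    using cd(4) by (auto simp: indicator_def fun_eq_iff)
  finally show ?thesis .
qed

text \<open>If all integrals vanished, so would the limit of those of the plateaus over (a, b),
  which is b - a.\<close>

lemma exists_test_function_integral_nonzero:
  assumes "a < (b::real)"
  obtains \<eta> where "test_function {a<..<b} \<eta>" "(LINT x|lborel. \<eta> x) \<noteq> 0"
proof (rule ccontr)
  assume no: "\<not> thesis"
  let ?g = "\<lambda>x. indicator {a..b} x *\<^sub>R (1::complex)"
  have g: "integrable lborel ?g" by (rule borel_integrable_compact) auto
  have "(LINT x|lborel. ?g x * of_real (plateau a b (Suc n) x)) = 0" for n
  proof -
    have t: "test_function {a<..<b} (\<lambda>x. of_real (plateau a b (Suc n) x))"
      by (rule plateau_test_function) auto
    obtain c d where cd: "a < c" "c \<le> d" "d < b" "\<forall>x. x \<notin> {c..d} \<longrightarrow> complex_of_real (plateau a b (Suc n) x) = 0"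
      by (rule test_function_support[OF t assms])
    have "(LINT x|lborel. ?g x * of_real (plateau a b (Suc n) x)) = (LINT x|lborel. of_real (plateau a b (Suc n) x))"
      by (rule Bochner_Integration.integral_cong) (use cd in \<open>auto simp: indicator_def\<close>)
    then show ?thesis using no that t by metis
  qed
  with plateau_integral_tendsto[OF g, of a b]
  have "(LINT x|lborel. ?g x * of_real (indicator {a<..<b} x)) = 0"
    by (simp add: LIMSEQ_const_iff)
  also have "(\<lambda>x. ?g x * of_real (indicator {a<..<b} x)) = (\<lambda>x. complex_of_real (indicator {a<..<b} x))"
    by (auto simp: indicator_def)
  finally show False using assms by simp
qed

lemma locally_integrable_mult_test:
  assumes v: "locally_integrable {a<..<b} v" and \<phi>: "test_function {a<..<b} \<phi>" and "a < (b::real)"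
  shows "integrable (lebesgue_on {a<..<b}) (\<lambda>x. v x * \<phi> x)"
proof -
  obtain c d where cd: "a < c" "c \<le> d" "d < b" "\<forall>x. x \<notin> {c..d} \<longrightarrow> \<phi> x = 0"
    by (rule test_function_support[OF \<phi> assms(3)])
  obtain B where B: "\<And>x. cmod (\<phi> x) \<le> B"
    using test_function_bounded[OF \<phi> assms(3)] by metis
  have "v absolutely_integrable_on {c..d}"
    using v cd(1-3) unfolding locally_integrable_def
    by (elim allE[of _ "{c..d}"]) auto
  then have "integrable lebesgue (\<lambda>x. indicator {c..d} x *\<^sub>R v x)"
    by (simp add: set_integrable_def)
  then have "integrable lebesgue (\<lambda>x. (indicator {c..d} x *\<^sub>R v x) * \<phi> x)"
    by (rule integrable_mult_bounded)
      (auto intro!: B measurable_completion simp: test_function_measurable[OF \<phi>])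
  also have "(\<lambda>x. (indicator {c..d} x *\<^sub>R v x) * \<phi> x) = (\<lambda>x. indicator {a<..<b} x *\<^sub>R (v x * \<phi> x))"
    using cd by (auto simp: indicator_def fun_eq_iff)
  finally show ?thesis by (subst integrable_restrict_space) auto
qed

lemma integrable_imp_locally_integrable:
  assumes "integrable (lebesgue_on {a<..<b}) v"
  shows "locally_integrable {a<..<(b::real)} v"
  unfolding locally_integrable_def
proof safe
  fix K assume K: "compact K" "K \<subseteq> {a<..<b}"
  have "integrable lebesgue (\<lambda>x. indicator {a<..<b} x *\<^sub>R v x)"
    using assms by (subst (asm) integrable_restrict_space) auto
  then have "integrable lebesgue (\<lambda>x. indicator K x *\<^sub>R (indicator {a<..<b} x *\<^sub>R v x))"
    by (rule integrable_mult_indicator[rotated]) (use K in \<open>auto intro: lmeasurable_compact fmeasurableD\<close>)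
  also have "(\<lambda>x. indicator K x *\<^sub>R (indicator {a<..<b} x *\<^sub>R v x)) = (\<lambda>x. indicator K x *\<^sub>R v x)"
    using K(2) by (auto simp: indicator_def fun_eq_iff)
  finally show "v absolutely_integrable_on K" by (simp add: set_integrable_def)
qed

lemma shrunken_interval_subset: "{a + 1 / real (Suc n)..b - 1 / real (Suc n)} \<subseteq> {a<..<b}"
proof
  fix x assume "x \<in> {a + 1 / real (Suc n)..b - 1 / real (Suc n)}"
  moreover have "0 < 1 / real (Suc n)" by simp
  ultimately show "x \<in> {a<..<b}"
    unfolding atLeastAtMost_iff greaterThanLessThan_iff by linarith
qed

lemma locally_integrable_measurable:
  assumes v: "locally_integrable {a<..<(b::real)} v"
  shows "v \<in> borel_measurable (lebesgue_on {a<..<b})"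
proof -
  have "(\<lambda>x. indicator {a<..<b} x *\<^sub>R v x) \<in> borel_measurable lebesgue"
  proof (rule borel_measurable_LIMSEQ_metric)
    show "(\<lambda>x. indicator {a + 1 / Suc n..b - 1 / Suc n} x *\<^sub>R v x) \<in> borel_measurable lebesgue" for n
    proof -
      have "v absolutely_integrable_on {a + 1 / Suc n..b - 1 / Suc n}"
        using v shrunken_interval_subset compact_Icc unfolding locally_integrable_def by blast
      then show ?thesis by (auto simp: set_integrable_def dest: borel_measurable_integrable)
    qed
    show "(\<lambda>n. indicator {a + 1 / Suc n..b - 1 / Suc n} x *\<^sub>R v x) \<longlonglongrightarrow> indicator {a<..<b} x *\<^sub>R v x" for x
    proof (rule tendsto_eventually)
      show "\<forall>\<^sub>F n in sequentially. indicator {a + 1 / Suc n..b - 1 / Suc n} x *\<^sub>R v x = indicator {a<..<b} x *\<^sub>R v x"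
      proof (cases "x \<in> {a<..<b}")
        case True
        have l: "(\<lambda>n. 1 / real (Suc n)) \<longlonglongrightarrow> 0" using LIMSEQ_inverse_real_of_nat by (simp add: divide_inverse)
        have "\<forall>\<^sub>F n in sequentially. 1 / real (Suc n) < x - a" "\<forall>\<^sub>F n in sequentially. 1 / real (Suc n) < b - x"
          using True by (intro order_tendstoD(2)[OF l]; simp)+
        then show ?thesis by eventually_elim (use True in \<open>auto simp: indicator_def\<close>)
      next
        case False
        have "x \<notin> {a + 1 / real (Suc n)..b - 1 / real (Suc n)}" for n
        proof -
          show ?thesis using False shrunken_interval_subset[of a n b] by blast
        qed
        then show ?thesis using False by (simp del: of_nat_Suc)
      qed
    qed
  qed
  then show ?thesis by (subst borel_measurable_restrict_space_iff) auto
qed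

text \<open>Localised by exhaustion: on each slightly smaller interval w is integrable, and test
  functions of the smaller interval are test functions of the larger one. Countably many null sets
  are then united.\<close>

lemma weak_zero:
  fixes w :: "real \<Rightarrow> complex"
  assumes w: "locally_integrable {a<..<b} w" and "a < b"
    and z: "\<And>\<phi>. test_function {a<..<b} \<phi> \<Longrightarrow> (LINT x|lebesgue_on {a<..<b}. w x * \<phi> x) = 0"
  shows "AE x in lebesgue_on {a<..<b}. w x = 0"
proof -
  have AEn: "AE x in lebesgue. x \<in> {a + 1 / Suc n<..<b - 1 / Suc n} \<longrightarrow> w x = 0" for n
  proof (cases "a + 1 / Suc n < b - 1 / Suc n")
    case True
    let ?c = "a + 1 / Suc n" and ?d = "b - 1 / Suc n"
    have sub: "{?c..?d} \<subseteq> {a<..<b}" by (rule shrunken_interval_subset)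
    have "w absolutely_integrable_on {?c..?d}"
      using w sub compact_Icc unfolding locally_integrable_def by blast
    then have "w absolutely_integrable_on {?c<..<?d}"
      by (rule set_integrable_subset) auto
    then have wi: "integrable (lebesgue_on {?c<..<?d}) w"
      by (simp add: set_integrable_def integrable_restrict_space)
    have "AE x in lebesgue_on {?c<..<?d}. w x = 0"
    proof (rule weak_zero_integrable[OF wi True])
      fix \<phi> assume t: "test_function {?c<..<?d} \<phi>"
      obtain c d where cd: "?c < c" "c \<le> d" "d < ?d" "\<forall>x. x \<notin> {c..d} \<longrightarrow> \<phi> x = 0"
        by (rule test_function_support[OF t True])
      have "{?c<..<?d} \<subseteq> {a<..<b}"
        using sub greaterThanLessThan_subseteq_atLeastAtMost_iff[of ?c ?d ?c ?d] by blast
      then have "test_function {a<..<b} \<phi>"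
        using t unfolding test_function_def by blast
      from z[OF this] have "(LINT x|lebesgue. indicator {a<..<b} x *\<^sub>R (w x * \<phi> x)) = 0"
        by (subst (asm) integral_restrict_space) auto
      also have "(\<lambda>x. indicator {a<..<b} x *\<^sub>R (w x * \<phi> x)) = (\<lambda>x. indicator {?c<..<?d} x *\<^sub>R (w x * \<phi> x))"
      proof
        fix x
        show "indicator {a<..<b} x *\<^sub>R (w x * \<phi> x) = indicator {?c<..<?d} x *\<^sub>R (w x * \<phi> x)"
        proof (cases "x \<in> {c..d}")
          case True
          then have "x \<in> {?c<..<?d}" using cd by auto
          moreover from this have "x \<in> {?c..?d}" by simp
          then have "x \<in> {a<..<b}" using sub by blast
          ultimately show ?thesis by (simp del: of_nat_Suc)
        qed (use cd(4) in simp)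
      qed
      finally show "(LINT x|lebesgue_on {?c<..<?d}. w x * \<phi> x) = 0"
        by (subst integral_restrict_space) auto
    qed
    then show ?thesis by (subst (asm) AE_restrict_space_iff) auto
  qed auto
  have "AE x in lebesgue. \<forall>n. x \<in> {a + 1 / Suc n<..<b - 1 / Suc n} \<longrightarrow> w x = 0"
    using AEn by (simp only: AE_all_countable) simp
  then have "AE x in lebesgue. x \<in> {a<..<b} \<longrightarrow> w x = 0"
  proof (rule eventually_mono, intro impI)
    fix x assume H: "\<forall>n. x \<in> {a + 1 / Suc n<..<b - 1 / Suc n} \<longrightarrow> w x = 0" and x: "x \<in> {a<..<b}"
    then have "0 < min (x - a) (b - x)" by auto
    then obtain n where "inverse (real (Suc n)) < min (x - a) (b - x)" using reals_Archimedean by blast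
    then have "x \<in> {a + 1 / Suc n<..<b - 1 / Suc n}" by (auto simp: divide_inverse)
    then show "w x = 0" using H by blast
  qed
  then show ?thesis by (subst AE_restrict_space_iff) auto
qed

section \<open>Weak derivatives and continuous representatives\<close>

lemma negligible_of_AE:
  fixes S :: "real set"
  assumes "AE x in lebesgue_on S. P x" "S \<in> sets borel"
  shows "negligible {x \<in> S. \<not> P x}"
proof -
  have "AE x in lebesgue. x \<in> S \<longrightarrow> P x"
    using assms by (subst (asm) AE_restrict_space_iff) auto
  then obtain N where "N \<in> null_sets lebesgue" "{x \<in> space lebesgue. \<not> (x \<in> S \<longrightarrow> P x)} \<subseteq> N"
    unfolding eventually_ae_filter by blast
  moreover from this(2) have "{x \<in> S. \<not> P x} \<subseteq> N"
    unfolding space_completion space_lborel space_borel by blast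
  ultimately show ?thesis
    by (metis negligible_iff_null_sets negligible_subset)
qed

text \<open>A closed set that contains almost every point of an open interval contains the interval,
  hence also its endpoints. Facts about continuous representatives thereby hold pointwise up to the
  boundary.\<close>

lemma AE_interval_closed:
  fixes f :: "real \<Rightarrow> 'a::t2_space"
  assumes "a < b" "continuous_on {a..b} f" "AE x in lebesgue_on {a<..<b}. f x \<in> C" "closed C" "x \<in> {a..b}"
  shows "f x \<in> C"
proof -
  let ?K = "{a..b} \<inter> f -` C"
  have cl: "closed ?K"
    using assms by (intro continuous_closed_preimage) auto
  have "AE x\<in>{a<..<b} in lebesgue. x \<in> ?K"
    using assms(3) by (subst (asm) AE_restrict_space_iff) (auto elim: eventually_mono)
  then have "{a<..<b} \<subseteq> ?K"
    using mem_closed_if_AE_lebesgue_open[OF open_greaterThanLessThan cl] by blast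
  then have "closure {a<..<b} \<subseteq> ?K" using cl by (rule closure_minimal)
  then show ?thesis using assms by auto
qed

lemma AE_interval_eq:
  fixes f g :: "real \<Rightarrow> complex"
  assumes "a < b" "continuous_on {a..b} f" "continuous_on {a..b} g"
    "AE x in lebesgue_on {a<..<b}. f x = g x" "x \<in> {a..b}"
  shows "f x = g x"
proof -
  have "f x - g x \<in> {0}"
    by (rule AE_interval_closed[OF assms(1), of "\<lambda>x. f x - g x"])
      (use assms in \<open>auto intro!: continuous_intros elim: eventually_mono\<close>)
  then show ?thesis by simp
qed

lemma integrable_imp_absolutely_integrable_Icc:
  fixes v :: "real \<Rightarrow> complex"
  assumes "integrable (lebesgue_on {a<..<b}) v"
  shows "v absolutely_integrable_on {a..b}"
proof -
  have "v absolutely_integrable_on {a<..<b}"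
    using assms by (simp add: set_integrable_def integrable_restrict_space)
  moreover have "v absolutely_integrable_on {a<..<b} \<longleftrightarrow> v absolutely_integrable_on {a..b}"
    by (rule absolutely_integrable_spike_set_eq)
      (auto intro: negligible_subset[OF negligible_finite[of "{a, b}"]])
  ultimately show ?thesis by simp
qed

lemma absolutely_integrable_imp_integrable_sub:
  fixes v :: "real \<Rightarrow> complex"
  assumes "v absolutely_integrable_on {a..b::real}" "{x..y} \<subseteq> {a..b}"
  shows "v integrable_on {x..y}"
  using integrable_subinterval_real[OF set_lebesgue_integral_eq_integral(1)[OF assms(1)] assms(2)] .

lemma integral_AE_cong:
  fixes v w :: "real \<Rightarrow> complex"
  assumes "AE x in lebesgue_on {a<..<b}. v x = w x" "{x..y} \<subseteq> {a..b}"
  shows "integral {x..y} v = integral {x..y} w"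
proof (rule integral_spike)
  show "negligible ({x \<in> {a<..<b}. v x \<noteq> w x} \<union> {a, b})"
    using negligible_of_AE[OF assms(1)] by (intro negligible_Un) auto
  show "w t = v t" if "t \<in> {x..y} - ({x \<in> {a<..<b}. v x \<noteq> w x} \<union> {a, b})" for t
  proof -
    have "t \<in> {a..b}" using that assms(2) by blast
    then show ?thesis using that by auto
  qed
qed

lemma integral_AE_bound:
  fixes v :: "real \<Rightarrow> complex"
  assumes v: "v absolutely_integrable_on {a..b}" and B: "AE x in lebesgue_on {a<..<b}. cmod (v x) \<le> B"
    and xy: "{x..y} \<subseteq> {a..b}" "x \<le> y" "0 \<le> B"
  shows "cmod (integral {x..y} v) \<le> B * (y - x)"
proof -
  \<comment> \<open>Truncation replaces the almost everywhere bound by an everywhere bound without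
    changing the integral.\<close>
  define w where "w t = (if cmod (v t) \<le> B then v t else 0)" for t
  have eq: "AE x in lebesgue_on {a<..<b}. v x = w x"
    using B by eventually_elim (simp add: w_def)
  let ?N = "{x \<in> {a<..<b}. v x \<noteq> w x} \<union> {a, b}"
  have N: "negligible ?N"
    using negligible_of_AE[OF eq] by (intro negligible_Un) auto
  have "(v has_integral integral {x..y} v) {x..y}"
    using absolutely_integrable_imp_integrable_sub[OF v xy(1)] by (rule integrable_integral)
  then have "(w has_integral integral {x..y} v) {x..y}"
  proof (rule has_integral_spike[OF N, rotated])
    show "w t = v t" if "t \<in> {x..y} - ?N" for t
    proof -
      have "t \<in> {a..b}" using that xy(1) by blast
      then show ?thesis using that by auto
    qed
  qed
  from has_integral_bound_real[OF xy(3) finite.emptyI this] show ?thesis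
    using xy by (auto simp: w_def)
qed

section \<open>Uniqueness, linearity and primitives of weak derivatives\<close>

lemma continuous_imp_locally_integrable:
  assumes "continuous_on {a..b::real} p"
  shows "locally_integrable {a<..<b} p"
proof (rule integrable_imp_locally_integrable)
  have "p absolutely_integrable_on {a..b}"
    using assms by (rule absolutely_integrable_continuous_real)
  then have "p absolutely_integrable_on {a<..<b}"
    by (rule set_integrable_subset) auto
  then show "integrable (lebesgue_on {a<..<b}) p"
    by (simp add: set_integrable_def integrable_restrict_space)
qed

lemma locally_integrable_diff:
  "locally_integrable U f \<Longrightarrow> locally_integrable U g \<Longrightarrow> locally_integrable U (\<lambda>x. f x - g x)"
  unfolding locally_integrable_def by (auto intro!: set_integral_diff)

lemma is_weak_deriv_pairing:
  assumes "is_weak_deriv U k u v" "test_function U \<phi>"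
  shows "(LINT x|lebesgue_on U. u x * nth_vderiv k \<phi> x) = (-1) ^ k * (LINT x|lebesgue_on U. v x * \<phi> x)"
  using assms unfolding is_weak_deriv_def by blast

lemma weak_deriv_AE_unique:
  assumes "is_weak_deriv {a<..<b} k u v" "is_weak_deriv {a<..<b} k u v'" "a < (b::real)"
  shows "AE x in lebesgue_on {a<..<b}. v x = v' x"
proof -
  have v: "locally_integrable {a<..<b} v" "locally_integrable {a<..<b} v'"
    using assms by (auto simp: is_weak_deriv_def)
  have "AE x in lebesgue_on {a<..<b}. v x - v' x = 0"
  proof (rule weak_zero[OF _ assms(3)])
    show "locally_integrable {a<..<b} (\<lambda>x. v x - v' x)"
      using v by (intro locally_integrable_diff)
    fix \<phi> assume t: "test_function {a<..<b} \<phi>"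
    have "(-1) ^ k * (LINT x|lebesgue_on {a<..<b}. v x * \<phi> x) = (-1) ^ k * (LINT x|lebesgue_on {a<..<b}. v' x * \<phi> x)"
      using is_weak_deriv_pairing[OF assms(1) t] is_weak_deriv_pairing[OF assms(2) t] by simp
    then show "(LINT x|lebesgue_on {a<..<b}. (v x - v' x) * \<phi> x) = 0"
      using locally_integrable_mult_test[OF v(1) t assms(3)] locally_integrable_mult_test[OF v(2) t assms(3)]
      by (simp add: left_diff_distrib)
  qed
  then show ?thesis by simp
qed

lemma integral_mult_test_cong:
  assumes "AE x in lebesgue_on {a<..<b}. v x = v' x" "locally_integrable {a<..<(b::real)} v" "locally_integrable {a<..<b} v'"
    "test_function {a<..<b} \<phi>" "a < b"
  shows "(LINT x|lebesgue_on {a<..<b}. v x * \<phi> x) = (LINT x|lebesgue_on {a<..<b}. v' x * \<phi> x)"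
  using locally_integrable_mult_test[OF assms(2,4,5)] locally_integrable_mult_test[OF assms(3,4,5)] assms(1)
  by (intro integral_cong_AE) (auto intro: borel_measurable_integrable elim: eventually_mono)

lemma is_weak_deriv_AE_cong:
  assumes "is_weak_deriv {a<..<b} k u v" "AE x in lebesgue_on {a<..<b}. v x = v' x"
    "locally_integrable {a<..<(b::real)} v'" "a < b"
  shows "is_weak_deriv {a<..<b} k u v'"
proof -
  have l: "locally_integrable {a<..<b} u" "locally_integrable {a<..<b} v"
    using assms(1) by (auto simp: is_weak_deriv_def)
  show ?thesis
    unfolding is_weak_deriv_def
  proof (intro conjI allI impI l(1) assms(3))
    fix \<phi> assume t: "test_function {a<..<b} \<phi>"
    show "(LINT x|lebesgue_on {a<..<b}. u x * nth_vderiv k \<phi> x) = (-1) ^ k * (LINT x|lebesgue_on {a<..<b}. v' x * \<phi> x)"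
      using is_weak_deriv_pairing[OF assms(1) t] integral_mult_test_cong[OF assms(2) l(2) assms(3) t assms(4)] by simp
  qed
qed

lemma is_weak_deriv_lincomb:
  assumes "is_weak_deriv {a<..<b} k f v" "is_weak_deriv {a<..<b} k g w" "a < (b::real)"
  shows "is_weak_deriv {a<..<b} k (\<lambda>x. f x + \<kappa> * g x) (\<lambda>x. v x + \<kappa> * w x)"
proof -
  have l: "locally_integrable {a<..<b} f" "locally_integrable {a<..<b} v"
     "locally_integrable {a<..<b} g" "locally_integrable {a<..<b} w"
    using assms by (auto simp: is_weak_deriv_def)
  have L: "locally_integrable {a<..<b} (\<lambda>x. p x + \<kappa> * q x)"
    if "locally_integrable {a<..<b} p" "locally_integrable {a<..<b} q" for p q
    unfolding locally_integrable_def
  proof (intro allI impI)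
    fix K assume "compact K \<and> K \<subseteq> {a<..<b}"
    then have "p absolutely_integrable_on K" "q absolutely_integrable_on K"
      using that unfolding locally_integrable_def by blast+
    then show "(\<lambda>x. p x + \<kappa> * q x) absolutely_integrable_on K"
      by (intro set_integral_add(1) set_integrable_mult_right)
  qed
  have I: "(LINT x|lebesgue_on {a<..<b}. (p x + \<kappa> * q x) * \<phi> x)
       = (LINT x|lebesgue_on {a<..<b}. p x * \<phi> x) + \<kappa> * (LINT x|lebesgue_on {a<..<b}. q x * \<phi> x)"
    if "locally_integrable {a<..<b} p" "locally_integrable {a<..<b} q" "test_function {a<..<b} \<phi>" for p q \<phi>
    using locally_integrable_mult_test[OF that(1,3) assms(3)] locally_integrable_mult_test[OF that(2,3) assms(3)]
    by (simp add: distrib_right mult.assoc)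
  have T: "test_function {a<..<b} (nth_vderiv k \<phi>)" if "test_function {a<..<b} \<phi>" for \<phi>
    using that
  proof (induction k arbitrary: \<phi>)
    case (Suc k)
    have "nth_vderiv (Suc k) \<phi> = nth_vderiv k (nth_vderiv 1 \<phi>)" by (simp add: nth_vderiv_Suc)
    then show ?case using Suc test_function_deriv[OF _ assms(3)] by metis
  qed simp
  show ?thesis
    unfolding is_weak_deriv_def
  proof (intro conjI allI impI)
    fix \<phi> assume t: "test_function {a<..<b} \<phi>"
    show "(LINT x|lebesgue_on {a<..<b}. (f x + \<kappa> * g x) * nth_vderiv k \<phi> x)
        = (-1) ^ k * (LINT x|lebesgue_on {a<..<b}. (v x + \<kappa> * w x) * \<phi> x)"
      unfolding I[OF l(1,3) T[OF t]] I[OF l(2,4) t]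
      using is_weak_deriv_pairing[OF assms(1) t] is_weak_deriv_pairing[OF assms(2) t]
      by (simp add: algebra_simps)
  qed (intro L l)+
qed

text \<open>Testing the derivative of order k with \<phi>' shows that consecutive weak derivatives
  are related as function and first derivative, so orders can be handled one at a time.\<close>

lemma weak_deriv_Suc_pairing:
  assumes "is_weak_deriv {a<..<b} k u v" "is_weak_deriv {a<..<b} (Suc k) u v'" "a < (b::real)"
    and t: "test_function {a<..<b} \<phi>"
  shows "(LINT x|lebesgue_on {a<..<b}. v x * nth_vderiv 1 \<phi> x) = - (LINT x|lebesgue_on {a<..<b}. v' x * \<phi> x)"
proof -
  have "nth_vderiv (Suc k) \<phi> = nth_vderiv k (nth_vderiv 1 \<phi>)" by (simp add: nth_vderiv_Suc)
  then have "(-1) ^ k * (LINT x|lebesgue_on {a<..<b}. v x * nth_vderiv 1 \<phi> x)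
     = (-1) ^ Suc k * (LINT x|lebesgue_on {a<..<b}. v' x * \<phi> x)"
    using is_weak_deriv_pairing[OF assms(1) test_function_deriv[OF t assms(3)]]
      is_weak_deriv_pairing[OF assms(2) t] by simp
  then have "(-1) ^ k * (LINT x|lebesgue_on {a<..<b}. v x * nth_vderiv 1 \<phi> x)
     = (-1) ^ k * (- (LINT x|lebesgue_on {a<..<b}. v' x * \<phi> x))" by simp
  then show ?thesis
    by (simp only: mult_left_cancel power_not_zero neg_equal_0_iff_equal one_neq_zero not_False_eq_True)
qed

text \<open>Du Bois-Reymond's argument: u minus a primitive of v annihilates all derivatives of test
  functions. These are exactly the test functions of mean zero, so what remains is a
  constant.\<close>

lemma weak_deriv_imp_primitive:
  fixes u v :: "real \<Rightarrow> complex"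
  assumes u: "integrable (lebesgue_on {a<..<b}) u" and v: "integrable (lebesgue_on {a<..<b}) v" and ab: "a < b"
    and uv: "\<And>\<phi>. test_function {a<..<b} \<phi> \<Longrightarrow>
       (LINT x|lebesgue_on {a<..<b}. u x * nth_vderiv 1 \<phi> x) = - (LINT x|lebesgue_on {a<..<b}. v x * \<phi> x)"
  shows "\<exists>c. AE x in lebesgue_on {a<..<b}. u x = c + integral {a..x} v"
proof -
  let ?M = "lebesgue_on {a<..<b}"
  obtain g where g: "integrable lborel g" "\<And>x. x \<notin> {a<..<b} \<Longrightarrow> g x = 0" "AE x in ?M. v x = g x"
    using lebesgue_on_borel_rep[OF v] by auto
  define P where "P x = integral {a..x} v" for x
  \<comment> \<open>The primitive in two forms: P as a gauge integral, which is continuous on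
    [a, b], and Q as a Lebesgue integral of the Borel representative, to which Fubini
    applies.\<close>
  define Q where "Q x = (LINT s|lborel. indicator {..x} s *\<^sub>R g s)" for x
  have PQ: "P x = Q x" if "x \<in> {a<..<b}" for x
  proof -
    have "P x = integral {a..x} g"
      unfolding P_def by (rule integral_AE_cong[OF g(3)]) (use that in auto)
    also have "\<dots> = (LINT s:{a..x}|lborel. g s)"
      by (rule set_borel_integral_eq_integral(2)[symmetric])
        (use g(1) in \<open>auto simp: set_integrable_def intro: integrable_mult_indicator\<close>)
    also have "\<dots> = Q x"
      unfolding Q_def set_lebesgue_integral_def
    proof (rule Bochner_Integration.integral_cong)
      fix s
      show "indicator {a..x} s *\<^sub>R g s = indicator {..x} s *\<^sub>R g s"
        using g(2)[of s] by (cases "a \<le> s") (auto simp: indicator_def)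
    qed simp
    finally show ?thesis .
  qed
  have va: "v absolutely_integrable_on {a..b}" using v by (rule integrable_imp_absolutely_integrable_Icc)
  have contP: "continuous_on {a..b} P"
    unfolding P_def by (rule indefinite_integral_continuous_1)
      (rule absolutely_integrable_imp_integrable_sub[OF va], simp)
  have Pl: "locally_integrable {a<..<b} P" by (rule continuous_imp_locally_integrable[OF contP])
  have ul: "locally_integrable {a<..<b} u" by (rule integrable_imp_locally_integrable[OF u])
  define w where "w x = u x - P x" for x
  have wl: "locally_integrable {a<..<b} w"
    using ul Pl unfolding w_def by (intro locally_integrable_diff)
  have Pp: "(LINT x|?M. P x * nth_vderiv 1 \<phi> x) = - (LINT x|?M. v x * \<phi> x)" if t: "test_function {a<..<b} \<phi>" for \<phi>
  proof -
    have t': "test_function {a<..<b} (nth_vderiv 1 \<phi>)" by (rule test_function_deriv[OF t ab])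
    obtain c d where cd: "a < c" "c \<le> d" "d < b" "\<forall>x. x \<notin> {c..d} \<longrightarrow> nth_vderiv 1 \<phi> x = 0"
      by (rule test_function_support[OF t' ab])
    have [measurable]: "nth_vderiv 1 \<phi> \<in> borel_measurable borel" "g \<in> borel_measurable borel"
      using test_function_measurable[OF t'] g(1) by (auto dest: borel_measurable_integrable)
    have "Q = (\<lambda>x. LINT s|lborel. (if s \<le> x then g s else 0))"
      unfolding Q_def by (intro ext Bochner_Integration.integral_cong) (auto simp: indicator_def)
    then have [measurable]: "Q \<in> borel_measurable borel"
      by simp
    have "(LINT x|?M. P x * nth_vderiv 1 \<phi> x) = (LINT x|?M. Q x * nth_vderiv 1 \<phi> x)"
      by (rule Bochner_Integration.integral_cong) (use PQ in auto)
    also have "\<dots> = (LINT x|lborel. Q x * nth_vderiv 1 \<phi> x)"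
    proof (rule integral_lebesgue_on_borel)
      fix x assume "x \<notin> {a<..<b}"
      then have "x \<notin> {c..d}" using cd by auto
      then show "Q x * nth_vderiv 1 \<phi> x = 0" using cd(4) by simp
    qed measurable
    also have "\<dots> = (LINT s|lborel. g s * (LINT x|lborel. indicator {s..} x *\<^sub>R nth_vderiv 1 \<phi> x))"
      unfolding Q_def by (rule integral_primitive_mult[OF g(1) test_function_integrable[OF t' ab]])
    also have "\<dots> = - (LINT s|lborel. g s * \<phi> s)"
      unfolding test_function_tail_integral[OF t ab] by simp
    also have "(LINT s|lborel. g s * \<phi> s) = (LINT x|?M. v x * \<phi> x)"
      by (rule pairing_borel_rep[OF v g test_function_measurable[OF t], symmetric]) simp_all
    finally show ?thesis .
  qed
  have ortho: "(LINT x|?M. w x * nth_vderiv 1 \<phi> x) = 0" if t: "test_function {a<..<b} \<phi>" for \<phi>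
  proof -
    have t': "test_function {a<..<b} (nth_vderiv 1 \<phi>)" by (rule test_function_deriv[OF t ab])
    have "(LINT x|?M. w x * nth_vderiv 1 \<phi> x) = (LINT x|?M. u x * nth_vderiv 1 \<phi> x) - (LINT x|?M. P x * nth_vderiv 1 \<phi> x)"
      using locally_integrable_mult_test[OF ul t' ab] locally_integrable_mult_test[OF Pl t' ab]
      unfolding w_def left_diff_distrib by (rule Bochner_Integration.integral_diff)
    then show ?thesis using uv[OF t] Pp[OF t] by simp
  qed
  obtain \<eta> where \<eta>: "test_function {a<..<b} \<eta>" "(LINT x|lborel. \<eta> x) \<noteq> 0"
    using exists_test_function_integral_nonzero[OF ab] by metis
  \<comment> \<open>The only possible value of the constant, found by testing with one fixed \<eta>
    of nonzero mean.\<close>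
  define C where "C = (LINT x|?M. w x * \<eta> x) / (LINT x|lborel. \<eta> x)"
  have "AE x in ?M. w x - C = 0"
  proof (rule weak_zero[OF _ ab])
    have cl: "locally_integrable {a<..<b} (\<lambda>x. C)"
      by (rule continuous_imp_locally_integrable) auto
    then show "locally_integrable {a<..<b} (\<lambda>x. w x - C)"
      using wl by (intro locally_integrable_diff)
    fix \<phi> assume t: "test_function {a<..<b} \<phi>"
    \<comment> \<open>This multiple of \<eta> makes the mean of \<phi> + \<kappa> \<eta> zero, so
      that the sum is the derivative of a test function.\<close>
    define \<kappa> where "\<kappa> = - (LINT x|lborel. \<phi> x) / (LINT x|lborel. \<eta> x)"
    have "test_function {a<..<b} (\<lambda>x. \<phi> x + \<kappa> * \<eta> x)"
      by (rule test_function_lincomb[OF t \<eta>(1) ab])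
    moreover have "(LINT x|lborel. \<phi> x + \<kappa> * \<eta> x) = 0"
      using test_function_integrable[OF t ab] test_function_integrable[OF \<eta>(1) ab] \<eta>(2)
      by (simp add: \<kappa>_def)
    ultimately obtain \<theta> where \<theta>: "test_function {a<..<b} \<theta>" "nth_vderiv 1 \<theta> = (\<lambda>x. \<phi> x + \<kappa> * \<eta> x)"
      using test_function_primitive[OF _ ab] by metis
    have iw: "integrable ?M (\<lambda>x. w x * \<phi> x)" "integrable ?M (\<lambda>x. w x * \<eta> x)"
      using locally_integrable_mult_test[OF wl _ ab] t \<eta>(1) by auto
    have "(LINT x|?M. w x * \<phi> x) + \<kappa> * (LINT x|?M. w x * \<eta> x) = (LINT x|?M. w x * (\<phi> x + \<kappa> * \<eta> x))"
      using iw by (simp add: distrib_left mult.left_commute)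
    also have "\<dots> = 0" using ortho[OF \<theta>(1)] \<theta>(2) by simp
    finally have 1: "(LINT x|?M. w x * \<phi> x) = C * (LINT x|lborel. \<phi> x)"
      using \<eta>(2) by (simp add: \<kappa>_def C_def field_simps add_eq_0_iff)
    obtain c d where cd: "a < c" "c \<le> d" "d < b" "\<forall>x. x \<notin> {c..d} \<longrightarrow> \<phi> x = 0"
      by (rule test_function_support[OF t ab])
    have 2: "(LINT x|?M. \<phi> x) = (LINT x|lborel. \<phi> x)"
    proof (rule integral_lebesgue_on_borel)
      fix x assume "x \<notin> {a<..<b}"
      then have "x \<notin> {c..d}" using cd by auto
      then show "\<phi> x = 0" using cd(4) by simp
    qed (use test_function_measurable[OF t] in auto)
    have "(LINT x|?M. (w x - C) * \<phi> x) = (LINT x|?M. w x * \<phi> x) - C * (LINT x|?M. \<phi> x)"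
      using iw(1) locally_integrable_mult_test[OF cl t ab] unfolding left_diff_distrib
      by (subst Bochner_Integration.integral_diff) auto
    then show "(LINT x|?M. (w x - C) * \<phi> x) = 0" using 1 2 by simp
  qed
  then have "AE x in ?M. u x = C + integral {a..x} v"
    by eventually_elim (simp add: w_def P_def algebra_simps)
  then show ?thesis by blast
qed

section \<open>Essential supremum norms and continuous representatives\<close>

lemma esssup_cmod_nonneg:
  assumes "a < (b::real)"
  shows "0 \<le> esssup (lebesgue_on {a<..<b}) (\<lambda>x. ereal (cmod (u x)))"
proof (cases "(\<lambda>x. ereal (cmod (u x))) \<in> borel_measurable (lebesgue_on {a<..<b})")
  case True
  have "emeasure (lebesgue_on {a<..<b}) (space (lebesgue_on {a<..<b})) \<noteq> 0"
    using assms by (simp add: emeasure_restrict_space)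
  then have "(0::ereal) = esssup (lebesgue_on {a<..<b}) (\<lambda>x. 0)"
    by (simp add: esssup_const)
  also have "\<dots> \<le> esssup (lebesgue_on {a<..<b}) (\<lambda>x. ereal (cmod (u x)))"
    by (rule esssup_mono) auto
  finally show ?thesis .
\<comment> \<open>By convention the essential supremum of a nonmeasurable function is the top
  element.\<close>
qed (simp add: esssup_non_measurable top_ereal_def)

lemma Linf_norm_nonneg: "a < b \<Longrightarrow> 0 \<le> Linf_norm {a<..<b} u"
  unfolding Linf_norm_def by (intro real_of_ereal_pos esssup_cmod_nonneg)

lemma LinfI:
  assumes "v \<in> borel_measurable (lebesgue_on U)" "AE x in lebesgue_on U. cmod (v x) \<le> B"
  shows "v \<in> Linf U"
proof -
  have "esssup (lebesgue_on U) (\<lambda>x. ereal (cmod (v x))) \<le> ereal B"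
    using assms by (intro esssup_I) auto
  then show ?thesis using assms by (auto simp: Linf_def intro: le_less_trans)
qed

lemma Linf_AE:
  assumes "v \<in> Linf {a<..<b}" "a < b"
  shows "AE x in lebesgue_on {a<..<b}. cmod (v x) \<le> Linf_norm {a<..<b} v"
proof -
  let ?e = "esssup (lebesgue_on {a<..<b}) (\<lambda>x. ereal (cmod (v x)))"
  have "?e = ereal (Linf_norm {a<..<b} v)"
    using assms esssup_cmod_nonneg[OF assms(2), of v] unfolding Linf_def Linf_norm_def
    by (cases ?e) auto
  then show ?thesis
    using esssup_AE[of "\<lambda>x. ereal (cmod (v x))" "lebesgue_on {a<..<b}"] by simp
qed

lemma Linf_norm_le:
  assumes "v \<in> borel_measurable (lebesgue_on {a<..<b})" "AE x in lebesgue_on {a<..<b}. cmod (v x) \<le> B" "a < b"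
  shows "Linf_norm {a<..<b} v \<le> B"
proof -
  let ?e = "esssup (lebesgue_on {a<..<b}) (\<lambda>x. ereal (cmod (v x)))"
  have "?e \<le> ereal B"
    using assms by (intro esssup_I) auto
  moreover have "0 \<le> ?e" by (rule esssup_cmod_nonneg[OF assms(3)])
  ultimately show ?thesis unfolding Linf_norm_def by (cases ?e) auto
qed

lemma integrable_const_lebesgue_on: "integrable (lebesgue_on {a<..<b::real}) (\<lambda>x. c::real)"
proof -
  have "integrable lebesgue (indicator {a<..<b} :: real \<Rightarrow> real)"
    by (rule integrable_real_indicator) (cases "a \<le> b"; simp)+
  then show ?thesis by (subst integrable_restrict_space) auto
qed

lemma Linf_integrable:
  assumes "v \<in> Linf {a<..<b}" "a < b"
  shows "integrable (lebesgue_on {a<..<b}) v"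
proof (rule Bochner_Integration.integrable_bound[OF integrable_const_lebesgue_on[of a b "Linf_norm {a<..<b} v"]])
  show "v \<in> borel_measurable (lebesgue_on {a<..<b})" using assms by (simp add: Linf_def)
  show "AE x in lebesgue_on {a<..<b}. cmod (v x) \<le> norm (Linf_norm {a<..<b} v)"
    using Linf_AE[OF assms] by eventually_elim auto
qed

lemma Linf_lincomb:
  assumes "v \<in> Linf {a<..<b}" "w \<in> Linf {a<..<b}" "a < b"
  shows "(\<lambda>x. v x + \<kappa> * w x) \<in> Linf {a<..<b}"
proof (rule LinfI)
  have [measurable]: "v \<in> borel_measurable (lebesgue_on {a<..<b})" "w \<in> borel_measurable (lebesgue_on {a<..<b})"
    using assms by (auto simp: Linf_def)
  show "(\<lambda>x. v x + \<kappa> * w x) \<in> borel_measurable (lebesgue_on {a<..<b})" by measurable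
  show "AE x in lebesgue_on {a<..<b}. cmod (v x + \<kappa> * w x) \<le> Linf_norm {a<..<b} v + cmod \<kappa> * Linf_norm {a<..<b} w"
    using Linf_AE[OF assms(1,3)] Linf_AE[OF assms(2,3)]
  proof eventually_elim
    case (elim x)
    have "cmod (v x + \<kappa> * w x) \<le> cmod (v x) + cmod \<kappa> * cmod (w x)"
      by (metis norm_mult norm_triangle_ineq)
    also have "\<dots> \<le> Linf_norm {a<..<b} v + cmod \<kappa> * Linf_norm {a<..<b} w"
      using elim by (intro add_mono mult_left_mono) auto
    finally show ?case .
  qed
qed

lemma W_inf_lincomb:
  assumes "f \<in> W_inf {a<..<b} k" "g \<in> W_inf {a<..<b} k" "a < b"
  shows "(\<lambda>x. f x + \<kappa> * g x) \<in> W_inf {a<..<b} k"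
  unfolding W_inf_def
proof safe
  fix j assume "j \<le> k"
  then obtain v w where "v \<in> Linf {a<..<b}" "is_weak_deriv {a<..<b} j f v"
     "w \<in> Linf {a<..<b}" "is_weak_deriv {a<..<b} j g w"
    using assms(1,2) unfolding W_inf_def by blast
  then show "\<exists>v\<in>Linf {a<..<b}. is_weak_deriv {a<..<b} j (\<lambda>x. f x + \<kappa> * g x) v"
    using Linf_lincomb is_weak_deriv_lincomb assms(3) by blast
qed

text \<open>\<open>weak_deriv\<close> is an arbitrary choice and need not be the bounded witness in
  \<open>W_inf\<close>; uniqueness almost everywhere transfers the bound to it.\<close>

lemma W_inf_weak_deriv:
  assumes "u \<in> W_inf {a<..<b} k" "j \<le> k" "a < b"
  shows "is_weak_deriv {a<..<b} j u (weak_deriv {a<..<b} j u)" "weak_deriv {a<..<b} j u \<in> Linf {a<..<b}"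
proof -
  obtain v where v: "v \<in> Linf {a<..<b}" "is_weak_deriv {a<..<b} j u v"
    using assms unfolding W_inf_def by blast
  show w: "is_weak_deriv {a<..<b} j u (weak_deriv {a<..<b} j u)"
    unfolding weak_deriv_def by (rule someI[where P = "is_weak_deriv {a<..<b} j u", OF v(2)])
  show "weak_deriv {a<..<b} j u \<in> Linf {a<..<b}"
  proof (rule LinfI)
    show "weak_deriv {a<..<b} j u \<in> borel_measurable (lebesgue_on {a<..<b})"
      using w by (auto simp: is_weak_deriv_def intro: locally_integrable_measurable)
    show "AE x in lebesgue_on {a<..<b}. cmod (weak_deriv {a<..<b} j u x) \<le> Linf_norm {a<..<b} v"
      using weak_deriv_AE_unique[OF w v(2) assms(3)] Linf_AE[OF v(1) assms(3)]
      by eventually_elim simp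
  qed
qed

lemma W_inf_norm_ge:
  assumes "a < b" "j \<le> k"
  shows "Linf_norm {a<..<b} (weak_deriv {a<..<b} j u) \<le> W_inf_norm {a<..<b} k u"
  unfolding W_inf_norm_def
  using assms by (intro member_le_sum) (auto intro: Linf_norm_nonneg)

lemma W_inf_norm_nonneg: "a < b \<Longrightarrow> 0 \<le> W_inf_norm {a<..<b} k u"
  unfolding W_inf_norm_def by (intro sum_nonneg Linf_norm_nonneg)

text \<open>Each weak derivative is almost everywhere a primitive of the next one. Since the last
  has nothing above it, orders 0 to k yield continuous representatives only below k, and these are
  linked by classical derivatives.\<close>

lemma weak_deriv_chain:
  fixes v :: "nat \<Rightarrow> real \<Rightarrow> complex"
  assumes v: "\<And>j. j \<le> k \<Longrightarrow> is_weak_deriv {a<..<b} j u (v j)" "\<And>j. j \<le> k \<Longrightarrow> integrable (lebesgue_on {a<..<b}) (v j)"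
    and ab: "a < b"
  obtains p where "\<And>j. j < k \<Longrightarrow> continuous_on {a..b} (p j)"
    "\<And>j. j < k \<Longrightarrow> AE x in lebesgue_on {a<..<b}. v j x = p j x"
    "\<And>j x y. j < k \<Longrightarrow> a \<le> x \<Longrightarrow> x \<le> y \<Longrightarrow> y \<le> b \<Longrightarrow> p j y - p j x = integral {x..y} (v (Suc j))"
    "\<And>j x. Suc j < k \<Longrightarrow> x \<in> {a..b} \<Longrightarrow> (p j has_vector_derivative p (Suc j) x) (at x within {a..b})"
proof -
  have "\<exists>c. AE x in lebesgue_on {a<..<b}. v j x = c + integral {a..x} (v (Suc j))" if "j < k" for j
    by (rule weak_deriv_imp_primitive)
      (use that v ab weak_deriv_Suc_pairing[OF v(1) v(1), of j] in auto)
  then obtain c where c: "\<And>j. j < k \<Longrightarrow> AE x in lebesgue_on {a<..<b}. v j x = c j + integral {a..x} (v (Suc j))"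
    by metis
  define p where "p j x = c j + integral {a..x} (v (Suc j))" for j x
  have va: "v j absolutely_integrable_on {a..b}" if "j \<le> k" for j
    using v(2)[OF that] by (rule integrable_imp_absolutely_integrable_Icc)
  have cont: "continuous_on {a..b} (p j)" if "j < k" for j
    unfolding p_def using that
    by (intro continuous_intros indefinite_integral_continuous_1 absolutely_integrable_imp_integrable_sub[OF va]) auto
  have AEp: "AE x in lebesgue_on {a<..<b}. v j x = p j x" if "j < k" for j
    using c[OF that] by (simp add: p_def)
  have "p j y - p j x = integral {x..y} (v (Suc j))" if "j < k" "a \<le> x" "x \<le> y" "y \<le> b" for j x y
    using Henstock_Kurzweil_Integration.integral_combine[of a x y "v (Suc j)"]
      absolutely_integrable_imp_integrable_sub[OF va, of "Suc j" a y] that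
    by (simp add: p_def algebra_simps)
  moreover have "(p j has_vector_derivative p (Suc j) x) (at x within {a..b})" if "Suc j < k" "x \<in> {a..b}" for j x
  proof -
    have "((\<lambda>y. c j + integral {a..y} (p (Suc j))) has_vector_derivative 0 + p (Suc j) x) (at x within {a..b})"
      by (intro derivative_intros integral_has_vector_derivative cont that)
    then have "((\<lambda>y. c j + integral {a..y} (p (Suc j))) has_vector_derivative p (Suc j) x) (at x within {a..b})"
      by simp
    \<comment> \<open>Under the integral the weak derivative may be exchanged for its continuous
      representative; this makes the primitive differentiable at every point.\<close>
    moreover have "c j + integral {a..y} (p (Suc j)) = p j y" if "y \<in> {a..b}" for y
      unfolding p_def[of j]
      by (rule arg_cong[where f = "\<lambda>z. c j + z"], rule integral_AE_cong[symmetric, OF AEp])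
        (use that \<open>Suc j < k\<close> in auto)
    ultimately show ?thesis
      using has_vector_derivative_transform[OF that(2), of "p j" "\<lambda>y. c j + integral {a..y} (p (Suc j))"] by metis
  qed
  ultimately show thesis using that[of p] cont AEp by blast
qed

text \<open>\<open>p 0, \<dots>, p (k - 1)\<close> are the continuous representatives of the weak derivatives of an element of
  \<open>W\<^sup>k\<^sup>,\<^sup>\<infinity>(a, b)\<close>; they extend continuously to the closed interval.\<close>

definition sob_rep :: "real \<Rightarrow> real \<Rightarrow> nat \<Rightarrow> (nat \<Rightarrow> real \<Rightarrow> complex) \<Rightarrow> real \<Rightarrow> (real \<Rightarrow> complex) \<Rightarrow> bool" where
  "sob_rep a b k p B u \<longleftrightarrow>
     (\<forall>j<k. is_weak_deriv {a<..<b} j u (p j)) \<and>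
     (\<forall>j x. Suc j < k \<and> x \<in> {a..b} \<longrightarrow> (p j has_vector_derivative p (Suc j) x) (at x within {a..b})) \<and>
     (\<forall>j<k. \<forall>x\<in>{a..b}. cmod (p j x) \<le> B) \<and>
     (\<forall>j<k. \<forall>x\<in>{a..b}. \<forall>y\<in>{a..b}. cmod (p j x - p j y) \<le> B * \<bar>x - y\<bar>)"

lemma sob_repD:
  assumes "sob_rep a b k p B u"
  shows sob_rep_weak: "j < k \<Longrightarrow> is_weak_deriv {a<..<b} j u (p j)"
    and sob_rep_deriv: "Suc j < k \<Longrightarrow> x \<in> {a..b} \<Longrightarrow> (p j has_vector_derivative p (Suc j) x) (at x within {a..b})"
    and sob_rep_bound: "j < k \<Longrightarrow> x \<in> {a..b} \<Longrightarrow> cmod (p j x) \<le> B"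
    and sob_rep_lipschitz: "j < k \<Longrightarrow> x \<in> {a..b} \<Longrightarrow> y \<in> {a..b} \<Longrightarrow> cmod (p j x - p j y) \<le> B * \<bar>x - y\<bar>"
  using assms unfolding sob_rep_def by blast+

lemma sob_rep_continuous: "sob_rep a b k p B u \<Longrightarrow> j < k \<Longrightarrow> continuous_on {a..b} (p j)"
proof -
  assume s: "sob_rep a b k p B u" and j: "j < k"
  have "\<bar>B\<bar>-lipschitz_on {a..b} (p j)"
  proof (rule lipschitz_onI)
    fix x y assume "x \<in> {a..b}" "y \<in> {a..b}"
    then have "cmod (p j x - p j y) \<le> B * \<bar>x - y\<bar>" using s j unfolding sob_rep_def by blast
    also have "\<dots> \<le> \<bar>B\<bar> * \<bar>x - y\<bar>" by (intro mult_right_mono) auto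
    finally show "dist (p j x) (p j y) \<le> \<bar>B\<bar> * dist x y" by (simp add: dist_norm)
  qed simp
  then show ?thesis by (rule lipschitz_on_continuous_on)
qed

lemma sob_rep_mono:
  assumes "sob_rep a b k p B u" "B \<le> B'"
  shows "sob_rep a b k p B' u"
proof -
  have "cmod (p j x - p j y) \<le> B' * \<bar>x - y\<bar>" if "cmod (p j x - p j y) \<le> B * \<bar>x - y\<bar>" for j x y
    using that mult_right_mono[OF assms(2), of "\<bar>x - y\<bar>"] by simp
  then show ?thesis using assms unfolding sob_rep_def by (meson order_trans)
qed

text \<open>One constant serves both purposes: the norm is a sum that dominates the supremum of
  every derivative, and the Lipschitz constant of a representative is the supremum of the next
  derivative.\<close>

lemma W_inf_sob_rep:
  assumes "u \<in> W_inf {a<..<b} k" "a < b"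
  shows "\<exists>p. sob_rep a b k p (W_inf_norm {a<..<b} k u) u"
proof -
  let ?v = "\<lambda>j. weak_deriv {a<..<b} j u" and ?B = "W_inf_norm {a<..<b} k u"
  have B: "AE x in lebesgue_on {a<..<b}. cmod (?v j x) \<le> ?B" if "j \<le> k" for j
    using Linf_AE[OF W_inf_weak_deriv(2)[OF assms(1) that assms(2)] assms(2)]
      W_inf_norm_ge[OF assms(2) that, of u] by (auto elim: eventually_mono)
  have vi: "integrable (lebesgue_on {a<..<b}) (?v j)" if "j \<le> k" for j
    by (rule Linf_integrable[OF W_inf_weak_deriv(2)[OF assms(1) that assms(2)] assms(2)])
  obtain p where p: "\<And>j. j < k \<Longrightarrow> continuous_on {a..b} (p j)"
    "\<And>j. j < k \<Longrightarrow> AE x in lebesgue_on {a<..<b}. ?v j x = p j x"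
    "\<And>j x y. j < k \<Longrightarrow> a \<le> x \<Longrightarrow> x \<le> y \<Longrightarrow> y \<le> b \<Longrightarrow> p j y - p j x = integral {x..y} (?v (Suc j))"
    "\<And>j x. Suc j < k \<Longrightarrow> x \<in> {a..b} \<Longrightarrow> (p j has_vector_derivative p (Suc j) x) (at x within {a..b})"
    by (rule weak_deriv_chain[of k a b u ?v, OF W_inf_weak_deriv(1)[OF assms(1)] vi assms(2)]) (use assms in auto)
  have L: "cmod (p j y - p j x) \<le> ?B * (y - x)" if "j < k" "a \<le> x" "x \<le> y" "y \<le> b" for j x y
    unfolding p(3)[OF that]
    by (rule integral_AE_bound[OF integrable_imp_absolutely_integrable_Icc[OF vi] B])
      (use that W_inf_norm_nonneg[OF assms(2)] in auto)
  have "sob_rep a b k p ?B u"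
    unfolding sob_rep_def
  proof (intro conjI allI impI ballI)
    fix j assume j: "j < k"
    show "is_weak_deriv {a<..<b} j u (p j)"
      by (rule is_weak_deriv_AE_cong[OF W_inf_weak_deriv(1)[OF assms(1) _ assms(2)] p(2)[OF j] continuous_imp_locally_integrable[OF p(1)[OF j]] assms(2)])
        (use j in auto)
    show "cmod (p j x) \<le> ?B" if "x \<in> {a..b}" for x
    proof -
      have "AE x in lebesgue_on {a<..<b}. p j x \<in> cball 0 ?B"
        using B[OF less_imp_le[OF j]] p(2)[OF j] by eventually_elim auto
      then have "p j x \<in> cball 0 ?B"
        by (rule AE_interval_closed[OF assms(2) p(1)[OF j] _ _ that]) simp
      then show ?thesis by simp
    qed
    show "cmod (p j x - p j y) \<le> ?B * \<bar>x - y\<bar>" if "x \<in> {a..b}" "y \<in> {a..b}" for x y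
      using L[OF j, of x y] L[OF j, of y x] that by (cases "x \<le> y") (auto simp: norm_minus_commute)
  qed (use p(4) in auto)
  then show ?thesis by blast
qed

text \<open>Representatives that come from different regularity hypotheses, with different orders
  and bounds, are identified pointwise through this fact.\<close>

lemma sob_rep_unique:
  assumes p: "sob_rep a b k p B u" and q: "sob_rep a b k' q B' u" and ab: "a < b" and j: "j < k" "j < k'" and x: "x \<in> {a..b}"
  shows "p j x = q j x"
proof -
  have "is_weak_deriv {a<..<b} j u (p j)" "is_weak_deriv {a<..<b} j u (q j)"
    using p q j unfolding sob_rep_def by blast+
  then show ?thesis
    using AE_interval_eq[OF ab sob_rep_continuous[OF p j(1)] sob_rep_continuous[OF q j(2)] _ x]
      weak_deriv_AE_unique[OF _ _ ab] by blast
qed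

lemma sob_rep_lincomb:
  assumes p: "sob_rep a b k p B f" and q: "sob_rep a b k q B' g" and ab: "a < b"
  shows "sob_rep a b k (\<lambda>j x. p j x + \<kappa> * q j x) (B + cmod \<kappa> * B') (\<lambda>x. f x + \<kappa> * g x)"
  unfolding sob_rep_def
proof (intro conjI allI impI ballI)
  show "is_weak_deriv {a<..<b} j (\<lambda>x. f x + \<kappa> * g x) (\<lambda>x. p j x + \<kappa> * q j x)" if "j < k" for j
    using p q that ab unfolding sob_rep_def by (intro is_weak_deriv_lincomb) auto
  show "((\<lambda>x. p j x + \<kappa> * q j x) has_vector_derivative p (Suc j) x + \<kappa> * q (Suc j) x) (at x within {a..b})"
    if "Suc j < k \<and> x \<in> {a..b}" for j x
  proof -
    have "(p j has_vector_derivative p (Suc j) x) (at x within {a..b})"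
        "(q j has_vector_derivative q (Suc j) x) (at x within {a..b})"
      using p q that unfolding sob_rep_def by blast+
    then show ?thesis by (auto intro!: derivative_eq_intros)
  qed
  fix j assume j: "j < k"
  show "cmod (p j x + \<kappa> * q j x) \<le> B + cmod \<kappa> * B'" if "x \<in> {a..b}" for x
  proof -
    have *: "cmod (p j x) \<le> B" "cmod (q j x) \<le> B'"
      using p q that j unfolding sob_rep_def by blast+
    have "cmod (p j x + \<kappa> * q j x) \<le> cmod (p j x) + cmod \<kappa> * cmod (q j x)"
      by (metis norm_mult norm_triangle_ineq)
    also have "\<dots> \<le> B + cmod \<kappa> * B'" using * by (intro add_mono mult_left_mono) auto
    finally show ?thesis .
  qed
  show "cmod (p j x + \<kappa> * q j x - (p j y + \<kappa> * q j y)) \<le> (B + cmod \<kappa> * B') * \<bar>x - y\<bar>"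
    if "x \<in> {a..b}" "y \<in> {a..b}" for x y
  proof -
    have *: "cmod (p j x - p j y) \<le> B * \<bar>x - y\<bar>" "cmod (q j x - q j y) \<le> B' * \<bar>x - y\<bar>"
      using p q that j unfolding sob_rep_def by blast+
    have "p j x + \<kappa> * q j x - (p j y + \<kappa> * q j y) = (p j x - p j y) + \<kappa> * (q j x - q j y)"
      by (simp add: algebra_simps)
    then have "cmod (p j x + \<kappa> * q j x - (p j y + \<kappa> * q j y)) \<le> cmod (p j x - p j y) + cmod \<kappa> * cmod (q j x - q j y)"
      by (metis norm_mult norm_triangle_ineq)
    also have "\<dots> \<le> B * \<bar>x - y\<bar> + cmod \<kappa> * (B' * \<bar>x - y\<bar>)" using * by (intro add_mono mult_left_mono) auto
    finally show ?thesis by (simp add: algebra_simps)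
  qed
qed

lemma sob_rep_0:
  assumes p: "sob_rep a b k p B u" and k: "0 < k" and c: "continuous_on {a..b} u" and ab: "a < b" and x: "x \<in> {a..b}"
  shows "p 0 x = u x"
proof -
  have d: "is_weak_deriv {a<..<b} 0 u (p 0)" using p k by (auto simp: sob_rep_def)
  then have "is_weak_deriv {a<..<b} 0 u u" by (auto simp: is_weak_deriv_def)
  with d show ?thesis
    using AE_interval_eq[OF ab sob_rep_continuous[OF p k] c _ x] weak_deriv_AE_unique[OF _ _ ab] by blast
qed

section \<open>Classical regularity of the solution\<close>

lemma vector_derivative_bound:
  fixes f :: "real \<Rightarrow> complex"
  assumes "convex S" "\<And>x. x \<in> S \<Longrightarrow> (f has_vector_derivative f' x) (at x within S)"
    "\<And>x. x \<in> S \<Longrightarrow> cmod (f' x) \<le> B" "x \<in> S" "y \<in> S"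
  shows "cmod (f x - f y) \<le> B * \<bar>x - y\<bar>"
proof -
  have "norm (f x - f y) \<le> B * norm (x - y)"
  proof (rule differentiable_bound[OF assms(1)])
    show "(f has_derivative (\<lambda>h. h *\<^sub>R f' z)) (at z within S)" if "z \<in> S" for z
      using assms(2)[OF that] by (simp add: has_vector_derivative_def)
    show "onorm (\<lambda>h. h *\<^sub>R f' z) \<le> B" if "z \<in> S" for z
    proof (rule onorm_le)
      show "norm (h *\<^sub>R f' z) \<le> B * norm h" for h
        using mult_right_mono[OF assms(3)[OF that], of "\<bar>h\<bar>"] by (simp add: mult.commute)
    qed
  qed (use assms in auto)
  then show ?thesis by simp
qed

lemma has_vector_derivative_withinI_bound:
  fixes f :: "real \<Rightarrow> complex"
  assumes "(N \<longlongrightarrow> 0) (at t within I)"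
    and "\<And>s. s \<in> I \<Longrightarrow> s \<noteq> t \<Longrightarrow> cmod ((f s - f t) /\<^sub>R (s - t) - d) \<le> N s"
  shows "(f has_vector_derivative d) (at t within I)"
  unfolding has_vector_derivative_def has_derivative_iff_norm
proof
  show "bounded_linear (\<lambda>h::real. h *\<^sub>R d)" by (rule bounded_linear_scaleR_left)
  show "((\<lambda>y. norm (f y - f t - (y - t) *\<^sub>R d) / norm (y - t)) \<longlongrightarrow> 0) (at t within I)"
  proof (rule Lim_null_comparison[OF _ assms(1)])
    show "\<forall>\<^sub>F s in at t within I. norm (norm (f s - f t - (s - t) *\<^sub>R d) / norm (s - t)) \<le> N s"
      unfolding eventually_at_filter
    proof (intro always_eventually allI impI)
      fix s assume s: "s \<noteq> t" "s \<in> I"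
      then have "f s - f t - (s - t) *\<^sub>R d = (s - t) *\<^sub>R ((f s - f t) /\<^sub>R (s - t) - d)"
        by (simp add: scaleR_diff_right)
      then have "norm (f s - f t - (s - t) *\<^sub>R d) / norm (s - t) = norm ((f s - f t) /\<^sub>R (s - t) - d)"
        using s by simp
      then show "norm (norm (f s - f t - (s - t) *\<^sub>R d) / norm (s - t)) \<le> N s"
        using assms(2)[of s] s by simp
    qed
  qed
qed

text \<open>Stated for a predicate monotone in the bound, so that it applies to the existence of
  representatives with that bound.\<close>

lemma compact_locally_bounded:
  fixes Q :: "real \<Rightarrow> real \<Rightarrow> bool"
  assumes "compact I" and mono: "\<And>s B B'. Q s B \<Longrightarrow> B \<le> B' \<Longrightarrow> Q s B'"
    and loc: "\<And>t. t \<in> I \<Longrightarrow> \<exists>B. \<exists>d>0. \<forall>s\<in>I. dist s t < d \<longrightarrow> Q s B"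
  obtains B where "\<And>s. s \<in> I \<Longrightarrow> Q s B"
proof -
  obtain Bf d where Bd: "\<And>t. t \<in> I \<Longrightarrow> d t > 0" "\<And>t s. t \<in> I \<Longrightarrow> s \<in> I \<Longrightarrow> dist s t < d t \<Longrightarrow> Q s (Bf t)"
    using loc by metis
  have "I \<subseteq> (\<Union>t\<in>I. ball t (d t))" using Bd(1) by force
  then obtain F where F: "F \<subseteq> I" "finite F" "I \<subseteq> (\<Union>t\<in>F. ball t (d t))"
    using compactE_image[OF assms(1), of I "\<lambda>t. ball t (d t)"] by auto
  have "Q s (\<Sum>t\<in>F. \<bar>Bf t\<bar>)" if "s \<in> I" for s
  proof -
    have "s \<in> (\<Union>t\<in>F. ball t (d t))" using F(3) that by blast
    then obtain t where t: "t \<in> F" "dist s t < d t" by (auto simp: dist_commute)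
    have "Bf t \<le> \<bar>Bf t\<bar>" by simp
    also have "\<dots> \<le> (\<Sum>t\<in>F. \<bar>Bf t\<bar>)" using t F(2) by (intro member_le_sum) auto
    finally show ?thesis using mono[OF Bd(2)[of t s]] t F(1) that by blast
  qed
  then show thesis using that by blast
qed

lemma Ck_intoE:
  assumes "Ck_into m I X N u"
  obtains D where "\<forall>t\<in>I. D 0 t = u t" "\<forall>k\<le>m. \<forall>t\<in>I. D k t \<in> X"
    "\<forall>k\<le>m. \<forall>t\<in>I. ((\<lambda>s. N (\<lambda>x. D k s x - D k t x)) \<longlongrightarrow> 0) (at t within I)"
    "\<forall>k<m. \<forall>t\<in>I.
       ((\<lambda>s. N (\<lambda>x. (D k s x - D k t x) /\<^sub>R (s - t) - D (Suc k) t x)) \<longlongrightarrow> 0) (at t within I)"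
proof -
  obtain D where D: "(\<forall>t\<in>I. D 0 t = u t) \<and>
        (\<forall>k\<le>m. \<forall>t\<in>I. D k t \<in> X \<and>
           ((\<lambda>s. N (\<lambda>x. D k s x - D k t x)) \<longlongrightarrow> 0) (at t within I)) \<and>
        (\<forall>k<m. \<forall>t\<in>I.
           ((\<lambda>s. N (\<lambda>x. (D k s x - D k t x) /\<^sub>R (s - t) - D (Suc k) t x)) \<longlongrightarrow> 0)
             (at t within I))"
    using assms unfolding Ck_into_def by (elim exE)
  note D1 = D[THEN conjunct1] and D2 = D[THEN conjunct2, THEN conjunct1] and D3 = D[THEN conjunct2, THEN conjunct2]
  show thesis
    by (rule that[OF D1 _ _ D3]) (simp_all add: D2)
qed

text \<open>Continuity in time together with compactness of [0, T] gives one bound for all times.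
  The error of a time difference quotient has its own representatives, bounded by its norm; by
  uniqueness they are the same combination of the given ones, so norm derivatives become pointwise
  derivatives of every representative.\<close>

lemma time_regularity:
  assumes C: "Ck_into m {0..T} (W_inf {a<..<b} k) (W_inf_norm {a<..<b} k) \<psi>" and ab: "a < b"
  obtains P D K where "0 \<le> K" "\<forall>t\<in>{0..T}. D 0 t = \<psi> t"
    "\<forall>l\<le>m. \<forall>t\<in>{0..T}. sob_rep a b k (P l t) K (D l t)"
    "\<forall>l<m. \<forall>j<k. \<forall>t\<in>{0..T}. \<forall>x\<in>{a..b}.
        ((\<lambda>s. P l s j x) has_vector_derivative P (Suc l) t j x) (at t within {0..T})"
proof -
  let ?I = "{0..T}" and ?N = "W_inf_norm {a<..<b} k" and ?X = "W_inf {a<..<b} k"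
  obtain D where D0: "\<forall>t\<in>?I. D 0 t = \<psi> t" "\<forall>k\<le>m. \<forall>t\<in>?I. D k t \<in> ?X"
    "\<forall>k\<le>m. \<forall>t\<in>?I. ((\<lambda>s. ?N (\<lambda>x. D k s x - D k t x)) \<longlongrightarrow> 0) (at t within ?I)"
    "\<forall>k<m. \<forall>t\<in>?I.
       ((\<lambda>s. ?N (\<lambda>x. (D k s x - D k t x) /\<^sub>R (s - t) - D (Suc k) t x)) \<longlongrightarrow> 0) (at t within ?I)"
    by (rule Ck_intoE[OF C])
  note D = D0[rule_format]
  have "\<exists>B. \<forall>t\<in>?I. \<exists>p. sob_rep a b k p B (D l t)" if l: "l \<le> m" for l
  proof -
    have loc: "\<exists>B. \<exists>d>0. \<forall>s\<in>?I. dist s t < d \<longrightarrow> (\<exists>p. sob_rep a b k p B (D l s))" if t: "t \<in> ?I" for t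
    proof -
    obtain d where d: "d > 0" "\<And>s. s \<in> ?I \<Longrightarrow> s \<noteq> t \<Longrightarrow> dist s t < d \<Longrightarrow> ?N (\<lambda>x. D l s x - D l t x) < 1"
      using order_tendstoD(2)[OF D(3)[OF l t] zero_less_one] unfolding eventually_at by blast
    obtain p where p: "sob_rep a b k p (?N (D l t)) (D l t)"
      using W_inf_sob_rep[OF D(2)[OF l t] ab] by blast
    have "\<exists>p. sob_rep a b k p (1 + ?N (D l t)) (D l s)" if s: "s \<in> ?I" "dist s t < d" for s
    proof (cases "s = t")
      case True
      then show ?thesis using sob_rep_mono[OF p, of "1 + ?N (D l t)"] by auto
    next
      case False
      have "(\<lambda>x. D l s x + (-1) * D l t x) \<in> ?X"
        by (rule W_inf_lincomb[OF D(2)[OF l s(1)] D(2)[OF l t] ab])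
      then obtain q where q: "sob_rep a b k q (?N (\<lambda>x. D l s x - D l t x)) (\<lambda>x. D l s x - D l t x)"
        using W_inf_sob_rep[OF _ ab] by fastforce
      have "sob_rep a b k (\<lambda>j x. q j x + 1 * p j x) (?N (\<lambda>x. D l s x - D l t x) + cmod 1 * ?N (D l t)) (\<lambda>x. (D l s x - D l t x) + 1 * D l t x)"
        by (rule sob_rep_lincomb[OF q p ab])
      then have "sob_rep a b k (\<lambda>j x. q j x + p j x) (?N (\<lambda>x. D l s x - D l t x) + ?N (D l t)) (D l s)"
        by simp
      from sob_rep_mono[OF this, of "1 + ?N (D l t)"] d(2)[OF s(1) False s(2)]
      show ?thesis by force
    qed
    then show ?thesis
      using d(1) by blast
    qed
    show ?thesis
      by (rule compact_locally_bounded[of ?I "\<lambda>t B. \<exists>p. sob_rep a b k p B (D l t)", OF _ _ loc])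
        (use sob_rep_mono in blast)+
  qed
  then obtain Bf where Bf: "\<And>l t. l \<le> m \<Longrightarrow> t \<in> ?I \<Longrightarrow> \<exists>p. sob_rep a b k p (Bf l) (D l t)"
    by metis
  define K where "K = (\<Sum>l\<le>m. \<bar>Bf l\<bar>)"
  have "\<exists>p. sob_rep a b k p K (D l t)" if "l \<le> m" "t \<in> ?I" for l t
  proof -
    have "Bf l \<le> \<bar>Bf l\<bar>" by simp
    also have "\<dots> \<le> K" unfolding K_def using that by (intro member_le_sum) auto
    finally show ?thesis using Bf[OF that] sob_rep_mono by blast
  qed
  then obtain P where P: "\<And>l t. l \<le> m \<Longrightarrow> t \<in> ?I \<Longrightarrow> sob_rep a b k (P l t) K (D l t)"
    by metis
  have "0 \<le> K" unfolding K_def by (simp add: sum_nonneg)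
  moreover have "((\<lambda>s. P l s j x) has_vector_derivative P (Suc l) t j x) (at t within ?I)"
    if l: "l < m" and j: "j < k" and t: "t \<in> ?I" and x: "x \<in> {a..b}" for l j t x
    proof (rule has_vector_derivative_withinI_bound[OF D(4)[OF l t]])
      fix s assume s: "s \<in> ?I" "s \<noteq> t"
      define \<kappa> where "\<kappa> = complex_of_real (inverse (s - t))"
      define q0 where "q0 = (\<lambda>x. \<kappa> * (D l s x - D l t x) - D (Suc l) t x)"
      let ?q = "\<lambda>x. (D l s x - D l t x) /\<^sub>R (s - t) - D (Suc l) t x"
      have q0: "?q = q0"
        unfolding q0_def \<kappa>_def by (simp only: scaleR_conv_of_real)
      have lm: "l \<le> m" "Suc l \<le> m" using l by auto
      \<comment> \<open>The combination lemmas only form f + \<kappa> g, so the quotient error,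
        which is -r, is reached as r + (-2) r.\<close>
      define r where "r = (\<lambda>x. D (Suc l) t x + (- \<kappa>) * (D l s x + (-1) * D l t x))"
      define R where "R = (\<lambda>j x. P (Suc l) t j x + (- \<kappa>) * (P l s j x + (-1) * P l t j x))"
      have R: "sob_rep a b k R (K + cmod (- \<kappa>) * (K + cmod (-1) * K)) r"
        unfolding r_def R_def by (intro sob_rep_lincomb P ab s t lm)
      have X: "r \<in> ?X"
        unfolding r_def by (intro W_inf_lincomb D(2) ab s t lm)
      have rq: "q0 x = r x + (-2) * r x" for x
        unfolding q0_def r_def by (simp add: algebra_simps)
      have "(\<lambda>x. r x + (-2) * r x) \<in> ?X"
        by (rule W_inf_lincomb[OF X X ab])
      then have "q0 \<in> ?X" using rq by presburger
      then obtain q where q: "sob_rep a b k q (?N q0) q0" using W_inf_sob_rep[OF _ ab] by blast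
      have "sob_rep a b k (\<lambda>j x. R j x + (-2) * R j x) ((K + cmod (- \<kappa>) * (K + cmod (-1) * K)) + cmod (-2) * (K + cmod (- \<kappa>) * (K + cmod (-1) * K))) (\<lambda>x. r x + (-2) * r x)"
        by (rule sob_rep_lincomb[OF R R ab])
      then have S: "sob_rep a b k (\<lambda>j x. R j x + (-2) * R j x) ((K + cmod (- \<kappa>) * (K + cmod (-1) * K)) + cmod (-2) * (K + cmod (- \<kappa>) * (K + cmod (-1) * K))) q0"
        unfolding rq[symmetric] .
      have "R j x + (-2) * R j x = q j x"
        by (rule sob_rep_unique[OF S q ab j j x])
      moreover have "\<kappa> * (P l s j x - P l t j x) - P (Suc l) t j x = R j x + (-2) * R j x"
        unfolding R_def by (simp add: algebra_simps)
      ultimately have "\<kappa> * (P l s j x - P l t j x) - P (Suc l) t j x = q j x"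
        by simp
      then have "(P l s j x - P l t j x) /\<^sub>R (s - t) - P (Suc l) t j x = q j x"
        unfolding \<kappa>_def by (simp only: scaleR_conv_of_real)
      moreover have "cmod (q j x) \<le> ?N ?q"
        unfolding q0 using q j x unfolding sob_rep_def by blast
      ultimately show "cmod ((P l s j x - P l t j x) /\<^sub>R (s - t) - P (Suc l) t j x) \<le> ?N ?q"
        by simp
    qed
  ultimately show thesis
    using P D0(1) by (intro that[of K D P]) simp_all
qed

text \<open>Serves to forget the H^1_0 component of the regularity hypothesis with five space
  derivatives.\<close>

lemma Ck_into_mono:
  assumes "Ck_into m I X N u" "X \<subseteq> X'" "\<And>f. 0 \<le> N' f" "\<And>f. N' f \<le> N f"
  shows "Ck_into m I X' N' u"
proof -
  have lim: "((\<lambda>s. N' (g s)) \<longlongrightarrow> 0) F" if "((\<lambda>s. N (g s)) \<longlongrightarrow> 0) F" for g :: "real \<Rightarrow> real \<Rightarrow> complex" and F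
    by (rule Lim_null_comparison[OF _ that]) (use assms(3,4) in auto)
  obtain D where D0: "\<forall>t\<in>I. D 0 t = u t" "\<forall>k\<le>m. \<forall>t\<in>I. D k t \<in> X"
    "\<forall>k\<le>m. \<forall>t\<in>I. ((\<lambda>s. N (\<lambda>x. D k s x - D k t x)) \<longlongrightarrow> 0) (at t within I)"
    "\<forall>k<m. \<forall>t\<in>I.
       ((\<lambda>s. N (\<lambda>x. (D k s x - D k t x) /\<^sub>R (s - t) - D (Suc k) t x)) \<longlongrightarrow> 0) (at t within I)"
    by (rule Ck_intoE[OF assms(1)])
  note D = D0[rule_format]
  show ?thesis
    unfolding Ck_into_def
  proof (intro exI[of _ D] conjI allI impI ballI)
    show "D k t \<in> X'" if "k \<le> m" "t \<in> I" for k t using D(2)[OF that] assms(2) by blast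
  qed (intro D lim; assumption)+
qed

section \<open>From the distributional to the pointwise equation\<close>

lemma norm_integral_interval_le:
  fixes f :: "real \<Rightarrow> complex"
  assumes "integrable (lebesgue_on {a<..<b}) f" "\<And>x. x \<in> {a<..<b} \<Longrightarrow> cmod (f x) \<le> C" "a < b"
  shows "cmod (LINT x|lebesgue_on {a<..<b}. f x) \<le> C * (b - a)"
proof -
  have "cmod (LINT x|lebesgue_on {a<..<b}. f x) \<le> (LINT x|lebesgue_on {a<..<b}. cmod (f x))"
    by (rule integral_norm_bound)
  also have "\<dots> \<le> (LINT x|lebesgue_on {a<..<b}. C)"
    by (rule integral_mono) (use assms integrable_const_lebesgue_on in auto)
  also have "\<dots> = C * (b - a)"
    using assms(3) by (simp add: measure_restrict_space)
  finally show ?thesis .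
qed

text \<open>Differentiation under the integral sign. The time derivative is Lipschitz in time
  uniformly in x, so the quotient error is at most K |s - t| before integration.\<close>

lemma has_vector_derivative_pairing:
  fixes \<psi> d :: "real \<Rightarrow> real \<Rightarrow> complex"
  assumes der: "\<And>s x. s \<in> {0..T} \<Longrightarrow> x \<in> {a..b} \<Longrightarrow> ((\<lambda>s. \<psi> s x) has_vector_derivative d s x) (at s within {0..T})"
    and L: "\<And>s t x. s \<in> {0..T} \<Longrightarrow> t \<in> {0..T} \<Longrightarrow> x \<in> {a..b} \<Longrightarrow> cmod (d s x - d t x) \<le> K * \<bar>s - t\<bar>"
    and c: "\<And>s. s \<in> {0..T} \<Longrightarrow> continuous_on {a..b} (\<psi> s)" "\<And>s. s \<in> {0..T} \<Longrightarrow> continuous_on {a..b} (d s)"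
    and \<phi>: "test_function {a<..<b} \<phi>" and ab: "a < b" and t: "t \<in> {0..T}" and K: "0 \<le> K"
  shows "((\<lambda>s. LINT x|lebesgue_on {a<..<b}. \<psi> s x * \<phi> x) has_vector_derivative
     (LINT x|lebesgue_on {a<..<b}. d t x * \<phi> x)) (at t within {0..T})"
proof -
  obtain B where B: "0 \<le> B" "\<And>x. cmod (\<phi> x) \<le> B" using test_function_bounded[OF \<phi> ab] by metis
  have int: "integrable (lebesgue_on {a<..<b}) (\<lambda>x. f x * \<phi> x)" if "continuous_on {a..b} f" for f
    by (rule locally_integrable_mult_test[OF continuous_imp_locally_integrable[OF that] \<phi> ab])
  show ?thesis
  proof (rule has_vector_derivative_withinI_bound)
    show "((\<lambda>s. K * \<bar>s - t\<bar> * B * (b - a)) \<longlongrightarrow> 0) (at t within {0..T})"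
      by (auto intro!: tendsto_eq_intros)
    fix s assume s: "s \<in> {0..T}" "s \<noteq> t"
    let ?f = "\<lambda>x. ((\<psi> s x - \<psi> t x) /\<^sub>R (s - t) - d t x) * \<phi> x"
    have "((LINT x|lebesgue_on {a<..<b}. \<psi> s x * \<phi> x) - (LINT x|lebesgue_on {a<..<b}. \<psi> t x * \<phi> x)) /\<^sub>R (s - t)
       - (LINT x|lebesgue_on {a<..<b}. d t x * \<phi> x) = (LINT x|lebesgue_on {a<..<b}. (\<psi> s x * \<phi> x - \<psi> t x * \<phi> x) /\<^sub>R (s - t) - d t x * \<phi> x)"
      using int[OF c(1)[OF s(1)]] int[OF c(1)[OF t]] int[OF c(2)[OF t]] by simp
    also have "\<dots> = (LINT x|lebesgue_on {a<..<b}. ?f x)"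
      by (rule Bochner_Integration.integral_cong) (auto simp: scaleR_conv_of_real algebra_simps)
    also have "cmod \<dots> \<le> K * \<bar>s - t\<bar> * B * (b - a)"
    proof (rule norm_integral_interval_le[OF _ _ ab])
      show "integrable (lebesgue_on {a<..<b}) ?f"
        by (rule int) (intro continuous_intros c s t)
      fix x assume x: "x \<in> {a<..<b}"
      then have x': "x \<in> {a..b}" by auto
      let ?S = "closed_segment t s"
      have S: "?S \<subseteq> {0..T}" using t s by (auto simp: closed_segment_eq_real_ivl split: if_splits)
      \<comment> \<open>The mean value inequality is used on the segment between t and s only, where
        the derivative deviates from its value at t by at most K |s - t|.\<close>
      have "norm (\<psi> s x - \<psi> t x - (s - t) *\<^sub>R d t x) \<le> norm (s - t) * (K * \<bar>s - t\<bar>)"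
      proof (rule vector_differentiable_bound_linearization[where S = ?S and f = "\<lambda>s. \<psi> s x" and f' = "\<lambda>s. d s x"])
        show "((\<lambda>s. \<psi> s x) has_vector_derivative d r x) (at r within ?S)" if "r \<in> ?S" for r
          by (rule has_vector_derivative_within_subset[OF der S]) (use that S x' in auto)
        show "norm (d r x - d t x) \<le> K * \<bar>s - t\<bar>" if "r \<in> ?S" for r
        proof -
          have "norm (d r x - d t x) \<le> K * \<bar>r - t\<bar>" using that S x' t by (intro L) auto
          also have "\<dots> \<le> K * \<bar>s - t\<bar>" using that K
            by (intro mult_left_mono) (auto simp: closed_segment_eq_real_ivl split: if_splits)
          finally show ?thesis .
        qed
      qed auto
      moreover have "\<psi> s x - \<psi> t x - (s - t) *\<^sub>R d t x = (s - t) *\<^sub>R ((\<psi> s x - \<psi> t x) /\<^sub>R (s - t) - d t x)"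
        using s by (simp add: scaleR_diff_right)
      ultimately have "\<bar>s - t\<bar> * cmod ((\<psi> s x - \<psi> t x) /\<^sub>R (s - t) - d t x) \<le> \<bar>s - t\<bar> * (K * \<bar>s - t\<bar>)"
        by (metis norm_scaleR real_norm_def)
      then have "cmod ((\<psi> s x - \<psi> t x) /\<^sub>R (s - t) - d t x) \<le> K * \<bar>s - t\<bar>"
        using s by simp
      then show "cmod (?f x) \<le> K * \<bar>s - t\<bar> * B"
        unfolding norm_mult using B K by (intro mult_mono) auto
    qed
    finally show "cmod (((LINT x|lebesgue_on {a<..<b}. \<psi> s x * \<phi> x) - (LINT x|lebesgue_on {a<..<b}. \<psi> t x * \<phi> x)) /\<^sub>R (s - t)
       - (LINT x|lebesgue_on {a<..<b}. d t x * \<phi> x)) \<le> K * \<bar>s - t\<bar> * B * (b - a)" .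
  qed
qed

text \<open>With both derivatives moved off the test function, the equation says that a continuous
  function annihilates all test functions. Hence it vanishes on the closed interval, endpoints
  included.\<close>

lemma nls_pointwise:
  fixes \<psi> :: "real \<Rightarrow> real \<Rightarrow> complex"
  assumes sol: "nls_solution a b \<beta> V \<psi>0 S \<psi>" and t: "0 < t" "t \<le> T" "ereal T < S" and ab: "a < b"
    and V: "continuous_on {a..b} V"
    and p: "is_weak_deriv {a<..<b} 2 (\<psi> t) p" "continuous_on {a..b} p"
    and d: "continuous_on {a..b} d"
    and der: "\<And>\<phi>. test_function {a<..<b} \<phi> \<Longrightarrow> ((\<lambda>s. LINT x|lebesgue_on {a<..<b}. \<psi> s x * \<phi> x) has_vector_derivative
     (LINT x|lebesgue_on {a<..<b}. d x * \<phi> x)) (at t within {0..T})"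
    and x: "x \<in> {a..b}"
  shows "\<i> * d x = - (1/2) * p x + (of_real (V x) * \<psi> t x + of_real (\<beta> * (cmod (\<psi> t x))\<^sup>2) * \<psi> t x)"
proof -
  let ?M = "lebesgue_on {a<..<b}"
  let ?N = "\<lambda>x. of_real (V x) * \<psi> t x + of_real (\<beta> * (cmod (\<psi> t x))\<^sup>2) * \<psi> t x"
  have tS: "ereal t < S" using t by (meson ereal_less_eq(3) le_less_trans)
  have cont: "continuous_on {a..b} (\<psi> t)"
    using sol t(1) tS unfolding nls_solution_def Let_def by auto
  have cN: "continuous_on {a..b} ?N"
    by (intro continuous_intros cont V)
  let ?w = "\<lambda>x. \<i> * d x + (1/2) * p x - ?N x"
  have cw: "continuous_on {a..b} ?w"
    by (intro continuous_intros d p(2) cN)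
  have "AE x in ?M. ?w x = 0"
  proof (rule weak_zero[OF continuous_imp_locally_integrable[OF cw] ab])
    fix \<phi> assume \<phi>: "test_function {a<..<b} \<phi>"
    obtain D where D: "((\<lambda>s. LINT x|?M. \<psi> s x * \<phi> x) has_vector_derivative D) (at t)"
      "\<i> * D = - (1/2) * (LINT x|?M. \<psi> t x * nth_vderiv 2 \<phi> x) + (LINT x|?M. ?N x * \<phi> x)"
      using sol \<phi> t(1) tS unfolding nls_solution_def Let_def by blast
    \<comment> \<open>The notion of solution supplies a two-sided derivative, the regularity one
      within [0, T]; they agree because t is a limit point of [0, T].\<close>
    have "D = (LINT x|?M. d x * \<phi> x)"
    proof (rule vector_derivative_unique_within[OF _ has_vector_derivative_at_within[OF D(1)] der[OF \<phi>]])
      show "at t within {0..T} \<noteq> bot"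
        using t by (simp add: trivial_limit_within islimpt_Icc)
    qed
    moreover have "(LINT x|?M. \<psi> t x * nth_vderiv 2 \<phi> x) = (LINT x|?M. p x * \<phi> x)"
      using is_weak_deriv_pairing[OF p(1) \<phi>] by simp
    ultimately have eq: "\<i> * (LINT x|?M. d x * \<phi> x) + (1/2) * (LINT x|?M. p x * \<phi> x) - (LINT x|?M. ?N x * \<phi> x) = 0"
      using D(2) by (simp add: algebra_simps)
    have int: "integrable ?M (\<lambda>x. f x * \<phi> x)" if "continuous_on {a..b} f" for f
      by (rule locally_integrable_mult_test[OF continuous_imp_locally_integrable[OF that] \<phi> ab])
    have "(LINT x|?M. ?w x * \<phi> x) = (LINT x|?M. \<i> * (d x * \<phi> x) + (1/2) * (p x * \<phi> x) - ?N x * \<phi> x)"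
      by (rule Bochner_Integration.integral_cong) (auto simp: algebra_simps)
    also have "\<dots> = (LINT x|?M. \<i> * (d x * \<phi> x) + (1/2) * (p x * \<phi> x)) - (LINT x|?M. ?N x * \<phi> x)"
      by (intro Bochner_Integration.integral_diff Bochner_Integration.integrable_add integrable_mult_right int d p(2) cN)
    also have "(LINT x|?M. \<i> * (d x * \<phi> x) + (1/2) * (p x * \<phi> x)) = (LINT x|?M. \<i> * (d x * \<phi> x)) + (LINT x|?M. (1/2) * (p x * \<phi> x))"
      by (intro Bochner_Integration.integral_add integrable_mult_right int d p(2))
    also have "\<dots> = \<i> * (LINT x|?M. d x * \<phi> x) + (1/2) * (LINT x|?M. p x * \<phi> x)"
      by (simp only: integral_mult_right_zero)
    finally show "(LINT x|?M. ?w x * \<phi> x) = 0" using eq by simp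
  qed
  then have "?w x = 0"
    by (intro AE_interval_eq[OF ab cw _ _ x, of "\<lambda>_. 0"]) auto
  then show ?thesis by (simp add: algebra_simps)
qed

text \<open>Comparing the coefficients of \<open>(x - e)\<^sup>2\<close> in the equation at an endpoint \<open>e\<close>.\<close>

lemma endpoint_fourth_derivative:
  fixes q :: "nat \<Rightarrow> real \<Rightarrow> complex" and g :: "nat \<Rightarrow> real \<Rightarrow> complex"
  assumes J: "J = {a..b}" "a < b" and e: "e \<in> J"
    and q: "\<And>j x. j < 4 \<Longrightarrow> x \<in> J \<Longrightarrow> (q j has_vector_derivative q (Suc j) x) (at x within J)"
      "\<And>x y. x \<in> J \<Longrightarrow> y \<in> J \<Longrightarrow> cmod (q 4 x - q 4 y) \<le> K * \<bar>x - y\<bar>"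
      "\<And>j x. j \<le> 4 \<Longrightarrow> x \<in> J \<Longrightarrow> cmod (q j x) \<le> K" "q 0 e = 0" "q 2 e = 0"
    and g: "\<And>j x. j < 2 \<Longrightarrow> x \<in> J \<Longrightarrow> (g j has_vector_derivative g (Suc j) x) (at x within J)"
      "\<And>x y. x \<in> J \<Longrightarrow> y \<in> J \<Longrightarrow> cmod (g 2 x - g 2 y) \<le> K * \<bar>x - y\<bar>" "g 0 e = 0" "g 2 e = 0"
    and V: "\<And>x. x \<in> J \<Longrightarrow> (V has_real_derivative V' x) (at x within J)"
    and eq: "\<And>x. x \<in> J \<Longrightarrow> \<i> * g 0 x = - (1/2) * q 2 x + (of_real (V x) * q 0 x + of_real (\<beta> * (cmod (q 0 x))\<^sup>2) * q 0 x)"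
  shows "q 4 e = 4 * of_real (V' e) * q 1 e"
proof -
  have K0: "0 \<le> K" using q(3)[of 0 e] e norm_ge_zero order_trans by blast
  \<comment> \<open>The second derivative is merely Lipschitz, so the cubic remainder comes from two
    mean value inequalities. The estimate is used for q, for q shifted by two orders, and for
    g.\<close>
  have taylor: "cmod (h 0 x - h 0 e - of_real (x - e) * h 1 e - of_real ((x - e)\<^sup>2 / 2) * h 2 e) \<le> K * \<bar>x - e\<bar> ^ 3"
    if h: "\<And>j x. j < 2 \<Longrightarrow> x \<in> J \<Longrightarrow> (h j has_vector_derivative h (Suc j) x) (at x within J)"
      "\<And>x y. x \<in> J \<Longrightarrow> y \<in> J \<Longrightarrow> cmod (h 2 x - h 2 y) \<le> K * \<bar>x - y\<bar>" and x: "x \<in> J"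
    for h :: "nat \<Rightarrow> real \<Rightarrow> complex" and x
  proof -
    let ?S = "closed_segment e x"
    have S: "?S \<subseteq> J" using e x by (auto simp: J closed_segment_eq_real_ivl split: if_splits)
    have Sy: "\<bar>y - e\<bar> \<le> \<bar>x - e\<bar>" if "y \<in> ?S" for y
      using that by (auto simp: closed_segment_eq_real_ivl split: if_splits)
    define r1 where "r1 y = h 1 y - h 1 e - of_real (y - e) * h 2 e" for y
    define r0 where "r0 y = h 0 y - h 0 e - of_real (y - e) * h 1 e - of_real ((y - e)\<^sup>2 / 2) * h 2 e" for y
    have d1: "(r1 has_vector_derivative h 2 y - h 2 e) (at y within ?S)" if "y \<in> ?S" for y
    proof -
      have "(h 1 has_vector_derivative h 2 y) (at y within ?S)"
        using has_vector_derivative_within_subset[OF h(1)[of 1 y] S] that S by (auto simp: numeral_2_eq_2)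
      then show ?thesis unfolding r1_def
        by (auto intro!: derivative_eq_intros)
    qed
    have d0: "(r0 has_vector_derivative r1 y) (at y within ?S)" if "y \<in> ?S" for y
    proof -
      have 1: "(h 0 has_vector_derivative h 1 y) (at y within ?S)"
        using has_vector_derivative_within_subset[OF h(1)[of 0 y] S] that S by auto
      have 2: "((\<lambda>y. complex_of_real ((y - e)\<^sup>2 / 2)) has_vector_derivative of_real (y - e)) (at y within ?S)"
        by (rule has_vector_derivative_of_real)
          (auto intro!: derivative_eq_intros simp flip: has_real_derivative_iff_has_vector_derivative)
      show ?thesis unfolding r0_def r1_def
        by (rule derivative_eq_intros 1 2 refl | simp)+
    qed
    have b1: "cmod (r1 y) \<le> K * \<bar>x - e\<bar> * \<bar>x - e\<bar>" if y: "y \<in> ?S" for y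
    proof -
      have "cmod (r1 y - r1 e) \<le> (K * \<bar>x - e\<bar>) * \<bar>y - e\<bar>"
      proof (rule vector_derivative_bound[OF convex_closed_segment d1])
        show "cmod (h 2 z - h 2 e) \<le> K * \<bar>x - e\<bar>" if "z \<in> ?S" for z
        proof -
          have "cmod (h 2 z - h 2 e) \<le> K * \<bar>z - e\<bar>" using h(2) that S e by blast
          also have "\<dots> \<le> K * \<bar>x - e\<bar>" using Sy[OF that] K0 by (intro mult_left_mono)
          finally show ?thesis .
        qed
      qed (use y in auto)
      also have "\<dots> \<le> (K * \<bar>x - e\<bar>) * \<bar>x - e\<bar>" using Sy[OF y] K0 by (intro mult_left_mono) auto
      finally show ?thesis by (simp add: r1_def)
    qed
    have "cmod (r0 x - r0 e) \<le> (K * \<bar>x - e\<bar> * \<bar>x - e\<bar>) * \<bar>x - e\<bar>"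
      by (rule vector_derivative_bound[OF convex_closed_segment d0 b1]) auto
    then show ?thesis by (simp add: r0_def power3_eq_cube mult.assoc)
  qed
  \<comment> \<open>The coefficient of x - e that remains with \<open>V\<close> frozen at e.\<close>
  define \<alpha> where "\<alpha> = (1/2) * q 3 e - of_real (V e) * q 1 e + \<i> * g 1 e"
  obtain BV where BV: "\<And>x. x \<in> J \<Longrightarrow> \<bar>V x\<bar> \<le> BV" "0 \<le> BV"
  proof -
    have "continuous_on J V" using V by (meson DERIV_continuous continuous_on_eq_continuous_within)
    then have "bounded (V ` J)" by (intro compact_imp_bounded compact_continuous_image) (auto simp: J)
    then obtain B where "\<forall>y\<in>V ` J. norm y \<le> B" unfolding bounded_iff by blast
    then show thesis using that[of "\<bar>B\<bar>"] by force
  qed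
  \<comment> \<open>Minus the equation with \<open>q 0\<close>, \<open>q 2\<close> and
    \<open>g 0\<close> replaced by their Taylor polynomials and the cubic nonlinearity dropped. The
    variation of \<open>V\<close> is left unexpanded and will appear as a difference
    quotient.\<close>
  define F where "F x = of_real (x - e) * \<alpha> + of_real ((x - e)\<^sup>2) * (q 4 e / 4)
      - of_real ((V x - V e) * (x - e)) * q 1 e" for x
  define C where "C = K + BV * K + \<bar>\<beta>\<bar> * K ^ 3 + K"
  have Fb: "cmod (F x) \<le> C * \<bar>x - e\<bar> ^ 3" if x: "x \<in> J" for x
  proof -
    have q2L: "cmod (q 2 x - q 2 y) \<le> K * \<bar>x - y\<bar>" if "x \<in> J" "y \<in> J" for x y
    proof (rule vector_derivative_bound[where S = J])
      show "(q 2 has_vector_derivative q 3 z) (at z within J)" if "z \<in> J" for z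
        using q(1)[of 2 z] that by (simp add: eval_nat_numeral)
      show "cmod (q 3 z) \<le> K" if "z \<in> J" for z using q(3)[of 3 z] that by simp
    qed (use that J in auto)
    have t1: "cmod (q 2 x - of_real (x - e) * q 3 e - of_real ((x - e)\<^sup>2 / 2) * q 4 e) \<le> K * \<bar>x - e\<bar> ^ 3"
    proof -
      have "cmod (q (0 + 2) x - q (0 + 2) e - of_real (x - e) * q (1 + 2) e - of_real ((x - e)\<^sup>2 / 2) * q (2 + 2) e) \<le> K * \<bar>x - e\<bar> ^ 3"
        by (rule taylor[of "\<lambda>j. q (j + 2)"]) (use q(1)[of "_ + 2"] q(2) x in auto)
      then show ?thesis using q(5) by (simp add: eval_nat_numeral)
    qed
    have t2: "cmod (q 0 x - of_real (x - e) * q 1 e) \<le> K * \<bar>x - e\<bar> ^ 3"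
      using taylor[of q, OF q(1) q2L x] q(4,5) by simp
    have t3: "cmod (g 0 x - of_real (x - e) * g 1 e) \<le> K * \<bar>x - e\<bar> ^ 3"
      using taylor[of g, OF g(1,2) x] g(3,4) by simp
    have t4: "cmod (of_real (\<beta> * (cmod (q 0 x))\<^sup>2) * q 0 x) \<le> \<bar>\<beta>\<bar> * K ^ 3 * \<bar>x - e\<bar> ^ 3"
    proof -
      have "cmod (q 0 x - q 0 e) \<le> K * \<bar>x - e\<bar>"
      proof (rule vector_derivative_bound[where S = J])
        show "(q 0 has_vector_derivative q 1 z) (at z within J)" if "z \<in> J" for z
          using q(1)[of 0 z] that by simp
        show "cmod (q 1 z) \<le> K" if "z \<in> J" for z using q(3)[of 1 z] that by simp
      qed (use x e J in auto)
      then have "cmod (q 0 x) ^ 3 \<le> (K * \<bar>x - e\<bar>) ^ 3" using q(4) by (intro power_mono) auto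
      then have "\<bar>\<beta>\<bar> * cmod (q 0 x) ^ 3 \<le> \<bar>\<beta>\<bar> * (K * \<bar>x - e\<bar>) ^ 3" by (intro mult_left_mono) auto
      moreover have "cmod (of_real (\<beta> * (cmod (q 0 x))\<^sup>2) * q 0 x) = \<bar>\<beta>\<bar> * cmod (q 0 x) ^ 3"
        by (simp add: norm_mult power2_eq_square power3_eq_cube)
      ultimately show ?thesis by (simp only: power_mult_distrib mult.assoc)
    qed
    let ?r1 = "q 2 x - of_real (x - e) * q 3 e - of_real ((x - e)\<^sup>2 / 2) * q 4 e"
    let ?r2 = "q 0 x - of_real (x - e) * q 1 e"
    let ?r3 = "g 0 x - of_real (x - e) * g 1 e"
    let ?r4 = "of_real (\<beta> * (cmod (q 0 x))\<^sup>2) * q 0 x"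
    have "F x = - (1/2) * ?r1 + of_real (V x) * ?r2 + ?r4 - \<i> * ?r3"
    proof -
      obtain y where y: "complex_of_real (x - e) = y" by blast
      obtain w where w: "?r4 = w" by blast
      obtain v where v: "complex_of_real (V x) = v" by blast
      have 0: "- (1/2) * q 2 x + v * q 0 x + w - \<i> * g 0 x = 0"
        using eq[OF x] w v by (simp add: add.assoc)
      have "F x = y * \<alpha> + y\<^sup>2 * (q 4 e / 4) - (v - of_real (V e)) * y * q 1 e"
        unfolding F_def of_real_mult of_real_power y of_real_diff[of "V x"] v ..
      also have "\<dots> = - (1/2) * (q 2 x - y * q 3 e - y\<^sup>2 / 2 * q 4 e) + v * (q 0 x - y * q 1 e) + w - \<i> * (g 0 x - y * g 1 e)
          - (- (1/2) * q 2 x + v * q 0 x + w - \<i> * g 0 x)"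
        unfolding \<alpha>_def by (simp add: algebra_simps)
      also have "\<dots> = - (1/2) * ?r1 + of_real (V x) * ?r2 + ?r4 - \<i> * ?r3"
        unfolding 0 w of_real_divide of_real_power y v by simp
      finally show ?thesis .
    qed
    also have "cmod \<dots> \<le> cmod (- (1/2) * ?r1) + cmod (of_real (V x) * ?r2) + cmod ?r4 + cmod (\<i> * ?r3)"
      by (intro order_trans[OF norm_triangle_ineq4] order_trans[OF norm_triangle_ineq] add_mono order_refl)
    also have "\<dots> \<le> K * \<bar>x - e\<bar> ^ 3 + BV * (K * \<bar>x - e\<bar> ^ 3) + \<bar>\<beta>\<bar> * K ^ 3 * \<bar>x - e\<bar> ^ 3 + K * \<bar>x - e\<bar> ^ 3"
    proof (intro add_mono t4)
      have "cmod (- (1/2) * ?r1) = (1/2) * cmod ?r1" unfolding norm_mult by simp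
      also have "\<dots> \<le> 1 * cmod ?r1" by (intro mult_right_mono) auto
      also have "\<dots> \<le> K * \<bar>x - e\<bar> ^ 3" using t1 by (simp only: mult_1)
      finally show "cmod (- (1/2) * ?r1) \<le> K * \<bar>x - e\<bar> ^ 3" .
      show "cmod (of_real (V x) * ?r2) \<le> BV * (K * \<bar>x - e\<bar> ^ 3)"
        unfolding norm_mult norm_of_real using t2 BV x by (intro mult_mono) auto
      show "cmod (\<i> * ?r3) \<le> K * \<bar>x - e\<bar> ^ 3" unfolding norm_mult using t3 by simp
    qed
    also have "\<dots> = C * \<bar>x - e\<bar> ^ 3" unfolding C_def by (simp add: algebra_simps)
    finally show ?thesis .
  qed
  have nb: "at e within J \<noteq> bot"
    using e J by (simp add: trivial_limit_within islimpt_Icc)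
  have lim0: "((\<lambda>x. x - e) \<longlongrightarrow> 0) (at e within J)" by (auto intro!: tendsto_eq_intros)
  have Vq: "((\<lambda>x. (V x - V e) / (x - e)) \<longlongrightarrow> V' e) (at e within J)"
    using V[OF e] by (simp add: has_field_derivative_iff)
  have V0: "((\<lambda>x. V x - V e) \<longlongrightarrow> 0) (at e within J)"
  proof -
    have "(V \<longlongrightarrow> V e) (at e within J)" using DERIV_continuous[OF V[OF e]] by (simp add: continuous_within)
    then show ?thesis by (simp add: LIM_zero)
  qed
  have ev: "\<forall>\<^sub>F x in at e within J. x \<in> J \<and> x \<noteq> e" by (auto simp: eventually_at_filter)
  have small: "((\<lambda>x. F x / of_real (x - e) ^ n) \<longlongrightarrow> 0) (at e within J)" if n: "n < 3" for n
  proof (rule Lim_null_comparison)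
    show "((\<lambda>x. C * \<bar>x - e\<bar> ^ (3 - n)) \<longlongrightarrow> 0) (at e within J)"
      using n by (auto intro!: tendsto_eq_intros)
    show "\<forall>\<^sub>F x in at e within J. norm (F x / of_real (x - e) ^ n) \<le> C * \<bar>x - e\<bar> ^ (3 - n)"
      using ev
    proof eventually_elim
      case (elim x)
      have "\<bar>x - e\<bar> ^ 3 = \<bar>x - e\<bar> ^ (3 - n) * \<bar>x - e\<bar> ^ n"
        using n by (simp flip: power_add)
      then show ?case using Fb[of x] elim
        by (simp add: norm_divide norm_power divide_le_eq mult.assoc flip: of_real_diff)
    qed
  qed
  \<comment> \<open>First order: F divided by x - e tends to \<alpha> and also to 0.\<close>
  have "((\<lambda>x. \<alpha> + of_real (x - e) * (q 4 e / 4) - of_real (V x - V e) * q 1 e) \<longlongrightarrow> \<alpha> + of_real 0 * (q 4 e / 4) - of_real 0 * q 1 e) (at e within J)"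
    by (intro tendsto_intros lim0 V0)
  moreover have "((\<lambda>x. \<alpha> + of_real (x - e) * (q 4 e / 4) - of_real (V x - V e) * q 1 e) \<longlongrightarrow> 0) (at e within J)"
  proof (rule Lim_transform_eventually[OF small[of 1]])
    show "\<forall>\<^sub>F x in at e within J. F x / of_real (x - e) ^ 1 = \<alpha> + of_real (x - e) * (q 4 e / 4) - of_real (V x - V e) * q 1 e"
      using ev
    proof eventually_elim
      case (elim x)
      define y where "y = complex_of_real (x - e)"
      have "y \<noteq> 0" using elim by (simp add: y_def)
      moreover have "F x = y * (\<alpha> + y * (q 4 e / 4) - of_real (V x - V e) * q 1 e)"
        unfolding F_def of_real_mult of_real_power y_def[symmetric]
        by (simp add: distrib_left right_diff_distrib power2_eq_square mult.left_commute mult.assoc)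
      ultimately show ?case unfolding y_def[symmetric] by simp
    qed
  qed simp
  ultimately have \<alpha>: "\<alpha> = 0" using tendsto_unique[OF nb] by fastforce
  \<comment> \<open>Second order: with \<alpha> = 0, division by (x - e)^2 turns the variation of
    \<open>V\<close> into its difference quotient, whose limit is V'(e).\<close>
  have "((\<lambda>x. q 4 e / 4 - of_real ((V x - V e) / (x - e)) * q 1 e) \<longlongrightarrow> q 4 e / 4 - of_real (V' e) * q 1 e) (at e within J)"
    by (intro tendsto_intros Vq)
  moreover have "((\<lambda>x. q 4 e / 4 - of_real ((V x - V e) / (x - e)) * q 1 e) \<longlongrightarrow> 0) (at e within J)"
  proof (rule Lim_transform_eventually[OF small[of 2]])
    show "\<forall>\<^sub>F x in at e within J. F x / of_real (x - e) ^ 2 = q 4 e / 4 - of_real ((V x - V e) / (x - e)) * q 1 e"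
      using ev
    proof eventually_elim
      case (elim x)
      define y where "y = complex_of_real (x - e)"
      have y: "y \<noteq> 0" using elim by (simp add: y_def)
      have "F x = y\<^sup>2 * (q 4 e / 4) - of_real (V x - V e) * y * q 1 e"
        unfolding F_def \<alpha> of_real_mult of_real_power y_def[symmetric] by simp
      also have "\<dots> = y\<^sup>2 * (q 4 e / 4 - (of_real (V x - V e) / y) * q 1 e)"
        using y by (simp add: right_diff_distrib power2_eq_square)
      finally show ?case using y unfolding of_real_divide y_def[symmetric] by simp
    qed
  qed simp
  ultimately have "q 4 e / 4 - of_real (V' e) * q 1 e = 0" using tendsto_unique[OF nb] by blast
  then show ?thesis by (simp add: field_simps)
qed

section \<open>Boundary trace of functions in H^2_0\<close>

lemma test_function_mult:
  assumes "test_function {a<..<b} \<phi>" "test_function {a<..<b} \<theta>" "a < (b::real)"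
  shows "test_function {a<..<b} (\<lambda>x. \<phi> x * \<theta> x)"
proof -
  obtain c d where cd: "a < c" "c \<le> d" "d < b" "\<forall>x. x \<notin> {c..d} \<longrightarrow> \<phi> x = 0"
    by (rule test_function_support[OF assms(1,3)])
  show ?thesis
    by (rule test_functionI[where c = c and d = d])
      (use cd in \<open>auto intro!: smooth_upto_mult test_function_smooth[OF assms(1)] test_function_smooth[OF assms(2)]\<close>)
qed

lemma test_function_by_parts:
  assumes \<phi>: "test_function {a<..<b} \<phi>" and \<theta>: "test_function {a<..<b} \<theta>" and ab: "a < (b::real)"
  shows "(LINT x|lebesgue_on {a<..<b}. \<phi> x * nth_vderiv 1 \<theta> x) = - (LINT x|lebesgue_on {a<..<b}. nth_vderiv 1 \<phi> x * \<theta> x)"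
proof -
  let ?f = "\<lambda>x. \<phi> x * \<theta> x"
  have f: "test_function {a<..<b} ?f" by (rule test_function_mult[OF \<phi> \<theta> ab])
  have f': "test_function {a<..<b} (nth_vderiv 1 ?f)" by (rule test_function_deriv[OF f ab])
  have li: "locally_integrable {a<..<b} \<rho>" if "test_function {a<..<b} \<rho>" for \<rho>
    by (rule continuous_imp_locally_integrable[OF test_function_continuous[OF that]])
  obtain c d where cd: "a < c" "c \<le> d" "d < b" "\<forall>x. x \<notin> {c..d} \<longrightarrow> nth_vderiv 1 ?f x = 0"
    by (rule test_function_support[OF f' ab])
  obtain c' d' where cd': "a < c'" "c' \<le> d'" "d' < b" "\<forall>x. x \<notin> {c'..d'} \<longrightarrow> \<phi> x = 0"
    by (rule test_function_support[OF \<phi> ab])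
  have deq: "nth_vderiv 1 ?f x = \<phi> x * nth_vderiv 1 \<theta> x + nth_vderiv 1 \<phi> x * \<theta> x" for x
    using vector_derivative_unique_at[OF test_function_vderiv[OF f]
      has_vector_derivative_mult[OF test_function_vderiv[OF \<phi>] test_function_vderiv[OF \<theta>]]] .
  have "(LINT x|lebesgue_on {a<..<b}. nth_vderiv 1 ?f x) = (LINT x|lborel. nth_vderiv 1 ?f x)"
  proof (rule integral_lebesgue_on_borel)
    fix x assume "x \<notin> {a<..<b}"
    then have "x \<notin> {c..d}" using cd by auto
    then show "nth_vderiv 1 ?f x = 0" using cd(4) by blast
  qed (use test_function_measurable[OF f'] in auto)
  also have "\<dots> = (LINT x|lborel. indicator {a..} x *\<^sub>R nth_vderiv 1 ?f x)"
  proof (rule Bochner_Integration.integral_cong)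
    fix x
    have "x < a \<Longrightarrow> x \<notin> {c..d}" using cd by auto
    then show "nth_vderiv 1 ?f x = indicator {a..} x *\<^sub>R nth_vderiv 1 ?f x"
      using cd(4) by (cases "x < a") (auto simp: indicator_def simp del: One_nat_def)
  qed simp
  also have "\<dots> = - ?f a" by (rule test_function_tail_integral[OF f ab])
  also have "\<phi> a = 0" using cd' by auto
  finally have "(LINT x|lebesgue_on {a<..<b}. \<phi> x * nth_vderiv 1 \<theta> x + nth_vderiv 1 \<phi> x * \<theta> x) = 0"
    unfolding deq by simp
  moreover have "(LINT x|lebesgue_on {a<..<b}. \<phi> x * nth_vderiv 1 \<theta> x + nth_vderiv 1 \<phi> x * \<theta> x)
    = (LINT x|lebesgue_on {a<..<b}. \<phi> x * nth_vderiv 1 \<theta> x) + (LINT x|lebesgue_on {a<..<b}. nth_vderiv 1 \<phi> x * \<theta> x)"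
    by (intro Bochner_Integration.integral_add locally_integrable_mult_test li ab \<phi> \<theta> test_function_deriv)
  ultimately show ?thesis by (simp add: add_eq_0_iff)
qed

lemma test_function_nth_vderiv:
  assumes "test_function {a<..<b} \<phi>" "a < (b::real)"
  shows "test_function {a<..<b} (nth_vderiv k \<phi>)"
proof (induction k)
  case (Suc k)
  have "nth_vderiv (Suc k) \<phi> = nth_vderiv 1 (nth_vderiv k \<phi>)" by (simp add: nth_vderiv_Suc' nth_vderiv_Suc)
  then show ?case using test_function_deriv[OF Suc assms(2)] by simp
qed (use assms in simp)

lemma test_function_is_weak_deriv:
  assumes "test_function {a<..<b} \<phi>" "a < (b::real)"
  shows "is_weak_deriv {a<..<b} k \<phi> (nth_vderiv k \<phi>)"
proof -
  have li: "locally_integrable {a<..<b} \<rho>" if "test_function {a<..<b} \<rho>" for \<rho>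
    by (rule continuous_imp_locally_integrable[OF test_function_continuous[OF that]])
  have "(LINT x|lebesgue_on {a<..<b}. \<phi> x * nth_vderiv k \<theta> x) = (-1) ^ k * (LINT x|lebesgue_on {a<..<b}. nth_vderiv k \<phi> x * \<theta> x)"
    if \<theta>: "test_function {a<..<b} \<theta>" for \<theta>
    using assms(1)
  proof (induction k arbitrary: \<phi>)
    case (Suc k)
    have s: "nth_vderiv (Suc k) \<theta> = nth_vderiv 1 (nth_vderiv k \<theta>)" by (simp add: nth_vderiv_Suc' nth_vderiv_Suc)
    have s': "nth_vderiv (Suc k) \<phi> = nth_vderiv k (nth_vderiv 1 \<phi>)" by (simp add: nth_vderiv_Suc)
    show ?case
      unfolding s test_function_by_parts[OF Suc.prems test_function_nth_vderiv[OF \<theta> assms(2)] assms(2)]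
        Suc.IH[OF test_function_deriv[OF Suc.prems assms(2)]] s' by simp
  qed simp
  then show ?thesis
    unfolding is_weak_deriv_def using li assms test_function_nth_vderiv by blast
qed

lemma integral_lebesgue_on_continuous:
  fixes f :: "real \<Rightarrow> real"
  assumes "continuous_on {a..b} f"
  shows "(LINT x|lebesgue_on {a<..<b}. f x) = integral {a..b} f"
proof -
  have "f absolutely_integrable_on {a..b}"
    using assms by (rule absolutely_integrable_continuous_real)
  then have "f absolutely_integrable_on {a<..<b}"
    by (rule set_integrable_subset) auto
  then have "integrable (lebesgue_on {a<..<b}) f"
    by (simp add: set_integrable_def integrable_restrict_space)
  then have "(LINT x|lebesgue_on {a<..<b}. f x) = integral {a<..<b} f"
    by (rule lebesgue_integral_eq_integral) auto
  also have "\<dots> = integral {a..b} f" by (rule integral_open_interval_real[symmetric])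
  finally show ?thesis .
qed

lemma L2_norm_continuous_rep:
  assumes "is_weak_deriv {a<..<b} j w c" "continuous_on {a..b} c" "a < b"
  shows "(L2_norm {a<..<b} (weak_deriv {a<..<b} j w))\<^sup>2 = integral {a..b} (\<lambda>x. (cmod (c x))\<^sup>2)"
proof -
  have wd: "is_weak_deriv {a<..<b} j w (weak_deriv {a<..<b} j w)"
    unfolding weak_deriv_def by (rule someI[where P = "is_weak_deriv {a<..<b} j w", OF assms(1)])
  have [measurable]: "weak_deriv {a<..<b} j w \<in> borel_measurable (lebesgue_on {a<..<b})" "c \<in> borel_measurable (lebesgue_on {a<..<b})"
    using wd assms(1) by (auto simp: is_weak_deriv_def intro: locally_integrable_measurable)
  have "(LINT x|lebesgue_on {a<..<b}. (cmod (weak_deriv {a<..<b} j w x))\<^sup>2) = (LINT x|lebesgue_on {a<..<b}. (cmod (c x))\<^sup>2)"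
  proof (rule integral_cong_AE)
    show "AE x in lebesgue_on {a<..<b}. (cmod (weak_deriv {a<..<b} j w x))\<^sup>2 = (cmod (c x))\<^sup>2"
      using weak_deriv_AE_unique[OF wd assms(1,3)] by eventually_elim simp
  qed measurable
  also have "\<dots> = integral {a..b} (\<lambda>x. (cmod (c x))\<^sup>2)"
    by (rule integral_lebesgue_on_continuous) (intro continuous_intros assms)
  finally have eq: "(LINT x|lebesgue_on {a<..<b}. (cmod (weak_deriv {a<..<b} j w x))\<^sup>2) = integral {a..b} (\<lambda>x. (cmod (c x))\<^sup>2)" .
  moreover have "0 \<le> (LINT x|lebesgue_on {a<..<b}. (cmod (weak_deriv {a<..<b} j w x))\<^sup>2)"
    by (rule Bochner_Integration.integral_nonneg) simp
  ultimately show ?thesis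
    unfolding L2_norm_def by simp
qed

text \<open>At e the derivative of an approximating test function is zero, so \<open>p 1 e\<close>
  is up to sign the value at e of the derivative of the difference. That value is bounded by the
  value at any x plus the integral of the second derivative; averaging over x leaves only integrals
  that the H^2 distance controls.\<close>

lemma H0_2_trace:
  assumes u: "u \<in> H0_space {a<..<b} 2" and p: "sob_rep a b k p B u" and k: "3 \<le> k" and ab: "a < b" and e: "e \<in> {a, b}"
  shows "p 1 e = 0"
proof -
  obtain \<phi> where \<phi>: "\<And>n. test_function {a<..<b} (\<phi> n)"
     "(\<lambda>n. H_norm {a<..<b} 2 (\<lambda>x. \<phi> n x - u x)) \<longlonglongrightarrow> 0"
    using u unfolding H0_space_def by blast
  define N where "N n = H_norm {a<..<b} 2 (\<lambda>x. \<phi> n x - u x)" for n :: nat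
  define L where "L = b - a"
  have L: "0 < L" using ab by (simp add: L_def)
  have bound: "cmod (p 1 e) * L \<le> (1 + L) * (\<mu> * L + (N n)\<^sup>2 / \<mu>)" if l: "0 < \<mu>" for \<mu> n
  proof -
    define c where "c j x = nth_vderiv j (\<phi> n) x - p j x" for j x
    have cc: "continuous_on {a..b} (c j)" if "j \<le> 2" for j
      unfolding c_def using that k
      by (intro continuous_intros test_function_continuous[OF test_function_nth_vderiv[OF \<phi>(1) ab]] sob_rep_continuous[OF p]) auto
    have cw: "is_weak_deriv {a<..<b} j (\<lambda>x. \<phi> n x - u x) (c j)" if "j \<le> 2" for j
    proof -
      have "is_weak_deriv {a<..<b} j u (p j)" using p that k by (auto simp: sob_rep_def)
      from is_weak_deriv_lincomb[OF test_function_is_weak_deriv[OF \<phi>(1) ab] this ab, of n "-1"]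
      show ?thesis unfolding c_def by simp
    qed
    define S where "S j = integral {a..b} (\<lambda>x. (cmod (c j x))\<^sup>2)" for j
    have S0: "0 \<le> S j" if "j \<le> 2" for j
      unfolding S_def by (intro Henstock_Kurzweil_Integration.integral_nonneg integrable_continuous_real continuous_intros cc that) simp
    have N2: "(N n)\<^sup>2 = (\<Sum>j\<le>2. S j)"
    proof -
      have "(N n)\<^sup>2 = (\<Sum>j\<le>2. (L2_norm {a<..<b} (weak_deriv {a<..<b} j (\<lambda>x. \<phi> n x - u x)))\<^sup>2)"
        unfolding N_def H_norm_def by (simp add: sum_nonneg)
      also have "\<dots> = (\<Sum>j\<le>2. S j)"
        unfolding S_def by (intro sum.cong refl L2_norm_continuous_rep cw cc ab) auto
      finally show ?thesis .
    qed
    have SN: "S j \<le> (N n)\<^sup>2" if "j \<le> 2" for j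
      unfolding N2 using that by (intro member_le_sum) (auto intro: S0)
    have l1: "integral {a..b} (\<lambda>x. cmod (c j x)) \<le> \<mu> * L + (N n)\<^sup>2 / \<mu>" if j: "j \<le> 2" for j
    proof -
      \<comment> \<open>A weighted inequality in place of Cauchy-Schwarz: first n tends to infinity,
        which removes the quadratic part, then \<mu> tends to 0.\<close>
      have pt: "cmod (c j x) \<le> \<mu> + (cmod (c j x))\<^sup>2 / \<mu>" for x
      proof (cases "cmod (c j x) \<le> \<mu>")
        case True
        then show ?thesis using l by (simp add: add_increasing2)
      next
        case False
        then have "cmod (c j x) * \<mu> \<le> (cmod (c j x))\<^sup>2"
          unfolding power2_eq_square by (intro mult_left_mono) auto
        then have "cmod (c j x) \<le> (cmod (c j x))\<^sup>2 / \<mu>" using l by (simp add: pos_le_divide_eq)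
        then show ?thesis using l by linarith
      qed
      have "integral {a..b} (\<lambda>x. cmod (c j x)) \<le> integral {a..b} (\<lambda>x. \<mu> + (cmod (c j x))\<^sup>2 / \<mu>)"
        by (intro integral_le integrable_continuous_real continuous_intros cc j pt) (use l in auto)
      also have "\<dots> = \<mu> * L + S j / \<mu>"
        using ab cc[OF j] unfolding S_def L_def
        by (subst Henstock_Kurzweil_Integration.integral_add)
          (use l in \<open>auto intro!: integrable_continuous_real continuous_intros\<close>)
      also have "\<dots> \<le> \<mu> * L + (N n)\<^sup>2 / \<mu>" using SN[OF j] l by (intro add_left_mono divide_right_mono) auto
      finally show ?thesis .
    qed
    obtain g d where gd: "a < g" "g \<le> d" "d < b" "\<forall>x. x \<notin> {g..d} \<longrightarrow> nth_vderiv 1 (\<phi> n) x = 0"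
      by (rule test_function_support[OF test_function_nth_vderiv[OF \<phi>(1) ab] ab])
    have "e \<notin> {g..d}" using e gd by auto
    then have ce: "c 1 e = - p 1 e" unfolding c_def using gd(4) by (simp del: One_nat_def)
    have der: "(c 1 has_vector_derivative c 2 x) (at x within {a..b})" if "x \<in> {a..b}" for x
    proof -
      have "(p 1 has_vector_derivative p (Suc 1) x) (at x within {a..b})"
        by (rule sob_rep_deriv[OF p]) (use k that in auto)
      moreover have "(nth_vderiv 1 (\<phi> n) has_vector_derivative nth_vderiv 1 (nth_vderiv 1 (\<phi> n)) x) (at x within {a..b})"
        by (rule has_vector_derivative_at_within[OF test_function_vderiv[OF test_function_nth_vderiv[OF \<phi>(1) ab]]])
      moreover have "nth_vderiv 1 (nth_vderiv 1 (\<phi> n)) = nth_vderiv 2 (\<phi> n)"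
        by (simp add: nth_vderiv_Suc numeral_2_eq_2)
      ultimately show ?thesis
        unfolding c_def by (auto intro!: derivative_eq_intros simp: numeral_2_eq_2)
    qed
    have diff: "cmod (c 1 y - c 1 x) \<le> integral {a..b} (\<lambda>x. cmod (c 2 x))" if "a \<le> x" "x \<le> y" "y \<le> b" for x y
    proof -
      have sub: "{x..y} \<subseteq> {a..b}" using that by auto
      have c2: "continuous_on {a..b} (c 2)" "continuous_on {x..y} (c 2)"
        using cc[of 2] continuous_on_subset[OF _ sub] by auto
      have "(c 2 has_integral c 1 y - c 1 x) {x..y}"
      proof (rule fundamental_theorem_of_calculus[OF that(2)])
        show "(c 1 has_vector_derivative c 2 z) (at z within {x..y})" if "z \<in> {x..y}" for z
          by (rule has_vector_derivative_within_subset[OF der sub]) (use that sub in blast)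
      qed
      then have "cmod (c 1 y - c 1 x) = cmod (integral {x..y} (c 2))" by (simp add: integral_unique)
      also have "\<dots> \<le> integral {x..y} (\<lambda>x. cmod (c 2 x))"
        by (rule integral_norm_bound_integral) (auto intro!: integrable_continuous_real continuous_intros c2)
      also have "\<dots> \<le> integral {a..b} (\<lambda>x. cmod (c 2 x))"
        by (rule integral_subset_le[OF sub]) (auto intro!: integrable_continuous_real continuous_intros c2)
      finally show ?thesis .
    qed
    have "cmod (c 1 e) \<le> cmod (c 1 x) + integral {a..b} (\<lambda>x. cmod (c 2 x))" if x: "x \<in> {a..b}" for x
    proof -
      have "cmod (c 1 e - c 1 x) \<le> integral {a..b} (\<lambda>x. cmod (c 2 x))"
        using e x ab diff[of x e] diff[of e x] by (auto simp: norm_minus_commute)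
      then show ?thesis using norm_triangle_sub[of "c 1 e" "c 1 x"] by linarith
    qed
    then have "integral {a..b} (\<lambda>x. cmod (c 1 e)) \<le> integral {a..b} (\<lambda>x. cmod (c 1 x) + integral {a..b} (\<lambda>x. cmod (c 2 x)))"
      by (intro integral_le integrable_continuous_real continuous_intros cc) auto
    also have "\<dots> = integral {a..b} (\<lambda>x. cmod (c 1 x)) + L * integral {a..b} (\<lambda>x. cmod (c 2 x))"
      using ab cc[of 1] by (subst Henstock_Kurzweil_Integration.integral_add)
        (auto intro!: integrable_continuous_real continuous_intros simp: L_def)
    also have "\<dots> \<le> (\<mu> * L + (N n)\<^sup>2 / \<mu>) + L * (\<mu> * L + (N n)\<^sup>2 / \<mu>)"
      using L by (intro add_mono mult_left_mono l1) auto
    finally have F: "integral {a..b} (\<lambda>x. cmod (c 1 e)) \<le> (\<mu> * L + (N n)\<^sup>2 / \<mu>) + L * (\<mu> * L + (N n)\<^sup>2 / \<mu>)" .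
    have "integral {a..b} (\<lambda>x. cmod (c 1 e)) = cmod (p 1 e) * L"
      using ab unfolding ce by (simp add: L_def mult.commute)
    then show ?thesis using F by (simp only: distrib_right mult_1)
  qed
  have "cmod (p 1 e) * L \<le> (1 + L) * (\<mu> * L)" if l: "0 < \<mu>" for \<mu>
  proof (rule LIMSEQ_le_const)
    have "(\<lambda>n. (1 + L) * (\<mu> * L + (N n)\<^sup>2 / \<mu>)) \<longlonglongrightarrow> (1 + L) * (\<mu> * L + 0\<^sup>2 / \<mu>)"
      using \<phi>(2) l by (intro tendsto_intros) (auto simp: N_def)
    then show "(\<lambda>n. (1 + L) * (\<mu> * L + (N n)\<^sup>2 / \<mu>)) \<longlonglongrightarrow> (1 + L) * (\<mu> * L)" by simp
    show "\<exists>M. \<forall>n\<ge>M. cmod (p 1 e) * L \<le> (1 + L) * (\<mu> * L + (N n)\<^sup>2 / \<mu>)" using bound[OF l] by blast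
  qed
  note small = this
  have "cmod (p 1 e) * L \<le> 0 + \<epsilon>" if "0 < \<epsilon>" for \<epsilon>
    using small[of "\<epsilon> / ((1 + L) * L)"] L that by simp
  then have "cmod (p 1 e) * L \<le> 0" by (rule field_le_epsilon)
  then show ?thesis using L by (simp add: mult_le_0_iff)
qed

text \<open>Each regularity hypothesis has its own task. The first gives three time derivatives that
  are Lipschitz in space (\<open>d\<close>), the last gives four space derivatives
  (\<open>P\<close>), and the middle one gives the time derivative of \<psi>_xx and the expansion of
  \<psi>_t at an endpoint (\<open>B\<close>). Uniqueness of representatives and of derivatives glues
  them together.\<close>

lemma nls_regularity:
  fixes a b \<beta> T :: real and V V' :: "real \<Rightarrow> real" and \<psi> :: "real \<Rightarrow> real \<Rightarrow> complex"
  assumes ab: "a < b"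
    and V_C1: "\<forall>x\<in>{a..b}. (V has_real_derivative V' x) (at x within {a..b})"
    and sol: "nls_solution a b \<beta> V \<psi>0 S \<psi>"
    and T: "0 < T" "ereal T < S"
    and reg3: "Ck_into 3 {0..T} (W_inf {a<..<b} 1) (W_inf_norm {a<..<b} 1) \<psi>"
    and reg2: "Ck_into 2 {0..T} (W_inf {a<..<b} 3) (W_inf_norm {a<..<b} 3) \<psi>"
    and reg0: "Ck_into 0 {0..T} (W_inf {a<..<b} 5) (W_inf_norm {a<..<b} 5) \<psi>"
  obtains P :: "real \<Rightarrow> nat \<Rightarrow> real \<Rightarrow> complex" and d :: "nat \<Rightarrow> real \<Rightarrow> real \<Rightarrow> complex" and K :: real
  where "0 \<le> K"
    "\<forall>t\<in>{0..T}. sob_rep a b 5 (P t) K (\<psi> t)"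
    "\<forall>t\<in>{0..T}. \<forall>x\<in>{a..b}. P t 0 x = \<psi> t x \<and> d 0 t x = \<psi> t x"
    "\<forall>l<3. \<forall>t\<in>{0..T}. \<forall>x\<in>{a..b}. ((\<lambda>s. d l s x) has_vector_derivative d (Suc l) t x) (at t within {0..T})"
    "\<forall>l\<le>3. \<forall>t\<in>{0..T}. \<forall>x\<in>{a..b}. cmod (d l t x) \<le> K"
    "\<forall>l\<le>3. \<forall>t\<in>{0..T}. \<forall>x\<in>{a..b}. \<forall>y\<in>{a..b}. cmod (d l t x - d l t y) \<le> K * \<bar>x - y\<bar>"
    "\<forall>t\<in>{0..T}. \<forall>x\<in>{a..b}. \<i> * d 1 t x = - (1/2) * P t 2 x
        + (of_real (V x) * \<psi> t x + of_real (\<beta> * (cmod (\<psi> t x))\<^sup>2) * \<psi> t x)"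
    "\<forall>t\<in>{0..T}. \<forall>e\<in>{a, b}. P t 4 e = 4 * of_real (V' e) * P t 1 e"
proof -
  let ?I = "{0..T}" and ?J = "{a..b}"
  have \<psi>: "continuous_on ?J (\<psi> t)" "\<psi> t a = 0" "\<psi> t b = 0" if "t \<in> ?I" for t
  proof -
    have "ereal t < S" using that T by (meson atLeastAtMost_iff ereal_less_eq(3) le_less_trans)
    then show "continuous_on ?J (\<psi> t)" "\<psi> t a = 0" "\<psi> t b = 0"
      using sol that unfolding nls_solution_def Let_def by auto
  qed
  obtain A DA KA where A0: "0 \<le> KA" "\<forall>t\<in>{0..T}. DA 0 t = \<psi> t"
    "\<forall>l\<le>3. \<forall>t\<in>{0..T}. sob_rep a b 1 (A l t) KA (DA l t)"
    "\<forall>l<3. \<forall>j<1. \<forall>t\<in>{0..T}. \<forall>x\<in>{a..b}.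
        ((\<lambda>s. A l s j x) has_vector_derivative A (Suc l) t j x) (at t within {0..T})"
    by (rule time_regularity[OF reg3 ab])
  note A = A0[rule_format]
  obtain B DB KB where B0x: "0 \<le> KB" "\<forall>t\<in>{0..T}. DB 0 t = \<psi> t"
    "\<forall>l\<le>2. \<forall>t\<in>{0..T}. sob_rep a b 3 (B l t) KB (DB l t)"
    "\<forall>l<2. \<forall>j<3. \<forall>t\<in>{0..T}. \<forall>x\<in>{a..b}.
        ((\<lambda>s. B l s j x) has_vector_derivative B (Suc l) t j x) (at t within {0..T})"
    by (rule time_regularity[OF reg2 ab])
  note B = B0x[rule_format]
  obtain C DC KC where C0x: "0 \<le> KC" "\<forall>t\<in>{0..T}. DC 0 t = \<psi> t"
    "\<forall>l\<le>0. \<forall>t\<in>{0..T}. sob_rep a b 5 (C l t) KC (DC l t)"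
    "\<forall>l<0. \<forall>j<5. \<forall>t\<in>{0..T}. \<forall>x\<in>{a..b}.
        ((\<lambda>s. C l s j x) has_vector_derivative C (Suc l) t j x) (at t within {0..T})"
    by (rule time_regularity[OF reg0 ab])
  note C = C0x[rule_format]
  define K where "K = KA + KB + KC"
  have K: "0 \<le> K" "KA \<le> K" "KB \<le> K" "KC \<le> K" using A(1) B(1) C(1) by (auto simp: K_def)
  define P where "P = C 0"
  define d where "d l t x = A l t 0 x" for l t x
  have rA: "sob_rep a b 1 (A l t) K (DA l t)" if "l \<le> 3" "t \<in> ?I" for l t
    using sob_rep_mono[OF A(3)[OF that] K(2)] .
  have rB: "sob_rep a b 3 (B l t) K (DB l t)" if "l \<le> 2" "t \<in> ?I" for l t
    using sob_rep_mono[OF B(3)[OF that] K(3)] .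
  have rP: "sob_rep a b 5 (P t) K (\<psi> t)" if "t \<in> ?I" for t
    using sob_rep_mono[OF C(3)[OF le0 that] K(4)] C(2)[OF that] by (simp add: P_def)
  have rA0: "sob_rep a b 1 (A 0 t) K (\<psi> t)" if "t \<in> ?I" for t using rA[of 0 t] A(2)[OF that] that by simp
  have rB0: "sob_rep a b 3 (B 0 t) K (\<psi> t)" if "t \<in> ?I" for t using rB[of 0 t] B(2)[OF that] that by simp
  have P0: "P t 0 x = \<psi> t x" if "t \<in> ?I" "x \<in> ?J" for t x
    by (rule sob_rep_0[OF rP[OF that(1)] _ \<psi>(1)[OF that(1)] ab that(2)]) simp
  have d0: "d 0 t x = \<psi> t x" if "t \<in> ?I" "x \<in> ?J" for t x
    unfolding d_def by (rule sob_rep_0[OF rA0[OF that(1)] _ \<psi>(1)[OF that(1)] ab that(2)]) simp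
  have B0: "B 0 t 0 x = \<psi> t x" if "t \<in> ?I" "x \<in> ?J" for t x
    by (rule sob_rep_0[OF rB0[OF that(1)] _ \<psi>(1)[OF that(1)] ab that(2)]) simp
  have B2: "B 0 t 2 x = P t 2 x" if "t \<in> ?I" "x \<in> ?J" for t x
    by (rule sob_rep_unique[OF rB0[OF that(1)] rP[OF that(1)] ab _ _ that(2)]) simp_all
  have nb: "at t within ?I \<noteq> bot" if "t \<in> ?I" for t
    using that T(1) by (simp add: trivial_limit_within islimpt_Icc)
  have der: "((\<lambda>s. d l s x) has_vector_derivative d (Suc l) t x) (at t within ?I)" if "l < 3" "t \<in> ?I" "x \<in> ?J" for l t x
    unfolding d_def using A(4)[of l 0 t x] that by simp
  have der0: "((\<lambda>s. \<psi> s x) has_vector_derivative d 1 t x) (at t within ?I)" if "t \<in> ?I" "x \<in> ?J" for t x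
    using has_vector_derivative_transform[OF that(1) _ der[of 0 t x]] d0 that by simp
  have B1: "B 1 t 0 x = d 1 t x" if "t \<in> ?I" "x \<in> ?J" for t x
  proof (rule vector_derivative_unique_within[OF nb[OF that(1)] _ der0[OF that]])
    show "((\<lambda>s. \<psi> s x) has_vector_derivative B 1 t 0 x) (at t within ?I)"
      using has_vector_derivative_transform[OF that(1) _ B(4)[of 0 0 t x], of "\<lambda>s. \<psi> s x"] B0 that by simp
  qed
  have bd: "cmod (d l t x) \<le> K" if "l \<le> 3" "t \<in> ?I" "x \<in> ?J" for l t x
    unfolding d_def by (rule sob_rep_bound[OF rA[OF that(1,2)] _ that(3)]) simp
  have Ld: "cmod (d l t x - d l t y) \<le> K * \<bar>x - y\<bar>" if "l \<le> 3" "t \<in> ?I" "x \<in> ?J" "y \<in> ?J" for l t x y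
    unfolding d_def by (rule sob_rep_lipschitz[OF rA[OF that(1,2)] _ that(3,4)]) simp
  have Vc: "continuous_on ?J V"
    using V_C1 by (meson DERIV_continuous continuous_on_eq_continuous_within)
  have cd: "continuous_on ?J (d l t)" if "l \<le> 3" "t \<in> ?I" for l t
    using sob_rep_continuous[OF rA[OF that], of 0] unfolding d_def by simp
  have pde_pos: "\<i> * d 1 t x = - (1/2) * P t 2 x
        + (of_real (V x) * \<psi> t x + of_real (\<beta> * (cmod (\<psi> t x))\<^sup>2) * \<psi> t x)" if t: "0 < t" "t \<le> T" and x: "x \<in> ?J" for t x
  proof (rule nls_pointwise[OF sol t T(2) ab Vc])
    have tI: "t \<in> ?I" using t by simp
    show "is_weak_deriv {a<..<b} 2 (\<psi> t) (P t 2)" by (rule sob_rep_weak[OF rP[OF tI]]) simp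
    show "continuous_on ?J (P t 2)" by (rule sob_rep_continuous[OF rP[OF tI]]) simp
    show "continuous_on ?J (d 1 t)" using cd[of 1 t] tI by simp
    fix \<phi> assume \<phi>: "test_function {a<..<b} \<phi>"
    show "((\<lambda>s. LINT x|lebesgue_on {a<..<b}. \<psi> s x * \<phi> x) has_vector_derivative
       (LINT x|lebesgue_on {a<..<b}. d 1 t x * \<phi> x)) (at t within ?I)"
    proof (rule has_vector_derivative_pairing[where d = "d 1", OF der0 _ \<psi>(1) cd \<phi> ab tI K(1)])
      fix s r x assume srx: "s \<in> ?I" "r \<in> ?I" "x \<in> ?J"
      show "cmod (d 1 s x - d 1 r x) \<le> K * \<bar>s - r\<bar>"
      proof (rule vector_derivative_bound[where S = ?I])
        show "((\<lambda>s. d 1 s x) has_vector_derivative d 2 q x) (at q within ?I)" if "q \<in> ?I" for q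
          using der[of 1 q x] that srx by (simp add: numeral_2_eq_2)
        show "cmod (d 2 q x) \<le> K" if "q \<in> ?I" for q using bd[of 2 q x] that srx by simp
      qed (use srx in auto)
    qed auto
  qed (rule x)
  have tc: "((\<lambda>s. f s x) \<longlongrightarrow> f t x) (at t within ?I)" if "((\<lambda>s. f s x) has_vector_derivative D) (at t within ?I)" for f :: "real \<Rightarrow> real \<Rightarrow> complex" and D t x
    using has_vector_derivative_continuous[OF that] by (simp add: continuous_within)
  have derP2: "((\<lambda>s. P s 2 x) has_vector_derivative B 1 t 2 x) (at t within ?I)" if "t \<in> ?I" "x \<in> ?J" for t x
    using has_vector_derivative_transform[OF that(1) _ B(4)[of 0 2 t x], of "\<lambda>s. P s 2 x"] B2 that by simp
  have pde: "\<i> * d 1 t x = - (1/2) * P t 2 x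
        + (of_real (V x) * \<psi> t x + of_real (\<beta> * (cmod (\<psi> t x))\<^sup>2) * \<psi> t x)" if t: "t \<in> ?I" and x: "x \<in> ?J" for t x
  proof (cases "t = 0")
    case False
    then show ?thesis using pde_pos t x by simp
  next
    case True
    \<comment> \<open>The notion of solution says nothing at t = 0; there the equation follows by
      continuity in time, which for \<psi>_xx comes from the middle hypothesis.\<close>
    let ?R = "\<lambda>s. \<i> * d 1 s x - (- (1/2) * P s 2 x
        + (of_real (V x) * \<psi> s x + of_real (\<beta> * (cmod (\<psi> s x))\<^sup>2) * \<psi> s x))"
    have "(?R \<longlongrightarrow> ?R t) (at t within ?I)"
      by (intro tendsto_intros tc[of "d 1", OF der] tc[of "\<lambda>s. P s 2", OF derP2] tc[of \<psi>, OF der0]) (use t x in auto)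
    moreover have "(?R \<longlongrightarrow> 0) (at t within ?I)"
    proof (rule Lim_transform_eventually[OF tendsto_const])
      show "\<forall>\<^sub>F s in at t within ?I. 0 = ?R s"
        unfolding eventually_at_filter using pde_pos[OF _ _ x] True by (intro always_eventually) auto
    qed
    ultimately have "?R t = 0" using tendsto_unique[OF nb[OF t]] by blast
    then show ?thesis by simp
  qed
  have bdry: "P t 4 e = 4 * of_real (V' e) * P t 1 e" if t: "t \<in> ?I" and e: "e \<in> {a, b}" for t e
  proof -
    have eJ: "e \<in> ?J" using e ab by auto
    have \<psi>e: "\<psi> s e = 0" if "s \<in> ?I" for s using \<psi>(2,3)[OF that] e by auto
    have d1e: "d 1 s e = 0" if "s \<in> ?I" for s
    proof (rule vector_derivative_unique_within[OF nb[OF that] der0[OF that eJ]])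
      show "((\<lambda>s. \<psi> s e) has_vector_derivative 0) (at s within ?I)"
        using has_vector_derivative_transform[OF that _ has_vector_derivative_const, of "\<lambda>s. \<psi> s e" 0] \<psi>e by simp
    qed
    have P2e: "P s 2 e = 0" if "s \<in> ?I" for s
      using pde[OF that eJ] d1e[OF that] \<psi>e[OF that] by simp
    \<comment> \<open>\<psi>_xx vanishes at e for all times, hence so does its time derivative. This
      removes the quadratic term of \<psi>_t at e.\<close>
    have B2e: "B 1 t 2 e = 0"
    proof (rule vector_derivative_unique_within[OF nb[OF t] derP2[OF t eJ]])
      show "((\<lambda>s. P s 2 e) has_vector_derivative 0) (at t within ?I)"
        using has_vector_derivative_transform[OF t _ has_vector_derivative_const, of "\<lambda>s. P s 2 e" 0] P2e by simp
    qed
    have rB1: "sob_rep a b 3 (B 1 t) K (DB 1 t)" using rB[of 1 t] t by simp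
    show ?thesis
    proof (rule endpoint_fourth_derivative[where q = "P t" and g = "B 1 t" and J = ?J and K = K and V = V and \<beta> = \<beta>, OF refl ab eJ])
      show "(P t j has_vector_derivative P t (Suc j) x) (at x within ?J)" if "j < 4" "x \<in> ?J" for j x
        by (rule sob_rep_deriv[OF rP[OF t]]) (use that in auto)
      show "cmod (P t 4 x - P t 4 y) \<le> K * \<bar>x - y\<bar>" if "x \<in> ?J" "y \<in> ?J" for x y
        by (rule sob_rep_lipschitz[OF rP[OF t] _ that]) simp
      show "cmod (P t j x) \<le> K" if "j \<le> 4" "x \<in> ?J" for j x
        by (rule sob_rep_bound[OF rP[OF t]]) (use that in auto)
      show "P t 0 e = 0" using P0[OF t eJ] \<psi>e[OF t] by simp
      show "P t 2 e = 0" by (rule P2e[OF t])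
      show "(B 1 t j has_vector_derivative B 1 t (Suc j) x) (at x within ?J)" if "j < 2" "x \<in> ?J" for j x
        by (rule sob_rep_deriv[OF rB1]) (use that in auto)
      show "cmod (B 1 t 2 x - B 1 t 2 y) \<le> K * \<bar>x - y\<bar>" if "x \<in> ?J" "y \<in> ?J" for x y
        by (rule sob_rep_lipschitz[OF rB1 _ that]) simp
      show "B 1 t 0 e = 0" using B1[OF t eJ] d1e[OF t] by simp
      show "B 1 t 2 e = 0" by (rule B2e)
      show "(V has_real_derivative V' x) (at x within ?J)" if "x \<in> ?J" for x using V_C1 that by blast
      show "\<i> * B 1 t 0 x = - (1 / 2) * P t 2 x + (of_real (V x) * P t 0 x + of_real (\<beta> * (cmod (P t 0 x))\<^sup>2) * P t 0 x)" if "x \<in> ?J" for x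
        using pde[OF t that] B1[OF t that] P0[OF t that] by simp
    qed
  qed
  show thesis
    by (rule that[of K P d]) (use K(1) rP P0 d0 der bd Ld pde bdry in \<open>simp_all del: One_nat_def\<close>)
qed

section \<open>Stability, conservation laws and solvability of the scheme\<close>

lemma grid_l2_norm_L2_set: "0 \<le> h \<Longrightarrow> grid_l2_norm h M v = sqrt h * L2_set (\<lambda>j. cmod (v j)) {..<M}"
  by (simp add: grid_l2_norm_def L2_set_def real_sqrt_mult)

lemma grid_l2_norm_sq: "0 \<le> h \<Longrightarrow> (grid_l2_norm h M v)\<^sup>2 = h * (\<Sum>j<M. (cmod (v j))\<^sup>2)"
  by (simp add: grid_l2_norm_def sum_nonneg)

lemma grid_l2_norm_nonneg: "0 \<le> h \<Longrightarrow> 0 \<le> grid_l2_norm h M v"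
  by (simp add: grid_l2_norm_def sum_nonneg)

lemma grid_l2_norm_triangle:
  "0 \<le> h \<Longrightarrow> grid_l2_norm h M (\<lambda>j. f j + g j) \<le> grid_l2_norm h M f + grid_l2_norm h M g"
proof -
  assume h: "0 \<le> h"
  have "L2_set (\<lambda>j. cmod (f j + g j)) {..<M} \<le> L2_set (\<lambda>j. cmod (f j) + cmod (g j)) {..<M}"
    by (intro L2_set_mono norm_triangle_ineq) auto
  also have "\<dots> \<le> L2_set (\<lambda>j. cmod (f j)) {..<M} + L2_set (\<lambda>j. cmod (g j)) {..<M}"
    by (rule L2_set_triangle_ineq)
  finally show ?thesis using h by (simp add: grid_l2_norm_L2_set mult_left_mono flip: distrib_left)
qed

lemma grid_l2_norm_mono:
  assumes "0 \<le> h" "\<And>j. j < M \<Longrightarrow> cmod (f j) \<le> cmod (g j)"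
  shows "grid_l2_norm h M f \<le> grid_l2_norm h M g"
  using assms by (auto simp: grid_l2_norm_L2_set intro!: mult_left_mono L2_set_mono)

lemma grid_l2_norm_scale:
  assumes "0 \<le> h"
  shows "grid_l2_norm h M (\<lambda>j. c * f j) = cmod c * grid_l2_norm h M f"
proof -
  have "(\<Sum>j<M. (cmod (c * f j))\<^sup>2) = (cmod c)\<^sup>2 * (\<Sum>j<M. (cmod (f j))\<^sup>2)"
    by (simp add: norm_mult power_mult_distrib sum_distrib_left)
  then show ?thesis
    by (simp add: grid_l2_norm_def real_sqrt_mult real_sqrt_abs2 mult.left_commute)
qed

lemma grid_l2_norm_le_sup:
  assumes "0 \<le> h" "0 \<le> B" "\<And>j. j < M \<Longrightarrow> cmod (f j) \<le> B"
  shows "grid_l2_norm h M f \<le> sqrt (h * real M) * B"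
proof -
  have "(\<Sum>j<M. (cmod (f j))\<^sup>2) \<le> (\<Sum>j<M. B\<^sup>2)"
    by (intro sum_mono power_mono assms) auto
  then have "h * (\<Sum>j<M. (cmod (f j))\<^sup>2) \<le> (h * real M) * B\<^sup>2"
    using assms(1) by (simp add: mult_left_mono mult.assoc)
  then have "grid_l2_norm h M f \<le> sqrt ((h * real M) * B\<^sup>2)"
    unfolding grid_l2_norm_def by simp
  then show ?thesis using assms(2) by (simp add: real_sqrt_mult)
qed

lemma grid_cauchy_schwarz:
  assumes h: "0 \<le> h"
  shows "h * (\<Sum>j<M. cmod (f j) * cmod (g j)) \<le> grid_l2_norm h M f * grid_l2_norm h M g"
proof -
  have "(\<Sum>j<M. \<bar>cmod (f j)\<bar> * \<bar>cmod (g j)\<bar>) \<le> L2_set (\<lambda>j. cmod (f j)) {..<M} * L2_set (\<lambda>j. cmod (g j)) {..<M}"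
    by (rule L2_set_mult_ineq)
  then have "h * (\<Sum>j<M. cmod (f j) * cmod (g j)) \<le> h * (L2_set (\<lambda>j. cmod (f j)) {..<M} * L2_set (\<lambda>j. cmod (g j)) {..<M})"
    using h by (intro mult_left_mono) auto
  also have "\<dots> = (sqrt h * sqrt h) * (L2_set (\<lambda>j. cmod (f j)) {..<M} * L2_set (\<lambda>j. cmod (g j)) {..<M})"
    using h by simp
  finally show ?thesis using h by (simp only: grid_l2_norm_L2_set mult_ac)
qed

text \<open>The boundary terms stay in the statement because the partial sums of the induction end
  at an interior node.\<close>

lemma summation_by_parts_aux:
  fixes F G :: "nat \<Rightarrow> complex"
  shows "(\<Sum>j\<in>{1..<Suc m}. F j * (G (j + 1) - 2 * G j + G (j - 1))) + (\<Sum>j<Suc m. (F (Suc j) - F j) * (G (Suc j) - G j))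
     = F (Suc m) * (G (Suc m) - G m) - F 0 * (G 1 - G 0)"
proof (induction m)
  case 0
  show ?case by (simp add: algebra_simps)
next
  case (Suc m)
  have "(\<Sum>j\<in>{1..<Suc (Suc m)}. F j * (G (j + 1) - 2 * G j + G (j - 1))) + (\<Sum>j<Suc (Suc m). (F (Suc j) - F j) * (G (Suc j) - G j))
    = ((\<Sum>j\<in>{1..<Suc m}. F j * (G (j + 1) - 2 * G j + G (j - 1))) + (\<Sum>j<Suc m. (F (Suc j) - F j) * (G (Suc j) - G j)))
      + F (Suc m) * (G (Suc (Suc m)) - 2 * G (Suc m) + G m) + (F (Suc (Suc m)) - F (Suc m)) * (G (Suc (Suc m)) - G (Suc m))"
    by simp
  also have "\<dots> = F (Suc (Suc m)) * (G (Suc (Suc m)) - G (Suc m)) - F 0 * (G 1 - G 0)"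
    unfolding Suc.IH by (simp add: algebra_simps)
  finally show ?case .
qed

lemma summation_by_parts:
  fixes F G :: "nat \<Rightarrow> complex"
  assumes "F 0 = 0" "F M = 0" "0 < M"
  shows "(\<Sum>j\<in>{1..<M}. F j * (G (j + 1) - 2 * G j + G (j - 1))) = - (\<Sum>j<M. (F (Suc j) - F j) * (G (Suc j) - G j))"
proof -
  obtain m where "M = Suc m" using assms(3) gr0_implies_Suc by blast
  then show ?thesis
    using summation_by_parts_aux[of F G m] assms(1,2) by (simp only: eq_neg_iff_add_eq_0 mult_zero_left diff_0_right)
qed

section \<open>Stability of linear Crank-Nicolson steps\<close>

definition zero_bdry :: "nat \<Rightarrow> (nat \<Rightarrow> complex) \<Rightarrow> bool" where
  "zero_bdry M f \<longleftrightarrow> f 0 = 0 \<and> f M = 0"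

text \<open>Everything except the discrete Laplacian goes into the source g. The same relation then
  describes the scheme, the sampled exact solution with its residual, the iterates of the solver,
  and differences of any of these.\<close>

definition cn_step :: "real \<Rightarrow> real \<Rightarrow> nat \<Rightarrow> (nat \<Rightarrow> complex) \<Rightarrow> (nat \<Rightarrow> complex) \<Rightarrow> (nat \<Rightarrow> complex) \<Rightarrow> bool" where
  "cn_step h \<tau> M e e' g \<longleftrightarrow>
     (\<forall>j\<in>{1..<M}. \<i> * ((e' j - e j) / of_real \<tau>) = - (1/2) * dx2 h (\<lambda>k. (e' k + e k) / 2) j + g j)"

text \<open>The flag selects the L^2 norm or the H^1 seminorm, so that stability, Lipschitz and
  error estimates are proved once for both.\<close>

definition grid_norm :: "real \<Rightarrow> nat \<Rightarrow> bool \<Rightarrow> (nat \<Rightarrow> complex) \<Rightarrow> real" where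
  "grid_norm h M s f = (if s then grid_l2_norm h M (dx_plus h f) else grid_l2_norm h M f)"

lemma grid_norm_simps [simp]:
  "grid_norm h M True f = grid_l2_norm h M (dx_plus h f)" "grid_norm h M False f = grid_l2_norm h M f"
  by (simp_all add: grid_norm_def)

text \<open>The left side of the identity is half the difference of the squared norms up to the
  factor h. Cauchy-Schwarz bounds the right side by the norm of g times the mean of the two norms,
  and their sum cancels. Grid functions and difference quotients are treated alike.\<close>

lemma norm_step_of_identity:
  assumes h: "0 < h" and \<tau>: "0 < \<tau>"
    and id: "Re (\<Sum>j<M. (a' j - a j) * cnj ((a' j + a j) / 2)) = \<tau> * Im (\<Sum>j<M. g j * cnj ((a' j + a j) / 2))"
  shows "grid_l2_norm h M a' \<le> grid_l2_norm h M a + \<tau> * grid_l2_norm h M g"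
proof -
  let ?n = "grid_l2_norm h M"
  let ?w = "\<lambda>j. (a' j + a j) / 2"
  have n0: "0 \<le> ?n f" for f using h by (simp add: grid_l2_norm_nonneg)
  have "Re ((a' j - a j) * cnj (?w j)) = ((cmod (a' j))\<^sup>2 - (cmod (a j))\<^sup>2) / 2" for j
    unfolding cmod_power2 by (simp add: power2_eq_square field_simps)
  then have R: "Re (\<Sum>j<M. (a' j - a j) * cnj (?w j)) = ((\<Sum>j<M. (cmod (a' j))\<^sup>2) - (\<Sum>j<M. (cmod (a j))\<^sup>2)) / 2"
    by (simp only: Re_sum sum_subtractf sum_divide_distrib[symmetric])
  have "(?n a')\<^sup>2 - (?n a)\<^sup>2 = 2 * (h * Re (\<Sum>j<M. (a' j - a j) * cnj (?w j)))"
    unfolding R using h by (simp add: grid_l2_norm_sq algebra_simps)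
  also have "\<dots> = 2 * \<tau> * (h * Im (\<Sum>j<M. g j * cnj (?w j)))"
    unfolding id by simp
  also have "h * Im (\<Sum>j<M. g j * cnj (?w j)) \<le> ?n g * ?n ?w"
  proof -
    have "Im (\<Sum>j<M. g j * cnj (?w j)) \<le> cmod (\<Sum>j<M. g j * cnj (?w j))"
      using abs_Im_le_cmod abs_le_iff by blast
    also have "\<dots> \<le> (\<Sum>j<M. cmod (g j * cnj (?w j)))" by (rule norm_sum)
    also have "\<dots> = (\<Sum>j<M. cmod (g j) * cmod (?w j))" by (simp only: norm_mult complex_mod_cnj)
    finally have "h * Im (\<Sum>j<M. g j * cnj (?w j)) \<le> h * (\<Sum>j<M. cmod (g j) * cmod (?w j))"
      using h by (intro mult_left_mono) auto
    also have "\<dots> \<le> ?n g * ?n ?w" using h by (intro grid_cauchy_schwarz) simp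
    finally show ?thesis .
  qed
  also have "?n ?w \<le> (?n a' + ?n a) / 2"
  proof -
    have "?n ?w = ?n (\<lambda>j. (1/2) * (a' j + a j))" by simp
    also have "\<dots> = (1/2) * ?n (\<lambda>j. a' j + a j)"
      using h by (subst grid_l2_norm_scale) auto
    also have "\<dots> \<le> (1/2) * (?n a' + ?n a)"
      using h by (intro mult_left_mono grid_l2_norm_triangle) auto
    finally show ?thesis by simp
  qed
  finally have "(?n a')\<^sup>2 - (?n a)\<^sup>2 \<le> 2 * \<tau> * (?n g * ((?n a' + ?n a) / 2))"
    using \<tau> n0 by (simp add: mult_left_mono)
  then have le: "(?n a' - ?n a) * (?n a' + ?n a) \<le> (\<tau> * ?n g) * (?n a' + ?n a)"
    by (simp add: power2_eq_square algebra_simps)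
  show ?thesis
  proof (cases "?n a' + ?n a = 0")
    case True
    then have "?n a' = 0" using n0[of a] n0[of a'] by linarith
    then show ?thesis using n0 \<tau> by simp
  next
    case False
    then have "0 < ?n a' + ?n a" using n0[of a] n0[of a'] by linarith
    with le have "?n a' - ?n a \<le> \<tau> * ?n g" by (rule mult_right_le_imp_le)
    then show ?thesis by simp
  qed
qed

lemma sum_interior:
  fixes f :: "nat \<Rightarrow> 'a::comm_monoid_add"
  assumes "f 0 = 0" "0 < M"
  shows "(\<Sum>j<M. f j) = (\<Sum>j\<in>{1..<M}. f j)"
  using assms by (simp add: lessThan_atLeast0 sum.atLeast_Suc_lessThan)

lemma i_divide_eqD: "\<i> * (x / t) = y \<Longrightarrow> t \<noteq> 0 \<Longrightarrow> x = - \<i> * t * y"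
  by (auto simp: mult.assoc)

text \<open>Multiply by the conjugate midpoint value and sum by parts: the Laplacian contributes i
  times a real number, which the real part removes.\<close>

lemma cn_step_identity_L2:
  assumes h: "0 < h" and \<tau>: "0 < \<tau>" and M: "0 < M"
    and st: "cn_step h \<tau> M e e' g" and z: "zero_bdry M e" "zero_bdry M e'" "zero_bdry M g"
  shows "Re (\<Sum>j<M. (e' j - e j) * cnj ((e' j + e j) / 2)) = \<tau> * Im (\<Sum>j<M. g j * cnj ((e' j + e j) / 2))"
proof -
  let ?w = "\<lambda>j. (e' j + e j) / 2"
  have eq: "(e' j - e j) * cnj (?w j) = - \<i> * of_real \<tau> * (g j * cnj (?w j))
      + \<i> * of_real (\<tau> / (2 * h\<^sup>2)) * (cnj (?w j) * (?w (j + 1) - 2 * ?w j + ?w (j - 1)))" if "j \<in> {1..<M}" for j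
  proof -
    have "\<i> * ((e' j - e j) / of_real \<tau>) = - (1/2) * dx2 h ?w j + g j"
      using st that unfolding cn_step_def by blast
    then have "e' j - e j = - \<i> * of_real \<tau> * (- (1/2) * dx2 h ?w j + g j)"
      by (rule i_divide_eqD) (use \<tau> in simp)
    also have "dx2 h ?w j = (?w (j + 1) - 2 * ?w j + ?w (j - 1)) / of_real (h\<^sup>2)" unfolding dx2_def ..
    finally have 1: "e' j - e j = - \<i> * of_real \<tau> * (- (1/2) * ((?w (j + 1) - 2 * ?w j + ?w (j - 1)) / of_real (h\<^sup>2)) + g j)" .
    obtain D where D: "?w (j + 1) - 2 * ?w j + ?w (j - 1) = D" by blast
    obtain c where c: "cnj (?w j) = c" by blast
    show ?thesis unfolding 1 D c using h by (simp add: field_simps)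
  qed
  have "(\<Sum>j<M. (e' j - e j) * cnj (?w j)) = (\<Sum>j\<in>{1..<M}. (e' j - e j) * cnj (?w j))"
    by (rule sum_interior) (use z M in \<open>auto simp: zero_bdry_def\<close>)
  also have "\<dots> = - \<i> * of_real \<tau> * (\<Sum>j\<in>{1..<M}. g j * cnj (?w j))
      + \<i> * of_real (\<tau> / (2 * h\<^sup>2)) * (\<Sum>j\<in>{1..<M}. cnj (?w j) * (?w (j + 1) - 2 * ?w j + ?w (j - 1)))"
    by (simp only: sum.cong[OF refl eq] sum.distrib sum_distrib_left)
  also have "(\<Sum>j\<in>{1..<M}. g j * cnj (?w j)) = (\<Sum>j<M. g j * cnj (?w j))"
    by (rule sum_interior[symmetric]) (use z M in \<open>auto simp: zero_bdry_def\<close>)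
  also have "(\<Sum>j\<in>{1..<M}. cnj (?w j) * (?w (j + 1) - 2 * ?w j + ?w (j - 1)))
     = - (\<Sum>j<M. (cnj (?w (Suc j)) - cnj (?w j)) * (?w (Suc j) - ?w j))"
    by (rule summation_by_parts) (use z M in \<open>auto simp: zero_bdry_def\<close>)
  also have "\<dots> = - of_real (\<Sum>j<M. (cmod (?w (Suc j) - ?w j))\<^sup>2)"
    by (simp only: complex_cnj_diff[symmetric] mult.commute[of "cnj _"] complex_norm_square[symmetric] of_real_sum)
  finally have "Re (\<Sum>j<M. (e' j - e j) * cnj (?w j)) = Re (- \<i> * of_real \<tau> * (\<Sum>j<M. g j * cnj (?w j)))"
    by (simp only: plus_complex.sel) simp
  then show ?thesis by simp
qed

text \<open>Now the multiplier is the conjugate second difference of the midpoint, against which the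
  Laplacian contributes i times a square. Moving one difference from the multiplier onto g is where
  g has to vanish at both ends.\<close>

lemma cn_step_identity_H1:
  assumes h: "0 < h" and \<tau>: "0 < \<tau>" and M: "0 < M"
    and st: "cn_step h \<tau> M e e' g" and z: "zero_bdry M e" "zero_bdry M e'" "zero_bdry M g"
  shows "Re (\<Sum>j<M. (dx_plus h e' j - dx_plus h e j) * cnj ((dx_plus h e' j + dx_plus h e j) / 2))
     = \<tau> * Im (\<Sum>j<M. dx_plus h g j * cnj ((dx_plus h e' j + dx_plus h e j) / 2))"
proof -
  let ?w = "\<lambda>j. (e' j + e j) / 2"
  let ?D = "\<lambda>j. ?w (j + 1) - 2 * ?w j + ?w (j - 1)"
  have sbp: "(\<Sum>j\<in>{1..<M}. f j * cnj (?D j)) = - of_real (h\<^sup>2) * (\<Sum>j<M. dx_plus h f j * cnj ((dx_plus h e' j + dx_plus h e j) / 2))"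
    if f: "zero_bdry M f" for f
  proof -
    have "(\<Sum>j\<in>{1..<M}. f j * (cnj (?w (j + 1)) - 2 * cnj (?w j) + cnj (?w (j - 1))))
       = - (\<Sum>j<M. (f (Suc j) - f j) * (cnj (?w (Suc j)) - cnj (?w j)))"
      by (rule summation_by_parts) (use f M in \<open>auto simp: zero_bdry_def\<close>)
    also have "\<dots> = - of_real (h\<^sup>2) * (\<Sum>j<M. dx_plus h f j * cnj ((dx_plus h e' j + dx_plus h e j) / 2))"
      unfolding sum_distrib_left sum_negf[symmetric]
      by (rule sum.cong) (use h in \<open>auto simp: dx_plus_def field_simps power2_eq_square\<close>)
    finally show ?thesis by simp
  qed
  have eq: "(e' j - e j) * cnj (?D j) = - \<i> * of_real \<tau> * (g j * cnj (?D j))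
      + \<i> * of_real (\<tau> / (2 * h\<^sup>2) * (cmod (?D j))\<^sup>2)" if "j \<in> {1..<M}" for j
  proof -
    have "\<i> * ((e' j - e j) / of_real \<tau>) = - (1/2) * dx2 h ?w j + g j"
      using st that unfolding cn_step_def by blast
    then have "e' j - e j = - \<i> * of_real \<tau> * (- (1/2) * dx2 h ?w j + g j)"
      by (rule i_divide_eqD) (use \<tau> in simp)
    also have "dx2 h ?w j = ?D j / of_real (h\<^sup>2)" unfolding dx2_def ..
    finally have 1: "e' j - e j = - \<i> * of_real \<tau> * (- (1/2) * (?D j / of_real (h\<^sup>2)) + g j)" .
    obtain D where D: "?D j = D" by blast
    show ?thesis unfolding 1 D of_real_mult complex_norm_square
      using h by (simp add: field_simps)
  qed
  have "- of_real (h\<^sup>2) * (\<Sum>j<M. dx_plus h (\<lambda>j. e' j - e j) j * cnj ((dx_plus h e' j + dx_plus h e j) / 2)) = (\<Sum>j\<in>{1..<M}. (e' j - e j) * cnj (?D j))"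
    by (rule sbp[symmetric]) (use z in \<open>auto simp: zero_bdry_def\<close>)
  also have "\<dots> = - \<i> * of_real \<tau> * (\<Sum>j\<in>{1..<M}. g j * cnj (?D j)) + \<i> * of_real (\<Sum>j\<in>{1..<M}. \<tau> / (2 * h\<^sup>2) * (cmod (?D j))\<^sup>2)"
    by (simp only: sum.cong[OF refl eq] sum.distrib sum_distrib_left of_real_sum)
  also have "(\<Sum>j\<in>{1..<M}. g j * cnj (?D j)) = - of_real (h\<^sup>2) * (\<Sum>j<M. dx_plus h g j * cnj ((dx_plus h e' j + dx_plus h e j) / 2))"
    by (rule sbp[OF z(3)])
  finally have "Re (- of_real (h\<^sup>2) * (\<Sum>j<M. dx_plus h (\<lambda>j. e' j - e j) j * cnj ((dx_plus h e' j + dx_plus h e j) / 2)))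
     = Re (- \<i> * of_real \<tau> * (- of_real (h\<^sup>2) * (\<Sum>j<M. dx_plus h g j * cnj ((dx_plus h e' j + dx_plus h e j) / 2))))"
    by (simp only: plus_complex.sel) simp
  then have "h\<^sup>2 * Re (\<Sum>j<M. dx_plus h (\<lambda>j. e' j - e j) j * cnj ((dx_plus h e' j + dx_plus h e j) / 2))
     = h\<^sup>2 * (\<tau> * Im (\<Sum>j<M. dx_plus h g j * cnj ((dx_plus h e' j + dx_plus h e j) / 2)))"
    by (simp flip: of_real_power)
  then have "Re (\<Sum>j<M. dx_plus h (\<lambda>j. e' j - e j) j * cnj ((dx_plus h e' j + dx_plus h e j) / 2))
     = \<tau> * Im (\<Sum>j<M. dx_plus h g j * cnj ((dx_plus h e' j + dx_plus h e j) / 2))"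
    using h by simp
  moreover have "dx_plus h (\<lambda>j. e' j - e j) j = dx_plus h e' j - dx_plus h e j" for j
    by (simp add: dx_plus_def diff_divide_distrib)
  ultimately show ?thesis by simp
qed

lemma cn_step_stable:
  assumes "0 < h" "0 < \<tau>" "0 < M" "cn_step h \<tau> M e e' g" "zero_bdry M e" "zero_bdry M e'" "zero_bdry M g"
  shows "grid_norm h M s e' \<le> grid_norm h M s e + \<tau> * grid_norm h M s g"
  using norm_step_of_identity[OF assms(1,2) cn_step_identity_L2[OF assms]]
    norm_step_of_identity[OF assms(1,2) cn_step_identity_H1[OF assms]]
  by (cases s) auto

section \<open>Discrete Sobolev inequalities and products\<close>

lemma dx_plus_add: "dx_plus h (\<lambda>j. f j + g j) = (\<lambda>j. dx_plus h f j + dx_plus h g j)"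
  by (auto simp: dx_plus_def add_divide_distrib diff_divide_distrib)

lemma dx_plus_scale: "dx_plus h (\<lambda>j. c * f j) = (\<lambda>j. c * dx_plus h f j)"
  by (auto simp: dx_plus_def right_diff_distrib)

lemma grid_norm_nonneg: "0 \<le> h \<Longrightarrow> 0 \<le> grid_norm h M s f"
  by (simp add: grid_norm_def grid_l2_norm_nonneg)

lemma grid_norm_triangle: "0 \<le> h \<Longrightarrow> grid_norm h M s (\<lambda>j. f j + g j) \<le> grid_norm h M s f + grid_norm h M s g"
  by (simp add: grid_norm_def dx_plus_add grid_l2_norm_triangle)

lemma grid_norm_scale: "0 \<le> h \<Longrightarrow> grid_norm h M s (\<lambda>j. c * f j) = cmod c * grid_norm h M s f"
  by (simp add: grid_norm_def dx_plus_scale grid_l2_norm_scale)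

lemma grid_norm_zero [simp]: "grid_norm h M s (\<lambda>j. 0) = 0"
  by (simp add: grid_norm_def grid_l2_norm_def dx_plus_def)

lemma grid_norm_cong:
  assumes "\<And>j. j \<le> M \<Longrightarrow> f j = g j"
  shows "grid_norm h M s f = grid_norm h M s g"
proof -
  have "(\<Sum>j<M. (cmod (dx_plus h f j))\<^sup>2) = (\<Sum>j<M. (cmod (dx_plus h g j))\<^sup>2)"
    by (rule sum.cong) (use assms in \<open>auto simp: dx_plus_def\<close>)
  moreover have "(\<Sum>j<M. (cmod (f j))\<^sup>2) = (\<Sum>j<M. (cmod (g j))\<^sup>2)"
    by (rule sum.cong) (use assms in auto)
  ultimately show ?thesis by (simp add: grid_norm_def grid_l2_norm_def)
qed

lemma grid_norm_cnj: "0 \<le> h \<Longrightarrow> grid_norm h M s (\<lambda>j. cnj (f j)) = grid_norm h M s f"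
proof -
  assume h: "0 \<le> h"
  have "dx_plus h (\<lambda>j. cnj (f j)) j = cnj (dx_plus h f j)" for j by (simp add: dx_plus_def)
  then show ?thesis by (simp add: grid_norm_def grid_l2_norm_def)
qed

lemma zero_bdry_intros:
  "zero_bdry M f \<Longrightarrow> zero_bdry M g \<Longrightarrow> zero_bdry M (\<lambda>j. f j + g j)"
  "zero_bdry M f \<Longrightarrow> zero_bdry M g \<Longrightarrow> zero_bdry M (\<lambda>j. f j - g j)"
  "zero_bdry M g \<Longrightarrow> zero_bdry M (\<lambda>j. p j * g j)"
  "zero_bdry M f \<Longrightarrow> zero_bdry M (\<lambda>j. cnj (f j))"
  "zero_bdry M f \<Longrightarrow> zero_bdry M (\<lambda>j. f j / c)"
  "zero_bdry M (\<lambda>j. 0)"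
  by (auto simp: zero_bdry_def)

text \<open>Telescoping from the left end and Cauchy-Schwarz against the constant 1, whose norm is
  the square root of the interval length h M.\<close>

lemma grid_sup_bound:
  assumes h: "0 < h" and z: "f 0 = 0" and j: "j \<le> M"
  shows "cmod (f j) \<le> sqrt (h * real M) * grid_norm h M True f"
proof -
  have "f j = (\<Sum>k<j. f (Suc k) - f k)" using z by (simp add: sum_lessThan_telescope)
  also have "cmod \<dots> \<le> (\<Sum>k<j. cmod (f (Suc k) - f k))" by (rule norm_sum)
  also have "\<dots> \<le> (\<Sum>k<M. cmod (f (Suc k) - f k))" using j by (intro sum_mono2) auto
  also have "\<dots> = h * (\<Sum>k<M. cmod (dx_plus h f k) * cmod (1::complex))"
    unfolding sum_distrib_left by (rule sum.cong) (use h in \<open>auto simp: dx_plus_def norm_divide\<close>)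
  also have "\<dots> \<le> grid_l2_norm h M (dx_plus h f) * grid_l2_norm h M (\<lambda>_. 1)"
    using h by (intro grid_cauchy_schwarz) simp
  also have "grid_l2_norm h M (\<lambda>_. 1) = sqrt (h * real M)" by (simp add: grid_l2_norm_def)
  finally show ?thesis by (simp add: mult.commute)
qed

text \<open>The square-root form of the discrete Gagliardo-Nirenberg inequality is what makes the energy
  coercive for either sign of \<open>\<beta>\<close>.\<close>

lemma grid_gagliardo_nirenberg:
  assumes h: "0 < h" and z: "zero_bdry M f" and j: "j \<le> M"
  shows "(cmod (f j))\<^sup>2 \<le> 2 * grid_norm h M True f * grid_norm h M False f"
proof -
  have "(cmod (f j))\<^sup>2 = (\<Sum>k<j. (cmod (f (Suc k)))\<^sup>2 - (cmod (f k))\<^sup>2)"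
    using z sum_lessThan_telescope[of "\<lambda>k. (cmod (f k))\<^sup>2" j] by (simp add: zero_bdry_def)
  also have "\<dots> \<le> (\<Sum>k<j. cmod (f (Suc k) - f k) * cmod (f (Suc k)) + cmod (f (Suc k) - f k) * cmod (f k))"
  proof (rule sum_mono)
    fix k
    have "(cmod (f (Suc k)))\<^sup>2 - (cmod (f k))\<^sup>2 = (cmod (f (Suc k)) - cmod (f k)) * (cmod (f (Suc k)) + cmod (f k))"
      by (simp add: power2_eq_square algebra_simps)
    also have "\<dots> \<le> cmod (f (Suc k) - f k) * (cmod (f (Suc k)) + cmod (f k))"
      by (intro mult_right_mono norm_triangle_ineq2) auto
    finally show "(cmod (f (Suc k)))\<^sup>2 - (cmod (f k))\<^sup>2 \<le> cmod (f (Suc k) - f k) * cmod (f (Suc k)) + cmod (f (Suc k) - f k) * cmod (f k)"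
      by (simp add: distrib_left)
  qed
  also have "\<dots> \<le> (\<Sum>k<M. cmod (f (Suc k) - f k) * cmod (f (Suc k)) + cmod (f (Suc k) - f k) * cmod (f k))"
    using j by (intro sum_mono2) auto
  also have "\<dots> = h * (\<Sum>k<M. cmod (dx_plus h f k) * cmod (f (Suc k))) + h * (\<Sum>k<M. cmod (dx_plus h f k) * cmod (f k))"
    unfolding sum_distrib_left sum.distrib[symmetric]
    by (rule sum.cong) (use h in \<open>auto simp: dx_plus_def norm_divide\<close>)
  also have "\<dots> \<le> grid_l2_norm h M (dx_plus h f) * grid_l2_norm h M (\<lambda>k. f (Suc k)) + grid_l2_norm h M (dx_plus h f) * grid_l2_norm h M f"
    using h by (intro add_mono grid_cauchy_schwarz) auto
  \<comment> \<open>The index shift exchanges the value at node 0 for the one at node M, and both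
    are zero.\<close>
  also have "grid_l2_norm h M (\<lambda>k. f (Suc k)) = grid_l2_norm h M f"
  proof -
    have "(\<Sum>k<M. (cmod (f (Suc k)))\<^sup>2) - (\<Sum>k<M. (cmod (f k))\<^sup>2) = (\<Sum>k<M. (cmod (f (Suc k)))\<^sup>2 - (cmod (f k))\<^sup>2)"
      by (simp add: sum_subtractf)
    also have "\<dots> = 0" using z by (simp add: sum_lessThan_telescope[where f = "\<lambda>k. (cmod (f k))\<^sup>2"] zero_bdry_def)
    finally show ?thesis by (simp add: grid_l2_norm_def)
  qed
  finally show ?thesis by (simp add: mult_ac)
qed

lemma grid_l2_norm_mult_sup:
  assumes h: "0 \<le> h" and B: "0 \<le> B" "\<And>j. j < M \<Longrightarrow> cmod (f j) \<le> B"
  shows "grid_l2_norm h M (\<lambda>j. f j * g j) \<le> B * grid_l2_norm h M g"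
proof -
  have "grid_l2_norm h M (\<lambda>j. f j * g j) \<le> grid_l2_norm h M (\<lambda>j. of_real B * g j)"
    using h B by (intro grid_l2_norm_mono) (auto simp: norm_mult mult_right_mono)
  then show ?thesis using h B by (simp add: grid_l2_norm_scale)
qed

text \<open>Discrete product rule with every undifferentiated factor bounded by its maximum, hence
  by its H^1 seminorm. The H^1 case produces two such terms, the L^2 case one; the factor 2 covers
  both.\<close>

lemma grid_norm_mult:
  assumes h: "0 < h" and z: "f 0 = 0" "g 0 = 0"
  shows "grid_norm h M s (\<lambda>j. f j * g j) \<le> (2 * sqrt (h * real M)) * grid_norm h M True f * grid_norm h M s g"
proof -
  let ?c = "sqrt (h * real M)"
  have n0: "0 \<le> grid_norm h M s f" for s f using h by (simp add: grid_norm_nonneg)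
  have c0: "0 \<le> ?c" using h by simp
  show ?thesis
  proof (cases s)
    case False
    have "grid_l2_norm h M (\<lambda>j. f j * g j) \<le> (?c * grid_norm h M True f) * grid_l2_norm h M g"
      using h c0 n0[of True f] by (intro grid_l2_norm_mult_sup grid_sup_bound z) (auto simp del: grid_norm_simps)
    also have "\<dots> \<le> (2 * ?c * grid_norm h M True f) * grid_l2_norm h M g"
      using c0 n0[of True f] h by (intro mult_right_mono) (auto simp: grid_l2_norm_nonneg)
    finally show ?thesis using False by simp
  next
    case True
    have "dx_plus h (\<lambda>j. f j * g j) = (\<lambda>j. f (Suc j) * dx_plus h g j + g j * dx_plus h f j)"
      by (auto simp: dx_plus_def fun_eq_iff diff_divide_distrib algebra_simps)
    then have "grid_norm h M True (\<lambda>j. f j * g j) \<le> grid_l2_norm h M (\<lambda>j. f (Suc j) * dx_plus h g j) + grid_l2_norm h M (\<lambda>j. g j * dx_plus h f j)"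
      using h by (simp add: grid_l2_norm_triangle)
    also have "\<dots> \<le> (?c * grid_norm h M True f) * grid_l2_norm h M (dx_plus h g) + (?c * grid_norm h M True g) * grid_l2_norm h M (dx_plus h f)"
      using h c0 n0[of True f] n0[of True g]
      by (intro add_mono grid_l2_norm_mult_sup grid_sup_bound z) (auto simp del: grid_norm_simps)
    finally show ?thesis using True by (simp add: algebra_simps)
  qed
qed

text \<open>\<open>grid_norm_mult\<close> does not apply since the potential need not vanish at the
  boundary. The term in which \<open>W\<close> is differenced is controlled by a discrete Poincare
  inequality, the source of h M.\<close>

lemma grid_norm_mult_potential:
  assumes h: "0 < h" and z: "f 0 = 0"
    and V: "0 \<le> Vm" "\<And>j. j \<le> M \<Longrightarrow> \<bar>W j\<bar> \<le> Vm" "\<And>j. j < M \<Longrightarrow> \<bar>W (Suc j) - W j\<bar> \<le> Vm * h"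
  shows "grid_norm h M s (\<lambda>j. of_real (W j) * f j) \<le> Vm * (1 + h * real M) * grid_norm h M s f"
proof (cases s)
  case False
  have "grid_l2_norm h M (\<lambda>j. of_real (W j) * f j) \<le> Vm * grid_l2_norm h M f"
    using h V by (intro grid_l2_norm_mult_sup) auto
  also have "\<dots> \<le> (Vm * (1 + h * real M)) * grid_l2_norm h M f"
    using h V(1) by (intro mult_right_mono) (auto simp: grid_l2_norm_nonneg mult_le_cancel_left1)
  finally show ?thesis using False by simp
next
  case True
  let ?c = "sqrt (h * real M)"
  have n0: "0 \<le> grid_norm h M s f" for s f using h by (simp add: grid_norm_nonneg)
  have c0: "0 \<le> ?c" using h by simp
  have dW: "cmod (dx_plus h (\<lambda>j. of_real (W j)) j) \<le> Vm" if "j < M" for j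
    using V(3)[OF that] h by (simp add: dx_plus_def norm_divide divide_le_eq flip: of_real_diff)
  have "dx_plus h (\<lambda>j. of_real (W j) * f j) = (\<lambda>j. of_real (W (Suc j)) * dx_plus h f j + dx_plus h (\<lambda>j. of_real (W j)) j * f j)"
    by (auto simp: dx_plus_def fun_eq_iff diff_divide_distrib algebra_simps)
  then have "grid_norm h M True (\<lambda>j. of_real (W j) * f j) \<le> grid_l2_norm h M (\<lambda>j. of_real (W (Suc j)) * dx_plus h f j) + grid_l2_norm h M (\<lambda>j. dx_plus h (\<lambda>j. of_real (W j)) j * f j)"
    using h by (simp add: grid_l2_norm_triangle)
  also have "\<dots> \<le> Vm * grid_l2_norm h M (dx_plus h f) + Vm * grid_l2_norm h M f"
    using h V dW by (intro add_mono grid_l2_norm_mult_sup) auto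
  also have "\<dots> \<le> Vm * grid_l2_norm h M (dx_plus h f) + Vm * (?c * (?c * grid_norm h M True f))"
    using h c0 n0[of True f] V(1)
    by (intro add_mono order_refl mult_left_mono grid_l2_norm_le_sup grid_sup_bound z) (auto simp del: grid_norm_simps)
  also have "?c * (?c * grid_norm h M True f) = h * real M * grid_norm h M True f"
    using h by (simp flip: mult.assoc)
  finally show ?thesis using True by (simp add: algebra_simps)
qed

section \<open>The nonlinear term: Lipschitz bound and conservation laws\<close>

definition cnfd_rhs :: "(nat \<Rightarrow> real) \<Rightarrow> real \<Rightarrow> (nat \<Rightarrow> complex) \<Rightarrow> (nat \<Rightarrow> complex) \<Rightarrow> nat \<Rightarrow> complex" where
  "cnfd_rhs W \<beta> v u j = of_real (W j + \<beta> / 2 * ((cmod (v j))\<^sup>2 + (cmod (u j))\<^sup>2)) * ((v j + u j) / 2)"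

lemma zero_bdry_cnfd_rhs: "zero_bdry M v \<Longrightarrow> zero_bdry M u \<Longrightarrow> zero_bdry M (cnfd_rhs W \<beta> v u)"
  by (auto simp: zero_bdry_def cnfd_rhs_def)

text \<open>Write |v|^2 m as the product of v, cnj v and m, and exchange one factor at a time, in an
  order for which m' occurs only inside a difference. Two applications of
  \<open>grid_norm_mult\<close> per term give the squared constant.\<close>

lemma grid_norm_trilinear_diff:
  assumes h: "0 < h" and R: "0 \<le> R"
    and z: "zero_bdry M v" "zero_bdry M v'" "zero_bdry M m" "zero_bdry M m'"
    and b: "grid_norm h M True v \<le> R" "grid_norm h M True v' \<le> R" "grid_norm h M True m \<le> R"
  shows "grid_norm h M s (\<lambda>j. v j * cnj (v j) * m j - v' j * cnj (v' j) * m' j)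
    \<le> (2 * sqrt (h * real M))\<^sup>2 * R\<^sup>2 * (2 * grid_norm h M s (\<lambda>j. v j - v' j) + grid_norm h M s (\<lambda>j. m j - m' j))"
proof -
  let ?k = "2 * sqrt (h * real M)" and ?q = "grid_norm h M s" and ?p = "grid_norm h M True"
  have n0: "0 \<le> grid_norm h M s f" for s f using h by (simp add: grid_norm_nonneg)
  have k0: "0 \<le> ?k" using h by simp
  have two: "?q (\<lambda>j. (f j * g j) * d j) \<le> ?k\<^sup>2 * R\<^sup>2 * ?q d"
    if "f 0 = 0" "g 0 = 0" "d 0 = 0" "?p f \<le> R" "?p g \<le> R" for f g d
  proof -
    have "?q (\<lambda>j. (f j * g j) * d j) \<le> ?k * ?p (\<lambda>j. f j * g j) * ?q d"
      using that by (intro grid_norm_mult[OF h]) auto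
    also have "\<dots> \<le> ?k * (?k * R * R) * ?q d"
    proof (intro mult_right_mono mult_left_mono n0 k0)
      have "?p (\<lambda>j. f j * g j) \<le> ?k * ?p f * ?p g" by (rule grid_norm_mult[OF h, of f g M True, OF that(1,2)])
      also have "\<dots> \<le> ?k * R * R" using that k0 R n0 by (intro mult_mono mult_nonneg_nonneg) (auto simp del: grid_norm_simps)
      finally show "?p (\<lambda>j. f j * g j) \<le> ?k * R * R" .
    qed
    finally show ?thesis by (simp add: power2_eq_square mult_ac)
  qed
  have cb: "?p (\<lambda>j. cnj (f j)) = ?p f" for f using h by (intro grid_norm_cnj) simp
  have z0: "v 0 = 0" "v' 0 = 0" "m 0 = 0" "m' 0 = 0" using z by (auto simp: zero_bdry_def)
  have "(\<lambda>j. v j * cnj (v j) * m j - v' j * cnj (v' j) * m' j) =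
    (\<lambda>j. ((cnj (v j) * m j) * (v j - v' j) + (v' j * m j) * cnj (v j - v' j)) + (v' j * cnj (v' j)) * (m j - m' j))"
    by (auto simp: algebra_simps)
  then have "?q (\<lambda>j. v j * cnj (v j) * m j - v' j * cnj (v' j) * m' j) \<le>
     (?q (\<lambda>j. (cnj (v j) * m j) * (v j - v' j)) + ?q (\<lambda>j. (v' j * m j) * cnj (v j - v' j))) + ?q (\<lambda>j. (v' j * cnj (v' j)) * (m j - m' j))"
    using h by (simp only:) (intro order_trans[OF grid_norm_triangle] add_right_mono grid_norm_triangle; simp)
  also have "\<dots> \<le> (?k\<^sup>2 * R\<^sup>2 * ?q (\<lambda>j. v j - v' j) + ?k\<^sup>2 * R\<^sup>2 * ?q (\<lambda>j. cnj (v j - v' j))) + ?k\<^sup>2 * R\<^sup>2 * ?q (\<lambda>j. m j - m' j)"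
    using z0 b cb by (intro add_mono two) (auto simp del: grid_norm_simps)
  also have "?q (\<lambda>j. cnj (v j - v' j)) = ?q (\<lambda>j. v j - v' j)" using h by (intro grid_norm_cnj) simp
  finally show ?thesis by (simp add: algebra_simps del: grid_norm_simps)
qed

text \<open>\<open>L\<close> is the interval length. Let D, E and F be the distances of new values,
  old values and midpoints. The cubic term costs |\<beta>| / 2 times 4 L R^2 times 2 (D + E + F),
  and F is at most (D + E) / 2; this gives the factor 6. The mesh size enters only through L, so
  restrictions on \<tau> do not depend on it.\<close>

definition cnfd_lip :: "real \<Rightarrow> real \<Rightarrow> real \<Rightarrow> real \<Rightarrow> real" where
  "cnfd_lip L Vm \<beta> R = Vm * (1 + L) + 6 * \<bar>\<beta>\<bar> * L * R\<^sup>2"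

lemma cnfd_rhs_lipschitz:
  assumes h: "0 < h" and R: "0 \<le> R"
    and V: "0 \<le> Vm" "\<And>j. j \<le> M \<Longrightarrow> \<bar>W j\<bar> \<le> Vm" "\<And>j. j < M \<Longrightarrow> \<bar>W (Suc j) - W j\<bar> \<le> Vm * h"
    and z: "zero_bdry M v" "zero_bdry M v'" "zero_bdry M u" "zero_bdry M u'"
    and b: "grid_norm h M True v \<le> R" "grid_norm h M True v' \<le> R" "grid_norm h M True u \<le> R" "grid_norm h M True u' \<le> R"
  shows "grid_norm h M s (\<lambda>j. cnfd_rhs W \<beta> v u j - cnfd_rhs W \<beta> v' u' j)
    \<le> cnfd_lip (h * real M) Vm \<beta> R * (grid_norm h M s (\<lambda>j. v j - v' j) + grid_norm h M s (\<lambda>j. u j - u' j))"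
proof -
  let ?q = "grid_norm h M s" and ?p = "grid_norm h M True" and ?L = "h * real M"
  define m where "m j = (v j + u j) / 2" for j
  define m' where "m' j = (v' j + u' j) / 2" for j
  let ?D = "?q (\<lambda>j. v j - v' j)" and ?E = "?q (\<lambda>j. u j - u' j)" and ?F = "?q (\<lambda>j. m j - m' j)"
  have n0: "0 \<le> grid_norm h M s f" for s f using h by (simp add: grid_norm_nonneg)
  have half: "grid_norm h M s (\<lambda>j. (f j + g j) / 2) \<le> (grid_norm h M s f + grid_norm h M s g) / 2" for s f g
  proof -
    have "grid_norm h M s (\<lambda>j. (f j + g j) / 2) = grid_norm h M s (\<lambda>j. (1/2) * (f j + g j))" by (simp del: grid_norm_simps)
    also have "\<dots> = (1/2) * grid_norm h M s (\<lambda>j. f j + g j)" using h by (subst grid_norm_scale) auto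
    also have "\<dots> \<le> (1/2) * (grid_norm h M s f + grid_norm h M s g)"
      using h by (intro mult_left_mono grid_norm_triangle) auto
    finally show ?thesis by simp
  qed
  have zm: "zero_bdry M m" "zero_bdry M m'" using z by (auto simp: zero_bdry_def m_def m'_def)
  have bm: "?p m \<le> R" using half[of True v u] b by (simp add: m_def[abs_def] del: grid_norm_simps)
  have F: "?F \<le> (?D + ?E) / 2"
  proof -
    have "(\<lambda>j. m j - m' j) = (\<lambda>j. ((v j - v' j) + (u j - u' j)) / 2)" by (auto simp: m_def m'_def field_simps)
    then show ?thesis using half[of s "\<lambda>j. v j - v' j" "\<lambda>j. u j - u' j"] by simp
  qed
  have eq: "(\<lambda>j. cnfd_rhs W \<beta> v u j - cnfd_rhs W \<beta> v' u' j) = (\<lambda>j. of_real (W j) * (m j - m' j) +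
     of_real (\<beta> / 2) * ((v j * cnj (v j) * m j - v' j * cnj (v' j) * m' j) + (u j * cnj (u j) * m j - u' j * cnj (u' j) * m' j)))"
  proof
    fix j
    show "cnfd_rhs W \<beta> v u j - cnfd_rhs W \<beta> v' u' j = of_real (W j) * (m j - m' j) +
     of_real (\<beta> / 2) * ((v j * cnj (v j) * m j - v' j * cnj (v' j) * m' j) + (u j * cnj (u j) * m j - u' j * cnj (u' j) * m' j))"
      unfolding cnfd_rhs_def m_def[symmetric] m'_def[symmetric] of_real_add of_real_mult complex_norm_square
      by (simp add: algebra_simps)
  qed
  let ?k = "2 * sqrt ?L"
  have k2: "?k\<^sup>2 = 4 * ?L" using h by (simp add: power_mult_distrib)
  have "?q (\<lambda>j. cnfd_rhs W \<beta> v u j - cnfd_rhs W \<beta> v' u' j) \<le> ?q (\<lambda>j. of_real (W j) * (m j - m' j)) +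
     ?q (\<lambda>j. of_real (\<beta> / 2) * ((v j * cnj (v j) * m j - v' j * cnj (v' j) * m' j) + (u j * cnj (u j) * m j - u' j * cnj (u' j) * m' j)))"
    unfolding eq using h by (intro grid_norm_triangle) simp
  also have "?q (\<lambda>j. of_real (W j) * (m j - m' j)) \<le> Vm * (1 + ?L) * ?F"
    by (rule grid_norm_mult_potential[where f = "\<lambda>j. m j - m' j" and W = W, OF h _ V]) (use zm in \<open>auto simp: zero_bdry_def\<close>)
  also have "?q (\<lambda>j. of_real (\<beta> / 2) * ((v j * cnj (v j) * m j - v' j * cnj (v' j) * m' j) + (u j * cnj (u j) * m j - u' j * cnj (u' j) * m' j)))
     = \<bar>\<beta>\<bar> / 2 * ?q (\<lambda>j. (v j * cnj (v j) * m j - v' j * cnj (v' j) * m' j) + (u j * cnj (u j) * m j - u' j * cnj (u' j) * m' j))"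
    using h by (subst grid_norm_scale) (auto simp: norm_divide)
  also have "\<dots> \<le> \<bar>\<beta>\<bar> / 2 * (?k\<^sup>2 * R\<^sup>2 * (2 * ?D + ?F) + ?k\<^sup>2 * R\<^sup>2 * (2 * ?E + ?F))"
    using h by (intro mult_left_mono order_trans[OF grid_norm_triangle] add_mono grid_norm_trilinear_diff R z zm b bm) auto
  also have "\<dots> = \<bar>\<beta>\<bar> * (4 * ?L * R\<^sup>2 * (?D + ?E + ?F))" unfolding k2 by (simp add: algebra_simps del: grid_norm_simps)
  also have "Vm * (1 + ?L) * ?F + \<bar>\<beta>\<bar> * (4 * ?L * R\<^sup>2 * (?D + ?E + ?F)) \<le>
     Vm * (1 + ?L) * (?D + ?E) + \<bar>\<beta>\<bar> * (4 * ?L * R\<^sup>2 * (3 / 2 * (?D + ?E)))"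
    using F n0[of s "\<lambda>j. v j - v' j"] n0[of s "\<lambda>j. u j - u' j"] h V(1)
    by (intro add_mono mult_left_mono mult_nonneg_nonneg) (auto simp del: grid_norm_simps)
  also have "\<dots> = cnfd_lip ?L Vm \<beta> R * (?D + ?E)"
    by (simp add: cnfd_lip_def algebra_simps del: grid_norm_simps)
  finally show ?thesis by simp
qed

text \<open>Against the conjugate midpoint the nonlinear source is real, so the imaginary part in
  the L^2 identity vanishes.\<close>

lemma cnfd_rhs_mass:
  assumes h: "0 < h" and \<tau>: "0 < \<tau>" and M: "0 < M" and z: "zero_bdry M u" "zero_bdry M u'"
    and st: "cn_step h \<tau> M u u' (cnfd_rhs W \<beta> u' u)"
  shows "grid_norm h M False u' = grid_norm h M False u"
proof -
  let ?w = "\<lambda>j. (u' j + u j) / 2"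
  have "Im (cnfd_rhs W \<beta> u' u j * cnj (?w j)) = 0" for j
    unfolding cnfd_rhs_def mult.assoc complex_norm_square[symmetric] of_real_mult[symmetric] by simp
  then have "Re (\<Sum>j<M. (u' j - u j) * cnj (?w j)) = 0"
    unfolding cn_step_identity_L2[OF h \<tau> M st z zero_bdry_cnfd_rhs[OF z(2,1)]] by (simp add: Im_sum)
  moreover have f: "Re ((u' j - u j) * cnj (?w j)) = ((cmod (u' j))\<^sup>2 - (cmod (u j))\<^sup>2) / 2" for j
    unfolding cmod_power2 by (simp add: power2_eq_square field_simps)
  have "Re (\<Sum>j<M. (u' j - u j) * cnj (?w j)) = ((\<Sum>j<M. (cmod (u' j))\<^sup>2) - (\<Sum>j<M. (cmod (u j))\<^sup>2)) / 2"
    by (simp only: Re_sum f sum_subtractf sum_divide_distrib[symmetric])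
  ultimately have "(\<Sum>j<M. (cmod (u' j))\<^sup>2) = (\<Sum>j<M. (cmod (u j))\<^sup>2)"
    by simp
  then show ?thesis by (simp add: grid_l2_norm_def)
qed

definition grid_energy :: "real \<Rightarrow> nat \<Rightarrow> (nat \<Rightarrow> real) \<Rightarrow> real \<Rightarrow> (nat \<Rightarrow> complex) \<Rightarrow> real" where
  "grid_energy h M W \<beta> u = (grid_norm h M True u)\<^sup>2 / 2 + h * (\<Sum>j<M. W j * (cmod (u j))\<^sup>2 + \<beta> / 2 * (cmod (u j)) ^ 4)"

text \<open>Multiply by the conjugate increment: the time difference becomes purely imaginary, and
  the arithmetic mean of the squared moduli in the scheme turns the cubic term into an exact
  difference of fourth powers.\<close>

lemma cnfd_rhs_energy:
  assumes h: "0 < h" and \<tau>: "0 < \<tau>" and M: "0 < M" and z: "zero_bdry M u" "zero_bdry M u'"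
    and st: "cn_step h \<tau> M u u' (cnfd_rhs W \<beta> u' u)"
  shows "grid_energy h M W \<beta> u' = grid_energy h M W \<beta> u"
proof -
  let ?w = "\<lambda>j. (u' j + u j) / 2" and ?d = "\<lambda>j. u' j - u j"
  let ?D = "\<lambda>j. ?w (j + 1) - 2 * ?w j + ?w (j - 1)"
  define U where "U v j = W j * (cmod (v j))\<^sup>2 + \<beta> / 2 * (cmod (v j)) ^ 4" for v :: "nat \<Rightarrow> complex" and j
  have Rew: "Re (?w j * cnj (?d j)) = ((cmod (u' j))\<^sup>2 - (cmod (u j))\<^sup>2) / 2" for j
    unfolding cmod_power2 by (simp add: power2_eq_square field_simps)
  have pt: "Re (cnj (?d j) * ?D j) = h\<^sup>2 * (U u' j - U u j)" if j: "j \<in> {1..<M}" for j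
  proof -
    have "\<i> * (?d j / of_real \<tau>) = - (1/2) * (?D j / of_real (h\<^sup>2)) + cnfd_rhs W \<beta> u' u j"
      using st j unfolding cn_step_def dx2_def by blast
    then have "\<i> * (?d j / of_real \<tau>) * cnj (?d j) = (- (1/2) * (?D j / of_real (h\<^sup>2)) + cnfd_rhs W \<beta> u' u j) * cnj (?d j)"
      by simp
    moreover have "\<i> * (?d j / of_real \<tau>) * cnj (?d j) = \<i> * of_real ((cmod (?d j))\<^sup>2 / \<tau>)"
      by (simp add: complex_norm_square del: of_real_power)
    ultimately have "Re ((- (1/2) * (?D j / of_real (h\<^sup>2)) + cnfd_rhs W \<beta> u' u j) * cnj (?d j)) = 0"
      by (metis Re_i_times Im_complex_of_real neg_equal_0_iff_equal)
    moreover have "(- (1/2) * (?D j / of_real (h\<^sup>2)) + cnfd_rhs W \<beta> u' u j) * cnj (?d j)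
       = of_real (- 1 / (2 * h\<^sup>2)) * (cnj (?d j) * ?D j) + of_real (W j + \<beta> / 2 * ((cmod (u' j))\<^sup>2 + (cmod (u j))\<^sup>2)) * (?w j * cnj (?d j))"
    proof -
      obtain D w c where D: "?D j = D" and w: "?w j = w" and c: "cnj (?d j) = c" by blast
      show ?thesis unfolding cnfd_rhs_def D w c using h by (simp add: field_simps)
    qed
    ultimately have "(- 1 / (2 * h\<^sup>2)) * Re (cnj (?d j) * ?D j) + (W j + \<beta> / 2 * ((cmod (u' j))\<^sup>2 + (cmod (u j))\<^sup>2)) * Re (?w j * cnj (?d j)) = 0"
      by (simp only: plus_complex.sel Re_complex_of_real times_complex.sel Im_complex_of_real mult_zero_left diff_0_right)
    then have "Re (cnj (?d j) * ?D j) = h\<^sup>2 * (2 * ((W j + \<beta> / 2 * ((cmod (u' j))\<^sup>2 + (cmod (u j))\<^sup>2)) * Re (?w j * cnj (?d j))))"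
      using h by (simp add: field_simps del: times_complex.sel)
    also have "2 * ((W j + \<beta> / 2 * ((cmod (u' j))\<^sup>2 + (cmod (u j))\<^sup>2)) * Re (?w j * cnj (?d j))) = U u' j - U u j"
      unfolding Rew U_def by (simp add: field_simps power2_eq_square power4_eq_xxxx)
    finally show ?thesis .
  qed
  have "Re (\<Sum>j\<in>{1..<M}. cnj (?d j) * ?D j) = h\<^sup>2 * (\<Sum>j\<in>{1..<M}. U u' j - U u j)"
    by (simp only: Re_sum sum_distrib_left sum.cong[OF refl pt])
  also have "(\<Sum>j\<in>{1..<M}. U u' j - U u j) = (\<Sum>j<M. U u' j - U u j)"
    by (rule sum_interior[symmetric]) (use z M in \<open>auto simp: zero_bdry_def U_def\<close>)
  also have "(\<Sum>j\<in>{1..<M}. cnj (?d j) * ?D j) = - (\<Sum>j<M. (cnj (?d (Suc j)) - cnj (?d j)) * (?w (Suc j) - ?w j))"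
    by (rule summation_by_parts) (use z M in \<open>auto simp: zero_bdry_def\<close>)
  finally have 1: "- Re (\<Sum>j<M. (cnj (?d (Suc j)) - cnj (?d j)) * (?w (Suc j) - ?w j)) = h\<^sup>2 * (\<Sum>j<M. U u' j - U u j)"
    by simp
  have "Re ((cnj (?d (Suc j)) - cnj (?d j)) * (?w (Suc j) - ?w j)) = h\<^sup>2 * (((cmod (dx_plus h u' j))\<^sup>2 - (cmod (dx_plus h u j))\<^sup>2) / 2)" for j
  proof -
    define p where "p = u' (Suc j) - u' j"
    define q where "q = u (Suc j) - u j"
    have e1: "(cnj (?d (Suc j)) - cnj (?d j)) * (?w (Suc j) - ?w j) = cnj (p - q) * ((p + q) / 2)"
      by (simp add: p_def q_def field_simps)
    have e2: "Re (cnj (p - q) * ((p + q) / 2)) = ((cmod p)\<^sup>2 - (cmod q)\<^sup>2) / 2"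
      unfolding cmod_power2 by (simp add: power2_eq_square field_simps)
    have e3: "(cmod (dx_plus h u' j))\<^sup>2 = (cmod p)\<^sup>2 / h\<^sup>2" "(cmod (dx_plus h u j))\<^sup>2 = (cmod q)\<^sup>2 / h\<^sup>2"
      by (simp_all add: dx_plus_def p_def q_def norm_divide power_divide)
    show ?thesis unfolding e1 e2 e3 using h by (simp add: field_simps)
  qed
  then have "Re (\<Sum>j<M. (cnj (?d (Suc j)) - cnj (?d j)) * (?w (Suc j) - ?w j)) = h\<^sup>2 * (\<Sum>j<M. ((cmod (dx_plus h u' j))\<^sup>2 - (cmod (dx_plus h u j))\<^sup>2) / 2)"
    by (simp only: Re_sum sum_distrib_left)
  with 1 h have "- (\<Sum>j<M. ((cmod (dx_plus h u' j))\<^sup>2 - (cmod (dx_plus h u j))\<^sup>2) / 2) = (\<Sum>j<M. U u' j - U u j)"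
    by (simp only: mult_minus_right[symmetric] mult_cancel_left power2_eq_square mult_eq_0_iff) simp
  then have "(\<Sum>j<M. (cmod (dx_plus h u' j))\<^sup>2) / 2 + (\<Sum>j<M. U u' j) = (\<Sum>j<M. (cmod (dx_plus h u j))\<^sup>2) / 2 + (\<Sum>j<M. U u j)"
    by (simp add: sum_subtractf diff_divide_distrib flip: sum_divide_distrib)
  then have "h * ((\<Sum>j<M. (cmod (dx_plus h u' j))\<^sup>2) / 2 + (\<Sum>j<M. U u' j)) = h * ((\<Sum>j<M. (cmod (dx_plus h u j))\<^sup>2) / 2 + (\<Sum>j<M. U u j))"
    by simp
  then show ?thesis
    unfolding grid_energy_def U_def[symmetric] using h by (simp add: grid_l2_norm_sq distrib_left)
qed

text \<open>If x >= 0 and x^2 <= 2|E| + 2|\<beta>| m^3 x, then either x <= 1, or division by x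
  yields x <= 2|E| + 2|\<beta>| m^3. The sum covers both cases.\<close>

definition apriori_radius :: "real \<Rightarrow> real \<Rightarrow> real \<Rightarrow> real" where
  "apriori_radius \<beta> m E = 1 + 2 * \<bar>E\<bar> + 2 * \<bar>\<beta>\<bar> * m ^ 3"

lemma grid_energy_coercive:
  assumes h: "0 < h" and z: "zero_bdry M u" and W: "\<And>j. j < M \<Longrightarrow> 0 \<le> W j"
    and m: "grid_norm h M False u \<le> m" and E: "grid_energy h M W \<beta> u \<le> E" and m0: "0 \<le> m"
  shows "grid_norm h M True u \<le> apriori_radius \<beta> m E"
proof -
  let ?x = "grid_norm h M True u" and ?y = "grid_norm h M False u"
  have n0: "0 \<le> ?x" "0 \<le> ?y" using h by (auto intro: grid_norm_nonneg simp del: grid_norm_simps)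
  have quart: "h * (\<Sum>j<M. (cmod (u j)) ^ 4) \<le> 2 * ?x * ?y ^ 3"
  proof -
    have "(\<Sum>j<M. (cmod (u j)) ^ 4) \<le> (\<Sum>j<M. (2 * ?x * ?y) * (cmod (u j))\<^sup>2)"
    proof (rule sum_mono)
      fix j assume "j \<in> {..<M}"
      then have "(cmod (u j))\<^sup>2 * (cmod (u j))\<^sup>2 \<le> (2 * ?x * ?y) * (cmod (u j))\<^sup>2"
        by (intro mult_right_mono grid_gagliardo_nirenberg[OF h z]) auto
      then show "(cmod (u j)) ^ 4 \<le> (2 * ?x * ?y) * (cmod (u j))\<^sup>2"
        by (simp only: power2_eq_square power4_eq_xxxx mult.assoc)
    qed
    then have "h * (\<Sum>j<M. (cmod (u j)) ^ 4) \<le> h * ((2 * ?x * ?y) * (\<Sum>j<M. (cmod (u j))\<^sup>2))"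
      using h by (simp only: sum_distrib_left[symmetric] mult_le_cancel_left_pos)
    also have "\<dots> = (2 * ?x * ?y) * ?y\<^sup>2" using h by (simp add: grid_l2_norm_sq)
    finally show ?thesis by (simp only: power2_eq_square power3_eq_cube mult.assoc)
  qed
  have "0 \<le> (\<Sum>j<M. W j * (cmod (u j))\<^sup>2)" using W by (intro sum_nonneg) auto
  then have pot: "0 \<le> h * (\<Sum>j<M. W j * (cmod (u j))\<^sup>2)" using h by simp
  have "?x\<^sup>2 / 2 + h * (\<Sum>j<M. W j * (cmod (u j))\<^sup>2) + \<beta> / 2 * (h * (\<Sum>j<M. (cmod (u j)) ^ 4)) \<le> E"
    using E by (simp add: grid_energy_def sum.distrib sum_distrib_left algebra_simps)
  moreover have "- (\<bar>\<beta>\<bar> * (?x * ?y ^ 3)) \<le> \<beta> / 2 * (h * (\<Sum>j<M. (cmod (u j)) ^ 4))"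
  proof -
    have s0: "0 \<le> h * (\<Sum>j<M. (cmod (u j)) ^ 4)" using h by (intro mult_nonneg_nonneg sum_nonneg) auto
    have "- (\<beta> / 2 * (h * (\<Sum>j<M. (cmod (u j)) ^ 4))) \<le> \<bar>\<beta>\<bar> / 2 * (h * (\<Sum>j<M. (cmod (u j)) ^ 4))"
      using s0 mult_right_mono[of "- \<beta>" "\<bar>\<beta>\<bar>" "h * (\<Sum>j<M. (cmod (u j)) ^ 4)"] by simp
    also have "\<dots> \<le> \<bar>\<beta>\<bar> / 2 * (2 * ?x * ?y ^ 3)" by (intro mult_left_mono quart) auto
    finally show ?thesis by simp
  qed
  ultimately have "?x\<^sup>2 \<le> 2 * E + 2 * \<bar>\<beta>\<bar> * (?x * ?y ^ 3)" using pot by linarith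
  also have "\<dots> \<le> 2 * \<bar>E\<bar> + 2 * \<bar>\<beta>\<bar> * (?x * m ^ 3)"
    using n0 m by (intro add_mono mult_left_mono power_mono) auto
  finally have sq: "?x * ?x \<le> 2 * \<bar>E\<bar> + (2 * \<bar>\<beta>\<bar> * m ^ 3) * ?x" by (simp only: power2_eq_square mult_ac)
  have c0: "0 \<le> 2 * \<bar>\<beta>\<bar> * m ^ 3" using m0 by simp
  show ?thesis
  proof (cases "?x \<le> 1")
    case True
    then show ?thesis using c0 by (simp add: apriori_radius_def del: grid_norm_simps)
  next
    case False
    then have "2 * \<bar>E\<bar> * 1 \<le> 2 * \<bar>E\<bar> * ?x" by (intro mult_left_mono) auto
    with sq have "?x * ?x \<le> (2 * \<bar>E\<bar> + 2 * \<bar>\<beta>\<bar> * m ^ 3) * ?x" by (simp add: distrib_right del: grid_norm_simps)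
    then have "?x \<le> 2 * \<bar>E\<bar> + 2 * \<bar>\<beta>\<bar> * m ^ 3" using False by (simp add: mult_le_cancel_right del: grid_norm_simps)
    then show ?thesis by (simp add: apriori_radius_def del: grid_norm_simps)
  qed
qed

section \<open>Solvability of a linear step\<close>

lemma cn_step_diff:
  assumes "cn_step h \<tau> M u u' g" "cn_step h \<tau> M v v' k"
  shows "cn_step h \<tau> M (\<lambda>j. u j - v j) (\<lambda>j. u' j - v' j) (\<lambda>j. g j - k j)"
  unfolding cn_step_def
proof
  fix j assume j: "j \<in> {1..<M}"
  have 1: "\<i> * ((u' j - u j) / of_real \<tau>) = - (1/2) * dx2 h (\<lambda>k. (u' k + u k) / 2) j + g j"
    "\<i> * ((v' j - v j) / of_real \<tau>) = - (1/2) * dx2 h (\<lambda>k. (v' k + v k) / 2) j + k j"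
    using assms j unfolding cn_step_def by blast+
  have e1: "dx2 h (\<lambda>k. (u' k - v' k + (u k - v k)) / 2) j = dx2 h (\<lambda>k. (u' k + u k) / 2) j - dx2 h (\<lambda>k. (v' k + v k) / 2) j"
    unfolding dx2_def diff_divide_distrib[symmetric] by (rule arg_cong[where f = "\<lambda>z. z / _"]) (simp add: field_simps)
  have e2: "\<i> * ((u' j - v' j - (u j - v j)) / of_real \<tau>) = \<i> * ((u' j - u j) / of_real \<tau>) - \<i> * ((v' j - v j) / of_real \<tau>)"
    unfolding divide_inverse by (simp add: algebra_simps)
  show "\<i> * ((u' j - v' j - (u j - v j)) / of_real \<tau>)
     = - (1/2) * dx2 h (\<lambda>k. (u' k - v' k + (u k - v k)) / 2) j + (g j - k j)"
    unfolding e2 1 e1 by (simp add: field_simps)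
qed

text \<open>The three-term recurrence that a linear step becomes when solved for the next node,
  started from 0 at node 0 and from a free value \<open>c\<close> at node 1.\<close>

fun shoot :: "complex \<Rightarrow> (nat \<Rightarrow> complex) \<Rightarrow> complex \<Rightarrow> nat \<Rightarrow> complex" where
  "shoot \<alpha> r c 0 = 0"
| "shoot \<alpha> r c (Suc 0) = c"
| "shoot \<alpha> r c (Suc (Suc n)) = \<alpha> * shoot \<alpha> r c (Suc n) - shoot \<alpha> r c n + r (Suc n)"

lemma shoot_affine: "shoot \<alpha> r c n = shoot \<alpha> r 0 n + c * shoot \<alpha> (\<lambda>_. 0) 1 n"
  by (induction \<alpha> r c n rule: shoot.induct) (simp_all add: algebra_simps)

lemma cn_step_shoot:
  assumes h: "0 < h" and \<tau>: "0 < \<tau>"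
    and v: "\<And>j. j \<in> {1..<M} \<Longrightarrow> v (j + 1) = (2 - 4 * \<i> * of_real (h\<^sup>2 / \<tau>)) * v j - v (j - 1)
       + (4 * \<i> * of_real (h\<^sup>2 / \<tau>) * u j + 4 * of_real (h\<^sup>2) * g j - (u (j + 1) - 2 * u j + u (j - 1)))"
  shows "cn_step h \<tau> M u v g"
  unfolding cn_step_def
proof
  fix j assume j: "j \<in> {1..<M}"
  let ?h = "complex_of_real (h\<^sup>2)" and ?t = "complex_of_real \<tau>"
  have h0: "?h \<noteq> 0" "?t \<noteq> 0" using h \<tau> by auto
  have D: "dx2 h (\<lambda>k. (v k + u k) / 2) j = (v (j + 1) - 2 * v j + v (j - 1) + (u (j + 1) - 2 * u j + u (j - 1))) / 2 / ?h"
    unfolding dx2_def by (rule arg_cong[where f = "\<lambda>z. z / _"]) (simp add: field_simps)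
  have "v (j + 1) - 2 * v j + v (j - 1) + (u (j + 1) - 2 * u j + u (j - 1)) = 4 * ?h * (g j - \<i> * ((v j - u j) / ?t))"
    unfolding v[OF j] of_real_divide by (simp add: algebra_simps diff_divide_distrib)
  moreover obtain q where q: "\<i> * ((v j - u j) / ?t) = q" by blast
  ultimately have "dx2 h (\<lambda>k. (v k + u k) / 2) j = 2 * (g j - q)"
    unfolding D using h0 by simp
  then have "q = - (1/2) * dx2 h (\<lambda>k. (v k + u k) / 2) j + g j" by (simp add: field_simps)
  then show "\<i> * ((v j - u j) / ?t) = - (1/2) * dx2 h (\<lambda>k. (v k + u k) / 2) j + g j" unfolding q .
qed

text \<open>Shooting: the value at node M is affine in the free value at node 1, so the right
  boundary condition can be met unless the homogeneous solution vanishes at M. In that case it would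
  be a step from 0 with zero source, and stability would make it vanish at node 1, where it equals
  1.\<close>

lemma cn_step_exists:
  assumes h: "0 < h" and \<tau>: "0 < \<tau>" and M: "2 \<le> M"
  shows "\<exists>v. zero_bdry M v \<and> cn_step h \<tau> M u v g"
proof -
  define \<alpha> where "\<alpha> = 2 - 4 * \<i> * complex_of_real (h\<^sup>2 / \<tau>)"
  define r where "r j = 4 * \<i> * of_real (h\<^sup>2 / \<tau>) * u j + 4 * of_real (h\<^sup>2) * g j - (u (j + 1) - 2 * u j + u (j - 1))" for j
  let ?z = "shoot \<alpha> (\<lambda>_. 0) 1"
  have rec: "shoot \<alpha> s c (j + 1) = \<alpha> * shoot \<alpha> s c j - shoot \<alpha> s c (j - 1) + s j" if j: "j \<in> {1..<M}" for s c j
  proof -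
    obtain i where "j = Suc i" using j by (cases j) auto
    then show ?thesis by simp
  qed
  have "?z M \<noteq> 0"
  proof
    assume zM: "?z M = 0"
    have st: "cn_step h \<tau> M (\<lambda>_. 0) ?z (\<lambda>_. 0)"
      by (rule cn_step_shoot[OF h \<tau>]) (use rec in \<open>simp add: \<alpha>_def\<close>)
    have "grid_norm h M True ?z \<le> grid_norm h M True (\<lambda>_. 0) + \<tau> * grid_norm h M True (\<lambda>_. 0)"
      by (rule cn_step_stable[OF h \<tau> _ st]) (use M zM in \<open>auto simp: zero_bdry_def\<close>)
    then have "grid_norm h M True ?z \<le> 0" by (simp only: grid_norm_zero)
    moreover have "cmod (?z 1) \<le> sqrt (h * real M) * grid_norm h M True ?z"
      by (rule grid_sup_bound[OF h]) (use M in auto)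
    moreover have "sqrt (h * real M) * grid_norm h M True ?z \<le> 0"
      using calculation(1) h by (intro mult_nonneg_nonpos) auto
    ultimately show False by simp
  qed
  define c where "c = - shoot \<alpha> r 0 M / ?z M"
  have "shoot \<alpha> r c M = 0"
    using shoot_affine[of \<alpha> r c M] \<open>?z M \<noteq> 0\<close> by (simp add: c_def)
  moreover have "cn_step h \<tau> M u (shoot \<alpha> r c) g"
    by (rule cn_step_shoot[OF h \<tau>]) (use rec[of _ r c] in \<open>simp add: \<alpha>_def r_def\<close>)
  ultimately show ?thesis by (intro exI[of _ "shoot \<alpha> r c"]) (simp add: zero_bdry_def)
qed

section \<open>Existence, uniqueness and error propagation for the nonlinear scheme\<close>

locale cnfd_grid =
  fixes h \<tau> :: real and M :: nat and W :: "nat \<Rightarrow> real" and \<beta> Vm :: real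
  assumes h: "0 < h" and \<tau>: "0 < \<tau>" and M: "2 \<le> M" and Vm: "0 \<le> Vm"
    and W: "\<And>j. j \<le> M \<Longrightarrow> 0 \<le> W j" "\<And>j. j \<le> M \<Longrightarrow> \<bar>W j\<bar> \<le> Vm"
      "\<And>j. j < M \<Longrightarrow> \<bar>W (Suc j) - W j\<bar> \<le> Vm * h"
begin

abbreviation "rhs \<equiv> cnfd_rhs W \<beta>"
abbreviation "lip \<equiv> cnfd_lip (h * real M) Vm \<beta>"
abbreviation "gn \<equiv> grid_norm h M"

declare grid_norm_simps [simp del]

lemma M0: "0 < M" using M by simp

lemma W_nonneg: "j < M \<Longrightarrow> 0 \<le> W j" using W(1) by simp

lemma gn_nonneg: "0 \<le> gn s f"
  using h by (simp add: grid_norm_nonneg)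

lemma lip_nonneg: "0 \<le> lip R"
  using h Vm by (simp add: cnfd_lip_def)

lemma rhs_lipschitz:
  assumes "0 \<le> R" "zero_bdry M v" "zero_bdry M v'" "zero_bdry M u" "zero_bdry M u'"
    "gn True v \<le> R" "gn True v' \<le> R" "gn True u \<le> R" "gn True u' \<le> R"
  shows "gn s (\<lambda>j. rhs v u j - rhs v' u' j) \<le> lip R * (gn s (\<lambda>j. v j - v' j) + gn s (\<lambda>j. u j - u' j))"
  by (rule cnfd_rhs_lipschitz[where W = W, OF h assms(1) Vm W(2,3) assms(2-9)])

lemma rhs_bound:
  assumes "0 \<le> R" "zero_bdry M v" "zero_bdry M u" "gn True v \<le> R" "gn True u \<le> R"
  shows "gn s (rhs v u) \<le> lip R * (gn s v + gn s u)"
proof -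
  have "gn s (\<lambda>j. rhs v u j - rhs (\<lambda>_. 0) (\<lambda>_. 0) j) \<le> lip R * (gn s (\<lambda>j. v j - 0) + gn s (\<lambda>j. u j - 0))"
    by (rule rhs_lipschitz) (use assms in \<open>auto simp: zero_bdry_def\<close>)
  moreover have "(\<lambda>j. rhs v u j - rhs (\<lambda>_. 0) (\<lambda>_. 0) j) = rhs v u" by (auto simp: cnfd_rhs_def)
  ultimately show ?thesis by simp
qed

lemma sup_bound: "zero_bdry M f \<Longrightarrow> j \<le> M \<Longrightarrow> cmod (f j) \<le> sqrt (h * real M) * gn True f"
  by (rule grid_sup_bound[OF h]) (auto simp: zero_bdry_def)

text \<open>Fixed-point iteration with the nonlinear source taken at the previous iterate, so that
  each iterate is a linear step. By stability the map contracts in the H^1 seminorm on the ball of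
  radius 2 R, with factor \<tau> times the Lipschitz constant there.\<close>

lemma nonlinear_step_exists:
  assumes u: "zero_bdry M u" "gn True u \<le> R" and R: "0 \<le> R" and small: "\<tau> * lip (2 * R) \<le> 1/3"
  shows "\<exists>v. zero_bdry M v \<and> cn_step h \<tau> M u v (rhs v u)"
proof -
  define F where "F v = (SOME v'. zero_bdry M v' \<and> cn_step h \<tau> M u v' (rhs v u))" for v
  have F: "zero_bdry M (F v) \<and> cn_step h \<tau> M u (F v) (rhs v u)" for v
    unfolding F_def by (rule someI_ex[OF cn_step_exists[OF h \<tau> M]])
  define x where "x n = (F ^^ n) u" for n
  have x0: "x 0 = u" and xS: "cn_step h \<tau> M u (x (Suc n)) (rhs (x n) u)" for n
    using F by (simp_all add: x_def)
  have xz: "zero_bdry M (x n)" for n using F u by (cases n) (simp_all add: x_def)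
  have xR: "gn True (x n) \<le> 2 * R" for n
  proof (induction n)
    case (Suc n)
    have "gn True (x (Suc n)) \<le> gn True u + \<tau> * gn True (rhs (x n) u)"
      by (rule cn_step_stable[OF h \<tau> M0 xS u(1) xz zero_bdry_cnfd_rhs[OF xz u(1)]])
    also have "\<dots> \<le> R + \<tau> * (lip (2 * R) * (gn True (x n) + gn True u))"
      using \<tau> u R Suc xz by (intro add_mono mult_left_mono rhs_bound) auto
    also have "\<dots> \<le> R + \<tau> * (lip (2 * R) * (2 * R + R))"
      using \<tau> u R Suc lip_nonneg by (intro add_mono mult_left_mono) auto
    also have "\<dots> = R + (\<tau> * lip (2 * R)) * (3 * R)" by (simp add: algebra_simps)
    \<comment> \<open>Origin of the bound 1/3: u has norm at most R and the iterate at most 2 R, so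
      the next iterate has norm at most R + (1/3) 3 R = 2 R.\<close>
    also have "\<dots> \<le> R + (1/3) * (3 * R)" using R small by (intro add_mono mult_right_mono) auto
    finally show ?case by simp
  qed (use u R x0 in simp)
  define d where "d n = gn True (\<lambda>j. x (Suc n) j - x n j)" for n
  have dS: "d (Suc n) \<le> (1/2) * d n" for n
  proof -
    have "d (Suc n) \<le> gn True (\<lambda>j. u j - u j) + \<tau> * gn True (\<lambda>j. rhs (x (Suc n)) u j - rhs (x n) u j)"
      unfolding d_def
      by (rule cn_step_stable[OF h \<tau> M0 cn_step_diff[OF xS xS]]) (intro zero_bdry_intros zero_bdry_cnfd_rhs xz u)+
    also have "\<dots> \<le> 0 + \<tau> * (lip (2 * R) * (d n + gn True (\<lambda>j. u j - u j)))"
      unfolding d_def using \<tau> u R xR xz by (intro add_mono mult_left_mono rhs_lipschitz) (auto intro: order_trans[OF u(2)])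
    also have "\<dots> = (\<tau> * lip (2 * R)) * d n" by simp
    also have "\<dots> \<le> (1/2) * d n"
      using small gn_nonneg by (intro mult_right_mono) (auto simp: d_def)
    finally show ?thesis .
  qed
  have dn: "d n \<le> (1/2) ^ n * d 0" for n
  proof (induction n)
    case (Suc n)
    then show ?case using dS[of n] by simp
  qed simp
  \<comment> \<open>Convergence at each node is enough, because the difference equation is local.
    The increments decay geometrically in the H^1 seminorm and hence at every node.\<close>
  have conv: "convergent (\<lambda>n. x n j)" if j: "j \<le> M" for j
  proof -
    have "summable (\<lambda>n. x (Suc n) j - x n j)"
    proof (rule summable_comparison_test)
      show "\<exists>N. \<forall>n\<ge>N. norm (x (Suc n) j - x n j) \<le> (sqrt (h * real M) * d 0) * (1/2) ^ n"
      proof (intro exI allI impI)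
        fix n
        have "norm (x (Suc n) j - x n j) \<le> sqrt (h * real M) * d n"
          unfolding d_def by (rule sup_bound[OF zero_bdry_intros(2)[OF xz xz] j])
        also have "\<dots> \<le> sqrt (h * real M) * ((1/2) ^ n * d 0)" using h dn by (intro mult_left_mono) auto
        finally show "norm (x (Suc n) j - x n j) \<le> (sqrt (h * real M) * d 0) * (1/2) ^ n" by (simp add: mult_ac)
      qed
      show "summable (\<lambda>n. (sqrt (h * real M) * d 0) * (1/2) ^ n)" by (intro summable_mult summable_geometric) simp
    qed
    then have "convergent (\<lambda>n. \<Sum>i<n. x (Suc i) j - x i j)" by (simp add: summable_iff_convergent)
    then have "convergent (\<lambda>n. x n j - x 0 j)" by (simp only: sum_lessThan_telescope[of "\<lambda>i. x i j"])
    then have "convergent (\<lambda>n. (x n j - x 0 j) + x 0 j)" by (intro convergent_add convergent_const)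
    then show ?thesis by simp
  qed
  define v where "v j = lim (\<lambda>n. x n j)" for j
  have L: "(\<lambda>n. x n j) \<longlonglongrightarrow> v j" if "j \<le> M" for j
    using conv[OF that] unfolding v_def by (simp add: convergent_LIMSEQ_iff)
  have "zero_bdry M v"
    using xz unfolding v_def zero_bdry_def by (simp add: lim_def[symmetric] limI)
  moreover have "cn_step h \<tau> M u v (rhs v u)"
    unfolding cn_step_def
  proof
    fix j assume j: "j \<in> {1..<M}"
    have jM: "j \<le> M" "j + 1 \<le> M" "j - 1 \<le> M" using j by auto
    note L' = LIMSEQ_Suc[OF L]
    have "(\<lambda>n. \<i> * ((x (Suc n) j - u j) / of_real \<tau>)) \<longlonglongrightarrow> \<i> * ((v j - u j) / of_real \<tau>)"
      by (intro tendsto_intros L' jM) (use \<tau> in auto)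
    moreover have "\<i> * ((x (Suc n) j - u j) / of_real \<tau>) = - (1/2) * dx2 h (\<lambda>k. (x (Suc n) k + u k) / 2) j + rhs (x n) u j" for n
      using xS[of n] j unfolding cn_step_def by blast
    moreover have "(\<lambda>n. - (1/2) * dx2 h (\<lambda>k. (x (Suc n) k + u k) / 2) j + rhs (x n) u j)
       \<longlonglongrightarrow> - (1/2) * dx2 h (\<lambda>k. (v k + u k) / 2) j + rhs v u j"
      unfolding dx2_def cnfd_rhs_def by (intro tendsto_intros L L' jM) (use h in auto)
    ultimately show "\<i> * ((v j - u j) / of_real \<tau>) = - (1/2) * dx2 h (\<lambda>k. (v k + u k) / 2) j + rhs v u j"
      using LIMSEQ_unique by simp
  qed
  ultimately show ?thesis by blast
qed

text \<open>Only conservation is used, so the bound covers every solution of the scheme however it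
  was obtained; uniqueness among all solutions rests on this.\<close>

lemma apriori_bound:
  assumes z: "\<And>k. k \<le> N \<Longrightarrow> zero_bdry M (v k)"
    and st: "\<And>k. k < N \<Longrightarrow> cn_step h \<tau> M (v k) (v (Suc k)) (rhs (v (Suc k)) (v k))"
    and init: "gn False (v 0) \<le> m" "grid_energy h M W \<beta> (v 0) \<le> E" and m: "0 \<le> m" and n: "n \<le> N"
  shows "gn True (v n) \<le> apriori_radius \<beta> m E"
proof -
  have "gn False (v n) = gn False (v 0) \<and> grid_energy h M W \<beta> (v n) = grid_energy h M W \<beta> (v 0)"
    using n
  proof (induction n)
    case (Suc n)
    then have "n \<le> N" "Suc n \<le> N" "n < N" by auto
    then show ?case
      using Suc.IH cnfd_rhs_mass[OF h \<tau> M0 z z st] cnfd_rhs_energy[OF h \<tau> M0 z z st] by simp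
  qed simp
  then show ?thesis
    using init by (intro grid_energy_coercive[where W = W, OF h z[OF n] W_nonneg _ _ m]) auto
qed

text \<open>The invariant carried from level to level is the bound on mass and energy, not one on
  the H^1 seminorm, which is not conserved. The radius therefore stays the same and one smallness
  condition on \<tau> suffices for all steps.\<close>

lemma sequence_exists:
  assumes z: "zero_bdry M u0" and init: "gn False u0 \<le> m" "grid_energy h M W \<beta> u0 \<le> E" and m: "0 \<le> m"
    and small: "\<tau> * lip (2 * apriori_radius \<beta> m E) \<le> 1/3"
  obtains u where "u 0 = u0" "\<And>n. zero_bdry M (u n)" "\<And>n. cn_step h \<tau> M (u n) (u (Suc n)) (rhs (u (Suc n)) (u n))"
proof -
  let ?R = "apriori_radius \<beta> m E"
  have R: "0 \<le> ?R" using m by (simp add: apriori_radius_def)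
  define P where "P n v \<longleftrightarrow> zero_bdry M v \<and> gn False v \<le> m \<and> grid_energy h M W \<beta> v \<le> E \<and> (n = 0 \<longrightarrow> v = u0)" for n :: nat and v
  have "\<exists>u. \<forall>n. P n (u n) \<and> cn_step h \<tau> M (u n) (u (Suc n)) (rhs (u (Suc n)) (u n))"
  proof (rule dependent_nat_choice)
    show "\<exists>v. P 0 v" using z init by (auto simp: P_def)
    fix v n assume P: "P n v"
    then have v: "zero_bdry M v" "gn False v \<le> m" "grid_energy h M W \<beta> v \<le> E" by (auto simp: P_def)
    have "gn True v \<le> ?R" by (rule grid_energy_coercive[where W = W, OF h v(1) W_nonneg v(2,3) m])
    then obtain w where w: "zero_bdry M w" "cn_step h \<tau> M v w (rhs w v)"
      using nonlinear_step_exists[OF v(1) _ R small] by blast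
    have "P (Suc n) w"
      using v w cnfd_rhs_mass[OF h \<tau> M0 v(1) w] cnfd_rhs_energy[OF h \<tau> M0 v(1) w] by (simp add: P_def)
    then show "\<exists>w. P (Suc n) w \<and> cn_step h \<tau> M v w (rhs w v)" using w by blast
  qed
  then obtain u where "\<forall>n. P n (u n) \<and> cn_step h \<tau> M (u n) (u (Suc n)) (rhs (u (Suc n)) (u n))" by blast
  then show thesis using that[of u] by (simp add: P_def)
qed

lemma sequence_unique:
  assumes v: "\<And>k. k \<le> N \<Longrightarrow> zero_bdry M (v k)" "\<And>k. k < N \<Longrightarrow> cn_step h \<tau> M (v k) (v (Suc k)) (rhs (v (Suc k)) (v k))"
      "\<And>k. k \<le> N \<Longrightarrow> gn True (v k) \<le> R"
    and w: "\<And>k. k \<le> N \<Longrightarrow> zero_bdry M (w k)" "\<And>k. k < N \<Longrightarrow> cn_step h \<tau> M (w k) (w (Suc k)) (rhs (w (Suc k)) (w k))"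
      "\<And>k. k \<le> N \<Longrightarrow> gn True (w k) \<le> R"
    and R: "0 \<le> R" and small: "\<tau> * lip R < 1" and init: "\<And>j. j \<le> M \<Longrightarrow> v 0 j = w 0 j" and nj: "n \<le> N" "j \<le> M"
  shows "v n j = w n j"
proof -
  have "gn True (\<lambda>j. v n j - w n j) = 0"
    using nj(1)
  proof (induction n)
    case 0
    have "gn True (\<lambda>j. v 0 j - w 0 j) = gn True (\<lambda>j. 0)" by (rule grid_norm_cong) (use init in auto)
    then show ?case by simp
  next
    case (Suc n)
    then have n: "n \<le> N" "Suc n \<le> N" "n < N" and IH: "gn True (\<lambda>j. v n j - w n j) = 0" by auto
    let ?e = "gn True (\<lambda>j. v (Suc n) j - w (Suc n) j)"
    have "?e \<le> gn True (\<lambda>j. v n j - w n j) + \<tau> * gn True (\<lambda>j. rhs (v (Suc n)) (v n) j - rhs (w (Suc n)) (w n) j)"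
      by (rule cn_step_stable[OF h \<tau> M0 cn_step_diff[OF v(2)[OF n(3)] w(2)[OF n(3)]]])
        (intro zero_bdry_intros zero_bdry_cnfd_rhs v(1) w(1) n)+
    also have "\<dots> \<le> 0 + \<tau> * (lip R * (?e + gn True (\<lambda>j. v n j - w n j)))"
      using \<tau> IH n by (intro add_mono mult_left_mono rhs_lipschitz R v(1,3) w(1,3)) auto
    finally have "?e \<le> (\<tau> * lip R) * ?e" using IH by simp
    then have "(1 - \<tau> * lip R) * ?e \<le> 0" by (simp add: algebra_simps)
    then have "?e \<le> 0" using small by (simp add: mult_le_0_iff)
    then show ?case using gn_nonneg[of True "\<lambda>j. v (Suc n) j - w (Suc n) j"] by linarith
  qed
  then have "cmod (v n j - w n j) \<le> sqrt (h * real M) * 0"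
    using sup_bound[OF zero_bdry_intros(2)[OF v(1)[OF nj(1)] w(1)[OF nj(1)]] nj(2)] by simp
  then show ?thesis by simp
qed

text \<open>Discrete Gronwall argument. The error is measured in either norm \<open>s\<close>, while
  the Lipschitz constant always comes from the H^1 ball that contains both sequences.\<close>

lemma error_bound:
  assumes u: "\<And>k. k \<le> N \<Longrightarrow> zero_bdry M (u k)" "\<And>k. k < N \<Longrightarrow> cn_step h \<tau> M (u k) (u (Suc k)) (rhs (u (Suc k)) (u k))"
      "\<And>k. k \<le> N \<Longrightarrow> gn True (u k) \<le> R"
    and p: "\<And>k. k \<le> N \<Longrightarrow> zero_bdry M (p k)"
      "\<And>k. k < N \<Longrightarrow> cn_step h \<tau> M (p k) (p (Suc k)) (\<lambda>j. rhs (p (Suc k)) (p k) j + \<xi> k j)"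
      "\<And>k. k \<le> N \<Longrightarrow> gn True (p k) \<le> R"
    and \<xi>: "\<And>k. k < N \<Longrightarrow> zero_bdry M (\<xi> k)" "\<And>k. k < N \<Longrightarrow> gn s (\<xi> k) \<le> \<epsilon>"
    and init: "\<And>j. j \<le> M \<Longrightarrow> p 0 j = u 0 j"
    and R: "0 \<le> R" and small: "\<tau> * lip R \<le> 1/2" and \<epsilon>: "0 \<le> \<epsilon>" and n: "n \<le> N"
  shows "gn s (\<lambda>j. p n j - u n j) \<le> 2 * (real n * \<tau>) * \<epsilon> * exp (4 * lip R * (real n * \<tau>))"
  using n
proof (induction n)
  case 0
  have "gn s (\<lambda>j. p 0 j - u 0 j) = gn s (\<lambda>j. 0)" by (rule grid_norm_cong) (use init in auto)
  then show ?case by simp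
next
  case (Suc n)
  then have n: "n \<le> N" "Suc n \<le> N" "n < N" by auto
  let ?e = "\<lambda>n. gn s (\<lambda>j. p n j - u n j)" and ?x = "\<tau> * lip R"
  let ?B = "2 * (real n * \<tau>) * \<epsilon> * exp (4 * lip R * (real n * \<tau>))"
  have x0: "0 \<le> ?x" using \<tau> lip_nonneg by simp
  have "(\<lambda>j. (rhs (p (Suc n)) (p n) j + \<xi> n j) - rhs (u (Suc n)) (u n) j) = (\<lambda>j. (rhs (p (Suc n)) (p n) j - rhs (u (Suc n)) (u n) j) + \<xi> n j)"
    by auto
  then have st: "cn_step h \<tau> M (\<lambda>j. p n j - u n j) (\<lambda>j. p (Suc n) j - u (Suc n) j)
     (\<lambda>j. (rhs (p (Suc n)) (p n) j - rhs (u (Suc n)) (u n) j) + \<xi> n j)"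
    using cn_step_diff[OF p(2)[OF n(3)] u(2)[OF n(3)]] by simp
  have "?e (Suc n) \<le> ?e n + \<tau> * gn s (\<lambda>j. (rhs (p (Suc n)) (p n) j - rhs (u (Suc n)) (u n) j) + \<xi> n j)"
    by (rule cn_step_stable[OF h \<tau> M0 st])
      (intro zero_bdry_intros zero_bdry_cnfd_rhs p(1) u(1) \<xi>(1) n)+
  also have "\<dots> \<le> ?e n + \<tau> * (lip R * (?e (Suc n) + ?e n) + \<epsilon>)"
  proof (intro add_left_mono mult_left_mono)
    have "gn s (\<lambda>j. (rhs (p (Suc n)) (p n) j - rhs (u (Suc n)) (u n) j) + \<xi> n j)
       \<le> gn s (\<lambda>j. rhs (p (Suc n)) (p n) j - rhs (u (Suc n)) (u n) j) + gn s (\<xi> n)"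
      using h by (intro grid_norm_triangle) simp
    also have "\<dots> \<le> lip R * (?e (Suc n) + ?e n) + \<epsilon>"
      by (intro add_mono rhs_lipschitz R p(1,3) u(1,3) n \<xi>(2))
    finally show "gn s (\<lambda>j. (rhs (p (Suc n)) (p n) j - rhs (u (Suc n)) (u n) j) + \<xi> n j) \<le> lip R * (?e (Suc n) + ?e n) + \<epsilon>" .
  qed (use \<tau> in simp)
  finally have "(1 - ?x) * ?e (Suc n) \<le> (1 + ?x) * ?e n + \<tau> * \<epsilon>" by (simp add: algebra_simps)
  also have "\<dots> \<le> (1 - ?x) * ((1 + 4 * ?x) * ?e n + 2 * \<tau> * \<epsilon>)"
  proof -
    \<comment> \<open>For x = \<tau> lip R at most 1/2, absorbing the new error on the left costs
      the factors (1 + x) / (1 - x) <= 1 + 4 x and 1 / (1 - x) <= 2.\<close>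
    have "0 \<le> ?x * (1 - 2 * ?x)" using x0 small by simp
    then have "1 + ?x \<le> (1 - ?x) * (1 + 4 * ?x)" by (simp add: algebra_simps)
    then have "(1 + ?x) * ?e n \<le> ((1 - ?x) * (1 + 4 * ?x)) * ?e n" by (intro mult_right_mono gn_nonneg)
    moreover have "1 * (\<tau> * \<epsilon>) \<le> ((1 - ?x) * 2) * (\<tau> * \<epsilon>)" using small \<tau> \<epsilon> by (intro mult_right_mono) auto
    ultimately show ?thesis unfolding distrib_left mult.assoc[symmetric] mult_1 by (rule add_mono)
  qed
  finally have "?e (Suc n) \<le> (1 + 4 * ?x) * ?e n + 2 * \<tau> * \<epsilon>"
    by (rule mult_left_le_imp_le) (use small in linarith)
  also have "\<dots> \<le> exp (4 * ?x) * ?B + (2 * \<tau> * \<epsilon>) * exp (4 * lip R * (real (Suc n) * \<tau>))"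
  proof (rule add_mono)
    have "1 + 4 * ?x \<le> exp (4 * ?x)" by (rule exp_ge_add_one_self)
    moreover have "?e n \<le> ?B" using Suc.IH n by simp
    ultimately show "(1 + 4 * ?x) * ?e n \<le> exp (4 * ?x) * ?B"
      using gn_nonneg by (intro mult_mono) auto
    have "1 \<le> exp (4 * lip R * (real (Suc n) * \<tau>))" using \<tau> lip_nonneg by (simp add: one_le_exp_iff)
    then show "2 * \<tau> * \<epsilon> \<le> 2 * \<tau> * \<epsilon> * exp (4 * lip R * (real (Suc n) * \<tau>))"
      using mult_left_mono[of 1 "exp (4 * lip R * (real (Suc n) * \<tau>))" "2 * \<tau> * \<epsilon>"] \<tau> \<epsilon> by simp
  qed
  also have "exp (4 * ?x) * ?B = 2 * (real n * \<tau>) * \<epsilon> * (exp (4 * ?x) * exp (4 * lip R * (real n * \<tau>)))" by simp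
  also have "exp (4 * ?x) * exp (4 * lip R * (real n * \<tau>)) = exp (4 * lip R * (real (Suc n) * \<tau>))"
    by (simp add: algebra_simps flip: exp_add)
  finally show ?case by (simp add: algebra_simps)
qed

end

section \<open>Consistency and convergence\<close>

lemma has_vector_derivative_shift:
  fixes q :: "real \<Rightarrow> complex"
  assumes "(q has_vector_derivative D) (at (c + \<sigma> * r) within S)" "\<And>s. s \<in> R \<Longrightarrow> c + \<sigma> * s \<in> S" "r \<in> R"
  shows "((\<lambda>r. q (c + \<sigma> * r)) has_vector_derivative of_real \<sigma> * D) (at r within R)"
proof -
  have 1: "((\<lambda>r. c + \<sigma> * r) has_vector_derivative \<sigma>) (at r within R)"
    by (auto intro!: derivative_eq_intros simp flip: has_real_derivative_iff_has_vector_derivative)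
  have "(q has_vector_derivative D) (at (c + \<sigma> * r) within (\<lambda>r. c + \<sigma> * r) ` R)"
    by (rule has_vector_derivative_within_subset[OF assms(1)]) (use assms(2) in auto)
  from vector_diff_chain_within[OF 1 this] show ?thesis by (simp add: o_def scaleR_conv_of_real)
qed

text \<open>A Taylor estimate by repeated mean value inequalities: each order below m starts from
  the value 0 and gains one factor h. Factorials are not tracked.\<close>

lemma iterated_derivative_bound:
  fixes e :: "nat \<Rightarrow> real \<Rightarrow> complex"
  assumes "\<And>k r. k < m \<Longrightarrow> r \<in> {0..h} \<Longrightarrow> (e k has_vector_derivative e (Suc k) r) (at r within {0..h})"
    "\<And>k. k < m \<Longrightarrow> e k 0 = 0" "\<And>r. r \<in> {0..h} \<Longrightarrow> cmod (e m r) \<le> B" and h: "0 \<le> h" and B: "0 \<le> B" and i: "i \<le> m" "r \<in> {0..h}"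
  shows "cmod (e (m - i) r) \<le> B * h ^ i"
  using i
proof (induction i arbitrary: r)
  case (Suc i)
  let ?k = "m - Suc i"
  have k: "Suc ?k = m - i" "?k < m" using Suc.prems by auto
  have "cmod (e ?k r - e ?k 0) \<le> (B * h ^ i) * \<bar>r - 0\<bar>"
  proof (rule vector_derivative_bound[where S = "{0..h}"])
    show "(e ?k has_vector_derivative e (m - i) s) (at s within {0..h})" if "s \<in> {0..h}" for s
      using assms(1)[OF k(2) that] k(1) by simp
    show "cmod (e (m - i) s) \<le> B * h ^ i" if "s \<in> {0..h}" for s using Suc.IH[OF _ that] Suc.prems by simp
  qed (use Suc.prems h in auto)
  also have "\<dots> \<le> (B * h ^ i) * h" using Suc.prems B h by (intro mult_left_mono) auto
  finally show ?case using assms(2)[OF k(2)] by (simp add: mult_ac)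
qed (use assms(3) in simp)

text \<open>As a function of the step s the unscaled error vanishes at s = 0 together with its
  derivative, and its second derivative is - s g'''(t + s) / 2. This gives third order, and division
  by \<tau> leaves second order.\<close>

lemma trapezoid_error:
  fixes g :: "nat \<Rightarrow> real \<Rightarrow> complex"
  assumes g: "\<And>k s. k < 3 \<Longrightarrow> s \<in> {0..T} \<Longrightarrow> (g k has_vector_derivative g (Suc k) s) (at s within {0..T})"
    and B: "\<And>s. s \<in> {0..T} \<Longrightarrow> cmod (g 3 s) \<le> B" "0 \<le> B" and t: "0 \<le> t" "t + \<tau> \<le> T" "0 < \<tau>"
  shows "cmod ((g 0 (t + \<tau>) - g 0 t) / of_real \<tau> - (g 1 (t + \<tau>) + g 1 t) / 2) \<le> B * \<tau>\<^sup>2"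
proof -
  define e :: "nat \<Rightarrow> real \<Rightarrow> complex" where
    "e k s = (if k = 0 then g 0 (t + 1 * s) - g 0 t - of_real s * ((g 1 t + g 1 (t + 1 * s)) / 2)
      else if k = 1 then (g 1 (t + 1 * s) - g 1 t) / 2 - of_real s * (g 2 (t + 1 * s) / 2)
      else - (of_real s * (g 3 (t + 1 * s) / 2)))" for k s
  have sub: "t + 1 * s \<in> {0..T}" if "s \<in> {0..\<tau>}" for s using that t by auto
  have gs: "((\<lambda>s. g k (t + 1 * s)) has_vector_derivative g (Suc k) (t + 1 * s)) (at s within {0..\<tau>})" if "k < 3" "s \<in> {0..\<tau>}" for k s
    using has_vector_derivative_shift[where c = t and \<sigma> = 1 and r = s, OF g[OF that(1) sub[OF that(2)]] sub that(2)] by simp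
  have idv: "((\<lambda>s. complex_of_real s) has_vector_derivative 1) (at s within {0..\<tau>})" for s
    using has_vector_derivative_of_real[OF DERIV_ident] by simp
  have "cmod (e (2 - 2) \<tau>) \<le> (B * \<tau>) * \<tau> ^ 2"
  proof (rule iterated_derivative_bound)
    fix k :: nat and s assume k: "k < 2" and s: "s \<in> {0..\<tau>}"
    have g0: "((\<lambda>s. g 0 (t + 1 * s)) has_vector_derivative g 1 (t + 1 * s)) (at s within {0..\<tau>})" using gs[of 0 s] s by simp
    have g1: "((\<lambda>s. g 1 (t + 1 * s)) has_vector_derivative g 2 (t + 1 * s)) (at s within {0..\<tau>})" using gs[of 1 s] s by (simp add: numeral_2_eq_2)
    have g2: "((\<lambda>s. g 2 (t + 1 * s)) has_vector_derivative g 3 (t + 1 * s)) (at s within {0..\<tau>})" using gs[of 2 s] s by (simp add: eval_nat_numeral)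
    have half: "((\<lambda>s. f s / 2) has_vector_derivative f' / 2) (at s within {0..\<tau>})" if "(f has_vector_derivative f') (at s within {0..\<tau>})" for f :: "real \<Rightarrow> complex" and f'
      using has_vector_derivative_mult_left[OF that, of "1/2"] by simp
    show "(e k has_vector_derivative e (Suc k) s) (at s within {0..\<tau>})"
    proof (cases "k = 0")
      case True
      have "((\<lambda>s. g 0 (t + 1 * s) - g 0 t - of_real s * ((g 1 t + g 1 (t + 1 * s)) / 2)) has_vector_derivative
         g 1 (t + 1 * s) - 0 - (of_real s * ((0 + g 2 (t + 1 * s)) / 2) + 1 * ((g 1 t + g 1 (t + 1 * s)) / 2))) (at s within {0..\<tau>})"
        by (intro has_vector_derivative_diff has_vector_derivative_mult has_vector_derivative_add half g0 g1 idv has_vector_derivative_const)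
      moreover have "g 1 (t + 1 * s) - 0 - (of_real s * ((0 + g 2 (t + 1 * s)) / 2) + 1 * ((g 1 t + g 1 (t + 1 * s)) / 2)) = e 1 s"
        by (simp add: e_def field_simps)
      moreover have "e k = (\<lambda>s. g 0 (t + 1 * s) - g 0 t - of_real s * ((g 1 t + g 1 (t + 1 * s)) / 2))"
        using True by (simp add: e_def fun_eq_iff)
      ultimately show ?thesis using True by simp
    next
      case False
      then have k1: "k = 1" using k by simp
      have "((\<lambda>s. (g 1 (t + 1 * s) - g 1 t) / 2 - of_real s * (g 2 (t + 1 * s) / 2)) has_vector_derivative
         (g 2 (t + 1 * s) - 0) / 2 - (of_real s * (g 3 (t + 1 * s) / 2) + 1 * (g 2 (t + 1 * s) / 2))) (at s within {0..\<tau>})"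
        by (intro has_vector_derivative_diff has_vector_derivative_mult half g1 g2 idv has_vector_derivative_const)
      moreover have "(g 2 (t + 1 * s) - 0) / 2 - (of_real s * (g 3 (t + 1 * s) / 2) + 1 * (g 2 (t + 1 * s) / 2)) = e 2 s"
        by (simp add: e_def)
      moreover have "e k = (\<lambda>s. (g 1 (t + 1 * s) - g 1 t) / 2 - of_real s * (g 2 (t + 1 * s) / 2))"
        using k1 by (simp add: e_def fun_eq_iff)
      ultimately show ?thesis using k1 by (simp add: numeral_2_eq_2)
    qed
  next
    show "e k 0 = 0" for k by (simp add: e_def)
    show "cmod (e 2 s) \<le> B * \<tau>" if s: "s \<in> {0..\<tau>}" for s
    proof -
      have "cmod (e 2 s) = s * cmod (g 3 (t + 1 * s)) / 2" using s by (simp add: e_def norm_mult)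
      also have "\<dots> \<le> s * cmod (g 3 (t + 1 * s))" using s by simp
      also have "\<dots> \<le> \<tau> * B" using s B(1)[OF sub[OF s]] B(2) by (intro mult_mono) auto
      finally show ?thesis by (simp add: mult.commute)
    qed
  qed (use t B in auto)
  then have le: "cmod (g 0 (t + \<tau>) - g 0 t - of_real \<tau> * ((g 1 t + g 1 (t + \<tau>)) / 2)) \<le> B * \<tau> ^ 2 * \<tau>"
    by (simp add: e_def mult_ac)
  have "(g 0 (t + \<tau>) - g 0 t) / of_real \<tau> - (g 1 (t + \<tau>) + g 1 t) / 2 = (g 0 (t + \<tau>) - g 0 t - of_real \<tau> * ((g 1 t + g 1 (t + \<tau>)) / 2)) / of_real \<tau>"
    using t by (simp add: field_simps)
  then have "cmod ((g 0 (t + \<tau>) - g 0 t) / of_real \<tau> - (g 1 (t + \<tau>) + g 1 t) / 2) = cmod (g 0 (t + \<tau>) - g 0 t - of_real \<tau> * ((g 1 t + g 1 (t + \<tau>)) / 2)) / \<tau>"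
    using t by (simp add: norm_divide)
  also have "\<dots> \<le> (B * \<tau> ^ 2 * \<tau>) / \<tau>" using le t by (intro divide_right_mono) auto
  finally show ?thesis using t by simp
qed

text \<open>The function q(x + r) + q(x - r) - 2 q(x) - r^2 q''(x) of r vanishes at 0 with its
  derivatives up to order three, and its fourth derivative is at most 2 B. The sign (-1)^k in
  \<open>e\<close> comes from differentiating the reflected branch.\<close>

lemma second_difference_error:
  fixes q :: "nat \<Rightarrow> real \<Rightarrow> complex"
  assumes q: "\<And>k y. k < 4 \<Longrightarrow> y \<in> {x - h..x + h} \<Longrightarrow> (q k has_vector_derivative q (Suc k) y) (at y within {x - h..x + h})"
    and B: "\<And>y. y \<in> {x - h..x + h} \<Longrightarrow> cmod (q 4 y) \<le> B" and h: "0 < h"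
  shows "cmod ((q 0 (x + h) - 2 * q 0 x + q 0 (x - h)) / of_real (h\<^sup>2) - q 2 x) \<le> 2 * B * h\<^sup>2"
proof -
  have B0: "0 \<le> B" by (rule order_trans[OF norm_ge_zero B[of x]]) (use h in auto)
  define c :: "nat \<Rightarrow> real \<Rightarrow> complex" where
    "c k r = (if k = 0 then 2 * q 0 x + of_real (r\<^sup>2) * q 2 x else if k = 1 then 2 * of_real r * q 2 x
       else if k = 2 then 2 * q 2 x else 0)" for k r
  define e :: "nat \<Rightarrow> real \<Rightarrow> complex" where
    "e k r = q k (x + 1 * r) + (-1) ^ k * q k (x + (-1) * r) - c k r" for k r
  have sub: "x + 1 * r \<in> {x - h..x + h}" "x + (-1) * r \<in> {x - h..x + h}" if "r \<in> {0..h}" for r using that by auto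
  have cd: "(c k has_vector_derivative c (Suc k) r) (at r within {0..h})" for k r
  proof -
    have idv: "((\<lambda>s. complex_of_real s) has_vector_derivative 1) (at r within {0..h})"
      using has_vector_derivative_of_real[OF DERIV_ident] by simp
    consider "k = 0" | "k = 1" | "k = 2" | "3 \<le> k" by linarith
    then show ?thesis
    proof cases
      case 1
      have "((\<lambda>r. 2 * q 0 x + (of_real r * of_real r) * q 2 x) has_vector_derivative 0 + (of_real r * 1 + 1 * of_real r) * q 2 x) (at r within {0..h})"
        by (intro has_vector_derivative_add has_vector_derivative_const has_vector_derivative_mult_left has_vector_derivative_mult idv)
      moreover have "c k = (\<lambda>r. 2 * q 0 x + (of_real r * of_real r) * q 2 x)" using 1 by (auto simp: c_def power2_eq_square)
      ultimately show ?thesis using 1 by (simp add: c_def)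
    next
      case 2
      have "((\<lambda>r. 2 * of_real r * q 2 x) has_vector_derivative 2 * 1 * q 2 x) (at r within {0..h})"
        by (intro has_vector_derivative_mult_left has_vector_derivative_mult_right idv)
      moreover have "c k = (\<lambda>r. 2 * of_real r * q 2 x)" using 2 by (auto simp: c_def)
      ultimately show ?thesis using 2 by (simp add: c_def)
    next
      case 3
      have "c k = (\<lambda>r. 2 * q 2 x)" "c (Suc k) r = 0" using 3 by (auto simp: c_def)
      then show ?thesis by simp
    next
      case 4
      have "c k = (\<lambda>r. 0)" "c (Suc k) r = 0" using 4 by (auto simp: c_def)
      then show ?thesis by simp
    qed
  qed
  have "cmod (e (4 - 4) h) \<le> (2 * B) * h ^ 4"
  proof (rule iterated_derivative_bound)
    fix k :: nat and r assume k: "k < 4" and r: "r \<in> {0..h}"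
    have 1: "((\<lambda>r. q k (x + 1 * r)) has_vector_derivative of_real 1 * q (Suc k) (x + 1 * r)) (at r within {0..h})"
      by (rule has_vector_derivative_shift[where c = x and \<sigma> = 1 and r = r, OF q[OF k sub(1)[OF r]] sub(1) r])
    have 2: "((\<lambda>r. q k (x + (-1) * r)) has_vector_derivative of_real (-1) * q (Suc k) (x + (-1) * r)) (at r within {0..h})"
      by (rule has_vector_derivative_shift[where c = x and \<sigma> = "-1" and r = r, OF q[OF k sub(2)[OF r]] sub(2) r])
    have "((\<lambda>r. q k (x + 1 * r) + (-1) ^ k * q k (x + (-1) * r) - c k r) has_vector_derivative
       of_real 1 * q (Suc k) (x + 1 * r) + (-1) ^ k * (of_real (-1) * q (Suc k) (x + (-1) * r)) - c (Suc k) r) (at r within {0..h})"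
      by (intro has_vector_derivative_add has_vector_derivative_diff has_vector_derivative_mult_right 1 2 cd)
    then show "(e k has_vector_derivative e (Suc k) r) (at r within {0..h})"
      unfolding e_def by simp
  next
    show "e k 0 = 0" if k: "k < 4" for k
    proof -
      consider "k = 0" | "k = 1" | "k = 2" | "k = 3" using k by linarith
      then show ?thesis by cases (simp_all add: e_def c_def)
    qed
    show "cmod (e 4 r) \<le> 2 * B" if r: "r \<in> {0..h}" for r
      unfolding e_def c_def
      using norm_triangle_ineq[of "q 4 (x + 1 * r)" "q 4 (x + (-1) * r)"] B[OF sub(1)[OF r]] B[OF sub(2)[OF r]] by simp
  qed (use h B0 in auto)
  then have le: "cmod (q 0 (x + h) - 2 * q 0 x + q 0 (x - h) - of_real (h\<^sup>2) * q 2 x) \<le> 2 * B * h ^ 4"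
    by (simp add: e_def c_def algebra_simps)
  have "(q 0 (x + h) - 2 * q 0 x + q 0 (x - h)) / of_real (h\<^sup>2) - q 2 x = (q 0 (x + h) - 2 * q 0 x + q 0 (x - h) - of_real (h\<^sup>2) * q 2 x) / of_real (h\<^sup>2)"
    using h by (simp add: field_simps)
  then have "cmod ((q 0 (x + h) - 2 * q 0 x + q 0 (x - h)) / of_real (h\<^sup>2) - q 2 x) = cmod (q 0 (x + h) - 2 * q 0 x + q 0 (x - h) - of_real (h\<^sup>2) * q 2 x) / h\<^sup>2"
    by (simp add: norm_divide norm_power)
  also have "\<dots> \<le> (2 * B * h ^ 4) / h\<^sup>2" using le by (intro divide_right_mono) auto
  also have "\<dots> = 2 * B * h\<^sup>2" using h by (simp add: power4_eq_xxxx power2_eq_square)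
  finally show ?thesis .
qed

lemma cmod_triple_diff:
  fixes f g k f' g' k' :: complex
  assumes "cmod f \<le> F" "cmod g \<le> G" "cmod k' \<le> H" "cmod g' \<le> G" "cmod f' \<le> F" "cmod k \<le> H"
    "cmod (f - f') \<le> F * \<delta>" "cmod (g - g') \<le> G * \<delta>" "cmod (k - k') \<le> H * \<delta>"
    and nn: "0 \<le> F" "0 \<le> G" "0 \<le> H" "0 \<le> \<delta>"
  shows "cmod (f * g * k - f' * g' * k') \<le> 3 * (F * G * H) * \<delta>"
proof -
  have "f * g * k - f' * g' * k' = (f - f') * g * k + f' * (g - g') * k + f' * g' * (k - k')"
    by (simp add: algebra_simps)
  also have "cmod \<dots> \<le> cmod (f - f') * cmod g * cmod k + cmod f' * cmod (g - g') * cmod k + cmod f' * cmod g' * cmod (k - k')"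
    by (metis norm_mult norm_triangle_le add_right_mono norm_triangle_ineq)
  also have "\<dots> \<le> (F * \<delta>) * G * H + F * (G * \<delta>) * H + F * G * (H * \<delta>)"
    using assms by (intro add_mono mult_mono) auto
  finally show ?thesis by (simp add: algebra_simps)
qed

text \<open>\<open>d l\<close> is the \<open>l\<close>-th time derivative and \<open>P t j\<close> the \<open>j\<close>-th space derivative of \<open>\<psi>\<close>.\<close>

locale regular_solution =
  fixes a b T \<beta> K :: real and V :: "real \<Rightarrow> real" and \<psi> :: "real \<Rightarrow> real \<Rightarrow> complex"
    and P :: "real \<Rightarrow> nat \<Rightarrow> real \<Rightarrow> complex" and d :: "nat \<Rightarrow> real \<Rightarrow> real \<Rightarrow> complex"
  assumes ab: "a < b" and K0: "0 \<le> K"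
    and rep: "\<And>t. t \<in> {0..T} \<Longrightarrow> sob_rep a b 5 (P t) K (\<psi> t)"
    and P0: "\<And>t x. t \<in> {0..T} \<Longrightarrow> x \<in> {a..b} \<Longrightarrow> P t 0 x = \<psi> t x"
    and d0: "\<And>t x. t \<in> {0..T} \<Longrightarrow> x \<in> {a..b} \<Longrightarrow> d 0 t x = \<psi> t x"
    and der: "\<And>l t x. l < 3 \<Longrightarrow> t \<in> {0..T} \<Longrightarrow> x \<in> {a..b} \<Longrightarrow>
        ((\<lambda>s. d l s x) has_vector_derivative d (Suc l) t x) (at t within {0..T})"
    and bd: "\<And>l t x. l \<le> 3 \<Longrightarrow> t \<in> {0..T} \<Longrightarrow> x \<in> {a..b} \<Longrightarrow> cmod (d l t x) \<le> K"
    and Ld: "\<And>l t x y. l \<le> 3 \<Longrightarrow> t \<in> {0..T} \<Longrightarrow> x \<in> {a..b} \<Longrightarrow> y \<in> {a..b} \<Longrightarrow> cmod (d l t x - d l t y) \<le> K * \<bar>x - y\<bar>"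
    and pde: "\<And>t x. t \<in> {0..T} \<Longrightarrow> x \<in> {a..b} \<Longrightarrow> \<i> * d 1 t x = - (1/2) * P t 2 x
        + (of_real (V x) * \<psi> t x + of_real (\<beta> * (cmod (\<psi> t x))\<^sup>2) * \<psi> t x)"
    and bdry: "\<And>t e. t \<in> {0..T} \<Longrightarrow> e \<in> {a, b} \<Longrightarrow> \<psi> t e = 0"
begin

section \<open>The residual of the exact solution\<close>

lemma time_derivative_zero_at_boundary:
  assumes "t \<in> {0..T}" "0 < T" "e \<in> {a, b}"
  shows "d 1 t e = 0"
proof (rule vector_derivative_unique_within)
  have e: "e \<in> {a..b}" using assms ab by auto
  show "at t within {0..T} \<noteq> bot" using assms by (simp add: trivial_limit_within islimpt_Icc)
  show "((\<lambda>s. d 0 s e) has_vector_derivative d 1 t e) (at t within {0..T})" using der[of 0 t e] assms e by simp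
  show "((\<lambda>s. d 0 s e) has_vector_derivative 0) (at t within {0..T})"
    using has_vector_derivative_transform[OF assms(1) _ has_vector_derivative_const, of "\<lambda>s. d 0 s e" 0] d0[OF _ e] bdry assms by simp
qed

text \<open>Mean value inequality in time. For the second claim it is applied to the difference of
  the values at two points, whose time derivative is small by the Lipschitz bound on
  \<open>d 1\<close>.\<close>

lemma time_increment:
  assumes t: "0 \<le> t" "t + \<tau> \<le> T" "0 < \<tau>" and x: "x \<in> {a..b}"
  shows "cmod (\<psi> (t + \<tau>) x - \<psi> t x) \<le> K * \<tau>"
    and "y \<in> {a..b} \<Longrightarrow> cmod ((\<psi> (t + \<tau>) x - \<psi> t x) - (\<psi> (t + \<tau>) y - \<psi> t y)) \<le> (K * \<tau>) * \<bar>x - y\<bar>"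
proof -
  have I: "t \<in> {0..T}" "t + \<tau> \<in> {0..T}" using t by auto
  have "cmod (d 0 (t + \<tau>) x - d 0 t x) \<le> K * \<bar>t + \<tau> - t\<bar>"
    by (rule vector_derivative_bound[where S = "{0..T}" and f = "\<lambda>s. d 0 s x" and f' = "\<lambda>s. d 1 s x"])
      (use der[of 0 _ x] bd[of 1 _ x] x I in auto)
  then show "cmod (\<psi> (t + \<tau>) x - \<psi> t x) \<le> K * \<tau>" using d0 I x t by simp
  assume y: "y \<in> {a..b}"
  have "cmod ((d 0 (t + \<tau>) x - d 0 (t + \<tau>) y) - (d 0 t x - d 0 t y)) \<le> (K * \<bar>x - y\<bar>) * \<bar>t + \<tau> - t\<bar>"
    by (rule vector_derivative_bound[where S = "{0..T}" and f = "\<lambda>s. d 0 s x - d 0 s y" and f' = "\<lambda>s. d 1 s x - d 1 s y"])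
      (use der[of 0 _ x] der[of 0 _ y] Ld[of 1 _ x y] x y I in \<open>auto intro!: has_vector_derivative_diff\<close>)
  then have "cmod ((d 0 (t + \<tau>) x - d 0 (t + \<tau>) y) - (d 0 t x - d 0 t y)) \<le> (K * \<tau>) * \<bar>x - y\<bar>" using t by (simp add: mult_ac)
  moreover have "(d 0 (t + \<tau>) x - d 0 (t + \<tau>) y) - (d 0 t x - d 0 t y) = (\<psi> (t + \<tau>) x - \<psi> t x) - (\<psi> (t + \<tau>) y - \<psi> t y)"
    using d0 I x y by simp
  ultimately show "cmod ((\<psi> (t + \<tau>) x - \<psi> t x) - (\<psi> (t + \<tau>) y - \<psi> t y)) \<le> (K * \<tau>) * \<bar>x - y\<bar>" by simp
qed

definition resA :: "real \<Rightarrow> real \<Rightarrow> real \<Rightarrow> complex" where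
  "resA t \<tau> x = (\<psi> (t + \<tau>) x - \<psi> t x) / of_real \<tau> - (d 1 (t + \<tau>) x + d 1 t x) / 2"

definition resB :: "real \<Rightarrow> real \<Rightarrow> real \<Rightarrow> complex" where
  "resB t h x = (\<psi> t (x + h) - 2 * \<psi> t x + \<psi> t (x - h)) / of_real (h\<^sup>2) - P t 2 x"

text \<open>With p and q the values at the new and the old level this is (|p|^2 - |q|^2)(p - q) / 4:
  the mean of |p|^2 p and |q|^2 q minus the cubic term of the scheme. The expanded form exhibits two
  time increments in each product.\<close>

definition resC :: "real \<Rightarrow> real \<Rightarrow> real \<Rightarrow> complex" where
  "resC t \<tau> x = (\<psi> (t + \<tau>) x * cnj (\<psi> (t + \<tau>) x - \<psi> t x) * (\<psi> (t + \<tau>) x - \<psi> t x)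
      + cnj (\<psi> t x) * (\<psi> (t + \<tau>) x - \<psi> t x) * (\<psi> (t + \<tau>) x - \<psi> t x)) / 4"

text \<open>Averaging the equation over the two time levels, instead of evaluating it at the midpoint,
  cancels the potential from the residual and needs no mixed space-time derivatives of \<open>\<psi>\<close>.\<close>

definition residual :: "real \<Rightarrow> real \<Rightarrow> real \<Rightarrow> real \<Rightarrow> complex" where
  "residual t \<tau> h x = \<i> * resA t \<tau> x + (resB (t + \<tau>) h x + resB t h x) / 4 + of_real \<beta> * resC t \<tau> x"

lemma residual_equation:
  assumes t: "0 \<le> t" "t + \<tau> \<le> T" "0 < \<tau>" and x: "x \<in> {a..b}"
  shows "\<i> * ((\<psi> (t + \<tau>) x - \<psi> t x) / of_real \<tau>)
    = - (1/2) * (((\<psi> (t + \<tau>) (x + h) + \<psi> t (x + h)) / 2 - 2 * ((\<psi> (t + \<tau>) x + \<psi> t x) / 2) + (\<psi> (t + \<tau>) (x - h) + \<psi> t (x - h)) / 2) / of_real (h\<^sup>2))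
      + (of_real (V x + \<beta> / 2 * ((cmod (\<psi> (t + \<tau>) x))\<^sup>2 + (cmod (\<psi> t x))\<^sup>2)) * ((\<psi> (t + \<tau>) x + \<psi> t x) / 2) + residual t \<tau> h x)"
proof -
  have I: "t \<in> {0..T}" "t + \<tau> \<in> {0..T}" using t by auto
  \<comment> \<open>All values become plain variables, so that after inserting the equation at both
    levels the claim is a polynomial identity.\<close>
  obtain p q where p: "\<psi> (t + \<tau>) x = p" and q: "\<psi> t x = q" by blast
  obtain p1 q1 where p1: "\<psi> (t + \<tau>) (x + h) = p1" and q1: "\<psi> t (x + h) = q1" by blast
  obtain p2 q2 where p2: "\<psi> (t + \<tau>) (x - h) = p2" and q2: "\<psi> t (x - h) = q2" by blast
  obtain D where D: "(p - q) / of_real \<tau> = D" by blast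
  obtain e1 e2 where e1: "d 1 (t + \<tau>) x = e1" and e2: "d 1 t x = e2" by blast
  obtain f1 f2 where f1: "P (t + \<tau>) 2 x = f1" and f2: "P t 2 x = f2" by blast
  obtain v where v: "complex_of_real (V x) = v" by blast
  obtain B where B: "complex_of_real \<beta> = B" by blast
  obtain H where H: "inverse (complex_of_real (h\<^sup>2)) = H" by blast
  have E1: "\<i> * e1 = - (1/2) * f1 + (v * p + B * (p * cnj p) * p)"
    using pde[OF I(2) x] unfolding p e1 f1 of_real_mult B complex_norm_square v .
  have E2: "\<i> * e2 = - (1/2) * f2 + (v * q + B * (q * cnj q) * q)"
    using pde[OF I(1) x] unfolding q e2 f2 of_real_mult B complex_norm_square v .
  have A: "\<i> * resA t \<tau> x = \<i> * D - (\<i> * e1 + \<i> * e2) / 2"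
    unfolding resA_def p q D e1 e2 by (simp add: algebra_simps)
  show ?thesis
    unfolding residual_def A E1 E2 resB_def resC_def p q p1 q1 p2 q2 D f1 f2 of_real_add of_real_mult of_real_divide v B complex_norm_square divide_inverse[of _ "complex_of_real (h\<^sup>2)"] H
    by (simp add: field_simps)
qed

lemma resA_bound:
  assumes t: "0 \<le> t" "t + \<tau> \<le> T" "0 < \<tau>" and x: "x \<in> {a..b}"
  shows "cmod (resA t \<tau> x) \<le> K * \<tau>\<^sup>2"
proof -
  have I: "t \<in> {0..T}" "t + \<tau> \<in> {0..T}" using t by auto
  have "cmod ((d 0 (t + \<tau>) x - d 0 t x) / of_real \<tau> - (d 1 (t + \<tau>) x + d 1 t x) / 2) \<le> K * \<tau>\<^sup>2"
    by (rule trapezoid_error[where g = "\<lambda>k s. d k s x" and T = T])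
      (use der[of _ _ x] bd[of 3 _ x] x K0 t in auto)
  then show ?thesis using d0[OF I(1) x] d0[OF I(2) x] by (simp add: resA_def)
qed

text \<open>The trapezoidal estimate applied to the difference of \<psi> at two points; its third
  time derivative is of size |x - y|, so smoothness in time and a Lipschitz bound in space are all
  that enters.\<close>

lemma resA_lipschitz:
  assumes t: "0 \<le> t" "t + \<tau> \<le> T" "0 < \<tau>" and x: "x \<in> {a..b}" and y: "y \<in> {a..b}"
  shows "cmod (resA t \<tau> x - resA t \<tau> y) \<le> K * \<bar>x - y\<bar> * \<tau>\<^sup>2"
proof -
  have I: "t \<in> {0..T}" "t + \<tau> \<in> {0..T}" using t by auto
  have "cmod (((d 0 (t + \<tau>) x - d 0 (t + \<tau>) y) - (d 0 t x - d 0 t y)) / of_real \<tau> - ((d 1 (t + \<tau>) x - d 1 (t + \<tau>) y) + (d 1 t x - d 1 t y)) / 2) \<le> (K * \<bar>x - y\<bar>) * \<tau>\<^sup>2"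
    by (rule trapezoid_error[where g = "\<lambda>k s. d k s x - d k s y" and T = T])
      (use der[of _ _ x] der[of _ _ y] Ld[of 3 _ x y] x y K0 t in \<open>auto intro!: has_vector_derivative_diff\<close>)
  moreover have "((d 0 (t + \<tau>) x - d 0 (t + \<tau>) y) - (d 0 t x - d 0 t y)) / of_real \<tau> - ((d 1 (t + \<tau>) x - d 1 (t + \<tau>) y) + (d 1 t x - d 1 t y)) / 2
     = resA t \<tau> x - resA t \<tau> y"
    unfolding resA_def d0[OF I(1) x] d0[OF I(2) x] d0[OF I(1) y] d0[OF I(2) y] by (simp add: diff_divide_distrib add_divide_distrib)
  ultimately show ?thesis by simp
qed

lemma psi_bounds:
  assumes "t \<in> {0..T}" "x \<in> {a..b}"
  shows "cmod (\<psi> t x) \<le> K" "y \<in> {a..b} \<Longrightarrow> cmod (\<psi> t x - \<psi> t y) \<le> K * \<bar>x - y\<bar>"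
  using bd[of 0 t x] Ld[of 0 t x y] d0 assms by auto

lemma resC_bound:
  assumes t: "0 \<le> t" "t + \<tau> \<le> T" "0 < \<tau>" and x: "x \<in> {a..b}"
  shows "cmod (resC t \<tau> x) \<le> K ^ 3 * \<tau>\<^sup>2"
proof -
  have I: "t \<in> {0..T}" "t + \<tau> \<in> {0..T}" using t by auto
  let ?D = "\<psi> (t + \<tau>) x - \<psi> t x"
  note D = time_increment(1)[OF t x]
  have "cmod (resC t \<tau> x) = cmod (\<psi> (t + \<tau>) x * cnj ?D * ?D + cnj (\<psi> t x) * ?D * ?D) / 4"
    unfolding resC_def by (simp add: norm_divide)
  also have "\<dots> \<le> (K * (K * \<tau>) * (K * \<tau>) + K * (K * \<tau>) * (K * \<tau>)) / 4"
  proof (intro divide_right_mono order_trans[OF norm_triangle_ineq] add_mono)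
    show "cmod (\<psi> (t + \<tau>) x * cnj ?D * ?D) \<le> K * (K * \<tau>) * (K * \<tau>)"
      unfolding norm_mult complex_mod_cnj using D psi_bounds(1)[OF I(2) x] K0 t by (intro mult_mono) auto
    show "cmod (cnj (\<psi> t x) * ?D * ?D) \<le> K * (K * \<tau>) * (K * \<tau>)"
      unfolding norm_mult complex_mod_cnj using D psi_bounds(1)[OF I(1) x] K0 t by (intro mult_mono) auto
  qed simp
  also have "\<dots> = K ^ 3 * \<tau>\<^sup>2 / 2" by (simp add: power2_eq_square power3_eq_cube)
  also have "\<dots> \<le> K ^ 3 * \<tau>\<^sup>2" using K0 by simp
  finally show ?thesis .
qed

lemma resC_lipschitz:
  assumes t: "0 \<le> t" "t + \<tau> \<le> T" "0 < \<tau>" and x: "x \<in> {a..b}" and y: "y \<in> {a..b}"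
  shows "cmod (resC t \<tau> x - resC t \<tau> y) \<le> 2 * K ^ 3 * \<bar>x - y\<bar> * \<tau>\<^sup>2"
proof -
  have I: "t \<in> {0..T}" "t + \<tau> \<in> {0..T}" using t by auto
  let ?D = "\<lambda>x. \<psi> (t + \<tau>) x - \<psi> t x"
  note D = time_increment(1)[OF t]
  have DL: "cmod (?D x - ?D y) \<le> (K * \<tau>) * \<bar>x - y\<bar>" by (rule time_increment(2)[OF t x y])
  have cD: "cmod (cnj (?D x)) \<le> K * \<tau>" "cmod (cnj (?D y)) \<le> K * \<tau>" "cmod (cnj (?D x) - cnj (?D y)) \<le> (K * \<tau>) * \<bar>x - y\<bar>"
    using D x y DL by (simp_all only: complex_cnj_diff[symmetric] complex_mod_cnj)
  have cp: "cmod (cnj (\<psi> t x)) \<le> K" "cmod (cnj (\<psi> t y)) \<le> K" "cmod (cnj (\<psi> t x) - cnj (\<psi> t y)) \<le> K * \<bar>x - y\<bar>"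
    using psi_bounds[OF I(1)] x y by (simp_all only: complex_cnj_diff[symmetric] complex_mod_cnj)
  have nn: "0 \<le> K * \<tau>" "0 \<le> \<bar>x - y\<bar>" using K0 t by auto
  have "resC t \<tau> x - resC t \<tau> y = ((\<psi> (t + \<tau>) x * cnj (?D x) * ?D x - \<psi> (t + \<tau>) y * cnj (?D y) * ?D y)
     + (cnj (\<psi> t x) * ?D x * ?D x - cnj (\<psi> t y) * ?D y * ?D y)) / 4"
    unfolding resC_def diff_divide_distrib[symmetric] by (rule arg_cong[where f = "\<lambda>z. z / 4"]) (simp only: add_diff_add)
  then have "cmod (resC t \<tau> x - resC t \<tau> y) = cmod ((\<psi> (t + \<tau>) x * cnj (?D x) * ?D x - \<psi> (t + \<tau>) y * cnj (?D y) * ?D y)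
     + (cnj (\<psi> t x) * ?D x * ?D x - cnj (\<psi> t y) * ?D y * ?D y)) / 4" by (simp only: norm_divide) simp
  also have "\<dots> \<le> (3 * (K * (K * \<tau>) * (K * \<tau>)) * \<bar>x - y\<bar> + 3 * (K * (K * \<tau>) * (K * \<tau>)) * \<bar>x - y\<bar>) / 4"
  proof (intro divide_right_mono order_trans[OF norm_triangle_ineq] add_mono)
    show "cmod (\<psi> (t + \<tau>) x * cnj (?D x) * ?D x - \<psi> (t + \<tau>) y * cnj (?D y) * ?D y) \<le> 3 * (K * (K * \<tau>) * (K * \<tau>)) * \<bar>x - y\<bar>"
      by (rule cmod_triple_diff[OF _ cD(1) D[OF y] cD(2) _ D[OF x] _ cD(3) DL K0 nn(1) nn(1) nn(2)])
        (use psi_bounds[OF I(2)] x y in auto)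
    show "cmod (cnj (\<psi> t x) * ?D x * ?D x - cnj (\<psi> t y) * ?D y * ?D y) \<le> 3 * (K * (K * \<tau>) * (K * \<tau>)) * \<bar>x - y\<bar>"
      by (rule cmod_triple_diff[OF cp(1) D[OF x] D[OF y] D[OF y] cp(2) D[OF x] cp(3) DL DL K0 nn(1) nn(1) nn(2)])
  qed simp
  also have "\<dots> = (3/2) * K ^ 3 * \<bar>x - y\<bar> * \<tau>\<^sup>2" by (simp add: power2_eq_square power3_eq_cube)
  also have "\<dots> \<le> 2 * K ^ 3 * \<bar>x - y\<bar> * \<tau>\<^sup>2" using K0 by (intro mult_right_mono) auto
  finally show ?thesis .
qed

lemma P_chain:
  assumes "t \<in> {0..T}" "S \<subseteq> {a..b}" "k < 4" "y \<in> S"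
  shows "(P t k has_vector_derivative P t (Suc k) y) (at y within S)"
  by (rule has_vector_derivative_within_subset[OF sob_rep_deriv[OF rep[OF assms(1)]] assms(2)]) (use assms in auto)

text \<open>Only the fourth derivative on the stencil enters, which is what makes a gain possible
  next to an endpoint where it vanishes.\<close>

lemma resB_local_bound:
  assumes t: "t \<in> {0..T}" and h: "0 < h" and x: "a \<le> x - h" "x + h \<le> b"
    and B: "\<And>y. y \<in> {x - h..x + h} \<Longrightarrow> cmod (P t 4 y) \<le> B"
  shows "cmod (resB t h x) \<le> 2 * B * h\<^sup>2"
proof -
  have "cmod ((P t 0 (x + h) - 2 * P t 0 x + P t 0 (x - h)) / of_real (h\<^sup>2) - P t 2 x) \<le> 2 * B * h\<^sup>2"
    by (rule second_difference_error[OF P_chain[OF t] B h]) (use x in auto)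
  then show ?thesis using P0[OF t] x h by (simp add: resB_def)
qed

lemma P4_bound: "t \<in> {0..T} \<Longrightarrow> y \<in> {a..b} \<Longrightarrow> cmod (P t 4 y) \<le> K"
  by (rule sob_rep_bound[OF rep]) auto

lemma P4_lipschitz: "t \<in> {0..T} \<Longrightarrow> x \<in> {a..b} \<Longrightarrow> y \<in> {a..b} \<Longrightarrow> cmod (P t 4 x - P t 4 y) \<le> K * \<bar>x - y\<bar>"
  by (rule sob_rep_lipschitz[OF rep]) auto

lemma resB_bound:
  assumes "t \<in> {0..T}" "0 < h" "a \<le> x - h" "x + h \<le> b"
  shows "cmod (resB t h x) \<le> 2 * K * h\<^sup>2"
  by (rule resB_local_bound[OF assms P4_bound[OF assms(1)]]) (use assms in auto)

text \<open>The stencil lies within distance 2 h of e, and the fourth derivative is Lipschitz and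
  zero at e.\<close>

lemma resB_near_boundary:
  assumes t: "t \<in> {0..T}" and h: "0 < h" and x: "a \<le> x - h" "x + h \<le> b"
    and e: "e \<in> {a, b}" "\<bar>x - e\<bar> = h" "P t 4 e = 0"
  shows "cmod (resB t h x) \<le> 4 * K * h * h\<^sup>2"
proof -
  have "cmod (resB t h x) \<le> 2 * (K * (2 * h)) * h\<^sup>2"
  proof (rule resB_local_bound[OF t h x])
    fix y assume y: "y \<in> {x - h..x + h}"
    have "cmod (P t 4 y - P t 4 e) \<le> K * \<bar>y - e\<bar>"
      by (rule P4_lipschitz[OF t]) (use y x e ab in auto)
    also have "\<dots> \<le> K * (2 * h)"
    proof (intro mult_left_mono K0)
      have "\<bar>y - x\<bar> \<le> h" using y by auto
      then show "\<bar>y - e\<bar> \<le> 2 * h" using e(2) by linarith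
    qed
    finally show "cmod (P t 4 y) \<le> K * (2 * h)" using e by simp
  qed
  then show ?thesis by (simp add: mult_ac)
qed

text \<open>The difference of neighbouring truncation errors is the truncation error of the function
  y -> \<psi>(y + h) - \<psi>(y). Its fourth derivative is at most K h by Lipschitz continuity,
  which takes the place of a fifth derivative.\<close>

lemma resB_shift:
  assumes t: "t \<in> {0..T}" and h: "0 < h" and x: "a \<le> x - h" "x + 2 * h \<le> b"
  shows "cmod (resB t h (x + h) - resB t h x) \<le> 2 * (K * h) * h\<^sup>2"
proof -
  define q where "q k y = P t k (h + 1 * y) - P t k y" for k y
  have "cmod ((q 0 (x + h) - 2 * q 0 x + q 0 (x - h)) / of_real (h\<^sup>2) - q 2 x) \<le> 2 * (K * h) * h\<^sup>2"
  proof (rule second_difference_error[OF _ _ h])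
    show "cmod (q 4 y) \<le> K * h" if "y \<in> {x - h..x + h}" for y
      unfolding q_def using P4_lipschitz[OF t, of "h + 1 * y" y] that x h by auto
    fix k y assume k: "(k::nat) < 4" and y: "y \<in> {x - h..x + h}"
    have 1: "((\<lambda>y. P t k (h + 1 * y)) has_vector_derivative of_real 1 * P t (Suc k) (h + 1 * y)) (at y within {x - h..x + h})"
      by (rule has_vector_derivative_shift[where c = h and \<sigma> = 1 and r = y and S = "{a..b}", OF P_chain[OF t order_refl k] _ y])
        (use y x h in auto)
    have 2: "(P t k has_vector_derivative P t (Suc k) y) (at y within {x - h..x + h})"
      by (rule P_chain[OF t _ k y]) (use x h in auto)
    show "(q k has_vector_derivative q (Suc k) y) (at y within {x - h..x + h})"
      using has_vector_derivative_diff[OF 1 2] unfolding q_def by simp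
  qed
  moreover have "(q 0 (x + h) - 2 * q 0 x + q 0 (x - h)) / of_real (h\<^sup>2) - q 2 x = resB t h (x + h) - resB t h x"
  proof -
    have J: "x - h \<in> {a..b}" "x \<in> {a..b}" "x + h \<in> {a..b}" "x + h + h \<in> {a..b}" using x h by auto
    have s: "h + 1 * (x + h) = x + h + h" "h + 1 * x = x + h" "h + 1 * (x - h) = x" "x + h - h = x" by auto
    show ?thesis
      unfolding q_def resB_def s P0[OF t J(1)] P0[OF t J(2)] P0[OF t J(3)] P0[OF t J(4)]
      by (simp add: diff_divide_distrib add_divide_distrib algebra_simps)
  qed
  ultimately show ?thesis by simp
qed

end

text \<open>The two cells at the boundary have total length 2 h, so the bound \<open>B2\<close> on
  their difference quotients counts only with weight sqrt h, whereas \<open>B1\<close> counts on the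
  whole interval.\<close>

lemma grid_norm_dx_plus_le:
  assumes h: "0 < h" and M: "2 \<le> M" and z: "zero_bdry M f" and B: "0 \<le> B1" "0 \<le> B2"
    and int: "\<And>j. 1 \<le> j \<Longrightarrow> Suc j < M \<Longrightarrow> cmod (f (Suc j) - f j) \<le> h * B1"
    and bd: "cmod (f 1) \<le> h * B2" "cmod (f (M - 1)) \<le> h * B2"
  shows "grid_norm h M True f \<le> sqrt (h * real M) * B1 + 2 * sqrt h * B2"
proof -
  define u where "u j = (if 1 \<le> j \<and> Suc j < M then dx_plus h f j else 0)" for j
  define v where "v j = (if 1 \<le> j \<and> Suc j < M then 0 else dx_plus h f j)" for j
  have "grid_norm h M True f = grid_l2_norm h M (\<lambda>j. u j + v j)"
    by (simp add: u_def v_def if_distrib cong: if_cong)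
  also have "\<dots> \<le> grid_l2_norm h M u + grid_l2_norm h M v"
    using h by (intro grid_l2_norm_triangle) simp
  also have "grid_l2_norm h M u \<le> sqrt (h * real M) * B1"
  proof (rule grid_l2_norm_le_sup)
    fix j assume "j < M"
    show "cmod (u j) \<le> B1"
      using int[of j] h B by (auto simp: u_def dx_plus_def norm_divide divide_le_eq mult.commute)
  qed (use h B in auto)
  also have "grid_l2_norm h M v \<le> 2 * sqrt h * B2"
  proof -
    have vb: "cmod (v j) \<le> B2" if "j \<in> {0, M - 1}" for j
    proof -
      have "Suc (M - 1) = M" using M by simp
      then have "cmod (f (Suc j) - f j) \<le> h * B2"
        using that bd z by (auto simp: zero_bdry_def)
      then show ?thesis using h B by (auto simp: v_def dx_plus_def norm_divide divide_le_eq mult.commute)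
    qed
    have "(\<Sum>j<M. (cmod (v j))\<^sup>2) = (\<Sum>j\<in>{0, M - 1}. (cmod (v j))\<^sup>2)"
      by (rule sum.mono_neutral_right) (use M in \<open>auto simp: v_def\<close>)
    also have "\<dots> \<le> (\<Sum>j\<in>{0, M - 1}. B2\<^sup>2)"
      by (intro sum_mono power_mono vb) auto
    also have "\<dots> \<le> 4 * B2\<^sup>2" by (cases "M - 1 = 0") auto
    finally have "h * (\<Sum>j<M. (cmod (v j))\<^sup>2) \<le> h * (4 * B2\<^sup>2)" using h by (intro mult_left_mono) auto
    also have "\<dots> = (2 * sqrt h * B2)\<^sup>2" using h by (simp add: power_mult_distrib)
    finally have "grid_l2_norm h M v \<le> sqrt ((2 * sqrt h * B2)\<^sup>2)" unfolding grid_l2_norm_def by (rule real_sqrt_le_mono)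
    then show ?thesis using h B by simp
  qed
  finally show ?thesis by simp
qed

lemma powr_three_halves:
  assumes "0 < h" "h \<le> 1"
  shows "h\<^sup>2 \<le> h powr (3/2)" "h powr (3/2) \<le> h" "sqrt h * h = h powr (3/2)"
proof -
  have "h powr 2 \<le> h powr (3/2)" by (rule powr_mono') (use assms in auto)
  then show "h\<^sup>2 \<le> h powr (3/2)" using assms by simp
  have "h powr (3/2) \<le> h powr 1" by (rule powr_mono') (use assms in auto)
  then show "h powr (3/2) \<le> h" using assms by simp
  have "h powr (3/2) = h powr (1/2 + 1)" by simp
  then show "sqrt h * h = h powr (3/2)" using assms unfolding powr_add by (simp add: powr_half_sqrt)
qed

section \<open>Discrete norms of the residual\<close>

context regular_solution
begin

text \<open>Large enough for the interior, difference and boundary estimates at once. The factor 2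
  is dictated by the Lipschitz bound of \<open>resC\<close> and by the boundary bound of
  \<open>resB\<close>.\<close>

definition res_const :: real where "res_const = 2 * (K + \<bar>\<beta>\<bar> * K ^ 3)"

lemma res_const_nonneg: "0 \<le> res_const"
  using K0 by (simp add: res_const_def)

lemma residual_norm_le:
  assumes "cmod A \<le> \<alpha>" "cmod B1 \<le> \<gamma>" "cmod B2 \<le> \<gamma>" "cmod C \<le> \<zeta>"
  shows "cmod (\<i> * A + (B1 + B2) / 4 + of_real \<beta> * C) \<le> \<alpha> + \<gamma> / 2 + \<bar>\<beta>\<bar> * \<zeta>"
proof -
  have "cmod (\<i> * A + (B1 + B2) / 4 + of_real \<beta> * C) \<le> cmod (\<i> * A) + cmod ((B1 + B2) / 4) + cmod (of_real \<beta> * C)"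
    by (intro order_trans[OF norm_triangle_ineq] add_mono norm_triangle_ineq order_refl)
  also have "\<dots> = cmod A + cmod (B1 + B2) / 4 + \<bar>\<beta>\<bar> * cmod C" by (simp add: norm_mult norm_divide)
  also have "\<dots> \<le> \<alpha> + (\<gamma> + \<gamma>) / 4 + \<bar>\<beta>\<bar> * \<zeta>"
    using assms by (intro add_mono divide_right_mono mult_left_mono order_trans[OF norm_triangle_ineq]) auto
  finally show ?thesis by simp
qed

lemma residual_interior:
  assumes t: "0 \<le> t" "t + \<tau> \<le> T" "0 < \<tau>" and h: "0 < h" and x: "a \<le> x - h" "x + h \<le> b"
  shows "cmod (residual t \<tau> h x) \<le> res_const * (h\<^sup>2 + \<tau>\<^sup>2)"
proof -
  have I: "t \<in> {0..T}" "t + \<tau> \<in> {0..T}" "x \<in> {a..b}" using t x h by auto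
  have "cmod (residual t \<tau> h x) \<le> K * \<tau>\<^sup>2 + (2 * K * h\<^sup>2) / 2 + \<bar>\<beta>\<bar> * (K ^ 3 * \<tau>\<^sup>2)"
    unfolding residual_def
    by (rule residual_norm_le[OF resA_bound[OF t I(3)] resB_bound[OF I(2) h x] resB_bound[OF I(1) h x] resC_bound[OF t I(3)]])
  also have "\<dots> \<le> res_const * (h\<^sup>2 + \<tau>\<^sup>2)"
  proof -
    have "0 \<le> K * \<tau>\<^sup>2" "0 \<le> K * h\<^sup>2" "0 \<le> \<bar>\<beta>\<bar> * K ^ 3 * \<tau>\<^sup>2" "0 \<le> \<bar>\<beta>\<bar> * K ^ 3 * h\<^sup>2" using K0 by simp_all
    then show ?thesis by (simp add: res_const_def algebra_simps)
  qed
  finally show ?thesis .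
qed

lemma residual_shift:
  assumes t: "0 \<le> t" "t + \<tau> \<le> T" "0 < \<tau>" and h: "0 < h" and x: "a \<le> x - h" "x + 2 * h \<le> b"
  shows "cmod (residual t \<tau> h (x + h) - residual t \<tau> h x) \<le> h * (res_const * (h\<^sup>2 + \<tau>\<^sup>2))"
proof -
  have I: "t \<in> {0..T}" "t + \<tau> \<in> {0..T}" "x \<in> {a..b}" "x + h \<in> {a..b}" using t x h by auto
  have "residual t \<tau> h (x + h) - residual t \<tau> h x = \<i> * (resA t \<tau> (x + h) - resA t \<tau> x)
     + ((resB (t + \<tau>) h (x + h) - resB (t + \<tau>) h x) + (resB t h (x + h) - resB t h x)) / 4 + of_real \<beta> * (resC t \<tau> (x + h) - resC t \<tau> x)"
    unfolding residual_def by (simp add: field_simps)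
  also have "cmod \<dots> \<le> K * h * \<tau>\<^sup>2 + (2 * (K * h) * h\<^sup>2) / 2 + \<bar>\<beta>\<bar> * (2 * K ^ 3 * h * \<tau>\<^sup>2)"
    by (rule residual_norm_le[OF _ resB_shift[OF I(2) h x] resB_shift[OF I(1) h x]])
      (use resA_lipschitz[OF t I(4,3)] resC_lipschitz[OF t I(4,3)] h in auto)
  also have "\<dots> \<le> h * (res_const * (h\<^sup>2 + \<tau>\<^sup>2))"
  proof -
    have "K * \<tau>\<^sup>2 + K * h\<^sup>2 + \<bar>\<beta>\<bar> * (2 * K ^ 3 * \<tau>\<^sup>2) \<le> res_const * (h\<^sup>2 + \<tau>\<^sup>2)"
    proof -
      have "0 \<le> K * \<tau>\<^sup>2" "0 \<le> K * h\<^sup>2" "0 \<le> \<bar>\<beta>\<bar> * K ^ 3 * \<tau>\<^sup>2" "0 \<le> \<bar>\<beta>\<bar> * K ^ 3 * h\<^sup>2" using K0 by simp_all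
      then show ?thesis by (simp add: res_const_def algebra_simps)
    qed
    from mult_left_mono[OF this, of h] h show ?thesis by (simp add: algebra_simps)
  qed
  finally show ?thesis .
qed

text \<open>\<open>resA\<close> and \<open>resC\<close> vanish at e because \<psi> and its time
  derivative do, so their Lipschitz bounds give a factor h. For \<open>resB\<close> the gain is left
  as a parameter \<gamma>: it is h in general and h^2 if the fourth derivative vanishes at
  e.\<close>

lemma residual_boundary:
  assumes t: "0 \<le> t" "t + \<tau> \<le> T" "0 < \<tau>" and h: "0 < h" and x: "a \<le> x - h" "x + h \<le> b"
    and e: "e \<in> {a, b}" "\<bar>x - e\<bar> = h" and \<gamma>: "cmod (resB t h x) \<le> 4 * K * h * \<gamma>" "cmod (resB (t + \<tau>) h x) \<le> 4 * K * h * \<gamma>" "0 \<le> \<gamma>"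
  shows "cmod (residual t \<tau> h x) \<le> h * (res_const * (\<gamma> + \<tau>\<^sup>2))"
proof -
  have I: "t \<in> {0..T}" "t + \<tau> \<in> {0..T}" "x \<in> {a..b}" "e \<in> {a..b}" "0 < T" using t x h e ab by auto
  have z: "\<psi> t e = 0" "\<psi> (t + \<tau>) e = 0" "d 1 t e = 0" "d 1 (t + \<tau>) e = 0"
    using bdry time_derivative_zero_at_boundary I e by auto
  have "cmod (resA t \<tau> x - resA t \<tau> e) \<le> K * h * \<tau>\<^sup>2" using resA_lipschitz[OF t I(3,4)] e by simp
  moreover have "resA t \<tau> e = 0" using z by (simp add: resA_def)
  ultimately have A: "cmod (resA t \<tau> x) \<le> K * h * \<tau>\<^sup>2" by simp
  have "cmod (resC t \<tau> x - resC t \<tau> e) \<le> 2 * K ^ 3 * h * \<tau>\<^sup>2" using resC_lipschitz[OF t I(3,4)] e by simp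
  moreover have "resC t \<tau> e = 0" using z by (simp add: resC_def)
  ultimately have C: "cmod (resC t \<tau> x) \<le> 2 * K ^ 3 * h * \<tau>\<^sup>2" by simp
  have "cmod (residual t \<tau> h x) \<le> K * h * \<tau>\<^sup>2 + (4 * K * h * \<gamma>) / 2 + \<bar>\<beta>\<bar> * (2 * K ^ 3 * h * \<tau>\<^sup>2)"
    unfolding residual_def by (rule residual_norm_le[OF A \<gamma>(2,1) C])
  also have "\<dots> = h * (K * \<tau>\<^sup>2 + 2 * K * \<gamma> + 2 * \<bar>\<beta>\<bar> * K ^ 3 * \<tau>\<^sup>2)" by (simp add: algebra_simps)
  also have "\<dots> \<le> h * (res_const * (\<gamma> + \<tau>\<^sup>2))"
  proof (rule mult_left_mono)
    have "0 \<le> K * \<tau>\<^sup>2" "0 \<le> \<bar>\<beta>\<bar> * K ^ 3 * \<gamma>" using K0 \<gamma>(3) by simp_all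
    then show "K * \<tau>\<^sup>2 + 2 * K * \<gamma> + 2 * \<bar>\<beta>\<bar> * K ^ 3 * \<tau>\<^sup>2 \<le> res_const * (\<gamma> + \<tau>\<^sup>2)"
      by (simp add: res_const_def algebra_simps)
  qed (use h in simp)
  finally show ?thesis .
qed

text \<open>The two summands are the weights of interior and boundary cells in
  \<open>grid_norm_dx_plus_le\<close>, the latter without its factor sqrt h.\<close>

definition err_const :: real where "err_const = (sqrt (b - a) + 2) * res_const"

lemma err_const_nonneg: "0 \<le> err_const"
  using res_const_nonneg ab by (simp add: err_const_def)

text \<open>At the boundary nodes the stencil of \<open>residual\<close> would leave [a, b]; the
  value 0 there is what the stability estimate asks of a source.\<close>

definition grid_residual :: "nat \<Rightarrow> real \<Rightarrow> real \<Rightarrow> nat \<Rightarrow> complex" where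
  "grid_residual M \<tau> t j = (if j \<in> {1..<M} then residual t \<tau> (mesh a b M) (node a b M j) else 0)"

lemma zero_bdry_grid_residual: "zero_bdry M (grid_residual M \<tau> t)"
  by (simp add: zero_bdry_def grid_residual_def)

context
  fixes M :: nat and h :: real
  assumes M: "2 \<le> M" and h_def: "h = mesh a b M" and h1: "h \<le> 1"
begin

lemma h_pos: "0 < h"
  using M ab by (simp add: h_def mesh_def)

lemma hM: "h * real M = b - a"
  using M by (simp add: h_def mesh_def)

lemma node_eq: "node a b M j = a + real j * h"
  by (simp add: node_def h_def)

lemma node_Suc: "node a b M (Suc j) = node a b M j + h"
  by (simp add: node_eq algebra_simps)

lemma node_in: "j \<le> M \<Longrightarrow> node a b M j \<in> {a..b}"
proof -
  assume "j \<le> M"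
  then have "real j * h \<le> real M * h" "0 \<le> real j * h" using h_pos by (auto intro: mult_right_mono)
  then show ?thesis using hM by (simp add: node_eq mult.commute)
qed

lemma node_interior:
  assumes "j \<in> {1..<M}"
  shows "a \<le> node a b M j - h" "node a b M j + h \<le> b"
proof -
  obtain i where i: "j = Suc i" using assms by (cases j) auto
  have "node a b M i \<in> {a..b}" "node a b M (Suc j) \<in> {a..b}"
    using node_in[of i] node_in[of "Suc j"] assms i by auto
  then show "a \<le> node a b M j - h" "node a b M j + h \<le> b" using node_Suc i by auto
qed

lemma node_0: "node a b M 0 = a" and node_M: "node a b M M = b"
  using hM by (simp_all add: node_eq mult.commute)

lemma grid_residual_L2:
  assumes t: "0 \<le> t" "t + \<tau> \<le> T" "0 < \<tau>"
  shows "grid_norm h M False (grid_residual M \<tau> t) \<le> err_const * (h\<^sup>2 + \<tau>\<^sup>2)"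
proof -
  have r0: "0 \<le> res_const * (h\<^sup>2 + \<tau>\<^sup>2)" using res_const_nonneg by simp
  have "grid_l2_norm h M (grid_residual M \<tau> t) \<le> sqrt (h * real M) * (res_const * (h\<^sup>2 + \<tau>\<^sup>2))"
  proof (rule grid_l2_norm_le_sup[OF _ r0])
    show "cmod (grid_residual M \<tau> t j) \<le> res_const * (h\<^sup>2 + \<tau>\<^sup>2)" for j
      using residual_interior[OF t h_pos node_interior] r0 by (simp add: grid_residual_def h_def)
  qed (use h_pos in simp)
  also have "\<dots> \<le> (sqrt (b - a) + 2) * (res_const * (h\<^sup>2 + \<tau>\<^sup>2))"
    unfolding hM by (intro mult_right_mono r0) simp
  finally show ?thesis by (simp add: err_const_def mult.assoc)
qed

lemma grid_residual_H1_aux: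
  assumes t: "0 \<le> t" "t + \<tau> \<le> T" "0 < \<tau>" and \<gamma>: "0 \<le> \<gamma>"
    and B: "\<And>s j e. s \<in> {t, t + \<tau>} \<Longrightarrow> j \<in> {1..<M} \<Longrightarrow> e \<in> {a, b} \<Longrightarrow> \<bar>node a b M j - e\<bar> = h \<Longrightarrow> cmod (resB s h (node a b M j)) \<le> 4 * K * h * \<gamma>"
  shows "grid_norm h M True (grid_residual M \<tau> t) \<le> sqrt (b - a) * (res_const * (h\<^sup>2 + \<tau>\<^sup>2)) + 2 * sqrt h * (res_const * (\<gamma> + \<tau>\<^sup>2))"
proof -
  have "grid_norm h M True (grid_residual M \<tau> t) \<le> sqrt (h * real M) * (res_const * (h\<^sup>2 + \<tau>\<^sup>2)) + 2 * sqrt h * (res_const * (\<gamma> + \<tau>\<^sup>2))"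
  proof (rule grid_norm_dx_plus_le[OF h_pos M zero_bdry_grid_residual])
    fix j assume j: "1 \<le> j" "Suc j < M"
    have "a \<le> node a b M j - h" "node a b M (Suc j) + h \<le> b" using node_interior[of j] node_interior[of "Suc j"] j by auto
    then have "node a b M j + 2 * h \<le> b" by (simp add: node_Suc)
    from residual_shift[OF t h_pos _ this] j node_interior[of j]
    show "cmod (grid_residual M \<tau> t (Suc j) - grid_residual M \<tau> t j) \<le> h * (res_const * (h\<^sup>2 + \<tau>\<^sup>2))"
      by (simp add: grid_residual_def node_Suc flip: h_def)
  next
    have bnd: "cmod (grid_residual M \<tau> t j) \<le> h * (res_const * (\<gamma> + \<tau>\<^sup>2))" if "j \<in> {1..<M}" "e \<in> {a, b}" "\<bar>node a b M j - e\<bar> = h" for j e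
      using residual_boundary[OF t h_pos node_interior[OF that(1)] that(2,3) B[OF _ that] B[OF _ that] \<gamma>] that(1)
      by (simp add: grid_residual_def flip: h_def)
    show "cmod (grid_residual M \<tau> t 1) \<le> h * (res_const * (\<gamma> + \<tau>\<^sup>2))"
      by (rule bnd[of _ a]) (use M h_pos in \<open>auto simp: node_eq\<close>)
    have "node a b M (M - 1) + h = b" using node_Suc[of "M - 1"] node_M M by simp
    then show "cmod (grid_residual M \<tau> t (M - 1)) \<le> h * (res_const * (\<gamma> + \<tau>\<^sup>2))"
      by (intro bnd[of _ b]) (use M h_pos in auto)
  qed (use res_const_nonneg \<gamma> in auto)
  then show ?thesis unfolding hM .
qed

lemma grid_residual_H1:
  assumes t: "0 \<le> t" "t + \<tau> \<le> T" "0 < \<tau>" and \<tau>1: "\<tau> \<le> 1"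
  shows "grid_norm h M True (grid_residual M \<tau> t) \<le> err_const * (h powr (3/2) + \<tau> powr (3/2))"
proof -
  have I: "t \<in> {0..T}" "t + \<tau> \<in> {0..T}" using t by auto
  \<comment> \<open>Here \<gamma> = h, since next to the boundary \<open>resB\<close> is merely
    O(h^2). The weight sqrt h of the boundary cells turns h into h^(3/2); the terms in \<tau>^2 are
    at most \<tau>^(3/2) because \<tau> <= 1.\<close>
  have "grid_norm h M True (grid_residual M \<tau> t) \<le> sqrt (b - a) * (res_const * (h\<^sup>2 + \<tau>\<^sup>2)) + 2 * sqrt h * (res_const * (h + \<tau>\<^sup>2))"
  proof (rule grid_residual_H1_aux[OF t])
    fix s j e assume s: "s \<in> {t, t + \<tau>}" and j: "j \<in> {1..<M}"
    have "cmod (resB s h (node a b M j)) \<le> 2 * K * h\<^sup>2"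
      by (rule resB_bound[OF _ h_pos node_interior[OF j]]) (use s I in auto)
    also have "\<dots> \<le> 4 * K * h\<^sup>2" using K0 by (intro mult_right_mono) auto
    finally show "cmod (resB s h (node a b M j)) \<le> 4 * K * h * h" by (simp add: power2_eq_square)
  qed (use h_pos in simp)
  also have "\<dots> = res_const * (sqrt (b - a) * (h\<^sup>2 + \<tau>\<^sup>2) + 2 * (sqrt h * h + sqrt h * \<tau>\<^sup>2))"
    by (simp add: algebra_simps)
  also have "\<dots> \<le> res_const * (sqrt (b - a) * (h powr (3/2) + \<tau> powr (3/2)) + 2 * (h powr (3/2) + \<tau> powr (3/2)))"
  proof (intro mult_left_mono add_mono res_const_nonneg powr_three_halves h_pos h1 t \<tau>1)
    show "sqrt h * h \<le> h powr (3/2)" using powr_three_halves(3)[OF h_pos h1] by simp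
    have "sqrt h * \<tau>\<^sup>2 \<le> 1 * \<tau>\<^sup>2" using h1 by (intro mult_right_mono) auto
    then show "sqrt h * \<tau>\<^sup>2 \<le> \<tau> powr (3/2)" using powr_three_halves(1)[OF t(3) \<tau>1] by simp
  qed (use ab in auto)
  finally show ?thesis by (simp add: err_const_def algebra_simps)
qed

lemma grid_residual_H1_compatible:
  assumes t: "0 \<le> t" "t + \<tau> \<le> T" "0 < \<tau>" and P4: "\<And>s e. s \<in> {0..T} \<Longrightarrow> e \<in> {a, b} \<Longrightarrow> P s 4 e = 0"
  shows "grid_norm h M True (grid_residual M \<tau> t) \<le> err_const * (h\<^sup>2 + \<tau>\<^sup>2)"
proof -
  have I: "t \<in> {0..T}" "t + \<tau> \<in> {0..T}" using t by auto
  \<comment> \<open>With \<gamma> = h^2 the boundary cells are as accurate as the interior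
    ones.\<close>
  have "grid_norm h M True (grid_residual M \<tau> t) \<le> sqrt (b - a) * (res_const * (h\<^sup>2 + \<tau>\<^sup>2)) + 2 * sqrt h * (res_const * (h\<^sup>2 + \<tau>\<^sup>2))"
  proof (rule grid_residual_H1_aux[OF t])
    fix s j e assume s: "s \<in> {t, t + \<tau>}" and j: "j \<in> {1..<M}" and e: "e \<in> {a, b}" "\<bar>node a b M j - e\<bar> = h"
    show "cmod (resB s h (node a b M j)) \<le> 4 * K * h * h\<^sup>2"
      by (rule resB_near_boundary[OF _ h_pos node_interior[OF j] e]) (use s I P4 e in auto)
  qed simp
  also have "\<dots> \<le> sqrt (b - a) * (res_const * (h\<^sup>2 + \<tau>\<^sup>2)) + 2 * 1 * (res_const * (h\<^sup>2 + \<tau>\<^sup>2))"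
    using res_const_nonneg h1 by (intro add_left_mono mult_right_mono mult_left_mono) auto
  finally show ?thesis by (simp add: err_const_def algebra_simps)
qed

end

end

section \<open>Bounds on the data and translation to the scheme\<close>

lemma real_derivative_bound:
  fixes f :: "real \<Rightarrow> real"
  assumes "\<And>x. x \<in> {a..b} \<Longrightarrow> (f has_real_derivative f' x) (at x within {a..b})" "\<And>x. x \<in> {a..b} \<Longrightarrow> \<bar>f' x\<bar> \<le> B"
    "x \<in> {a..b}" "y \<in> {a..b}"
  shows "\<bar>f x - f y\<bar> \<le> B * \<bar>x - y\<bar>"
proof -
  have "cmod (of_real (f x) - of_real (f y)) \<le> B * \<bar>x - y\<bar>"
    by (rule vector_derivative_bound[where S = "{a..b}" and f' = "\<lambda>x. of_real (f' x)"])
      (use assms in \<open>auto intro: has_vector_derivative_of_real\<close>)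
  then show ?thesis by (simp flip: of_real_diff)
qed

lemma C1_bounded_lipschitz:
  fixes V V' :: "real \<Rightarrow> real"
  assumes "\<And>x. x \<in> {a..b} \<Longrightarrow> (V has_real_derivative V' x) (at x within {a..b})" "continuous_on {a..b} V'"
  obtains B where "0 \<le> B" "\<forall>x\<in>{a..b}. \<bar>V x\<bar> \<le> B" "\<forall>x\<in>{a..b}. \<forall>y\<in>{a..b}. \<bar>V x - V y\<bar> \<le> B * \<bar>x - y\<bar>"
proof -
  have "continuous_on {a..b} V"
    using assms(1) by (meson DERIV_continuous continuous_on_eq_continuous_within)
  then have "bounded (V ` {a..b})" "bounded (V' ` {a..b})"
    using assms(2) by (auto intro!: compact_imp_bounded compact_continuous_image)
  then obtain B1 B2 where "\<forall>y\<in>V ` {a..b}. norm y \<le> B1" "\<forall>y\<in>V' ` {a..b}. norm y \<le> B2"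
    unfolding bounded_iff by blast
  then have B: "\<bar>V x\<bar> \<le> B1" "\<bar>V' x\<bar> \<le> B2" if "x \<in> {a..b}" for x
    using that by auto
  let ?B = "\<bar>B1\<bar> + \<bar>B2\<bar>"
  have "\<bar>V x\<bar> \<le> ?B" if "x \<in> {a..b}" for x using B(1)[OF that] by linarith
  moreover have VB: "\<bar>V' x\<bar> \<le> ?B" if "x \<in> {a..b}" for x using B(2)[OF that] by linarith
  have "\<bar>V x - V y\<bar> \<le> ?B * \<bar>x - y\<bar>" if "x \<in> {a..b}" "y \<in> {a..b}" for x y
    by (rule real_derivative_bound[OF assms(1) VB that])
  ultimately show thesis using that[of ?B] by simp
qed

text \<open>\<open>M1\<close> is built from essential suprema while grid nodes are single points;
  continuity transfers the bound to every point of the closed interval.\<close>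

lemma continuous_le_Linf_norm:
  fixes u :: "real \<Rightarrow> complex"
  assumes "continuous_on {a..b} u" "a < b" "\<And>x. x \<in> {a..b} \<Longrightarrow> cmod (u x) \<le> K"
  shows "x \<in> {a..b} \<Longrightarrow> cmod (u x) \<le> Linf_norm {a<..<b} u" and "Linf_norm {a<..<b} u \<le> K"
proof -
  have m: "u \<in> borel_measurable (lebesgue_on {a<..<b})"
    by (rule locally_integrable_measurable[OF continuous_imp_locally_integrable[OF assms(1)]])
  have K: "AE x in lebesgue_on {a<..<b}. cmod (u x) \<le> K"
    by (rule AE_I2) (use assms(3) in auto)
  show "Linf_norm {a<..<b} u \<le> K" by (rule Linf_norm_le[OF m K assms(2)])
  assume x: "x \<in> {a..b}"
  have "AE x in lebesgue_on {a<..<b}. u x \<in> cball 0 (Linf_norm {a<..<b} u)"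
    using Linf_AE[OF LinfI[OF m K] assms(2)] by eventually_elim simp
  then have "u x \<in> cball 0 (Linf_norm {a<..<b} u)"
    by (rule AE_interval_closed[OF assms(2,1) _ closed_cball x])
  then show "cmod (u x) \<le> Linf_norm {a<..<b} u" by simp
qed

lemma cnfd_solution_cn_step:
  assumes "cnfd_solution a b \<beta> V \<psi>0 T M \<tau> u" "real (Suc n) \<le> T / \<tau>"
  shows "cn_step (mesh a b M) \<tau> M (u n) (u (Suc n)) (cnfd_rhs (\<lambda>j. V (node a b M j)) \<beta> (u (Suc n)) (u n))"
    and "zero_bdry M (u (Suc n))"
proof -
  show "zero_bdry M (u (Suc n))" using assms by (simp add: cnfd_solution_def zero_bdry_def)
  show "cn_step (mesh a b M) \<tau> M (u n) (u (Suc n)) (cnfd_rhs (\<lambda>j. V (node a b M j)) \<beta> (u (Suc n)) (u n))"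
    unfolding cn_step_def cnfd_rhs_def
  proof
    fix j assume "j \<in> {1..<M}"
    then have "1 \<le> j \<and> j \<le> M - 1" by auto
    then show "\<i> * ((u (Suc n) j - u n j) / of_real \<tau>) = - (1/2) * dx2 (mesh a b M) (\<lambda>k. (u (Suc n) k + u n k) / 2) j
       + of_real (V (node a b M j) + \<beta> / 2 * ((cmod (u (Suc n) j))\<^sup>2 + (cmod (u n j))\<^sup>2)) * ((u (Suc n) j + u n j) / 2)"
      using assms unfolding cnfd_solution_def Let_def by blast
  qed
qed

lemma cn_step_cnfd_solution:
  assumes "\<And>j. j \<le> M \<Longrightarrow> u 0 j = \<psi>0 (node a b M j)" "\<And>n. zero_bdry M (u n)"
    "\<And>n. cn_step (mesh a b M) \<tau> M (u n) (u (Suc n)) (cnfd_rhs (\<lambda>j. V (node a b M j)) \<beta> (u (Suc n)) (u n))"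
  shows "cnfd_solution a b \<beta> V \<psi>0 T M \<tau> u"
  unfolding cnfd_solution_def Let_def
proof (intro conjI allI impI)
  fix n j assume "1 \<le> j \<and> j \<le> M - 1"
  then have "j \<in> {1..<M}" by auto
  then show "\<i> * ((u (Suc n) j - u n j) / of_real \<tau>) = - (1/2) * dx2 (mesh a b M) (\<lambda>k. (u (Suc n) k + u n k) / 2) j
       + of_real (V (node a b M j) + \<beta> / 2 * ((cmod (u (Suc n) j))\<^sup>2 + (cmod (u n j))\<^sup>2)) * ((u (Suc n) j + u n j) / 2)"
    using assms(3)[of n] unfolding cn_step_def cnfd_rhs_def by blast
qed (use assms(1,2) in \<open>auto simp: zero_bdry_def\<close>)

context regular_solution
begin

lemma psi_cn_step:
  assumes M: "2 \<le> M" and t: "0 \<le> t" "t + \<tau> \<le> T" "0 < \<tau>"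
  shows "cn_step (mesh a b M) \<tau> M (\<lambda>j. \<psi> t (node a b M j)) (\<lambda>j. \<psi> (t + \<tau>) (node a b M j))
    (\<lambda>j. cnfd_rhs (\<lambda>j. V (node a b M j)) \<beta> (\<lambda>j. \<psi> (t + \<tau>) (node a b M j)) (\<lambda>j. \<psi> t (node a b M j)) j + grid_residual M \<tau> t j)"
  unfolding cn_step_def
proof
  let ?h = "mesh a b M" and ?x = "node a b M"
  fix j assume j: "j \<in> {1..<M}"
  obtain i where i: "j = Suc i" using j by (cases j) auto
  have n: "?x (j + 1) = ?x j + ?h" "?x (j - 1) = ?x j - ?h" by (simp_all add: node_def i algebra_simps)
  have J: "?x j \<in> {a..b}"
  proof -
    have h0: "0 \<le> ?h" "real M * ?h = b - a" using ab M by (simp_all add: mesh_def)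
    have "real j * ?h \<le> real M * ?h" using j h0 by (intro mult_right_mono) auto
    then show ?thesis using h0 by (simp add: node_def)
  qed
  show "\<i> * ((\<psi> (t + \<tau>) (?x j) - \<psi> t (?x j)) / of_real \<tau>) = - (1/2) * dx2 ?h (\<lambda>k. (\<psi> (t + \<tau>) (?x k) + \<psi> t (?x k)) / 2) j
     + (cnfd_rhs (\<lambda>j. V (?x j)) \<beta> (\<lambda>j. \<psi> (t + \<tau>) (?x j)) (\<lambda>j. \<psi> t (?x j)) j + grid_residual M \<tau> t j)"
    unfolding dx2_def cnfd_rhs_def n residual_equation[OF t J, of ?h] using j by (simp add: grid_residual_def)
qed

text \<open>Bounds both discrete norms of the sampled exact solution, at every time in [0, T] and
  uniformly in the mesh, and not only its initial mass.\<close>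

definition init_mass :: real where "init_mass = sqrt (b - a) * K"

definition init_energy :: "real \<Rightarrow> real" where
  "init_energy Vm = (sqrt (b - a) * K)\<^sup>2 / 2 + (b - a) * (Vm * K\<^sup>2 + \<bar>\<beta>\<bar> / 2 * K ^ 4)"

context
  fixes M :: nat and h :: real
  assumes M: "2 \<le> M" and h_def: "h = mesh a b M" and h1: "h \<le> 1"
begin

lemma psi_zero_bdry: "t \<in> {0..T} \<Longrightarrow> zero_bdry M (\<lambda>j. \<psi> t (node a b M j))"
  using bdry node_0 node_M[OF M h_def h1] by (simp add: zero_bdry_def node_def)

lemma psi_grid_bounds:
  assumes t: "t \<in> {0..T}"
  shows "grid_norm h M s (\<lambda>j. \<psi> t (node a b M j)) \<le> init_mass"
proof -
  note node = node_in[OF M h_def h1] node_Suc[OF M h_def h1]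
  have h0: "0 < h" by (rule h_pos[OF M h_def h1])
  have "grid_l2_norm h M (\<lambda>j. \<psi> t (node a b M j)) \<le> sqrt (h * real M) * K"
    by (rule grid_l2_norm_le_sup) (use h0 K0 psi_bounds(1)[OF t node(1)] in auto)
  moreover have "grid_l2_norm h M (dx_plus h (\<lambda>j. \<psi> t (node a b M j))) \<le> sqrt (h * real M) * K"
  proof (rule grid_l2_norm_le_sup)
    fix j assume j: "j < M"
    then have "cmod (\<psi> t (node a b M (Suc j)) - \<psi> t (node a b M j)) \<le> K * \<bar>node a b M (Suc j) - node a b M j\<bar>"
      by (intro psi_bounds(2)[OF t] node(1)) auto
    then show "cmod (dx_plus h (\<lambda>j. \<psi> t (node a b M j)) j) \<le> K"
      using h0 by (simp add: dx_plus_def norm_divide divide_le_eq node(2))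
  qed (use h0 K0 in auto)
  ultimately show ?thesis using hM[OF M h_def h1] by (cases s) (simp_all add: init_mass_def)
qed

lemma psi_grid_energy:
  assumes t: "t \<in> {0..T}" and Vm: "\<And>x. x \<in> {a..b} \<Longrightarrow> \<bar>V x\<bar> \<le> Vm" "0 \<le> Vm"
  shows "grid_energy h M (\<lambda>j. V (node a b M j)) \<beta> (\<lambda>j. \<psi> t (node a b M j)) \<le> init_energy Vm"
proof -
  have h0: "0 < h" by (rule h_pos[OF M h_def h1])
  let ?u = "\<lambda>j. \<psi> t (node a b M j)"
  have "(grid_norm h M True ?u)\<^sup>2 \<le> (sqrt (b - a) * K)\<^sup>2"
    using psi_grid_bounds[OF t, of True] h0 by (intro power_mono) (auto simp: init_mass_def grid_l2_norm_nonneg)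
  moreover have "(\<Sum>j<M. V (node a b M j) * (cmod (?u j))\<^sup>2 + \<beta> / 2 * (cmod (?u j)) ^ 4) \<le> (\<Sum>j<M. Vm * K\<^sup>2 + \<bar>\<beta>\<bar> / 2 * K ^ 4)"
  proof (intro sum_mono add_mono)
    fix j assume "j \<in> {..<M}"
    then have J: "node a b M j \<in> {a..b}" by (intro node_in[OF M h_def h1]) auto
    have "V (node a b M j) \<le> Vm" using Vm(1)[OF J] by simp
    then show "V (node a b M j) * (cmod (?u j))\<^sup>2 \<le> Vm * K\<^sup>2"
      using psi_bounds(1)[OF t J] Vm(2) by (intro mult_mono power_mono) auto
    have "\<beta> / 2 * (cmod (?u j)) ^ 4 \<le> \<bar>\<beta>\<bar> / 2 * (cmod (?u j)) ^ 4" by (intro mult_right_mono) auto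
    also have "\<dots> \<le> \<bar>\<beta>\<bar> / 2 * K ^ 4"
      using psi_bounds(1)[OF t J] by (intro mult_left_mono power_mono) auto
    finally show "\<beta> / 2 * (cmod (?u j)) ^ 4 \<le> \<bar>\<beta>\<bar> / 2 * K ^ 4" .
  qed
  then have "h * (\<Sum>j<M. V (node a b M j) * (cmod (?u j))\<^sup>2 + \<beta> / 2 * (cmod (?u j)) ^ 4) \<le> h * (\<Sum>j<M. Vm * K\<^sup>2 + \<bar>\<beta>\<bar> / 2 * K ^ 4)"
    using h0 by (intro mult_left_mono) auto
  moreover have "h * (\<Sum>j<M. Vm * K\<^sup>2 + \<bar>\<beta>\<bar> / 2 * K ^ 4) = (h * real M) * (Vm * K\<^sup>2 + \<bar>\<beta>\<bar> / 2 * K ^ 4)" by simp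
  ultimately show ?thesis
    unfolding grid_energy_def init_energy_def hM[OF M h_def h1] by linarith
qed

end

end

section \<open>Convergence and the final choice of constants\<close>

context regular_solution
begin

definition rad0 :: "real \<Rightarrow> real" where
  "rad0 Vm = apriori_radius \<beta> init_mass (init_energy Vm)"

text \<open>The error estimate compares a discrete solution, bounded by \<open>rad0\<close>, with
  the sampled exact solution, bounded by \<open>init_mass\<close>; both must lie in the ball on
  which the nonlinearity is Lipschitz.\<close>

definition rad :: "real \<Rightarrow> real" where
  "rad Vm = max (rad0 Vm) init_mass"

definition conv_const :: "real \<Rightarrow> real" where
  "conv_const Vm = 2 * T * err_const * exp (4 * cnfd_lip (b - a) Vm \<beta> (rad Vm) * T)"

text \<open>The sampled exact solution satisfies the scheme with the residual as an additional
  source, so \<open>error_bound\<close> converts each bound on the residual into an error bound of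
  the same order. The first smallness condition has radius 2 \<open>rad0\<close> because the solver
  iterates in a ball of twice the a priori radius.\<close>

lemma scheme_convergence:
  assumes V: "0 \<le> Vm" "\<And>x. x \<in> {a..b} \<Longrightarrow> 0 \<le> V x" "\<And>x. x \<in> {a..b} \<Longrightarrow> \<bar>V x\<bar> \<le> Vm"
      "\<And>x y. x \<in> {a..b} \<Longrightarrow> y \<in> {a..b} \<Longrightarrow> \<bar>V x - V y\<bar> \<le> Vm * \<bar>x - y\<bar>"
    and T: "0 < T" and init: "\<And>x. x \<in> {a..b} \<Longrightarrow> \<psi> 0 x = \<psi>0 x"
    and M: "2 \<le> M" and h_def: "h = mesh a b M" and h1: "h \<le> 1" and \<tau>p: "0 < \<tau>" "\<tau> \<le> 1"
    and small: "\<tau> * cnfd_lip (b - a) Vm \<beta> (2 * rad0 Vm) \<le> 1/3" "\<tau> * cnfd_lip (b - a) Vm \<beta> (rad Vm) \<le> 1/3"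
  obtains u where "cnfd_solution a b \<beta> V \<psi>0 T M \<tau> u"
    "\<forall>v. cnfd_solution a b \<beta> V \<psi>0 T M \<tau> v \<longrightarrow> (\<forall>n j. real n \<le> T / \<tau> \<and> j \<le> M \<longrightarrow> v n j = u n j)"
    "\<forall>n. real n \<le> T / \<tau> \<longrightarrow> zero_bdry M (grid_error a b M \<tau> \<psi> u n) \<and>
       grid_norm h M False (grid_error a b M \<tau> \<psi> u n) \<le> conv_const Vm * (h\<^sup>2 + \<tau>\<^sup>2) \<and>
       grid_norm h M True (grid_error a b M \<tau> \<psi> u n) \<le> conv_const Vm * (h powr (3/2) + \<tau> powr (3/2)) \<and>
       ((\<forall>s\<in>{0..T}. \<forall>e\<in>{a, b}. P s 4 e = 0) \<longrightarrow> grid_norm h M True (grid_error a b M \<tau> \<psi> u n) \<le> conv_const Vm * (h\<^sup>2 + \<tau>\<^sup>2))"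
proof -
  define W where "W j = V (node a b M j)" for j
  define \<Psi> where "\<Psi> n j = \<psi> (real n * \<tau>) (node a b M j)" for n j
  note node = node_in[OF M h_def h1] node_Suc[OF M h_def h1]
  have h: "0 < h" by (rule h_pos[OF M h_def h1])
  have L: "h * real M = b - a" by (rule hM[OF M h_def h1])
  interpret cnfd_grid h \<tau> M W \<beta> Vm
  proof
    show "\<bar>W (Suc j) - W j\<bar> \<le> Vm * h" if "j < M" for j
    proof -
      have "\<bar>W (Suc j) - W j\<bar> \<le> Vm * \<bar>node a b M (Suc j) - node a b M j\<bar>"
        unfolding W_def using that by (intro V(4) node(1)) auto
      then show ?thesis using h by (simp add: node(2))
    qed
  qed (use h \<tau>p M V(1) V(2,3)[OF node(1)] in \<open>auto simp: W_def\<close>)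
  define N where "N = nat \<lfloor>T / \<tau>\<rfloor>"
  have N: "n \<le> N \<longleftrightarrow> real n \<le> T / \<tau>" for n
  proof -
    have "0 \<le> T / \<tau>" using T \<tau>p by simp
    then show ?thesis unfolding N_def by (simp add: le_nat_iff le_floor_iff)
  qed
  have tI: "real n * \<tau> \<in> {0..T}" if "n \<le> N" for n
    using that \<tau>p by (auto simp: N pos_le_divide_eq)
  have tS: "0 \<le> real n * \<tau>" "real n * \<tau> + \<tau> \<le> T" "0 < \<tau>" if "n < N" for n
  proof -
    have "Suc n \<le> N" using that by simp
    from tI[OF this] show "real n * \<tau> + \<tau> \<le> T" by (simp add: algebra_simps)
  qed (use \<tau>p in auto)
  have m0: "0 \<le> init_mass" using K0 ab by (simp add: init_mass_def)
  have R0: "0 \<le> rad0 Vm" using m0 by (simp add: rad0_def apriori_radius_def)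
  have z\<Psi>: "zero_bdry M (\<Psi> n)" if "n \<le> N" for n
    unfolding \<Psi>_def using psi_zero_bdry[OF M h_def h1 tI[OF that]] .
  have b\<Psi>: "gn s (\<Psi> n) \<le> init_mass" if "n \<le> N" for n s
    unfolding \<Psi>_def using psi_grid_bounds[OF M h_def h1 tI[OF that]] .
  have e\<Psi>: "grid_energy h M W \<beta> (\<Psi> 0) \<le> init_energy Vm"
    unfolding \<Psi>_def W_def by (rule psi_grid_energy[OF M h_def h1 tI V(3,1)]) simp_all
  have \<Psi>0: "\<Psi> 0 j = \<psi>0 (node a b M j)" if "j \<le> M" for j
    using init[OF node(1)[OF that]] by (simp add: \<Psi>_def)
  have sm: "\<tau> * lip (2 * apriori_radius \<beta> init_mass (init_energy Vm)) \<le> 1/3"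
    using small(1) unfolding L rad0_def .
  obtain u where u: "u 0 = \<Psi> 0" "\<And>n. zero_bdry M (u n)" "\<And>n. cn_step h \<tau> M (u n) (u (Suc n)) (rhs (u (Suc n)) (u n))"
    by (rule sequence_exists[OF z\<Psi>[OF le0] b\<Psi>[OF le0] e\<Psi> m0 sm]) blast
  have u_sol: "cnfd_solution a b \<beta> V \<psi>0 T M \<tau> u"
    by (rule cn_step_cnfd_solution) (use u \<Psi>0 in \<open>auto simp: h_def W_def[abs_def]\<close>)
  \<comment> \<open>The initial values are compared at nodes 0 to M only, because the scheme leaves
    other indices free; norms and energy depend on no other nodes.\<close>
  have R0_le: "gn True (v n) \<le> rad0 Vm"
    if "\<And>k. k \<le> N \<Longrightarrow> zero_bdry M (v k)" "\<And>k. k < N \<Longrightarrow> cn_step h \<tau> M (v k) (v (Suc k)) (rhs (v (Suc k)) (v k))"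
      "\<And>j. j \<le> M \<Longrightarrow> v 0 j = \<Psi> 0 j" "n \<le> N" for v n
  proof -
    have "gn False (v 0) = gn False (\<Psi> 0)" by (rule grid_norm_cong[OF that(3)])
    moreover have "grid_energy h M W \<beta> (v 0) = grid_energy h M W \<beta> (\<Psi> 0)"
      using that(3) grid_norm_cong[OF that(3), where h = h and s = True] by (simp add: grid_energy_def)
    ultimately show ?thesis
      unfolding rad0_def using b\<Psi>[OF le0] e\<Psi> by (intro apriori_bound[where v = v, OF that(1,2) _ _ m0 that(4)]) auto
  qed
  have uR0: "gn True (u n) \<le> rad0 Vm" if "n \<le> N" for n
    by (rule R0_le[where v = u, OF u(2,3) _ that]) (simp add: u(1))
  have uniq: "v n j = u n j" if v: "cnfd_solution a b \<beta> V \<psi>0 T M \<tau> v" and nj: "real n \<le> T / \<tau>" "j \<le> M" for v n j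
  proof -
    have v0: "v 0 j = \<Psi> 0 j" if "j \<le> M" for j using v that \<Psi>0[OF that] by (simp add: cnfd_solution_def)
    \<comment> \<open>The scheme prescribes boundary values from level one on; at level zero they
      come from the initial data.\<close>
    have vz: "zero_bdry M (v k)" if "k \<le> N" for k
    proof (cases k)
      case 0
      then show ?thesis using v0 z\<Psi>[OF le0] by (simp add: zero_bdry_def)
    next
      case (Suc n)
      then show ?thesis using cnfd_solution_cn_step(2)[OF v, of n] that N[of "Suc n"] by simp
    qed
    have vs: "cn_step h \<tau> M (v k) (v (Suc k)) (rhs (v (Suc k)) (v k))" if "k < N" for k
    proof -
      have "real (Suc k) \<le> T / \<tau>" using that N[of "Suc k"] by simp
      from cnfd_solution_cn_step(1)[OF v this] show ?thesis by (simp add: h_def W_def[abs_def])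
    qed
    have sm1: "\<tau> * lip (rad0 Vm) < 1"
    proof -
      have "lip (rad0 Vm) \<le> lip (2 * rad0 Vm)"
        unfolding cnfd_lip_def L using R0 ab by (intro add_left_mono mult_left_mono power_mono mult_nonneg_nonneg) auto
      then have "\<tau> * lip (rad0 Vm) \<le> \<tau> * lip (2 * rad0 Vm)" using \<tau>p by (intro mult_left_mono) auto
      then show ?thesis using small(1) unfolding L by linarith
    qed
    show ?thesis
    proof (rule sequence_unique[where v = v and w = u and R = "rad0 Vm" and N = N, OF vz vs _ u(2,3) uR0 R0 sm1])
      show "gn True (v k) \<le> rad0 Vm" if "k \<le> N" for k by (rule R0_le[where v = v, OF vz vs v0 that])
    qed (use nj N v0 u(1) in auto)
  qed
  have RR: "0 \<le> rad Vm" "rad0 Vm \<le> rad Vm" "init_mass \<le> rad Vm" using m0 by (auto simp: rad_def)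
  \<comment> \<open>Stated for an arbitrary residual bound \<epsilon> and either norm, so that it
    serves for all three error estimates. Since n \<tau> <= T, the Gronwall factor is uniform in
    n.\<close>
  have err: "gn s (grid_error a b M \<tau> \<psi> u n) \<le> 2 * T * \<epsilon> * exp (4 * cnfd_lip (b - a) Vm \<beta> (rad Vm) * T)"
    if n: "n \<le> N" and \<epsilon>: "0 \<le> \<epsilon>" "\<And>k. k < N \<Longrightarrow> gn s (grid_residual M \<tau> (real k * \<tau>)) \<le> \<epsilon>" for s n \<epsilon>
  proof -
    have st: "cn_step h \<tau> M (\<Psi> k) (\<Psi> (Suc k)) (\<lambda>j. rhs (\<Psi> (Suc k)) (\<Psi> k) j + grid_residual M \<tau> (real k * \<tau>) j)" if "k < N" for k
    proof -
      have "real (Suc k) * \<tau> = real k * \<tau> + \<tau>" by (simp add: algebra_simps)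
      then show ?thesis
        using psi_cn_step[OF M tS[OF that]] unfolding h_def W_def[abs_def] \<Psi>_def[abs_def] by simp
    qed
    have lp: "0 \<le> lip (rad Vm)" by (rule lip_nonneg)
    have "gn s (\<lambda>j. \<Psi> n j - u n j) \<le> 2 * (real n * \<tau>) * \<epsilon> * exp (4 * lip (rad Vm) * (real n * \<tau>))"
    proof (rule error_bound[where u = u and p = \<Psi> and \<xi> = "\<lambda>k. grid_residual M \<tau> (real k * \<tau>)" and R = "rad Vm" and N = N,
          OF u(2,3) _ z\<Psi> st _ zero_bdry_grid_residual \<epsilon>(2) _ RR(1) _ \<epsilon>(1) n])
      show "gn True (u k) \<le> rad Vm" if "k \<le> N" for k using uR0[OF that] RR(2) by linarith
      show "gn True (\<Psi> k) \<le> rad Vm" if "k \<le> N" for k using b\<Psi>[OF that, of True] RR(3) by linarith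
      show "\<Psi> 0 j = u 0 j" for j by (simp add: u(1))
      show "\<tau> * lip (rad Vm) \<le> 1 / 2" using small(2) unfolding L by linarith
    qed
    also have "\<dots> \<le> 2 * T * \<epsilon> * exp (4 * lip (rad Vm) * T)"
    proof (rule mult_mono)
      show "2 * (real n * \<tau>) * \<epsilon> \<le> 2 * T * \<epsilon>" using tI[OF n] \<epsilon>(1) by (intro mult_right_mono) auto
      have "4 * lip (rad Vm) * (real n * \<tau>) \<le> 4 * lip (rad Vm) * T"
        using tI[OF n] lp by (intro mult_left_mono) auto
      then show "exp (4 * lip (rad Vm) * (real n * \<tau>)) \<le> exp (4 * lip (rad Vm) * T)" by simp
    qed (use T \<epsilon>(1) in auto)
    finally show ?thesis unfolding L grid_error_def[abs_def] \<Psi>_def .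
  qed
  have "zero_bdry M (grid_error a b M \<tau> \<psi> u n) \<and>
       gn False (grid_error a b M \<tau> \<psi> u n) \<le> conv_const Vm * (h\<^sup>2 + \<tau>\<^sup>2) \<and>
       gn True (grid_error a b M \<tau> \<psi> u n) \<le> conv_const Vm * (h powr (3/2) + \<tau> powr (3/2)) \<and>
       ((\<forall>s\<in>{0..T}. \<forall>e\<in>{a, b}. P s 4 e = 0) \<longrightarrow> gn True (grid_error a b M \<tau> \<psi> u n) \<le> conv_const Vm * (h\<^sup>2 + \<tau>\<^sup>2))"
    if "real n \<le> T / \<tau>" for n
  proof (intro conjI impI)
    have n: "n \<le> N" using that N by simp
    have e0: "0 \<le> err_const" by (rule err_const_nonneg)
    show "zero_bdry M (grid_error a b M \<tau> \<psi> u n)"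
      using zero_bdry_intros(2)[OF z\<Psi>[OF n] u(2)[of n]] by (simp add: grid_error_def[abs_def] \<Psi>_def)
    have c: "2 * T * (err_const * \<epsilon>) * exp (4 * cnfd_lip (b - a) Vm \<beta> (rad Vm) * T) = conv_const Vm * \<epsilon>" for \<epsilon>
      by (simp add: conv_const_def)
    show "gn False (grid_error a b M \<tau> \<psi> u n) \<le> conv_const Vm * (h\<^sup>2 + \<tau>\<^sup>2)"
      unfolding c[symmetric] using grid_residual_L2[OF M h_def h1 tS] e0 by (intro err[OF n]) auto
    show "gn True (grid_error a b M \<tau> \<psi> u n) \<le> conv_const Vm * (h powr (3/2) + \<tau> powr (3/2))"
      unfolding c[symmetric] using grid_residual_H1[OF M h_def h1 tS \<tau>p(2)] e0 by (intro err[OF n]) auto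
    show "gn True (grid_error a b M \<tau> \<psi> u n) \<le> conv_const Vm * (h\<^sup>2 + \<tau>\<^sup>2)" if "\<forall>s\<in>{0..T}. \<forall>e\<in>{a, b}. P s 4 e = 0"
      unfolding c[symmetric] using grid_residual_H1_compatible[OF M h_def h1 tS] that e0 by (intro err[OF n]) auto
  qed
  then show thesis by (intro that[OF u_sol]) (use uniq in simp_all)
qed

end

theorem theorem4p2:
  fixes a b \<beta> T M1 :: real and V V' :: "real \<Rightarrow> real" and \<psi>0 :: "real \<Rightarrow> complex"
    and \<psi> :: "real \<Rightarrow> real \<Rightarrow> complex" and Tmax :: ereal
  assumes "a < b"
    and V_C1: "\<forall>x\<in>{a..b}. (V has_real_derivative V' x) (at x within {a..b})"
      "continuous_on {a..b} V'"
    and V_nonneg: "\<forall>x\<in>{a..b}. 0 \<le> V x"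
    and sol: "nls_maximal_solution a b \<beta> V \<psi>0 Tmax \<psi>"
    and T: "0 < T" "ereal T < Tmax"
    and reg3: "Ck_into 3 {0..T} (W_inf {a<..<b} 1) (W_inf_norm {a<..<b} 1) \<psi>"
    and reg2: "Ck_into 2 {0..T} (W_inf {a<..<b} 3) (W_inf_norm {a<..<b} 3) \<psi>"
    and reg0: "Ck_into 0 {0..T} (W_inf {a<..<b} 5 \<inter> H0_space {a<..<b} 1)
                 (\<lambda>u. W_inf_norm {a<..<b} 5 u + H_norm {a<..<b} 1 u) \<psi>"
    and M1: "M1 = (SUP t\<in>{0..T}. Linf_norm {a<..<b} (\<psi> t))"
  shows "\<exists>h0>0. \<exists>\<tau>0>0. \<exists>C>0. \<forall>(M::nat) (\<tau>::real).
    even M \<and> 0 < M \<and> mesh a b M \<le> h0 \<and> 0 < \<tau> \<and> \<tau> \<le> \<tau>0 \<longrightarrow>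
    (let h = mesh a b M in
     \<exists>u. cnfd_solution a b \<beta> V \<psi>0 T M \<tau> u \<and>
       (\<forall>v. cnfd_solution a b \<beta> V \<psi>0 T M \<tau> v \<longrightarrow>
          (\<forall>n j. real n \<le> T / \<tau> \<and> j \<le> M \<longrightarrow> v n j = u n j)) \<and>
       (\<forall>n. real n \<le> T / \<tau> \<longrightarrow>
          grid_l2_norm h M (grid_error a b M \<tau> \<psi> u n) \<le> C * (h\<^sup>2 + \<tau>\<^sup>2) \<and>
          grid_l2_norm h M (dx_plus h (grid_error a b M \<tau> \<psi> u n))
            \<le> C * (h powr (3/2) + \<tau> powr (3/2)) \<and>
          grid_max_norm M (u n) \<le> 1 + M1) \<and>
       (V' a = 0 \<and> V' b = 0 \<or>
        Ck_into 0 {0..T} (H0_space {a<..<b} 2) (H_norm {a<..<b} 2) \<psi> \<longrightarrow>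
        (\<forall>n. real n \<le> T / \<tau> \<longrightarrow>
          grid_l2_norm h M (grid_error a b M \<tau> \<psi> u n)
            + grid_l2_norm h M (dx_plus h (grid_error a b M \<tau> \<psi> u n))
              \<le> C * (h\<^sup>2 + \<tau>\<^sup>2) \<and>
          grid_max_norm M (u n) \<le> 1 + M1)))"
proof -
  have nls: "nls_solution a b \<beta> V \<psi>0 Tmax \<psi>"
    using sol by (simp add: nls_maximal_solution_def)
  have H0: "0 \<le> H_norm {a<..<b} 1 f" for f by (simp add: H_norm_def sum_nonneg)
  have reg0': "Ck_into 0 {0..T} (W_inf {a<..<b} 5) (W_inf_norm {a<..<b} 5) \<psi>"
    by (rule Ck_into_mono[OF reg0]) (use H0 W_inf_norm_nonneg[OF \<open>a < b\<close>] in auto)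
  have tT: "t \<in> {t. 0 \<le> t \<and> ereal t < Tmax}" if "t \<in> {0..T}" for t
    using that T(2) by (auto intro: le_less_trans[of "ereal t" "ereal T"])
  have \<psi>: "continuous_on {a..b} (\<psi> t)" "\<psi> t a = 0" "\<psi> t b = 0" if "t \<in> {0..T}" for t
    using nls tT[OF that] unfolding nls_solution_def Let_def by auto
  have init: "\<psi> 0 x = \<psi>0 x" if "x \<in> {a..b}" for x
    using nls that unfolding nls_solution_def Let_def by blast
  obtain P d K where reg: "0 \<le> K"
    "\<forall>t\<in>{0..T}. sob_rep a b 5 (P t) K (\<psi> t)"
    "\<forall>t\<in>{0..T}. \<forall>x\<in>{a..b}. P t 0 x = \<psi> t x \<and> d 0 t x = \<psi> t x"
    "\<forall>l<3. \<forall>t\<in>{0..T}. \<forall>x\<in>{a..b}. ((\<lambda>s. d l s x) has_vector_derivative d (Suc l) t x) (at t within {0..T})"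
    "\<forall>l\<le>3. \<forall>t\<in>{0..T}. \<forall>x\<in>{a..b}. cmod (d l t x) \<le> K"
    "\<forall>l\<le>3. \<forall>t\<in>{0..T}. \<forall>x\<in>{a..b}. \<forall>y\<in>{a..b}. cmod (d l t x - d l t y) \<le> K * \<bar>x - y\<bar>"
    "\<forall>t\<in>{0..T}. \<forall>x\<in>{a..b}. \<i> * d 1 t x = - (1/2) * P t 2 x
        + (of_real (V x) * \<psi> t x + of_real (\<beta> * (cmod (\<psi> t x))\<^sup>2) * \<psi> t x)"
    "\<forall>t\<in>{0..T}. \<forall>e\<in>{a, b}. P t 4 e = 4 * of_real (V' e) * P t 1 e"
    by (rule nls_regularity[OF \<open>a < b\<close> V_C1(1) nls T reg3 reg2 reg0'])
  interpret regular_solution a b T \<beta> K V \<psi> P d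
    by unfold_locales (use \<open>a < b\<close> reg \<psi> in \<open>simp_all del: One_nat_def\<close>, auto simp: \<psi>)
  obtain Vm where Vm: "0 \<le> Vm" "\<forall>x\<in>{a..b}. \<bar>V x\<bar> \<le> Vm" "\<forall>x\<in>{a..b}. \<forall>y\<in>{a..b}. \<bar>V x - V y\<bar> \<le> Vm * \<bar>x - y\<bar>"
    by (rule C1_bounded_lipschitz[of a b V V']) (use V_C1 in auto)
  have sup: "cmod (\<psi> t x) \<le> M1" if t: "t \<in> {0..T}" and x: "x \<in> {a..b}" for t x
  proof -
    \<comment> \<open>A real supremum is an upper bound only for sets bounded above; here K bounds
      all the norms.\<close>
    have bdd: "bdd_above ((\<lambda>t. Linf_norm {a<..<b} (\<psi> t)) ` {0..T})"
      using continuous_le_Linf_norm(2)[OF \<psi>(1) \<open>a < b\<close> psi_bounds(1)] by (intro bdd_aboveI2[of _ _ K]) auto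
    have "cmod (\<psi> t x) \<le> Linf_norm {a<..<b} (\<psi> t)"
      by (rule continuous_le_Linf_norm(1)[OF \<psi>(1)[OF t] \<open>a < b\<close> psi_bounds(1)[OF t] x])
    also have "\<dots> \<le> M1" unfolding M1 using bdd t by (intro cSUP_upper) auto
    finally show ?thesis .
  qed
  \<comment> \<open>The fourth derivative at an endpoint is 4 V'(e) \<psi>_x(e): the first
    alternative kills one factor, the second the other.\<close>
  have compat: "\<forall>s\<in>{0..T}. \<forall>e\<in>{a, b}. P s 4 e = 0"
    if "V' a = 0 \<and> V' b = 0 \<or> Ck_into 0 {0..T} (H0_space {a<..<b} 2) (H_norm {a<..<b} 2) \<psi>"
    using that
  proof
    assume "V' a = 0 \<and> V' b = 0"
    then show ?thesis using reg(8) by fastforce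
  next
    assume ck: "Ck_into 0 {0..T} (H0_space {a<..<b} 2) (H_norm {a<..<b} 2) \<psi>"
    obtain D where D: "\<forall>t\<in>{0..T}. D 0 t = \<psi> t" "\<forall>k\<le>0. \<forall>t\<in>{0..T}. D k t \<in> H0_space {a<..<b} 2"
      "\<forall>k\<le>0. \<forall>t\<in>{0..T}. ((\<lambda>s. H_norm {a<..<b} 2 (\<lambda>x. D k s x - D k t x)) \<longlongrightarrow> 0) (at t within {0..T})"
      "\<forall>k<0. \<forall>t\<in>{0..T}.
         ((\<lambda>s. H_norm {a<..<b} 2 (\<lambda>x. (D k s x - D k t x) /\<^sub>R (s - t) - D (Suc k) t x)) \<longlongrightarrow> 0) (at t within {0..T})"
      by (rule Ck_intoE[OF ck])
    show ?thesis
    proof (intro ballI)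
      fix s e assume s: "s \<in> {0..T}" and e: "e \<in> {a, b}"
      have "\<psi> s \<in> H0_space {a<..<b} 2" using D(1)[rule_format, OF s] D(2)[rule_format, OF order_refl s] by simp
      then have "P s 1 e = 0" by (rule H0_2_trace[OF _ rep[OF s] _ \<open>a < b\<close> e]) simp
      then show "P s 4 e = 0" using reg(8) s e by fastforce
    qed
  qed
  \<comment> \<open>The sum dominates both Lipschitz constants, so a single bound on \<tau> gives
    both smallness conditions.\<close>
  define l where "l = cnfd_lip (b - a) Vm \<beta> (2 * rad0 Vm) + cnfd_lip (b - a) Vm \<beta> (rad Vm)"
  have lip0: "0 \<le> cnfd_lip (b - a) Vm \<beta> R" for R using \<open>a < b\<close> Vm(1) by (simp add: cnfd_lip_def)
  have l0: "0 \<le> l" unfolding l_def by (intro add_nonneg_nonneg lip0)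
  define C0 where "C0 = conv_const Vm"
  have C0: "0 \<le> C0" unfolding C0_def conv_const_def using T(1) err_const_nonneg by simp
  \<comment> \<open>For h and \<tau> at most \<eta> the discrete Sobolev inequality makes the
    pointwise error at most 1, which is the 1 in 1 + M1. The 1 in the denominator allows C0 =
    0.\<close>
  define \<eta> where "\<eta> = 1 / (2 * (1 + sqrt (b - a) * C0))"
  have \<eta>: "0 < \<eta>" "sqrt (b - a) * (C0 * (\<eta> + \<eta>)) \<le> 1"
  proof -
    have p: "0 \<le> sqrt (b - a) * C0" using C0 \<open>a < b\<close> by simp
    then show "0 < \<eta>" by (simp add: \<eta>_def)
    have "sqrt (b - a) * (C0 * (\<eta> + \<eta>)) = (sqrt (b - a) * C0) * (2 * \<eta>)" by (simp add: algebra_simps)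
    also have "2 * \<eta> = 1 / (1 + sqrt (b - a) * C0)" unfolding \<eta>_def by (simp only: times_divide_eq_right mult_1_right divide_divide_eq_left) (simp add: mult_divide_mult_cancel_left_if del: distrib_left_numeral)
    also have "(sqrt (b - a) * C0) * (1 / (1 + sqrt (b - a) * C0)) = (sqrt (b - a) * C0) / (1 + sqrt (b - a) * C0)" by simp
    also have "\<dots> \<le> 1" using p by (simp add: divide_le_eq)
    finally show "sqrt (b - a) * (C0 * (\<eta> + \<eta>)) \<le> 1" .
  qed
  let ?h0 = "min 1 \<eta>" and ?\<tau>0 = "min (min 1 \<eta>) (1 / (3 * (1 + l)))"
  have main: "let h = mesh a b M in
     \<exists>u. cnfd_solution a b \<beta> V \<psi>0 T M \<tau> u \<and>
       (\<forall>v. cnfd_solution a b \<beta> V \<psi>0 T M \<tau> v \<longrightarrow>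
          (\<forall>n j. real n \<le> T / \<tau> \<and> j \<le> M \<longrightarrow> v n j = u n j)) \<and>
       (\<forall>n. real n \<le> T / \<tau> \<longrightarrow>
          grid_l2_norm h M (grid_error a b M \<tau> \<psi> u n) \<le> (2 * C0 + 1) * (h\<^sup>2 + \<tau>\<^sup>2) \<and>
          grid_l2_norm h M (dx_plus h (grid_error a b M \<tau> \<psi> u n))
            \<le> (2 * C0 + 1) * (h powr (3/2) + \<tau> powr (3/2)) \<and>
          grid_max_norm M (u n) \<le> 1 + M1) \<and>
       (V' a = 0 \<and> V' b = 0 \<or>
        Ck_into 0 {0..T} (H0_space {a<..<b} 2) (H_norm {a<..<b} 2) \<psi> \<longrightarrow>
        (\<forall>n. real n \<le> T / \<tau> \<longrightarrow>
          grid_l2_norm h M (grid_error a b M \<tau> \<psi> u n)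
            + grid_l2_norm h M (dx_plus h (grid_error a b M \<tau> \<psi> u n))
              \<le> (2 * C0 + 1) * (h\<^sup>2 + \<tau>\<^sup>2) \<and>
          grid_max_norm M (u n) \<le> 1 + M1))"
    if H: "even M \<and> 0 < M \<and> mesh a b M \<le> ?h0 \<and> 0 < \<tau> \<and> \<tau> \<le> ?\<tau>0" for M \<tau>
  proof -
    \<comment> \<open>Evenness excludes M = 1, for which there would be no interior node.\<close>
    have M: "2 \<le> M" using H by (auto elim!: evenE)
    define h where h: "h = mesh a b M"
    have h1: "h \<le> 1" "h \<le> \<eta>" and \<tau>: "0 < \<tau>" "\<tau> \<le> 1" "\<tau> \<le> \<eta>" using H by (auto simp: h)
    have h0: "0 < h" by (rule h_pos[OF M h h1(1)])
    have "0 < 3 * (1 + l)" using l0 by simp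
    then have "\<tau> * (3 * (1 + l)) \<le> 1" using H by (simp only: pos_le_divide_eq min.bounded_iff)
    moreover have "\<tau> * (3 * (1 + l)) = 3 * (\<tau> * (1 + l))" by (rule mult.left_commute)
    ultimately have "\<tau> * (1 + l) \<le> 1 / 3" by linarith
    then have \<tau>l: "\<tau> * r \<le> 1 / 3" if "r \<le> 1 + l" for r
      using mult_left_mono[OF that, of \<tau>] \<tau>(1) by linarith
    have small: "\<tau> * cnfd_lip (b - a) Vm \<beta> (2 * rad0 Vm) \<le> 1/3" "\<tau> * cnfd_lip (b - a) Vm \<beta> (rad Vm) \<le> 1/3"
      by (intro \<tau>l; use lip0[of "2 * rad0 Vm"] lip0[of "rad Vm"] in \<open>simp add: l_def\<close>)+
    obtain u where u: "cnfd_solution a b \<beta> V \<psi>0 T M \<tau> u"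
      "\<forall>v. cnfd_solution a b \<beta> V \<psi>0 T M \<tau> v \<longrightarrow> (\<forall>n j. real n \<le> T / \<tau> \<and> j \<le> M \<longrightarrow> v n j = u n j)"
      "\<forall>n. real n \<le> T / \<tau> \<longrightarrow> zero_bdry M (grid_error a b M \<tau> \<psi> u n) \<and>
       grid_norm h M False (grid_error a b M \<tau> \<psi> u n) \<le> conv_const Vm * (h\<^sup>2 + \<tau>\<^sup>2) \<and>
       grid_norm h M True (grid_error a b M \<tau> \<psi> u n) \<le> conv_const Vm * (h powr (3/2) + \<tau> powr (3/2)) \<and>
       ((\<forall>s\<in>{0..T}. \<forall>e\<in>{a, b}. P s 4 e = 0) \<longrightarrow> grid_norm h M True (grid_error a b M \<tau> \<psi> u n) \<le> conv_const Vm * (h\<^sup>2 + \<tau>\<^sup>2))"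
      by (rule scheme_convergence[of Vm \<psi>0 M h \<tau>, OF Vm(1) _ _ _ T(1) init M h h1(1) \<tau>(1,2) small])
        (use V_nonneg Vm(2,3) in auto)
    have sq: "0 \<le> h\<^sup>2 + \<tau>\<^sup>2" "0 \<le> h powr (3/2) + \<tau> powr (3/2)" by auto
    have "C0 * (h\<^sup>2 + \<tau>\<^sup>2) \<le> (2 * C0 + 1) * (h\<^sup>2 + \<tau>\<^sup>2)" "C0 * (h powr (3/2) + \<tau> powr (3/2)) \<le> (2 * C0 + 1) * (h powr (3/2) + \<tau> powr (3/2))"
      using C0 by (intro mult_right_mono sq; simp)+
    moreover have "grid_max_norm M (u n) \<le> 1 + M1" if n: "real n \<le> T / \<tau>" for n
    proof -
      let ?e = "grid_error a b M \<tau> \<psi> u n"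
      have tn: "real n * \<tau> \<in> {0..T}" using n \<tau> by (simp add: pos_le_divide_eq)
      have "cmod (u n j) \<le> 1 + M1" if j: "j \<le> M" for j
      proof -
        have "cmod (?e j) \<le> sqrt (h * real M) * grid_norm h M True ?e"
          by (rule grid_sup_bound[OF h0 _ j]) (use u(3) n in \<open>auto simp: zero_bdry_def\<close>)
        also have "\<dots> \<le> sqrt (b - a) * (C0 * (\<eta> + \<eta>))"
        proof -
          have "grid_norm h M True ?e \<le> C0 * (h powr (3/2) + \<tau> powr (3/2))" using u(3) n unfolding C0_def by blast
          also have "\<dots> \<le> C0 * (\<eta> + \<eta>)"
            using powr_three_halves(2)[OF h0 h1(1)] powr_three_halves(2)[OF \<tau>(1,2)] h1 \<tau> C0
            by (intro mult_left_mono add_mono) auto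
          finally show ?thesis unfolding hM[OF M h h1(1)] using \<open>a < b\<close> by (intro mult_left_mono) auto
        qed
        also have "\<dots> \<le> 1" by (rule \<eta>)
        finally have e: "cmod (?e j) \<le> 1" .
        have "cmod (\<psi> (real n * \<tau>) (node a b M j)) \<le> M1" by (rule sup[OF tn node_in[OF M h h1(1) j]])
        moreover have "u n j = \<psi> (real n * \<tau>) (node a b M j) - ?e j" by (simp add: grid_error_def)
        ultimately show ?thesis using e norm_triangle_ineq4[of "\<psi> (real n * \<tau>) (node a b M j)" "?e j"] by simp
      qed
      then show ?thesis unfolding grid_max_norm_def by (subst Max_le_iff) auto
    qed
    ultimately show ?thesis
      unfolding Let_def h[symmetric]
    proof (intro exI[of _ u] conjI u(1,2) allI impI)
      fix n assume n: "real n \<le> T / \<tau>"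
      have e: "grid_l2_norm h M (grid_error a b M \<tau> \<psi> u n) \<le> C0 * (h\<^sup>2 + \<tau>\<^sup>2)"
        "grid_l2_norm h M (dx_plus h (grid_error a b M \<tau> \<psi> u n)) \<le> C0 * (h powr (3/2) + \<tau> powr (3/2))"
        "(\<forall>s\<in>{0..T}. \<forall>e\<in>{a, b}. P s 4 e = 0) \<Longrightarrow> grid_l2_norm h M (dx_plus h (grid_error a b M \<tau> \<psi> u n)) \<le> C0 * (h\<^sup>2 + \<tau>\<^sup>2)"
        using u(3) n unfolding C0_def by auto
      show "grid_l2_norm h M (grid_error a b M \<tau> \<psi> u n) \<le> (2 * C0 + 1) * (h\<^sup>2 + \<tau>\<^sup>2)"
        using e(1) \<open>C0 * (h\<^sup>2 + \<tau>\<^sup>2) \<le> (2 * C0 + 1) * (h\<^sup>2 + \<tau>\<^sup>2)\<close> by linarith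
      show "grid_l2_norm h M (dx_plus h (grid_error a b M \<tau> \<psi> u n)) \<le> (2 * C0 + 1) * (h powr (3/2) + \<tau> powr (3/2))"
        using e(2) \<open>C0 * (h powr (3/2) + \<tau> powr (3/2)) \<le> (2 * C0 + 1) * (h powr (3/2) + \<tau> powr (3/2))\<close> by linarith
      show "grid_l2_norm h M (grid_error a b M \<tau> \<psi> u n) + grid_l2_norm h M (dx_plus h (grid_error a b M \<tau> \<psi> u n)) \<le> (2 * C0 + 1) * (h\<^sup>2 + \<tau>\<^sup>2)"
        if "V' a = 0 \<and> V' b = 0 \<or> Ck_into 0 {0..T} (H0_space {a<..<b} 2) (H_norm {a<..<b} 2) \<psi>"
      proof -
        obtain X where X: "h\<^sup>2 + \<tau>\<^sup>2 = X" by blast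
        \<comment> \<open>Twice C0 accounts for the sum of the two errors; the additional 1 makes
          the constant positive.\<close>
        have "(2 * C0 + 1) * X = C0 * X + C0 * X + X" by (simp add: algebra_simps)
        then show ?thesis using e(1) e(3)[OF compat[OF that]] sq(1) unfolding X by linarith
      qed
    qed auto
  qed
  have "0 < ?h0" "0 < ?\<tau>0" "0 < 2 * C0 + 1" using \<eta>(1) l0 C0 by auto
  then show ?thesis using main by blast
qed

end
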